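(* Let $F$ be a $p$-adic local field with $p$ odd, let $r\ge1$, $G=\mathrm{GL}_r(F)$, $K=\mathrm{GL}_r(\mathcal{O}_F)$, $X=\mathrm{Sym}_{r\times r}(F)\cap\mathrm{GL}_r(F)$, and let $R$ be a nonzero coefficient ring with $2\in R^\times$. Then $\mathcal{S}(X/K,R)$ is a free $\mathcal{H}(G,K)$-module of rank $4^r$, with basis $$\mathcal{B}=\left\{\delta_s(e)\ :\ s=(s_1,\ldots,s_r)\in\{\pm1\}^r,\ e\in\mathbb{Z}^r,\ e_i-e_{i+1}-c_i(s)\in\{0,1\}\text{ for }1\le i<r,\ e_r\in\{0,1\}\right\},$$ where $c_i(s)=1$ if $s_i\ne s_{i+1}$ and $c_i(s)=0$ if $s_i=s_{i+1}$.
   Context: Fix a uniformizer $\varpi$ of $F$. $G$ acts on $X$ on the right by $x\cdot g=g^{\intercal}xg$. $\mathcal{S}(X/K,R)$ is the $R$-module of compactly supported, locally constant, $K$-invariant functions $X\to R$. $\mathcal{H}(G,K)$ is the $R$-valued Hecke algebra (compactly supported $K$-bi-invariant functions $G\to R$ under convolution, with $\mathrm{char}(K)$ as identity), acting by $(Tf)(x)=\sum_{gK\in G/K}T(g)f(x\cdot g)$. The ring $R$ is commutative with $1$. Let $\mathrm{Sign}=\mathcal{O}_F^\times/(\mathcal{O}_F^\times)^2$, identified with $\{\pm1\}$. Characters $\mathrm{Sign}\to\{\pm1\}$ are identified with elements $s\in\{\pm1\}$: $s=1$ is the trivial character and $s=-1$ is the nontrivial one. For $e\in\mathbb{Z}^r$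 with $e_1\ge\cdots\ge e_r$ and $\chi\in\mathrm{Sign}^r$, let $\delta(e,\chi)\in\mathcal{S}(X/K,R)$ be the characteristic function of the $K$-orbit of $\mathrm{diag}(\varpi^{e_1}u_1,\ldots,\varpi^{e_r}u_r)$, where $u_i\in\mathcal{O}_F^\times$ has class $\chi_i$ in $\mathrm{Sign}$. For $s=(s_1,\ldots,s_r)\in\{\pm1\}^r$, put $\delta_s(e)=\sum_{\chi\in\mathrm{Sign}^r}\left(\prod_{i=1}^r s_i(\chi_i)\right)\delta(e,\chi)$. *)

theory Defs
  imports
    "HOL-Analysis.Abstract_Metric_Spaces"
    "HOL-Analysis.Function_Topology"
    "HOL-Algebra.Coset"
    "HOL-Library.Groups_Big_Fun"
    "HOL-Computational_Algebra.Primes"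
    "Jordan_Normal_Form.Matrix"
begin

section \<open>Local fields\<close>

text \<open>The field is given with an absolute value \<open>av\<close>; the valuation ring is the set
  \<open>av x \<le> 1\<close> and its maximal ideal is the set \<open>av x < 1\<close>.\<close>

definition integers :: "('a::field \<Rightarrow> real) \<Rightarrow> 'a set" where
  "integers av = {x. av x \<le> 1}"

definition unit_integers :: "('a::field \<Rightarrow> real) \<Rightarrow> 'a set" where
  "unit_integers av = {x. av x = 1}"

definition max_ideal :: "('a::field \<Rightarrow> real) \<Rightarrow> 'a set" where
  "max_ideal av = {x. av x < 1}"

definition uniformizer :: "('a::field \<Rightarrow> real) \<Rightarrow> 'a \<Rightarrow> bool" where
  "uniformizer av \<pi> \<longleftrightarrow> \<pi> \<noteq> 0 \<and> max_ideal av = (\<lambda>x. \<pi> * x) ` integers av"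

text \<open>A \<open>p\<close>-adic local field: a field of characteristic 0 that is complete for a discrete
  non-archimedean absolute value and has finite residue field of characteristic \<open>p\<close>.
  Discreteness (with nontriviality) is the existence of a uniformizer; the residue field has
  characteristic \<open>p\<close> because the prime \<open>p\<close> lies in the maximal ideal.\<close>

locale padic_local_field =
  fixes av :: "'a::field_char_0 \<Rightarrow> real" and p :: nat
  assumes av_nonneg: "av x \<ge> 0"
    and av_eq_0_iff: "av x = 0 \<longleftrightarrow> x = 0"
    and av_mult: "av (x * y) = av x * av y"
    and av_ultrametric: "av (x + y) \<le> max (av x) (av y)"
    and discrete: "\<exists>\<pi>. uniformizer av \<pi>"
    and complete: "Metric_space.mcomplete UNIV (\<lambda>x y. av (x - y))"
    and residue_field_finite:
      "finite (integers av //
        {(x, y). x \<in> integers av \<and> y \<in> integers av \<and> x - y \<in> max_ideal av})"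
    and prime_p: "prime p"
    and residue_char: "of_nat p \<in> max_ideal av"

definition field_topology :: "('a::field \<Rightarrow> real) \<Rightarrow> 'a topology" where
  "field_topology av = Metric_space.mtopology UNIV (\<lambda>x y. av (x - y))"

definition mat_topology :: "('a::field \<Rightarrow> real) \<Rightarrow> nat \<Rightarrow> 'a mat topology" where
  "mat_topology av r =
    pullback_topology (carrier_mat r r) (\<lambda>A. \<lambda>ij\<in>{..<r} \<times> {..<r}. A $$ ij)
      (product_topology (\<lambda>_. field_topology av) ({..<r} \<times> {..<r}))"


section \<open>The group, its maximal compact subgroup, and the symmetric space\<close>

definition GL :: "nat \<Rightarrow> 'a::field mat monoid" where
  "GL r = units_of (ring_mat TYPE('a) r ())"

definition integral_mat :: "('a::field \<Rightarrow> real) \<Rightarrow> nat \<Rightarrow> 'a mat \<Rightarrow> bool" where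
  "integral_mat av r A \<longleftrightarrow> (\<forall>i<r. \<forall>j<r. A $$ (i, j) \<in> integers av)"

definition GL_integers :: "('a::field \<Rightarrow> real) \<Rightarrow> nat \<Rightarrow> 'a mat set" where
  "GL_integers av r =
    {g \<in> carrier (GL r). integral_mat av r g \<and> integral_mat av r (inv\<^bsub>GL r\<^esub> g)}"

definition sym_space :: "nat \<Rightarrow> 'a::field mat set" where
  "sym_space r = {x \<in> carrier (GL r). transpose_mat x = x}"

definition act :: "'a::field mat \<Rightarrow> 'a mat \<Rightarrow> 'a mat" (infixl \<open>\<bullet>\<^sub>X\<close> 70) where
  "x \<bullet>\<^sub>X g = transpose_mat g * x * g"

text \<open>The subspace topology on \<open>GL r\<close> is the usual one, inversion being continuous for it.\<close>

definition GL_topology :: "('a::field \<Rightarrow> real) \<Rightarrow> nat \<Rightarrow> 'a mat topology" where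
  "GL_topology av r = subtopology (mat_topology av r) (carrier (GL r))"

definition sym_topology :: "('a::field \<Rightarrow> real) \<Rightarrow> nat \<Rightarrow> 'a mat topology" where
  "sym_topology av r = subtopology (mat_topology av r) (sym_space r)"

definition compactly_supported :: "'x topology \<Rightarrow> ('x \<Rightarrow> 'c::zero) \<Rightarrow> bool" where
  "compactly_supported T f \<longleftrightarrow> 
    compactin T (Abstract_Topology.closure_of T {x \<in> topspace T. f x \<noteq> 0})"

definition locally_constant :: "'x topology \<Rightarrow> ('x \<Rightarrow> 'c) \<Rightarrow> bool" where
  "locally_constant T f \<longleftrightarrow>
    (\<forall>x\<in>topspace T. \<exists>U. openin T U \<and> x \<in> U \<and> (\<forall>y\<in>U. f y = f x))"


section \<open>The Hecke algebra and its module of functions\<close>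

text \<open>Functions on \<open>GL r\<close> or on \<open>sym_space r\<close> are represented by functions on all matrices that
  vanish outside the domain.

  \<open>coset_sum\<close> is the sum over \<open>GL r / GL_integers av r\<close> of a function that is constant on left
  cosets, evaluated at a chosen representative; \<open>Sum_any\<close> sums over the support, which is
  finite in all uses below.\<close>

definition left_cosets :: "('a::field \<Rightarrow> real) \<Rightarrow> nat \<Rightarrow> 'a mat set set" where
  "left_cosets av r = (\<lambda>g. g <#\<^bsub>GL r\<^esub> GL_integers av r) ` carrier (GL r)"

definition coset_sum ::
    "('a::field \<Rightarrow> real) \<Rightarrow> nat \<Rightarrow> ('a mat \<Rightarrow> 'c::comm_monoid_add) \<Rightarrow> 'c" where
  "coset_sum av r \<phi> = Sum_any (\<lambda>C. if C \<in> left_cosets av r then \<phi> (SOME g. g \<in> C) else 0)"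

definition hecke_algebra ::
    "('a::field \<Rightarrow> real) \<Rightarrow> nat \<Rightarrow> ('a mat \<Rightarrow> 'c::comm_ring_1) ring" where
  "hecke_algebra av r = \<lparr>
    carrier = {T. (\<forall>g. g \<notin> carrier (GL r) \<longrightarrow> T g = 0) \<and>
      (\<forall>g\<in>carrier (GL r). \<forall>k\<in>GL_integers av r. \<forall>k'\<in>GL_integers av r. T (k * g * k') = T g) \<and>
      compactly_supported (GL_topology av r) T},
    monoid.mult = (\<lambda>T\<^sub>1 T\<^sub>2 x. if x \<in> carrier (GL r)
      then coset_sum av r (\<lambda>g. T\<^sub>1 g * T\<^sub>2 (inv\<^bsub>GL r\<^esub> g * x)) else 0),
    one = (\<lambda>x. if x \<in> GL_integers av r then 1 else 0),
    zero = (\<lambda>_. 0),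
    add = (\<lambda>T\<^sub>1 T\<^sub>2 x. T\<^sub>1 x + T\<^sub>2 x)\<rparr>"

text \<open>The fields \<open>mult\<close> and \<open>one\<close> of a module record carry no meaning.\<close>

definition schwartz_module ::
    "('a::field \<Rightarrow> real) \<Rightarrow> nat \<Rightarrow> ('a mat \<Rightarrow> 'c::comm_ring_1, 'a mat \<Rightarrow> 'c) module" where
  "schwartz_module av r = \<lparr>
    carrier = {f. (\<forall>x. x \<notin> sym_space r \<longrightarrow> f x = 0) \<and>
      (\<forall>x\<in>sym_space r. \<forall>k\<in>GL_integers av r. f (x \<bullet>\<^sub>X k) = f x) \<and>
      locally_constant (sym_topology av r) f \<and>
      compactly_supported (sym_topology av r) f},
    monoid.mult = undefined,
    one = undefined,
    zero = (\<lambda>_. 0),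
    add = (\<lambda>f\<^sub>1 f\<^sub>2 x. f\<^sub>1 x + f\<^sub>2 x),
    smult = (\<lambda>T f x. if x \<in> sym_space r
      then coset_sum av r (\<lambda>g. T g * f (x \<bullet>\<^sub>X g)) else 0)\<rparr>"

text \<open>The locale \<open>module\<close> of HOL-Algebra requires a commutative ring of scalars; this one has
  the same axioms over an arbitrary ring.\<close>

locale left_module = R?: ring + M?: abelian_group M for M (structure) +
  assumes smult_closed:
      "\<lbrakk>a \<in> carrier R; x \<in> carrier M\<rbrakk> \<Longrightarrow> a \<odot>\<^bsub>M\<^esub> x \<in> carrier M"
    and smult_l_distr:
      "\<lbrakk>a \<in> carrier R; b \<in> carrier R; x \<in> carrier M\<rbrakk> \<Longrightarrow>
        (a \<oplus> b) \<odot>\<^bsub>M\<^esub> x = a \<odot>\<^bsub>M\<^esub> x \<oplus>\<^bsub>M\<^esub> b \<odot>\<^bsub>M\<^esub> x"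
    and smult_r_distr:
      "\<lbrakk>a \<in> carrier R; x \<in> carrier M; y \<in> carrier M\<rbrakk> \<Longrightarrow>
        a \<odot>\<^bsub>M\<^esub> (x \<oplus>\<^bsub>M\<^esub> y) = a \<odot>\<^bsub>M\<^esub> x \<oplus>\<^bsub>M\<^esub> a \<odot>\<^bsub>M\<^esub> y"
    and smult_assoc1:
      "\<lbrakk>a \<in> carrier R; b \<in> carrier R; x \<in> carrier M\<rbrakk> \<Longrightarrow>
        (a \<otimes> b) \<odot>\<^bsub>M\<^esub> x = a \<odot>\<^bsub>M\<^esub> (b \<odot>\<^bsub>M\<^esub> x)"
    and smult_one:
      "x \<in> carrier M \<Longrightarrow> \<one> \<odot>\<^bsub>M\<^esub> x = x"

definition finite_basis :: "('h, 'z) ring_scheme \<Rightarrow> ('h, 'm, 'w) module_scheme \<Rightarrow> 'm set \<Rightarrow> bool"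
  where
  "finite_basis H M B \<longleftrightarrow> finite B \<and> B \<subseteq> carrier M \<and>
    (\<forall>f\<in>carrier M. \<exists>!a. a \<in> B \<rightarrow>\<^sub>E carrier H \<and> f = (\<Oplus>\<^bsub>M\<^esub>b\<in>B. a b \<odot>\<^bsub>M\<^esub> b))"


section \<open>The proposed basis\<close>

text \<open>\<open>unit_sign\<close> realizes the identification of the square classes of units with \<open>{1, -1}\<close>;
  under it \<open>sign_char s\<close> is the trivial character for \<open>s = 1\<close> and the nontrivial one for
  \<open>s = -1\<close>. Indices run over \<open>0, \<dots>, r - 1\<close> instead of \<open>1, \<dots>, r\<close>.\<close>

definition unit_sign :: "('a::field \<Rightarrow> real) \<Rightarrow> 'a \<Rightarrow> int" where
  "unit_sign av u = (if \<exists>w\<in>unit_integers av. u = w\<^sup>2 then 1 else -1)"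

definition sign_rep :: "('a::field \<Rightarrow> real) \<Rightarrow> int \<Rightarrow> 'a" where
  "sign_rep av c = (SOME u. u \<in> unit_integers av \<and> unit_sign av u = c)"

definition sign_char :: "int \<Rightarrow> int \<Rightarrow> int" where
  "sign_char s c = (if s = 1 then 1 else c)"

definition orbit_char :: "('a::field \<Rightarrow> real) \<Rightarrow> nat \<Rightarrow> 'a mat \<Rightarrow> 'a mat \<Rightarrow> 'c::comm_ring_1" where
  "orbit_char av r x y = (if \<exists>k\<in>GL_integers av r. y = x \<bullet>\<^sub>X k then 1 else 0)"

definition delta ::
    "('a::field \<Rightarrow> real) \<Rightarrow> 'a \<Rightarrow> nat \<Rightarrow> (nat \<Rightarrow> int) \<Rightarrow> (nat \<Rightarrow> int) \<Rightarrow> 'a mat \<Rightarrow> 'c::comm_ring_1"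
  where
  "delta av \<pi> r e \<eta> = orbit_char av r (mat_diag r (\<lambda>i. \<pi> powi (e i) * sign_rep av (\<eta> i)))"

definition delta_char ::
    "('a::field \<Rightarrow> real) \<Rightarrow> 'a \<Rightarrow> nat \<Rightarrow> (nat \<Rightarrow> int) \<Rightarrow> (nat \<Rightarrow> int) \<Rightarrow> 'a mat \<Rightarrow> 'c::comm_ring_1"
  where
  "delta_char av \<pi> r s e x =
    (\<Sum>\<eta>\<in>{..<r} \<rightarrow>\<^sub>E {1, -1}. of_int (\<Prod>i<r. sign_char (s i) (\<eta> i)) * delta av \<pi> r e \<eta> x)"

definition sign_change :: "(nat \<Rightarrow> int) \<Rightarrow> nat \<Rightarrow> int" where
  "sign_change s i = (if s i \<noteq> s (Suc i) then 1 else 0)"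

definition delta_basis ::
    "('a::field \<Rightarrow> real) \<Rightarrow> 'a \<Rightarrow> nat \<Rightarrow> ('a mat \<Rightarrow> 'c::comm_ring_1) set" where
  "delta_basis av \<pi> r = {delta_char av \<pi> r s e | s e.
    s \<in> {..<r} \<rightarrow>\<^sub>E {1, -1} \<and>
    (\<forall>i. Suc i < r \<longrightarrow> e i - e (Suc i) - sign_change s i \<in> {0, 1}) \<and>
    e (r - 1) \<in> {0, 1}}"

end

theory Submission
  imports Defs "Jordan_Normal_Form.Determinant" "Jordan_Normal_Form.Gauss_Jordan_Elimination"
begin

text \<open>
  A \<open>K\<close>-orbit of nondegenerate symmetric matrices contains a matrix \<open>diag (\<pi>\<^sup>e\<^sup>i u\<^sub>i)\<close> with weakly decreasing exponents
  \<open>e\<close>, its type. Since the residue characteristic is odd, the type is unique and the units \<open>u\<close> matter only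
  through the products of their square classes over the blocks of equal exponents (\<open>diagonalization\<close>,
  \<open>eqv_invariants\<close>, \<open>eqv_of_invariants\<close>). As 2 is invertible, the characters of sign vectors can replace the sign
  vectors: the functions \<open>\<delta>\<^sub>s(f)\<close> with \<open>s\<close> constant on the blocks of \<open>f\<close> form a basis of the module over the coefficient
  ring. The Hecke algebra is spanned by the characteristic functions \<open>T\<^sub>l\<close> of the double cosets of \<open>\<pi>\<^sup>-\<^sup>l\<close> with \<open>l\<close> dominant
  (\<open>cartan_decomposition\<close>).

  The proof compares these two families. If \<open>T\<^sub>l \<delta>\<^sub>s(e)\<close> does not vanish at a matrix of type \<open>f\<close>, then \<open>f\<close> is at least
  \<open>e + 2 l\<close> in the lexicographic order that starts at the last index, and both have the same sum
  (\<open>simultaneous_reduction\<close>, \<open>hact_hop_support\<close>). In the extreme case \<open>f = e + 2 l\<close> only one left coset contributes,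
  and the value at the signs \<open>\<eta>\<close> is \<open>s(\<eta>)\<close> times the order of a subgroup of \<open>{1, -1}\<^sup>r\<close>, which is a unit
  (\<open>coset_rigidity\<close>, \<open>hact_hop_leading\<close>). So \<open>T\<^sub>l \<delta>\<^sub>s(e)\<close> is a unit multiple of \<open>\<delta>\<^sub>s(e + 2 l)\<close> plus terms of larger type, of
  which only finitely many are possible.

  It remains to see that each pair \<open>(s, f)\<close> with \<open>s\<close> constant on the blocks of \<open>f\<close> is \<open>(s, e + 2 l)\<close> for exactly one
  index \<open>(s, e)\<close> of the proposed basis and one dominant \<open>l\<close>. The condition on \<open>s\<close> says that the gaps \<open>f\<^sub>i - f\<^sub>i\<^sub>+\<^sub>1\<close> are at
  least \<open>c\<^sub>i(s)\<close>. The excess is split into its parity, which goes to \<open>e\<close>, and twice the gap of \<open>l\<close>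
  (\<open>ishift_inj\<close>, \<open>ishift_surj\<close>). By triangularity the \<open>T\<^sub>l \<delta>\<^sub>s(e)\<close> form a basis over the coefficient ring, which is to say
  that the \<open>\<delta>\<^sub>s(e)\<close> form a basis over the Hecke algebra (\<open>schwartz_in_dspan\<close>, \<open>independent\<close>). There are \<open>2\<^sup>r\<close> choices of
  \<open>s\<close> and \<open>2\<^sup>r\<close> choices of parities.

  Topology enters only through the fact that cosets and orbits are open and compact: functions with compact support are
  functions with finite support modulo \<open>K\<close>, and the algebra of coset sums works for abstract groups.
\<close>

section \<open>The field\<close>

locale odd_padic = padic_local_field av p
  for av :: "'a::field_char_0 \<Rightarrow> real" and p :: nat +
  fixes \<pi> :: 'a
  assumes odd_p: "odd p" and unif: "uniformizer av \<pi>"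
begin

lemma av_0 [simp]: "av 0 = 0"
  by (simp add: av_eq_0_iff)

lemma av_1 [simp]: "av 1 = 1"
proof -
  have "av 1 * av 1 = av 1 * 1" using av_mult[of 1 1] by simp
  moreover have "av 1 \<noteq> 0" by (simp add: av_eq_0_iff)
  ultimately show ?thesis using mult_left_cancel by blast
qed

lemma av_pos: "x \<noteq> 0 \<Longrightarrow> av x > 0"
  using av_nonneg[of x] av_eq_0_iff[of x] by linarith

lemma av_uminus [simp]: "av (- x) = av x"
proof -
  have "av (-1) * av (-1) = 1" using av_mult[of "-1" "-1"] by simp
  hence "av (-1) = 1" using av_nonneg[of "-1"]
    by (metis abs_of_nonneg real_sqrt_abs2 real_sqrt_one)
  thus ?thesis using av_mult[of "-1" x] by simp
qed

lemma av_diff: "av (x - y) \<le> max (av x) (av y)"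
  using av_ultrametric[of x "- y"] by simp

lemma av_commute: "av (x - y) = av (y - x)"
  using av_uminus[of "x - y"] by simp

lemma av_inverse: "av (inverse x) = inverse (av x)"
proof (cases "x = 0")
  case False
  hence "av x * av (inverse x) = 1" by (metis av_1 av_mult right_inverse)
  thus ?thesis by (metis inverse_unique)
qed simp

lemma av_divide: "av (x / y) = av x / av y"
  by (simp add: divide_inverse av_mult av_inverse)

lemma av_power: "av (x ^ n) = av x ^ n"
  by (induction n) (simp_all add: av_mult)

lemma av_powi: "av (x powi n) = av x powi n"
  by (simp add: power_int_def av_power av_inverse)

lemma av_add_le: "av x \<le> b \<Longrightarrow> av y \<le> b \<Longrightarrow> av (x + y) \<le> b"
  using av_ultrametric[of x y] by linarith

lemma av_diff_le: "av x \<le> b \<Longrightarrow> av y \<le> b \<Longrightarrow> av (x - y) \<le> b"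
  using av_diff[of x y] by linarith

lemma av_add_less: "av x < b \<Longrightarrow> av y < b \<Longrightarrow> av (x + y) < b"
  using av_ultrametric[of x y] by linarith

lemma av_diff_less: "av x < b \<Longrightarrow> av y < b \<Longrightarrow> av (x - y) < b"
  using av_diff[of x y] by linarith

lemma av_sum_le: "(\<And>i. i \<in> A \<Longrightarrow> av (f i) \<le> b) \<Longrightarrow> b \<ge> 0 \<Longrightarrow> av (sum f A) \<le> b"
  by (induction A rule: infinite_finite_induct) (auto intro: av_add_le)

lemma av_sum_less: "(\<And>i. i \<in> A \<Longrightarrow> av (f i) < b) \<Longrightarrow> b > 0 \<Longrightarrow> av (sum f A) < b"
  by (induction A rule: infinite_finite_induct) (auto intro: av_add_less)

lemma av_prod: "av (prod f A) = (\<Prod>i\<in>A. av (f i))"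
  by (induction A rule: infinite_finite_induct) (auto simp: av_mult)

lemma av_add_eq: "av x < av y \<Longrightarrow> av (x + y) = av y"
  using av_ultrametric[of x y] av_diff[of "x + y" x] by (simp add: max_def split: if_splits)

lemma av_close_eq: "av (x - y) < av y \<Longrightarrow> av x = av y"
  using av_add_eq[of "x - y" y] by simp

lemma av_mult_le_1: "av x \<le> 1 \<Longrightarrow> av y \<le> 1 \<Longrightarrow> av (x * y) \<le> 1"
  by (simp add: av_mult mult_le_one av_nonneg)

lemma av_of_nat: "av (of_nat n) \<le> 1"
  by (induction n) (auto intro: av_add_le)

abbreviation c :: real where "c \<equiv> av \<pi>"

lemma unif_nz [simp]: "\<pi> \<noteq> 0" using unif by (simp add: uniformizer_def)

lemma c_pos: "0 < c" by (simp add: av_pos)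

lemma c_less_1: "c < 1"
proof -
  have "\<pi> * 1 \<in> (\<lambda>x. \<pi> * x) ` integers av" by (rule imageI) (simp add: integers_def)
  hence "\<pi> \<in> max_ideal av" using unif by (simp add: uniformizer_def)
  thus ?thesis by (simp add: max_ideal_def)
qed

lemma av_less_1_iff: "av x < 1 \<longleftrightarrow> av x \<le> c"
proof
  assume "av x < 1"
  hence "x \<in> max_ideal av" by (simp add: max_ideal_def)
  hence "x \<in> (\<lambda>x. \<pi> * x) ` integers av" using unif by (simp add: uniformizer_def)
  then obtain y where "x = \<pi> * y" "av y \<le> 1" by (auto simp: integers_def)
  thus "av x \<le> c" using c_pos by (simp add: av_mult)
qed (use c_less_1 in simp)

lemma c_powi_le_iff: "c powi m \<le> c powi n \<longleftrightarrow> n \<le> m"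
  using power_int_decreasing[of n m c] power_int_strict_decreasing[of m n c] c_pos c_less_1
  by (cases "n \<le> m") auto

lemma c_powi_less_iff: "c powi m < c powi n \<longleftrightarrow> n < m"
  using c_powi_le_iff[of n m] by linarith

lemma c_powi_eq_iff [simp]: "c powi m = c powi n \<longleftrightarrow> m = n"
  using c_powi_le_iff[of n m] c_powi_le_iff[of m n] by linarith

lemma c_powi_pos [simp]: "0 < c powi n" using c_pos by simp

lemma c_powi_nonneg [simp]: "0 \<le> c powi n" using c_powi_pos less_imp_le by blast

lemma powi_add_unif: "\<pi> powi (m + n) = \<pi> powi m * \<pi> powi n"
  by (simp add: power_int_add)

lemma powi_add_c: "c powi (m + n) = c powi m * c powi n"
  using c_pos by (simp add: power_int_add)

lemma c_powr: "c powi n = c powr (real_of_int n)"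
  using c_pos by (metis powr_real_of_int' less_imp_le less_irrefl)

text \<open>With \<open>n\<close> the floor of the logarithm of \<open>av x\<close> to base \<open>c\<close>, the quotient of \<open>x\<close> by \<open>\<pi> powi n\<close> has
  absolute value in \<open>(c, 1]\<close>, and nothing lies strictly between \<open>c\<close> and 1.\<close>

lemma value_group:
  assumes "x \<noteq> 0" shows "\<exists>n. av x = c powi n"
proof -
  define t where "t = ln (av x) / ln c"
  define n where "n = \<lfloor>t\<rfloor>"
  have lc: "ln c < 0" using c_pos c_less_1 by simp
  have e: "av x = c powr t" using av_pos[OF assms] c_pos lc
    by (simp add: t_def powr_def)
  have le: "av x \<le> c powi n" unfolding e c_powr n_def
    by (rule powr_mono') (use c_pos c_less_1 in auto)
  have gt: "c powi (n + 1) < av x"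
  proof -
    have "t < real_of_int (n + 1)" unfolding n_def by linarith
    thus ?thesis unfolding e c_powr using c_pos c_less_1 by (simp add: powr_less_mono')
  qed
  have pp: "0 < c powi n" by simp
  have "av (x / \<pi> powi n) > c"
  proof -
    have "c * c powi n < av x" using gt by (simp add: powi_add_c mult.commute)
    thus ?thesis using pp by (simp add: av_divide av_powi pos_less_divide_eq)
  qed
  hence "\<not> av (x / \<pi> powi n) < 1" using av_less_1_iff by auto
  hence "av x \<ge> c powi n" using pp by (simp add: av_divide av_powi not_less pos_le_divide_eq)
  thus ?thesis using le by (intro exI[of _ n]) simp
qed

lemma av_2 [simp]: "av 2 = 1"
proof (rule ccontr)
  assume "av 2 \<noteq> 1"
  hence "av 2 < 1" using av_of_nat[of 2] by simp
  obtain k where k: "p = 2 * k + 1" using odd_p by (elim oddE)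
  have "av (of_nat p) < 1" using residue_char by (simp add: max_ideal_def)
  moreover have "av (2 * of_nat k) < 1"
    using \<open>av 2 < 1\<close> av_of_nat[of k] av_nonneg[of 2] av_nonneg[of "of_nat k"]
    by (simp add: av_mult) (meson le_less_trans mult_left_le)
  ultimately have "av (of_nat p - 2 * of_nat k) < 1" by (rule av_diff_less)
  thus False by (simp add: k)
qed

subsection \<open>Completeness\<close>

sublocale AM: Metric_space UNIV "\<lambda>x y. av (x - y)"
proof
  fix x y z :: 'a
  show "av (x - z) \<le> av (x - y) + av (y - z)"
    using av_ultrametric[of "x - y" "y - z"] av_nonneg[of "x - y"] av_nonneg[of "y - z"] by simp
qed (auto simp: av_nonneg av_eq_0_iff intro: av_commute)

lemma cauchy_limit:
  assumes "\<And>n. av (f (Suc n) - f n) \<le> b * c ^ n"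
  obtains l where "\<And>n. av (f n - l) \<le> b * c ^ n"
proof -
  have b: "b \<ge> 0" using assms[of 0] order_trans[OF av_nonneg[of "f (Suc 0) - f 0"]] by simp
  have step: "av (f (n + k) - f n) \<le> b * c ^ n" for n k
  proof (induction k)
    case (Suc k)
    have "b * c ^ (n + k) \<le> b * c ^ n"
      using b c_pos c_less_1 by (intro mult_left_mono power_decreasing) auto
    hence "av (f (Suc (n + k)) - f (n + k)) \<le> b * c ^ n" using assms[of "n + k"] by simp
    from av_add_le[OF this Suc] show ?case by simp
  qed (use b c_pos in simp)
  have lim0: "(\<lambda>n. b * c ^ n) \<longlonglongrightarrow> 0"
    using c_pos c_less_1 by (intro tendsto_mult_right_zero LIMSEQ_realpow_zero) auto
  have "AM.MCauchy f" unfolding AM.MCauchy_def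
  proof (intro conjI allI impI)
    fix \<epsilon> :: real assume "\<epsilon> > 0"
    then obtain N where N: "\<And>n. n \<ge> N \<Longrightarrow> b * c ^ n < \<epsilon>"
      using lim0 order_tendstoD(2)[OF lim0, of \<epsilon>] by (auto simp: eventually_sequentially)
    have "av (f n - f n') < \<epsilon>" if "N \<le> n" "N \<le> n'" for n n'
    proof -
      have "av (f n - f N) \<le> b * c ^ N" "av (f n' - f N) \<le> b * c ^ N"
        using step[of N "n - N"] step[of N "n' - N"] that by simp_all
      from av_diff_le[OF this] show ?thesis using N[of N] by simp
    qed
    thus "\<exists>N. \<forall>n n'. N \<le> n \<longrightarrow> N \<le> n' \<longrightarrow> av (f n - f n') < \<epsilon>" by blast
  qed auto
  then obtain l where l: "limitin AM.mtopology f l sequentially"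
    using complete AM.mcomplete_def by blast
  have "av (f n - l) \<le> b * c ^ n" for n
  proof (rule ccontr)
    assume "\<not> ?thesis"
    hence gt: "av (f n - l) > b * c ^ n" by simp
    hence "av (f n - l) > 0" using b c_pos by (smt (verit) zero_le_mult_iff zero_le_power)
    then have "\<forall>\<^sub>F m in sequentially. av (f m - l) < av (f n - l)"
      using l by (simp add: AM.limitin_metric)
    then obtain N where "\<And>m. m \<ge> N \<Longrightarrow> av (f m - l) < av (f n - l)"
      by (auto simp: eventually_sequentially)
    then obtain m where m: "m \<ge> n" "av (f m - l) < av (f n - l)"
      by (meson max.cobounded1 max.cobounded2)
    have "av (f m - f n) < av (f n - l)" using step[of n "m - n"] m gt by simp
    from av_diff_less[OF m(2) this] show False by simp
  qed
  thus ?thesis using that by blast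
qed

lemma limit_unique_0:
  assumes "\<And>n. av x \<le> b * c ^ n" shows "x = 0"
proof -
  have "(\<lambda>n. b * c ^ n) \<longlonglongrightarrow> 0"
    using c_pos c_less_1 by (intro tendsto_mult_right_zero LIMSEQ_realpow_zero) auto
  hence "av x \<le> 0" by (rule LIMSEQ_le_const) (use assms in auto)
  thus ?thesis using av_nonneg[of x] av_eq_0_iff by force
qed

text \<open>Hensel's lemma for square roots: writing \<open>x = 1 + d\<close>, the map \<open>t \<mapsto> (d - t\<^sup>2) / 2\<close> contracts the maximal
  ideal by the factor \<open>c\<close> because 2 is a unit, and its fixed point \<open>l\<close> satisfies \<open>(1 + l)\<^sup>2 = x\<close>.\<close>

lemma one_unit_square:
  assumes "av (x - 1) < 1"
  obtains w where "w\<^sup>2 = x" "av w = 1"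
proof -
  \<comment> \<open>\<open>f\<close> iterates the contraction \<open>g\<close>, starting at 0.\<close>
  define d where "d = x - 1"
  have d: "av d \<le> c" using assms by (simp add: d_def av_less_1_iff)
  define g where "g t = (d - t\<^sup>2) / 2" for t
  define f where "f n = (g ^^ n) 0" for n
  have sq: "av (t\<^sup>2) \<le> c" if "av t \<le> c" for t
    using that c_less_1 c_pos av_nonneg[of t]
    by (smt (verit) av_power mult_left_le power2_eq_square)
  have g: "av (g t) \<le> c" if "av t \<le> c" for t
    using d sq[OF that] by (simp add: g_def av_divide av_diff_le)
  have fc: "av (f n) \<le> c" for n
    by (induction n) (use c_pos g in \<open>simp_all add: f_def\<close>)
  have gl: "av (g t - g s) \<le> c * av (t - s)" if "av t \<le> c" "av s \<le> c" for s t
  proof -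
    have e: "g t - g s = (t + s) * (s - t) / 2" by (simp add: g_def field_simps power2_eq_square)
    show ?thesis using av_add_le[OF that] av_commute[of s t] unfolding e
      by (simp add: av_divide av_mult mult_right_mono av_nonneg add.commute)
  qed
  have "av (f (Suc n) - f n) \<le> c * c ^ n" for n
  proof (induction n)
    case 0 thus ?case using d by (simp add: f_def g_def av_divide)
  next
    case (Suc n)
    have "av (f (Suc (Suc n)) - f (Suc n)) \<le> c * av (f (Suc n) - f n)"
      using gl[OF fc fc, of "Suc n" n] by (simp add: f_def)
    also have "\<dots> \<le> c * (c * c ^ n)" using Suc c_pos by (intro mult_left_mono) auto
    finally show ?case by simp
  qed
  then obtain l where l: "\<And>n. av (f n - l) \<le> c * c ^ n" using cauchy_limit by blast
  have lc: "av l \<le> c"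
    using av_diff_le[OF fc[of 0] l[of 0, simplified]] by (simp add: f_def)
  have "av (g l - l) \<le> c * c ^ n" for n
  proof -
    have "av (g l - f (Suc n)) \<le> c * av (l - f n)"
      using gl[OF lc fc, of n] by (simp add: f_def)
    also have "\<dots> \<le> c * c ^ n"
      using l[of n] c_pos c_less_1 av_commute[of l "f n"] av_nonneg[of "l - f n"]
      by (smt (verit) mult_left_le_one_le)
    finally have a: "av (g l - f (Suc n)) \<le> c * c ^ n" .
    have "c * c ^ Suc n \<le> c * c ^ n" using c_pos c_less_1
      by (intro mult_left_mono power_decreasing) auto
    hence "av (f (Suc n) - l) \<le> c * c ^ n" using l[of "Suc n"] by linarith
    from av_add_le[OF a this] show ?thesis by simp
  qed
  hence "g l - l = 0" by (rule limit_unique_0)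
  hence "d = 2 * l + l\<^sup>2" by (simp add: g_def field_simps)
  hence "(1 + l)\<^sup>2 = x" by (simp add: d_def power2_eq_square field_simps)
  moreover have "av (1 + l) = 1" using av_add_eq[of l 1] lc c_less_1 by (simp add: add.commute)
  ultimately show ?thesis using that by blast
qed

subsection \<open>The residue field and square classes of units\<close>

lemma finite_residue_reps:
  obtains S where "finite S" "S \<subseteq> integers av" "\<And>x. av x \<le> 1 \<Longrightarrow> \<exists>s\<in>S. av (x - s) < 1"
proof -
  let ?r = "{(x, y). x \<in> integers av \<and> y \<in> integers av \<and> x - y \<in> max_ideal av}"
  define S where "S = (\<lambda>X. SOME x. x \<in> X) ` (integers av // ?r)"
  have key: "(SOME y. y \<in> ?r `` {x}) \<in> integers av \<and> av (x - (SOME y. y \<in> ?r `` {x})) < 1"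
    if "av x \<le> 1" for x
  proof -
    define s where "s = (SOME y. y \<in> ?r `` {x})"
    have "x \<in> ?r `` {x}" using that by (simp add: integers_def max_ideal_def)
    hence "s \<in> ?r `` {x}" unfolding s_def by (rule someI)
    hence "s \<in> integers av \<and> av (x - s) < 1" by (simp add: max_ideal_def)
    thus ?thesis unfolding s_def .
  qed
  show ?thesis
  proof
    show "finite S" unfolding S_def using residue_field_finite by simp
    show "S \<subseteq> integers av"
      using key by (auto simp: S_def quotient_def integers_def)
    fix x assume x: "av x \<le> 1"
    hence "?r `` {x} \<in> integers av // ?r" by (intro quotientI) (simp add: integers_def)
    hence "(SOME y. y \<in> ?r `` {x}) \<in> S" unfolding S_def by (rule imageI)
    thus "\<exists>s\<in>S. av (x - s) < 1" using key[OF x] by blast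
  qed
qed

lemma unit_square_close:
  assumes "av (x - y) < 1" "av y = 1" "\<exists>w. av w = 1 \<and> y = w\<^sup>2"
  shows "\<exists>w. av w = 1 \<and> x = w\<^sup>2"
proof -
  obtain w where w: "av w = 1" "y = w\<^sup>2" using assms by blast
  have y0: "y \<noteq> 0" using assms(2) by auto
  have "x / y - 1 = (x - y) / y" using y0 by (simp add: field_simps)
  hence "av (x / y - 1) < 1" using assms by (simp add: av_divide)
  then obtain v where v: "v\<^sup>2 = x / y" "av v = 1" by (rule one_unit_square)
  have "x = (v * w)\<^sup>2" using v w y0 by (simp add: power_mult_distrib)
  thus ?thesis using v w by (intro exI[of _ "v * w"]) (simp add: av_mult)
qed

definition sq_unit :: "'a \<Rightarrow> bool" where "sq_unit x \<longleftrightarrow> (\<exists>w. av w = 1 \<and> x = w\<^sup>2)"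

lemma sq_unit_av: "sq_unit x \<Longrightarrow> av x = 1"
  by (auto simp: sq_unit_def av_power)

lemma sq_unit_mult: "sq_unit x \<Longrightarrow> sq_unit y \<Longrightarrow> sq_unit (x * y)"
  unfolding sq_unit_def by (metis av_mult mult_1 power_mult_distrib)

lemma sq_unit_inverse: "sq_unit x \<Longrightarrow> sq_unit (inverse x)"
  unfolding sq_unit_def by (metis av_inverse inverse_1 power_inverse)

lemma sq_unit_power2: "av x = 1 \<Longrightarrow> sq_unit (x\<^sup>2)" by (auto simp: sq_unit_def)

lemma sq_unit_1 [simp]: "sq_unit 1" using sq_unit_power2[of 1] by simp

lemma sq_unit_close: "av (x - y) < 1 \<Longrightarrow> sq_unit y \<Longrightarrow> sq_unit x"
  using unit_square_close sq_unit_av unfolding sq_unit_def by blast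

text \<open>Squaring is two-to-one on the nonzero residue classes, so that half of them are squares. By
  Hensel, a unit is a square as soon as its residue class is one.\<close>

lemma square_classes:
  shows "\<exists>u. av u = 1 \<and> \<not> sq_unit u"
    and "av u = 1 \<Longrightarrow> av v = 1 \<Longrightarrow> \<not> sq_unit u \<Longrightarrow> \<not> sq_unit v \<Longrightarrow> sq_unit (u * v)"
proof -
  obtain S where S: "finite S" "S \<subseteq> integers av" "\<And>x. av x \<le> 1 \<Longrightarrow> \<exists>s\<in>S. av (x - s) < 1"
    using finite_residue_reps by blast
  define cls where "cls x = {s \<in> S. av (x - s) < 1}" for x
  have cls_eq: "cls x = cls y \<longleftrightarrow> av (x - y) < 1" if xy1: "av x \<le> 1" "av y \<le> 1" for x y
  proof
    assume "cls x = cls y"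
    moreover obtain s where "s \<in> cls x" using S(3)[OF xy1(1)] by (auto simp: cls_def)
    ultimately have "av (x - s) < 1" "av (y - s) < 1" by (auto simp: cls_def)
    from av_diff_less[OF this] show "av (x - y) < 1" by simp
  next
    assume xy: "av (x - y) < 1"
    have "av (y - s) < 1" if "av (x - s) < 1" for s using av_diff_less[OF that xy] by simp
    moreover have "av (x - s) < 1" if "av (y - s) < 1" for s using av_add_less[OF that xy] by simp
    ultimately show "cls x = cls y" by (auto simp: cls_def)
  qed
  define U where "U = cls ` {x. av x = 1}"
  have finU: "finite U" using S(1) by (rule_tac finite_subset[of _ "Pow S"]) (auto simp: U_def cls_def)
  define I where "I = cls ` {x. sq_unit x}"
  have IU: "I \<subseteq> U" by (auto simp: I_def U_def sq_unit_av)
  have cardU: "card U = 2 * card I"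
  proof -
    define F where "F y = cls ` {x. av x = 1 \<and> cls (x\<^sup>2) = y}" for y
    have U: "U = (\<Union>y\<in>I. F y)"
      using sq_unit_power2 by (fastforce simp: U_def F_def I_def)
    have sqcong: "cls (x\<^sup>2) = cls (z\<^sup>2) \<longleftrightarrow> cls x = cls z \<or> cls x = cls (-z)"
      if "av x = 1" "av z = 1" for x z
    proof -
      have "x\<^sup>2 - z\<^sup>2 = (x - z) * (x - (-z))" by (simp add: power2_eq_square algebra_simps)
      hence "av (x\<^sup>2 - z\<^sup>2) = av (x - z) * av (x - (-z))" by (simp add: av_mult)
      moreover have "av (x - z) \<le> 1" "av (x - (-z)) \<le> 1"
        using that av_diff_le[of x 1 z] av_diff_le[of x 1 "- z"] by auto
      ultimately have "av (x\<^sup>2 - z\<^sup>2) < 1 \<longleftrightarrow> av (x - z) < 1 \<or> av (x - (-z)) < 1"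
        using av_nonneg[of "x - z"] av_nonneg[of "x - (-z)"]
        by (smt (verit, best) mult_left_le_one_le mult_right_le_one_le mult_cancel_left2)
      thus ?thesis using that by (simp add: cls_eq av_power)
    qed
    have disj: "F y \<inter> F z = {}" if "y \<noteq> z" for y z
    proof (rule ccontr)
      assume "F y \<inter> F z \<noteq> {}"
      then obtain a b where ab: "av a = 1" "av b = 1" "cls (a\<^sup>2) = y" "cls (b\<^sup>2) = z" "cls a = cls b"
        unfolding F_def by blast
      show False using sqcong[OF ab(1,2)] ab that by simp
    qed
    have c2: "card (F y) = 2" if yI: "y \<in> I" for y
    proof -
      obtain w where w: "av w = 1" "y = cls (w\<^sup>2)" using yI by (auto simp: I_def sq_unit_def)
      have "cls w \<in> F y" "cls (-w) \<in> F y"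
        unfolding F_def w(2) using w(1) by (intro imageI; simp)+
      moreover have "F y \<subseteq> {cls w, cls (-w)}"
        unfolding F_def w(2) using sqcong[OF _ w(1)] by blast
      ultimately have "F y = {cls w, cls (-w)}" by blast
      moreover have "cls w \<noteq> cls (-w)"
        using w(1) cls_eq[of w "-w"] by (simp add: av_mult flip: mult_2)
      ultimately show ?thesis by simp
    qed
    have "card U = (\<Sum>y\<in>I. card (F y))" unfolding U
      using finU IU c2 disj
      by (intro card_UN_disjoint) (auto intro: finite_subset card_ge_0_finite)
    also have "\<dots> = 2 * card I" using c2 by simp
    finally show ?thesis .
  qed
  have finI: "finite I" using finU IU finite_subset by blast
  have "cls 1 \<in> I" by (auto simp: I_def)
  hence I0: "card I > 0" using finI card_gt_0_iff by blast
  have memI: "sq_unit x" if "av x = 1" "cls x \<in> I" for x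
  proof -
    obtain y where "sq_unit y" "cls x = cls y" using \<open>cls x \<in> I\<close> by (auto simp: I_def)
    thus ?thesis using sq_unit_close[of x y] cls_eq[of x y] sq_unit_av[of y] that by auto
  qed
  show "\<exists>u. av u = 1 \<and> \<not> sq_unit u"
  proof (rule ccontr)
    assume "\<not> ?thesis"
    hence "U \<subseteq> I" by (auto simp: U_def I_def)
    hence "card U \<le> card I" using finI card_mono by blast
    thus False using cardU I0 by simp
  qed
  assume u: "av u = 1" "av v = 1" "\<not> sq_unit u" "\<not> sq_unit v"
  define J where "J = (\<lambda>w. cls (u * w)) ` {x. sq_unit x}"
  have JU: "J \<subseteq> U" using u by (auto simp: J_def U_def av_mult sq_unit_av)
  have u0: "u \<noteq> 0" using u by auto
  have IJ: "I \<inter> J = {}"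
  proof (rule ccontr)
    assume "I \<inter> J \<noteq> {}"
    then obtain w where w: "sq_unit w" "cls (u * w) \<in> I" by (auto simp: J_def)
    have "sq_unit (u * w)" by (rule memI) (use w u in \<open>simp_all add: av_mult sq_unit_av\<close>)
    hence "sq_unit (u * w * inverse w)" using w(1) sq_unit_inverse sq_unit_mult by blast
    moreover have "w \<noteq> 0" using sq_unit_av[OF w(1)] by auto
    hence "u * w * inverse w = u" by simp
    ultimately show False using u by metis
  qed
  have "card J = card I"
  proof -
    define h where "h X = cls (u * (SOME w. sq_unit w \<and> cls w = X))" for X
    have h: "h (cls w) = cls (u * w)" if "sq_unit w" for w
    proof -
      define v where "v = (SOME w'. sq_unit w' \<and> cls w' = cls w)"
      have v: "sq_unit v" "cls v = cls w"
        using someI[of "\<lambda>w'. sq_unit w' \<and> cls w' = cls w" w] that by (auto simp: v_def)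
      have "av (v - w) < 1" using v cls_eq[of v w] sq_unit_av that by simp
      moreover have "u * v - u * w = u * (v - w)" by (simp add: algebra_simps)
      ultimately have "cls (u * v) = cls (u * w)"
        using u that v cls_eq[of "u * v" "u * w"] by (simp add: av_mult sq_unit_av)
      thus ?thesis unfolding h_def v_def .
    qed
    have "J = h ` I" unfolding J_def I_def image_image using h by (intro image_cong) auto
    moreover have "inj_on h I"
    proof (rule inj_onI)
      fix X Y assume "X \<in> I" "Y \<in> I" "h X = h Y"
      then obtain a b where ab: "sq_unit a" "sq_unit b" "X = cls a" "Y = cls b" by (auto simp: I_def)
      have "cls (u * a) = cls (u * b)" using \<open>h X = h Y\<close> ab h by simp
      hence "av (u * a - u * b) < 1" using cls_eq[of "u * a" "u * b"] u ab
        by (simp add: av_mult sq_unit_av)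
      moreover have "u * a - u * b = u * (a - b)" by (simp add: algebra_simps)
      ultimately have "av (a - b) < 1" using u by (simp add: av_mult)
      thus "X = Y" using ab cls_eq[of a b] by (simp add: sq_unit_av)
    qed
    ultimately show ?thesis by (simp add: card_image)
  qed
  hence "card (I \<union> J) = card U" using cardU IJ finI finU JU finite_subset
    by (subst card_Un_disjoint) auto
  hence "I \<union> J = U" using IU JU finU by (intro card_seteq) auto
  moreover have "cls v \<in> U" using u by (auto simp: U_def)
  moreover have "cls v \<notin> I" using memI u by blast
  ultimately obtain w where w: "sq_unit w" "cls v = cls (u * w)" by (auto simp: J_def)
  hence "av (v - u * w) < 1" using cls_eq[of v "u * w"] u by (simp add: av_mult sq_unit_av)
  moreover have "u * v - u * (u * w) = u * (v - u * w)" by (simp add: algebra_simps)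
  ultimately have "av (u * v - u\<^sup>2 * w) < 1" using u by (simp add: av_mult power2_eq_square mult.assoc)
  moreover have "sq_unit (u\<^sup>2 * w)" using u w by (intro sq_unit_mult sq_unit_power2)
  ultimately show "sq_unit (u * v)" by (rule sq_unit_close)
qed

text \<open>Otherwise the elements whose residue class is zero or a square would be closed under sums and
  products. They contain \<open>-1 = (p - 1) - p\<close> and hence, by \<open>x = ((x + 1) / 2)\<^sup>2 - ((x - 1) / 2)\<^sup>2\<close>,
  everything integral.\<close>

lemma nonsquare_sum_of_squares:
  obtains a b where "sq_unit a" "sq_unit b" "av (a + b) = 1" "\<not> sq_unit (a + b)"
proof -
  have "\<exists>a b. sq_unit a \<and> sq_unit b \<and> av (a + b) = 1 \<and> \<not> sq_unit (a + b)"
  proof (rule ccontr)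
    assume N: "\<not> ?thesis"
    define C where "C x \<longleftrightarrow> av x < 1 \<or> sq_unit x" for x
    have add: "C (x + y)" if "C x" "C y" for x y
    proof (cases "av x < 1 \<or> av y < 1")
      case True
      thus ?thesis using that sq_unit_close[of "x + y" x] sq_unit_close[of "x + y" y]
        av_add_less[of x 1 y] unfolding C_def by auto
    next
      case False
      hence "sq_unit x" "sq_unit y" using that by (auto simp: C_def)
      moreover have "av (x + y) \<le> 1" using calculation sq_unit_av by (intro av_add_le) auto
      ultimately show ?thesis using N unfolding C_def by force
    qed
    have mult: "C (x * y)" if "C x" "C y" for x y
    proof -
      have "av x \<le> 1" "av y \<le> 1" using that sq_unit_av unfolding C_def by force+
      moreover have "av (x * y) < 1" if "av x < 1" "av y \<le> 1" for x y
        using that av_nonneg[of x] by (simp add: av_mult) (meson le_less_trans mult_left_le)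
      ultimately show ?thesis using that sq_unit_mult unfolding C_def by (metis mult.commute)
    qed
    have nat: "C (of_nat n)" for n
    proof (induction n)
      case (Suc n)
      thus ?case using add[of 1 "of_nat n"] by (simp add: C_def)
    qed (simp add: C_def)
    have m1: "C (-1)"
    proof -
      have "-1 = of_nat (p - 1) + (- of_nat p :: 'a)"
        using prime_gt_0_nat[OF prime_p] by (simp add: of_nat_diff Suc_leI)
      moreover have "C (- of_nat p)" using residue_char by (simp add: C_def max_ideal_def)
      ultimately show ?thesis using add[OF nat] by metis
    qed
    have sq: "C (x\<^sup>2)" if "av x \<le> 1" for x
      using that sq_unit_power2[of x] av_nonneg[of x] unfolding C_def
      by (cases "av x = 1") (auto simp: av_power power_less_one_iff)
    have "C x" if "av x = 1" for x
    proof -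
      have "x = ((x + 1) / 2)\<^sup>2 + (-1) * ((x - 1) / 2)\<^sup>2"
        by (simp add: power2_eq_square field_simps)
      moreover have "av ((x + 1) / 2) \<le> 1" "av ((x - 1) / 2) \<le> 1"
        using that by (auto simp: av_divide intro!: av_add_le av_diff_le)
      ultimately show ?thesis using add mult m1 sq by metis
    qed
    thus False using square_classes(1) unfolding C_def by force
  qed
  thus ?thesis using that by blast
qed

lemma finite_reps_mod_power:
  "\<exists>S. finite S \<and> S \<subseteq> integers av \<and> (\<forall>x. av x \<le> 1 \<longrightarrow> (\<exists>s\<in>S. av (x - s) \<le> c ^ N))"
proof (induction N)
  case 0
  show ?case by (rule exI[of _ "{0}"]) (auto simp: integers_def)
next
  case (Suc N)
  then obtain S where S: "finite S" "S \<subseteq> integers av" "\<And>x. av x \<le> 1 \<Longrightarrow> \<exists>s\<in>S. av (x - s) \<le> c ^ N"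
    by blast
  obtain T where T: "finite T" "T \<subseteq> integers av" "\<And>x. av x \<le> 1 \<Longrightarrow> \<exists>s\<in>T. av (x - s) < 1"
    using finite_residue_reps by blast
  let ?S = "(\<lambda>(s, t). s + \<pi> ^ N * t) ` (S \<times> T)"
  have cN: "c ^ N \<le> 1" "c ^ N > 0" using c_pos c_less_1 by (auto simp: power_le_one)
  have "?S \<subseteq> integers av"
  proof clarify
    fix s t assume "s \<in> S" "t \<in> T"
    hence "av s \<le> 1" "av t \<le> 1" using S T by (auto simp: integers_def)
    moreover have "av (\<pi> ^ N) \<le> 1" using cN by (simp add: av_power)
    ultimately show "s + \<pi> ^ N * t \<in> integers av"
      by (auto simp: integers_def intro!: av_add_le av_mult_le_1)
  qed
  moreover have "\<exists>s\<in>?S. av (x - s) \<le> c ^ Suc N" if x1: "av x \<le> 1" for x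
  proof -
    obtain s where s: "s \<in> S" "av (x - s) \<le> c ^ N" using S(3)[OF x1] by blast
    have "av ((x - s) / \<pi> ^ N) \<le> 1" using s cN by (simp add: av_divide av_power)
    then obtain t where t: "t \<in> T" "av ((x - s) / \<pi> ^ N - t) \<le> c"
      using T(3) av_less_1_iff by blast
    have "x - (s + \<pi> ^ N * t) = \<pi> ^ N * ((x - s) / \<pi> ^ N - t)" by (simp add: field_simps)
    hence "av (x - (s + \<pi> ^ N * t)) \<le> c ^ N * c" using t cN
      by (simp add: av_mult av_power mult_left_mono)
    thus ?thesis using s t by (intro bexI[of _ "s + \<pi> ^ N * t"]) (auto simp: mult.commute)
  qed
  ultimately show ?case using S(1) T(1) by (intro exI[of _ ?S]) blast
qed

text \<open>Closed balls are complete, and totally bounded because the residue field is finite.\<close>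

lemma integers_compact: "compactin (field_topology av) {x. av x \<le> b}"
proof -
  obtain m :: int where m: "b \<le> c powi m"
  proof (cases "b \<le> 0")
    case True thus ?thesis using that[of 0] by simp
  next
    case False
    obtain n where "(inverse c) ^ n > b" using real_arch_pow[of "inverse c" b] c_pos c_less_1
      by (auto simp: one_less_inverse_iff)
    thus ?thesis using that[of "- int n"] c_pos by (simp add: power_int_minus power_inverse)
  qed
  have cl: "closedin AM.mtopology {x. av x \<le> b}"
  proof -
    have "{x. av x \<le> b} = AM.mcball 0 b" by (auto simp: AM.mcball_def)
    thus ?thesis by simp
  qed
  have "AM.mtotally_bounded {x. av x \<le> c powi m}"
    unfolding AM.mtotally_bounded_def
  proof (intro allI impI)
    fix \<epsilon> :: real assume e: "\<epsilon> > 0"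
    obtain N where N: "c ^ N < \<epsilon> / c powi m"
      using real_arch_pow_inv[of "\<epsilon> / c powi m" c] c_less_1 e by auto
    obtain S where S: "finite S" "S \<subseteq> integers av" "\<And>x. av x \<le> 1 \<Longrightarrow> \<exists>s\<in>S. av (x - s) \<le> c ^ N"
      using finite_reps_mod_power[of N] by blast
    let ?K = "(\<lambda>s. \<pi> powi m * s) ` S"
    have "?K \<subseteq> {x. av x \<le> c powi m}" using S(2)
      by (auto simp: integers_def av_mult av_powi mult_left_le)
    moreover have "\<exists>s\<in>?K. av (s - x) < \<epsilon>" if "av x \<le> c powi m" for x
    proof -
      have "av (x / \<pi> powi m) \<le> 1" using that by (simp add: av_divide av_powi)
      then obtain s where s: "s \<in> S" "av (x / \<pi> powi m - s) \<le> c ^ N" using S(3) by blast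
      have "\<pi> powi m * s - x = - (\<pi> powi m * (x / \<pi> powi m - s))" by (simp add: field_simps)
      hence "av (\<pi> powi m * s - x) = c powi m * av (x / \<pi> powi m - s)" by (simp add: av_mult av_powi)
      also have "\<dots> \<le> c powi m * c ^ N" using s by (intro mult_left_mono) auto
      also have "\<dots> < \<epsilon>" using N by (simp add: pos_less_divide_eq mult.commute)
      finally show ?thesis using s by blast
    qed
    ultimately show "\<exists>K. finite K \<and> K \<subseteq> {x. av x \<le> c powi m} \<and> {x. av x \<le> c powi m} \<subseteq> (\<Union>x\<in>K. AM.mball x \<epsilon>)"
      using S(1) by (intro exI[of _ ?K]) (auto simp: AM.mball_def)
  qed
  hence "AM.mtotally_bounded {x. av x \<le> b}"
    by (rule AM.mtotally_bounded_subset) (use m in auto)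
  hence "compactin AM.mtopology (AM.mtopology closure_of {x. av x \<le> b})"
    using AM.mtotally_bounded_eq_compact_closure_of[OF complete] by blast
  thus ?thesis using cl by (simp add: field_topology_def closure_of_closedin)
qed

end

section \<open>Symmetric matrices and integral congruence\<close>

lemma sign_char_times:
  "x = 1 \<or> x = -1 \<Longrightarrow> y = 1 \<or> y = -1 \<Longrightarrow> sign_char s (x * y) = sign_char s x * sign_char s y"
  by (auto simp: sign_char_def)

text \<open>The orthogonal sum of the form \<open>A\<close> and the one-dimensional form \<open>\<langle>a\<rangle>\<close>, which comes last.\<close>

definition osum :: "'a::zero mat \<Rightarrow> 'a \<Rightarrow> 'a mat" where
  "osum A a = four_block_mat A (0\<^sub>m (dim_row A) 1) (0\<^sub>m 1 (dim_col A)) (mat 1 1 (\<lambda>_. a))"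

lemma osum_carrier [simp]: "A \<in> carrier_mat n n \<Longrightarrow> osum A a \<in> carrier_mat (Suc n) (Suc n)"
  by (auto simp: osum_def intro!: carrier_matI)

lemma osum_index:
  assumes "A \<in> carrier_mat n n" "i < Suc n" "j < Suc n"
  shows "osum A a $$ (i, j) = (if i < n \<and> j < n then A $$ (i, j) else if i = j then a else 0)"
  using assms by (auto simp: osum_def less_Suc_eq)

lemma osum_index_simps:
  assumes "A \<in> carrier_mat n n"
  shows "i < n \<Longrightarrow> j < n \<Longrightarrow> osum A a $$ (i, j) = A $$ (i, j)"
    and "i < n \<Longrightarrow> osum A a $$ (i, n) = 0"
    and "j < n \<Longrightarrow> osum A a $$ (n, j) = 0"
    and "osum A a $$ (n, n) = a"
  using assms by (auto simp: osum_index[OF assms])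

lemma osum_inject:
  assumes "A \<in> carrier_mat n n" "B \<in> carrier_mat n n" "osum A a = osum B b"
  shows "A = B" "a = b"
proof -
  show "A = B"
    using assms osum_index_simps(1)[OF assms(1)] osum_index_simps(1)[OF assms(2)]
    by (intro eq_matI) (auto, metis)
  show "a = b" using assms(3) osum_index_simps(4)[OF assms(1)] osum_index_simps(4)[OF assms(2)] by metis
qed

lemma osum_mult:
  fixes A B :: "'a::comm_ring_1 mat"
  assumes "A \<in> carrier_mat n n" "B \<in> carrier_mat n n"
  shows "osum A a * osum B b = osum (A * B) (a * b)"
  using assms unfolding osum_def
  by (subst mult_four_block_mat[of _ n n _ 1 _ 1 _ _ n _ 1])
    (auto intro!: cong_four_block_mat eq_matI simp: scalar_prod_def)

lemma osum_transpose: "A \<in> carrier_mat n n \<Longrightarrow> transpose_mat (osum A a) = osum (transpose_mat A) a"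
  unfolding osum_def
  by (subst transpose_four_block_mat[of _ n n _ 1 _ 1])
    (auto intro!: cong_four_block_mat)

lemma osum_act:
  fixes A B :: "'a::field mat"
  assumes "A \<in> carrier_mat n n" "B \<in> carrier_mat n n"
  shows "osum A a \<bullet>\<^sub>X osum B b = osum (A \<bullet>\<^sub>X B) (a * b\<^sup>2)"
  using assms unfolding act_def
  by (simp add: osum_transpose osum_mult[of _ n] power2_eq_square algebra_simps)

lemma osum_det:
  fixes A :: "'a::idom mat"
  assumes "A \<in> carrier_mat n n" shows "det (osum A a) = det A * a"
proof -
  have "det (mat 1 1 (\<lambda>_. a)) = a" by (subst det_single) auto
  thus ?thesis using assms unfolding osum_def
    by (subst det_four_block_mat_lower_left_zero[of _ n _ 1]) auto
qed

lemma mat_diag_Suc: "mat_diag (Suc n) f = osum (mat_diag n f) (f n)"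
  by (intro eq_matI) (auto simp: mat_diag_def osum_def less_Suc_eq)

lemma osum_of_zero_border:
  assumes "B \<in> carrier_mat (Suc n) (Suc n)"
    and "\<And>j. j < n \<Longrightarrow> B $$ (n, j) = 0" "\<And>j. j < n \<Longrightarrow> B $$ (j, n) = 0"
  shows "B = osum (mat n n (\<lambda>ij. B $$ ij)) (B $$ (n, n))"
  using assms by (intro eq_matI) (auto simp: osum_def less_Suc_eq)

lemma act_carrier [simp]:
  "A \<in> carrier_mat n n \<Longrightarrow> g \<in> carrier_mat n n \<Longrightarrow> A \<bullet>\<^sub>X g \<in> carrier_mat n n"
  by (simp add: act_def)

lemma act_act:
  assumes "A \<in> carrier_mat n n" "g \<in> carrier_mat n n" "h \<in> carrier_mat n n"
  shows "A \<bullet>\<^sub>X g \<bullet>\<^sub>X h = A \<bullet>\<^sub>X (g * h)"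
  using assms unfolding act_def
  by (simp add: transpose_mult[of _ n n _ n] assoc_mult_mat[of _ n n _ n _ n])

lemma act_one: "A \<in> carrier_mat n n \<Longrightarrow> A \<bullet>\<^sub>X 1\<^sub>m n = A"
  by (simp add: act_def)

lemma act_sym:
  assumes "A \<in> carrier_mat n n" "g \<in> carrier_mat n n" "transpose_mat A = A"
  shows "transpose_mat (A \<bullet>\<^sub>X g) = A \<bullet>\<^sub>X g"
  using assms unfolding act_def
  by (simp add: transpose_mult[of _ n n _ n] assoc_mult_mat[of _ n n _ n _ n])

lemma det_act:
  assumes "A \<in> carrier_mat n n" "g \<in> carrier_mat n n"
  shows "det (A \<bullet>\<^sub>X g) = (det g)\<^sup>2 * det A"
  using assms unfolding act_def
  by (simp add: det_mult[of _ n] det_transpose power2_eq_square)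

lemma mult_index_sum:
  assumes "A \<in> carrier_mat n m" "B \<in> carrier_mat m l" "i < n" "j < l"
  shows "(A * B) $$ (i, j) = (\<Sum>a<m. A $$ (i, a) * B $$ (a, j))"
  using assms by (simp add: scalar_prod_def atLeast0LessThan)

lemma act_index:
  assumes "A \<in> carrier_mat n n" "g \<in> carrier_mat n n" "i < n" "j < n"
  shows "(A \<bullet>\<^sub>X g) $$ (i, j) = (\<Sum>a<n. \<Sum>b<n. g $$ (a, i) * A $$ (a, b) * g $$ (b, j))"
proof -
  have "(A \<bullet>\<^sub>X g) $$ (i, j) = (\<Sum>b<n. (\<Sum>a<n. g $$ (a, i) * A $$ (a, b)) * g $$ (b, j))"
    using assms unfolding act_def
    by (subst mult_index_sum[of _ n n _ n])
      (auto simp: mult_index_sum[of "transpose_mat g" n n A n] simp del: index_mult_mat(1) intro!: sum.cong)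
  also have "\<dots> = (\<Sum>b<n. \<Sum>a<n. g $$ (a, i) * A $$ (a, b) * g $$ (b, j))"
    by (simp add: sum_distrib_right)
  also have "\<dots> = (\<Sum>a<n. \<Sum>b<n. g $$ (a, i) * A $$ (a, b) * g $$ (b, j))" by (rule sum.swap)
  finally show ?thesis .
qed

context odd_padic begin

definition bounded_mat :: "nat \<Rightarrow> real \<Rightarrow> 'a mat \<Rightarrow> bool" where
  "bounded_mat n b A \<longleftrightarrow> (\<forall>i<n. \<forall>j<n. av (A $$ (i, j)) \<le> b)"

text \<open>The general linear group of the ring of integers; the inverse of such a matrix is integral because the determinant is a unit.\<close>

definition GLO :: "nat \<Rightarrow> 'a mat set" where
  "GLO n = {k \<in> carrier_mat n n. bounded_mat n 1 k \<and> av (det k) = 1}"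

lemma GLO_carrier [simp]: "k \<in> GLO n \<Longrightarrow> k \<in> carrier_mat n n"
  by (auto simp: GLO_def)

lemma bounded_mat_mult:
  assumes "A \<in> carrier_mat n n" "B \<in> carrier_mat n n" "bounded_mat n a A" "bounded_mat n b B"
    and "a \<ge> 0" "b \<ge> 0"
  shows "bounded_mat n (a * b) (A * B)"
  unfolding bounded_mat_def
proof (intro allI impI)
  fix i j assume ij: "i < n" "j < n"
  have "av (A $$ (i, x) * B $$ (x, j)) \<le> a * b" if "x < n" for x
    using assms that ij by (simp add: av_mult bounded_mat_def mult_mono av_nonneg)
  thus "av ((A * B) $$ (i, j)) \<le> a * b"
    unfolding mult_index_sum[OF assms(1,2) ij] using assms by (intro av_sum_le) auto
qed

lemma bounded_mat_transpose:
  "A \<in> carrier_mat n n \<Longrightarrow> bounded_mat n b (transpose_mat A) = bounded_mat n b A"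
  by (auto simp: bounded_mat_def)

lemma bounded_mat_act:
  assumes "A \<in> carrier_mat n n" "k \<in> carrier_mat n n" "bounded_mat n 1 k" "bounded_mat n b A" "b \<ge> 0"
  shows "bounded_mat n b (A \<bullet>\<^sub>X k)"
proof -
  have "bounded_mat n (1 * b * 1) (transpose_mat k * A * k)"
    using assms by (intro bounded_mat_mult[of _ n]) (auto simp: bounded_mat_transpose)
  thus ?thesis by (simp add: act_def)
qed

lemma prod_le_1_real: "(\<And>i. i \<in> A \<Longrightarrow> av (f i) \<le> 1) \<Longrightarrow> av (prod f A) \<le> 1"
  unfolding av_prod by (intro prod_le_1) (auto simp: av_nonneg)

lemma det_integral:
  assumes "A \<in> carrier_mat n n" "bounded_mat n 1 A" shows "av (det A) \<le> 1"
  unfolding det_def'[OF assms(1)]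
proof (intro av_sum_le)
  fix q assume "q \<in> {q. q permutes {0..<n}}"
  hence q: "q i < n" if "i < n" for i using that permutes_in_image[of q "{0..<n}" i] by auto
  have "av (\<Prod>i = 0..<n. A $$ (i, q i)) \<le> 1"
    using assms q by (intro prod_le_1_real) (auto simp: bounded_mat_def)
  moreover have "av (signof q :: 'a) \<le> 1" by (simp add: sign_def)
  ultimately show "av (signof q * (\<Prod>i = 0..<n. A $$ (i, q i))) \<le> 1" by (intro av_mult_le_1)
qed simp

lemma GLO_mult:
  assumes "k \<in> GLO n" "l \<in> GLO n" shows "k * l \<in> GLO n"
proof -
  have c: "k \<in> carrier_mat n n" "l \<in> carrier_mat n n" using assms by simp_all
  have b: "bounded_mat n 1 k" "bounded_mat n 1 l" "av (det k) = 1" "av (det l) = 1"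
    using assms by (auto simp: GLO_def simp del: GLO_carrier)
  have "bounded_mat n (1 * 1) (k * l)" using b by (intro bounded_mat_mult c) auto
  moreover have "av (det (k * l)) = 1" using b by (simp add: det_mult[OF c] av_mult)
  ultimately show ?thesis using c mult_carrier_mat[OF c] by (auto simp: GLO_def simp del: GLO_carrier)
qed

lemma GLO_one [simp]: "1\<^sub>m n \<in> GLO n"
  by (auto simp: GLO_def bounded_mat_def simp del: GLO_carrier)

lemma GLO_transpose: "k \<in> GLO n \<Longrightarrow> transpose_mat k \<in> GLO n"
  by (auto simp: GLO_def bounded_mat_transpose det_transpose simp del: GLO_carrier)

lemma GLO_inverse:
  assumes "k \<in> GLO n"
  obtains l where "l \<in> GLO n" "k * l = 1\<^sub>m n" "l * k = 1\<^sub>m n"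
proof
  have k: "k \<in> carrier_mat n n" "bounded_mat n 1 k" "av (det k) = 1" using assms by (auto simp: GLO_def simp del: GLO_carrier)
  hence d: "det k \<noteq> 0" by auto
  define l where "l = inverse (det k) \<cdot>\<^sub>m adj_mat k"
  have lc: "l \<in> carrier_mat n n" using adj_mat(1)[OF k(1)] by (simp add: l_def)
  show kl: "k * l = 1\<^sub>m n" "l * k = 1\<^sub>m n"
    using adj_mat[OF k(1)] k d by (auto simp: l_def mult_smult_distrib mult_smult_assoc_mat[of _ n n])
  have "av (cofactor k j i) \<le> 1" if "i < n" "j < n" for i j
  proof -
    have "av (det (mat_delete k j i)) \<le> 1"
      by (rule det_integral[of _ "n - 1"])
        (use k that in \<open>auto simp: bounded_mat_def mat_delete_def\<close>)
    thus ?thesis by (simp add: cofactor_def av_mult av_power)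
  qed
  hence "bounded_mat n 1 l" using k
    by (auto simp: bounded_mat_def l_def adj_mat_def av_mult av_inverse)
  moreover have "det k * det l = 1" using kl lc k by (metis det_mult det_one)
  hence "av (det l) = 1" using k by (metis av_1 av_mult mult_1)
  ultimately show "l \<in> GLO n" using lc by (auto simp: GLO_def simp del: GLO_carrier)
qed

definition eqv :: "nat \<Rightarrow> 'a mat \<Rightarrow> 'a mat \<Rightarrow> bool" where
  "eqv n A B \<longleftrightarrow> (\<exists>k\<in>GLO n. B = A \<bullet>\<^sub>X k)"

lemma eqv_refl: "A \<in> carrier_mat n n \<Longrightarrow> eqv n A A"
  unfolding eqv_def by (rule bexI[of _ "1\<^sub>m n"]) (simp_all add: act_one)

lemma eqv_sym:
  assumes "A \<in> carrier_mat n n" "eqv n A B" shows "eqv n B A"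
proof -
  obtain k where k: "k \<in> GLO n" "B = A \<bullet>\<^sub>X k" using assms by (auto simp: eqv_def)
  obtain l where l: "l \<in> GLO n" "k * l = 1\<^sub>m n" using k GLO_inverse by metis
  have "B \<bullet>\<^sub>X l = A" using assms k l by (simp add: act_act act_one)
  thus ?thesis using l by (auto simp: eqv_def)
qed

lemma eqv_trans:
  assumes "A \<in> carrier_mat n n" "eqv n A B" "eqv n B C" shows "eqv n A C"
proof -
  obtain k l where k: "k \<in> GLO n" "B = A \<bullet>\<^sub>X k" "l \<in> GLO n" "C = B \<bullet>\<^sub>X l"
    using assms by (auto simp: eqv_def)
  hence "C = A \<bullet>\<^sub>X (k * l)" using assms(1) by (simp add: act_act)
  thus ?thesis using k GLO_mult by (auto simp: eqv_def)
qed

lemma eqv_carrier: "A \<in> carrier_mat n n \<Longrightarrow> eqv n A B \<Longrightarrow> B \<in> carrier_mat n n"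
  by (auto simp: eqv_def)

lemma eqv_act: "k \<in> GLO n \<Longrightarrow> eqv n A (A \<bullet>\<^sub>X k)"
  by (auto simp: eqv_def)

lemma eqv_det: "A \<in> carrier_mat n n \<Longrightarrow> eqv n A B \<Longrightarrow> av (det B) = av (det A)"
  by (auto simp: eqv_def det_act av_mult av_power GLO_def simp del: GLO_carrier)

lemma eqv_symmetric: "A \<in> carrier_mat n n \<Longrightarrow> transpose_mat A = A \<Longrightarrow> eqv n A B \<Longrightarrow> transpose_mat B = B"
  by (auto simp: eqv_def act_sym)

lemma eqv_bounded:
  "A \<in> carrier_mat n n \<Longrightarrow> eqv n A B \<Longrightarrow> bounded_mat n b A \<Longrightarrow> b \<ge> 0 \<Longrightarrow> bounded_mat n b B"
  by (auto simp: eqv_def GLO_def simp del: GLO_carrier intro!: bounded_mat_act)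

lemma osum_GLO: "h \<in> GLO n \<Longrightarrow> av b = 1 \<Longrightarrow> osum h b \<in> GLO (Suc n)"
  by (auto simp: GLO_def osum_det av_mult bounded_mat_def osum_index simp del: GLO_carrier)

lemma osum_eqv:
  assumes "A \<in> carrier_mat n n" "eqv n A B" shows "eqv (Suc n) (osum A a) (osum B a)"
proof -
  obtain k where k: "k \<in> GLO n" "B = A \<bullet>\<^sub>X k" using assms by (auto simp: eqv_def)
  have "osum B a = osum A a \<bullet>\<^sub>X osum k 1" using assms k by (simp add: osum_act[of _ n])
  thus ?thesis using osum_GLO[OF k(1), of 1] by (auto simp: eqv_def)
qed

lemma osum_eqv_square:
  assumes "A \<in> carrier_mat n n" "av w = 1" shows "eqv (Suc n) (osum A a) (osum A (a * w\<^sup>2))"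
proof -
  have "osum A (a * w\<^sup>2) = osum A a \<bullet>\<^sub>X osum (1\<^sub>m n) w"
    using assms by (simp add: osum_act[of _ n] act_one)
  thus ?thesis using osum_GLO[OF GLO_one assms(2)] by (auto simp: eqv_def)
qed

subsection \<open>Cancellation\<close>

text \<open>Witt cancellation over the ring of integers. The given \<open>k\<close> is an isometry from
  \<open>B \<oplus> \<langle>a\<rangle>\<close> to \<open>A \<oplus> \<langle>a\<rangle>\<close>; correcting its columns by multiples of the last column, as a
  reflection would do, gives an isometry from \<open>B\<close> to \<open>A\<close>.\<close>

lemma witt_cancellation:
  assumes A: "A \<in> carrier_mat n n" "det A \<noteq> 0" and B: "B \<in> carrier_mat n n" and a: "a \<noteq> 0"
    and e: "eqv (Suc n) (osum A a) (osum B a)"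
  shows "eqv n A B"
proof -
  obtain k where k: "k \<in> GLO (Suc n)" and kB: "osum A a \<bullet>\<^sub>X k = osum B a"
    using e by (auto simp: eqv_def)
  have kc: "k \<in> carrier_mat (Suc n) (Suc n)" and ki: "\<And>i j. i < Suc n \<Longrightarrow> j < Suc n \<Longrightarrow> av (k $$ (i, j)) \<le> 1"
    and kd: "av (det k) = 1" using k by (auto simp: GLO_def bounded_mat_def simp del: GLO_carrier)
  define bil where "bil x y = (\<Sum>i<n. \<Sum>j<n. x i * A $$ (i, j) * y j)" for x y
  define co where "co j = (\<lambda>i. k $$ (i, j))" for j
  have bl: "bil (\<lambda>i. x i - s * z i) (\<lambda>i. y i - t * w i)
      = bil x y - t * bil x w - s * bil z y + s * t * bil z w" for x y z w s t
    unfolding bil_def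
    by (simp add: sum_distrib_left algebra_simps flip: sum.distrib sum_subtractf)
  have main: "bil (co i) (co j) + k $$ (n, i) * a * k $$ (n, j) = osum B a $$ (i, j)"
    if "i < Suc n" "j < Suc n" for i j
  proof -
    have "osum B a $$ (i, j) = (\<Sum>b<Suc n. \<Sum>d<Suc n. k $$ (b, i) * osum A a $$ (b, d) * k $$ (d, j))"
      unfolding kB[symmetric] using A kc that by (subst act_index) auto
    also have "\<dots> = bil (co i) (co j) + k $$ (n, i) * a * k $$ (n, j)"
      using A by (simp add: bil_def co_def osum_index)
    finally show ?thesis by simp
  qed
  define \<alpha> where "\<alpha> = k $$ (n, n)"
  \<comment> \<open>As 2 is a unit, \<open>\<alpha> + 1\<close> and \<open>\<alpha> - 1\<close> are not both in the maximal ideal.\<close>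
  obtain \<epsilon> where eps: "\<epsilon>\<^sup>2 = 1" "av (\<alpha> + \<epsilon>) = 1"
  proof -
    have le: "av (\<alpha> + 1) \<le> 1" "av (\<alpha> + (-1)) \<le> 1"
      using ki[of n n] av_diff_le[of \<alpha> 1 1] by (auto simp: \<alpha>_def intro!: av_add_le)
    have "\<not> (av (\<alpha> + 1) < 1 \<and> av (\<alpha> + (-1)) < 1)"
    proof
      assume "av (\<alpha> + 1) < 1 \<and> av (\<alpha> + (-1)) < 1"
      hence "av ((\<alpha> + 1) - (\<alpha> + (-1))) < 1" by (intro av_diff_less) auto
      thus False by simp
    qed
    hence "av (\<alpha> + 1) = 1 \<or> av (\<alpha> + (-1)) = 1" using le by linarith
    thus ?thesis using that[of 1] that[of "-1"] by auto
  qed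
  have u0: "\<alpha> + \<epsilon> \<noteq> 0" using eps by auto
  define r where "r j = k $$ (n, j) / (\<alpha> + \<epsilon>)" for j
  define k' where "k' = mat n n (\<lambda>(i, j). k $$ (i, j) - r j * k $$ (i, n))"
  have k'c: "k' \<in> carrier_mat n n" by (simp add: k'_def)
  have act: "A \<bullet>\<^sub>X k' = B"
  proof (rule eq_matI)
    fix i j assume "i < dim_row B" "j < dim_col B"
    hence ij: "i < n" "j < n" using B by auto
    have "(A \<bullet>\<^sub>X k') $$ (i, j)
        = bil (\<lambda>x. co i x - r i * co n x) (\<lambda>x. co j x - r j * co n x)"
      using A k'c ij by (simp add: act_index k'_def bil_def co_def)
    also have "\<dots> = bil (co i) (co j) - r j * bil (co i) (co n) - r i * bil (co n) (co j)
        + r i * r j * bil (co n) (co n)" by (rule bl)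
    also have "bil (co i) (co j) = B $$ (i, j) - k $$ (n, i) * a * k $$ (n, j)"
      using main[of i j] ij B by (simp add: osum_index algebra_simps)
    also have "bil (co i) (co n) = - (k $$ (n, i) * a * \<alpha>)"
      using main[of i n] ij B by (simp add: osum_index \<alpha>_def eq_neg_iff_add_eq_0)
    also have "bil (co n) (co j) = - (\<alpha> * a * k $$ (n, j))"
      using main[of n j] ij B by (simp add: osum_index \<alpha>_def eq_neg_iff_add_eq_0)
    also have "bil (co n) (co n) = a - \<alpha> * a * \<alpha>"
      using main[of n n] B by (simp add: osum_index \<alpha>_def algebra_simps)
    also have "a - \<alpha> * a * \<alpha> = a * (\<epsilon> - \<alpha>) * (\<alpha> + \<epsilon>)"
      using eps(1) by (simp add: power2_eq_square algebra_simps)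
    also have "k $$ (n, i) = r i * (\<alpha> + \<epsilon>)" using u0 by (simp add: r_def)
    also have "k $$ (n, j) = r j * (\<alpha> + \<epsilon>)" using u0 by (simp add: r_def)
    finally have "(A \<bullet>\<^sub>X k') $$ (i, j) = B $$ (i, j) - r i * (\<alpha> + \<epsilon>) * a * (r j * (\<alpha> + \<epsilon>))
        - r j * - (r i * (\<alpha> + \<epsilon>) * a * \<alpha>) - r i * - (\<alpha> * a * (r j * (\<alpha> + \<epsilon>)))
        + r i * r j * (a * (\<epsilon> - \<alpha>) * (\<alpha> + \<epsilon>))" .
    thus "(A \<bullet>\<^sub>X k') $$ (i, j) = B $$ (i, j)" by (simp add: algebra_simps)
  qed (use A B k'c in \<open>auto simp: act_def\<close>)
  have "det (osum B a) = (det k)\<^sup>2 * det (osum A a)"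
    unfolding kB[symmetric] using A kc by (subst det_act[of _ "Suc n"]) auto
  hence "det B = (det k)\<^sup>2 * det A" using a A B by (simp add: osum_det)
  moreover have "det B = (det k')\<^sup>2 * det A" unfolding act[symmetric] using A k'c by (simp add: det_act)
  ultimately have "(det k')\<^sup>2 = (det k)\<^sup>2" using A by simp
  hence "(av (det k'))\<^sup>2 = 1" using kd by (metis av_power one_power2)
  hence "av (det k') = 1" using av_nonneg[of "det k'"] by (simp add: power2_eq_1_iff)
  moreover have "bounded_mat n 1 k'"
    using ki eps by (auto simp: bounded_mat_def k'_def r_def av_divide av_mult
      intro!: av_diff_le mult_le_one av_nonneg)
  ultimately show ?thesis using act k'c by (auto simp: eqv_def GLO_def simp del: GLO_carrier)
qed

subsection \<open>Powers of the uniformizer and parahoric subgroups\<close>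

definition dpi :: "nat \<Rightarrow> (nat \<Rightarrow> int) \<Rightarrow> 'a mat" where
  "dpi n l = mat_diag n (\<lambda>i. \<pi> powi l i)"

lemma dpi_carrier [simp]: "dpi n l \<in> carrier_mat n n"
  by (simp add: dpi_def)

lemma dpi_mult: "dpi n l * dpi n m = dpi n (\<lambda>i. l i + m i)"
  by (simp add: dpi_def powi_add_unif)

lemma dpi_0: "dpi n (\<lambda>_. 0) = 1\<^sub>m n" by (simp add: dpi_def)

definition dominant :: "nat \<Rightarrow> (nat \<Rightarrow> int) \<Rightarrow> bool" where
  "dominant n l \<longleftrightarrow> (\<forall>i. Suc i < n \<longrightarrow> l (Suc i) \<le> l i)"

lemma dominant_le: "dominant n l \<Longrightarrow> i \<le> j \<Longrightarrow> j < n \<Longrightarrow> l j \<le> l i"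
proof (induction j)
  case (Suc j)
  thus ?case by (cases "i = Suc j") (auto simp: dominant_def intro: order_trans)
qed simp

lemma dominant_Suc: "dominant (Suc n) l \<Longrightarrow> dominant n l"
  by (simp add: dominant_def)

lemma dominant_SucI: "dominant n l \<Longrightarrow> (n > 0 \<Longrightarrow> l n \<le> l (n - 1)) \<Longrightarrow> dominant (Suc n) l"
  unfolding dominant_def by (metis Suc_lessI Suc_less_SucD diff_Suc_1 zero_less_Suc less_Suc_eq)

text \<open>The changes of basis that are integral for two lattices in the relative position \<open>l\<close> at once; a
  reduction of \<open>A\<close> by them is a reduction of \<open>A \<cdot> \<pi>\<^sup>l\<close> too.\<close>

definition parahoric :: "nat \<Rightarrow> (nat \<Rightarrow> int) \<Rightarrow> 'a mat set" where
  "parahoric n l = {h \<in> GLO n. dpi n (\<lambda>i. - l i) * h * dpi n l \<in> GLO n}"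

lemma conj_dpi_index:
  assumes "h \<in> carrier_mat n n" "i < n" "j < n"
  shows "(dpi n (\<lambda>i. - l i) * h * dpi n l) $$ (i, j) = \<pi> powi (l j - l i) * h $$ (i, j)"
proof -
  have "\<pi> powi (l j - l i) = \<pi> powi (- l i) * \<pi> powi (l j)"
    by (simp flip: powi_add_unif)
  thus ?thesis using assms
    by (simp add: dpi_def mat_diag_mult_left[of _ n n] mat_diag_mult_right[of _ n n] algebra_simps)
qed

lemma det_conj_dpi:
  assumes "h \<in> carrier_mat n n"
  shows "det (dpi n (\<lambda>i. - l i) * h * dpi n l) = det h"
proof -
  have "det (dpi n (\<lambda>i. - l i)) * det (dpi n l) = det (dpi n (\<lambda>i. - l i) * dpi n l)"
    by (simp add: det_mult[of _ n])
  also have "\<dots> = 1" by (simp add: dpi_mult dpi_0)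
  finally show ?thesis using assms
    by (simp add: det_mult[of _ n] mult_carrier_mat[of _ n n _ n] mult.assoc mult.left_commute[of _ "det h"])
qed

lemma parahoric_iff:
  assumes "h \<in> GLO n"
  shows "h \<in> parahoric n l \<longleftrightarrow> (\<forall>i<n. \<forall>j<n. av (h $$ (i, j)) \<le> c powi (l i - l j))"
proof -
  have "c powi (l j - l i) * x \<le> 1 \<longleftrightarrow> x \<le> c powi (l i - l j)" for i j x
  proof -
    have "c powi (l i - l j) = inverse (c powi (l j - l i))" by (simp flip: power_int_minus)
    thus ?thesis by (simp add: field_simps)
  qed
  moreover have "dpi n (\<lambda>i. - l i) * h * dpi n l \<in> carrier_mat n n"
    using assms by (simp add: mult_carrier_mat[of _ n n _ n])
  ultimately show ?thesis using assms unfolding parahoric_def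
    by (auto simp: GLO_def det_conj_dpi bounded_mat_def conj_dpi_index av_mult av_powi
        simp del: index_mult_mat(1) GLO_carrier)
qed

lemma parahoric_GLO: "h \<in> parahoric n l \<Longrightarrow> h \<in> GLO n"
  by (simp add: parahoric_def)

lemma parahoric_carrier [simp]: "h \<in> parahoric n l \<Longrightarrow> h \<in> carrier_mat n n"
  by (simp add: parahoric_def)

lemma dpi_conj_mult:
  assumes "g \<in> carrier_mat n n" "h \<in> carrier_mat n n"
  shows "(dpi n (\<lambda>i. - l i) * g * dpi n l) * (dpi n (\<lambda>i. - l i) * h * dpi n l)
     = dpi n (\<lambda>i. - l i) * (g * h) * dpi n l"
proof -
  have "(dpi n (\<lambda>i. - l i) * g * dpi n l) * (dpi n (\<lambda>i. - l i) * h * dpi n l)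
     = dpi n (\<lambda>i. - l i) * (g * ((dpi n l * dpi n (\<lambda>i. - l i)) * (h * dpi n l)))"
    using assms by (simp add: assoc_mult_mat[of _ n n _ n _ n] mult_carrier_mat[of _ n n _ n])
  also have "\<dots> = dpi n (\<lambda>i. - l i) * (g * h) * dpi n l"
    using assms by (simp add: dpi_mult dpi_0 assoc_mult_mat[of _ n n _ n _ n] mult_carrier_mat[of _ n n _ n])
  finally show ?thesis .
qed

lemma parahoric_mult:
  assumes "g \<in> parahoric n l" "h \<in> parahoric n l" shows "g * h \<in> parahoric n l"
proof -
  have g: "g \<in> GLO n" "dpi n (\<lambda>i. - l i) * g * dpi n l \<in> GLO n"
    and h: "h \<in> GLO n" "dpi n (\<lambda>i. - l i) * h * dpi n l \<in> GLO n"
    using assms by (auto simp: parahoric_def)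
  have "dpi n (\<lambda>i. - l i) * (g * h) * dpi n l \<in> GLO n"
    using GLO_mult[OF g(2) h(2)] dpi_conj_mult[OF GLO_carrier[OF g(1)] GLO_carrier[OF h(1)], of l] by simp
  thus ?thesis using GLO_mult[OF g(1) h(1)] by (simp add: parahoric_def)
qed

lemma parahoric_one: "1\<^sub>m n \<in> parahoric n l"
  by (subst parahoric_iff) auto

lemma act_dpi_conj:
  assumes "A \<in> carrier_mat n n" "h \<in> carrier_mat n n"
  shows "A \<bullet>\<^sub>X dpi n l \<bullet>\<^sub>X (dpi n (\<lambda>i. - l i) * h * dpi n l) = A \<bullet>\<^sub>X h \<bullet>\<^sub>X dpi n l"
proof -
  have "dpi n l * (dpi n (\<lambda>i. - l i) * h * dpi n l) = (dpi n l * dpi n (\<lambda>i. - l i)) * (h * dpi n l)"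
    using assms by (simp add: assoc_mult_mat[of _ n n _ n _ n] mult_carrier_mat[of _ n n _ n])
  also have "\<dots> = h * dpi n l" using assms by (simp add: dpi_mult dpi_0 mult_carrier_mat[of _ n n _ n])
  finally show ?thesis using assms
    by (simp add: act_act[of _ n] mult_carrier_mat[of _ n n _ n])
qed

text \<open>The transposition of two indices at which \<open>l\<close> takes the same value is parahoric.\<close>

lemma act_diag_pivot:
  assumes A: "A \<in> carrier_mat (Suc n) (Suc n)" and l: "dominant (Suc n) l"
    and i: "i < Suc n" "l i = l n"
  obtains h where "h \<in> parahoric (Suc n) l" "(A \<bullet>\<^sub>X h) $$ (n, n) = A $$ (i, i)"
proof (cases "i = n")
  case True
  thus ?thesis using that[of "1\<^sub>m (Suc n)"] A by (simp add: parahoric_one act_one)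
next
  case False
  let ?h = "swaprows_mat (Suc n) i n :: 'a mat"
  have "?h \<in> GLO (Suc n)"
    using i False by (auto simp: GLO_def bounded_mat_def det_swaprows_mat simp del: GLO_carrier)
  hence 1: "?h \<in> parahoric (Suc n) l"
    using i False by (subst parahoric_iff) auto
  have hn: "?h $$ (a, n) = (if a = i then 1 else 0)" if "a < Suc n" for a
    using that i False by auto
  have "(A \<bullet>\<^sub>X ?h) $$ (n, n) = (\<Sum>a<Suc n. \<Sum>b<Suc n. ?h $$ (a, n) * A $$ (a, b) * ?h $$ (b, n))"
    using A by (subst act_index[of _ "Suc n"]) auto
  also have "\<dots> = (\<Sum>a<Suc n. \<Sum>b<Suc n. if a = i then (if b = i then A $$ (a, b) else 0) else 0)"
    by (intro sum.cong) (auto simp: hn simp del: index_mat_swaprows_mat)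
  also have "\<dots> = A $$ (i, i)" using i
    by (simp add: sum.delta' if_distrib[of "\<lambda>x. sum x _"] del: sum.lessThan_Suc cong: if_cong)
      (auto simp: sum.delta sum.If_cases)
  finally show ?thesis using that 1 by blast
qed

end

context odd_padic begin

lemma c_nz [simp]: "c \<noteq> 0" using c_pos by simp

subsection \<open>Diagonalization\<close>

lemma prod_list_ones: "prod_list (map (\<lambda>_. 1 :: 'a) xs) = 1"
  by (induction xs) auto

text \<open>Completing the square. The transformation only changes the last row of the identity, and \<open>l\<close> is
  smallest at the last index; so it is parahoric.\<close>

lemma act_elimination:
  assumes A: "A \<in> carrier_mat (Suc n) (Suc n)" "transpose_mat A = A" and l: "dominant (Suc n) l"
    and nn: "A $$ (n, n) \<noteq> 0" "\<And>j. j < n \<Longrightarrow> av (A $$ (n, j)) \<le> av (A $$ (n, n))"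
  obtains h A' where "h \<in> parahoric (Suc n) l" "A' \<in> carrier_mat n n"
    "A \<bullet>\<^sub>X h = osum A' (A $$ (n, n))"
    "\<And>i j. i < n \<Longrightarrow> j < n \<Longrightarrow> A' $$ (i, j) = A $$ (i, j) - A $$ (n, i) * A $$ (n, j) / A $$ (n, n)"
proof -
  define h where "h = mat (Suc n) (Suc n)
    (\<lambda>(i, j). if i = j then 1 else if i = n then - (A $$ (n, j) / A $$ (n, n)) else 0)"
  have hc: "h \<in> carrier_mat (Suc n) (Suc n)" by (simp add: h_def)
  have "det h = prod_list (diag_mat h)"
    by (rule det_lower_triangular[OF _ hc]) (auto simp: h_def)
  also have "diag_mat h = map (\<lambda>_. 1) [0..<Suc n]"
    unfolding diag_mat_def by (intro map_cong) (auto simp: h_def)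
  also have "prod_list (map (\<lambda>_. 1) [0..<Suc n]) = (1 :: 'a)"
    by (rule prod_list_ones)
  finally have dh: "det h = 1" .
  have q: "av (A $$ (n, j) / A $$ (n, n)) \<le> 1" if "j < n" for j
    using nn(2)[OF that] av_pos[OF nn(1)] by (simp add: av_divide)
  have hG: "h \<in> GLO (Suc n)" using hc dh q
    by (auto simp: GLO_def bounded_mat_def h_def simp del: GLO_carrier)
  have hP: "h \<in> parahoric (Suc n) l"
  proof (subst parahoric_iff[OF hG], intro allI impI)
    fix i j assume ij: "i < Suc n" "j < Suc n"
    have "1 \<le> c powi (l i - l j)" if "i = n"
      using c_powi_le_iff[of 0 "l i - l j"] dominant_le[OF l, of j n] ij that by simp
    thus "av (h $$ (i, j)) \<le> c powi (l i - l j)"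
      using ij q[of j] by (cases "i = j"; cases "i = n") (auto simp: h_def)
  qed
  have symA: "A $$ (i, j) = A $$ (j, i)" if "i < Suc n" "j < Suc n" for i j
    using A that by (metis carrier_matD index_transpose_mat(1))
  let ?B = "A \<bullet>\<^sub>X h"
  have Bc: "?B \<in> carrier_mat (Suc n) (Suc n)" using A hc by simp
  have hn: "h $$ (a, n) = (if a = n then 1 else 0)" if "a < Suc n" for a
    using that by (auto simp: h_def)
  have Bn: "?B $$ (n, j) = (\<Sum>b<Suc n. A $$ (n, b) * h $$ (b, j))" if "j < Suc n" for j
  proof -
    have "?B $$ (n, j) = (\<Sum>a<Suc n. \<Sum>b<Suc n. h $$ (a, n) * A $$ (a, b) * h $$ (b, j))"
      using A hc that by (subst act_index) auto
    also have "\<dots> = (\<Sum>a<Suc n. if a = n then (\<Sum>b<Suc n. A $$ (a, b) * h $$ (b, j)) else 0)"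
      by (intro sum.cong) (auto simp: hn simp del: sum.lessThan_Suc)
    finally show ?thesis by simp
  qed
  have Bnn: "?B $$ (n, n) = A $$ (n, n)" by (subst Bn) (auto simp: hn)
  have B0: "?B $$ (n, j) = 0" if "j < n" for j
  proof -
    have "(\<Sum>b<n. A $$ (n, b) * h $$ (b, j)) = (\<Sum>b<n. if b = j then A $$ (n, b) else 0)"
      using that by (intro sum.cong) (auto simp: h_def)
    also have "\<dots> = A $$ (n, j)" using that by simp
    finally show ?thesis using that nn(1) by (subst Bn) (auto simp: h_def)
  qed
  have "transpose_mat ?B = ?B" using A hc by (intro act_sym) auto
  hence B0': "?B $$ (j, n) = 0" if "j < n" for j
    using B0[OF that] Bc that by (metis carrier_matD index_transpose_mat(1) lessI less_SucI)
  have "?B = osum (mat n n (\<lambda>ij. ?B $$ ij)) (A $$ (n, n))"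
    using osum_of_zero_border[OF Bc] B0 B0' Bnn by simp
  moreover have "?B $$ (i, j) = A $$ (i, j) - A $$ (n, i) * A $$ (n, j) / A $$ (n, n)"
    if ij: "i < n" "j < n" for i j
  proof -
    have hi: "h $$ (a, i) = (if a = i then 1 else 0)" if "a < n" "i < n" for a i
      using that by (auto simp: h_def)
    have hn': "h $$ (n, i) = - (A $$ (n, i) / A $$ (n, n))" if "i < n" for i
      using that by (auto simp: h_def)
    have row: "(\<Sum>b<Suc n. A $$ (a, b) * h $$ (b, j)) = A $$ (a, j) + A $$ (a, n) * h $$ (n, j)" for a
    proof -
      have "(\<Sum>b<n. A $$ (a, b) * h $$ (b, j)) = (\<Sum>b<n. if b = j then A $$ (a, b) else 0)"
        using ij by (intro sum.cong) (auto simp: hi)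
      thus ?thesis using ij by simp
    qed
    have "?B $$ (i, j) = (\<Sum>a<Suc n. \<Sum>b<Suc n. h $$ (a, i) * A $$ (a, b) * h $$ (b, j))"
      using A hc ij by (subst act_index[of _ "Suc n"]) auto
    also have "\<dots> = (\<Sum>a<Suc n. h $$ (a, i) * (A $$ (a, j) + A $$ (a, n) * h $$ (n, j)))"
      unfolding row[symmetric] by (simp only: sum_distrib_left mult.assoc)
    also have "\<dots> = (\<Sum>a<n. if a = i then A $$ (a, j) + A $$ (a, n) * h $$ (n, j) else 0)
        + h $$ (n, i) * (A $$ (n, j) + A $$ (n, n) * h $$ (n, j))"
    proof -
      have "(\<Sum>a<n. h $$ (a, i) * (A $$ (a, j) + A $$ (a, n) * h $$ (n, j)))
        = (\<Sum>a<n. if a = i then A $$ (a, j) + A $$ (a, n) * h $$ (n, j) else 0)"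
        using ij by (intro sum.cong) (auto simp: hi)
      thus ?thesis by simp
    qed
    also have "A $$ (n, j) + A $$ (n, n) * h $$ (n, j) = 0"
      unfolding hn'[OF ij(2)] using nn(1) by simp
    also have "(\<Sum>a<n. if a = i then A $$ (a, j) + A $$ (a, n) * h $$ (n, j) else 0) + h $$ (n, i) * 0
        = A $$ (i, j) + A $$ (i, n) * h $$ (n, j)"
      using ij by simp
    finally show ?thesis using ij symA[of i n] unfolding hn'[OF ij(2)] by simp
  qed
  ultimately show ?thesis using that[of h "mat n n (\<lambda>ij. ?B $$ ij)"] hP by simp
qed

text \<open>An entry of largest absolute value can be moved onto the diagonal because the residue
  characteristic is odd: if \<open>A(i,j)\<close> is such an entry and \<open>A(i,i)\<close>, \<open>A(j,j)\<close> are smaller, then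
  \<open>e\<^sub>i + e\<^sub>j\<close> has length \<open>A(i,i) + 2 A(i,j) + A(j,j)\<close>. The cocharacter \<open>l\<close> records that the
  whole reduction can be done inside the parahoric subgroup attached to \<open>l\<close>, provided that
  \<open>i\<close> and \<open>j\<close> lie in the last block of \<open>l\<close>.\<close>

lemma act_pivot:
  assumes A: "A \<in> carrier_mat (Suc n) (Suc n)" "transpose_mat A = A" and l: "dominant (Suc n) l"
    and b: "bounded_mat (Suc n) (c powi m) A"
    and ij: "i < Suc n" "j < Suc n" "l i = l n" "l j = l n" "av (A $$ (i, j)) = c powi m"
  obtains h A' a where "h \<in> parahoric (Suc n) l" "A' \<in> carrier_mat n n"
    "A \<bullet>\<^sub>X h = osum A' a" "av a = c powi m"
proof -
  have symA: "A $$ (i, j) = A $$ (j, i)" if "i < Suc n" "j < Suc n" for i j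
    using A that by (metis carrier_matD index_transpose_mat(1))
  have "\<exists>g\<in>parahoric (Suc n) l. \<exists>i<Suc n. l i = l n \<and> av ((A \<bullet>\<^sub>X g) $$ (i, i)) = c powi m"
  proof (cases "\<exists>i<Suc n. l i = l n \<and> av (A $$ (i, i)) = c powi m")
    case True
    thus ?thesis using A by (intro bexI[of _ "1\<^sub>m (Suc n)"]) (auto simp: parahoric_one act_one)
  next
    case False
    hence ne: "i \<noteq> j" and "av (A $$ (i, i)) \<noteq> c powi m" "av (A $$ (j, j)) \<noteq> c powi m"
      using ij by auto
    hence lt: "av (A $$ (i, i)) < c powi m" "av (A $$ (j, j)) < c powi m"
      using b ij by (auto simp: bounded_mat_def order_less_le)
    \<comment> \<open>This adds the \<open>j\<close>-th basis vector to the \<open>i\<close>-th one.\<close>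
    let ?g = "addrow_mat (Suc n) 1 j i :: 'a mat"
    have gG: "?g \<in> GLO (Suc n)" using ne
      by (auto simp: GLO_def bounded_mat_def det_addrow_mat simp del: GLO_carrier)
    have gP: "?g \<in> parahoric (Suc n) l"
      using ij ne by (subst parahoric_iff[OF gG]) auto
    have gi: "?g $$ (a, i) = (if a = i then 1 else 0) + (if a = j then 1 else 0)" if "a < Suc n" for a
      using that ij ne by auto
    have "(A \<bullet>\<^sub>X ?g) $$ (i, i) = (\<Sum>a<Suc n. \<Sum>b<Suc n. ?g $$ (a, i) * A $$ (a, b) * ?g $$ (b, i))"
      using A ij by (subst act_index[of _ "Suc n"]) auto
    also have "\<dots> = (\<Sum>a<Suc n. ?g $$ (a, i) * (\<Sum>b<Suc n. (if b = i then A $$ (a, b) else 0) + (if b = j then A $$ (a, b) else 0)))"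
      unfolding sum_distrib_left by (intro sum.cong refl) (auto simp: gi algebra_simps simp del: index_mat_addrow_mat)
    also have "\<dots> = (\<Sum>a<Suc n. (if a = i then A $$ (a, i) + A $$ (a, j) else 0) + (if a = j then A $$ (a, i) + A $$ (a, j) else 0))"
      using ij by (intro sum.cong refl) (auto simp: gi sum.distrib algebra_simps simp del: index_mat_addrow_mat sum.lessThan_Suc)
    also have "\<dots> = (A $$ (i, i) + A $$ (j, j)) + 2 * A $$ (i, j)"
      using ij symA[of i j] by (simp add: sum.distrib del: sum.lessThan_Suc)
    finally have "(A \<bullet>\<^sub>X ?g) $$ (i, i) = (A $$ (i, i) + A $$ (j, j)) + 2 * A $$ (i, j)" .
    moreover have "av (A $$ (i, i) + A $$ (j, j)) < c powi m" using lt by (rule av_add_less)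
    hence "av ((A $$ (i, i) + A $$ (j, j)) + 2 * A $$ (i, j)) = c powi m"
      using ij by (subst av_add_eq) (auto simp: av_mult)
    ultimately show ?thesis using gP ij by (intro bexI[of _ ?g] exI[of _ i]) auto
  qed
  then obtain g i where g: "g \<in> parahoric (Suc n) l" "i < Suc n" "l i = l n"
    "av ((A \<bullet>\<^sub>X g) $$ (i, i)) = c powi m" by blast
  define B where "B = A \<bullet>\<^sub>X g"
  have gc: "g \<in> carrier_mat (Suc n) (Suc n)" using g by simp
  have B: "B \<in> carrier_mat (Suc n) (Suc n)" using A gc by (simp add: B_def)
  obtain g' where g': "g' \<in> parahoric (Suc n) l" "(B \<bullet>\<^sub>X g') $$ (n, n) = B $$ (i, i)"
    using act_diag_pivot[OF B l g(2,3)] by blast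
  have gg: "g * g' \<in> parahoric (Suc n) l" using g g' by (intro parahoric_mult)
  define C where "C = A \<bullet>\<^sub>X (g * g')"
  have CB: "C = B \<bullet>\<^sub>X g'" unfolding C_def B_def using A g g' by (intro act_act[symmetric]) auto
  have C: "C \<in> carrier_mat (Suc n) (Suc n)" "transpose_mat C = C"
    using A parahoric_carrier[OF gg] by (auto simp: C_def act_sym)
  have Cn: "av (C $$ (n, n)) = c powi m" using g g' by (simp add: CB B_def)
  have "bounded_mat (Suc n) (c powi m) C" unfolding C_def
    using A b parahoric_GLO[OF gg] by (intro bounded_mat_act) (auto simp: GLO_def simp del: GLO_carrier)
  hence "av (C $$ (n, j)) \<le> av (C $$ (n, n))" if "j < n" for j
    using that Cn by (auto simp: bounded_mat_def)
  note le = this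
  have nz: "C $$ (n, n) \<noteq> 0" using Cn c_powi_pos[of m] by auto
  obtain h A' where h: "h \<in> parahoric (Suc n) l" "A' \<in> carrier_mat n n"
    "C \<bullet>\<^sub>X h = osum A' (C $$ (n, n))" by (rule act_elimination[OF C l nz le])
  have "A \<bullet>\<^sub>X (g * g' * h) = osum A' (C $$ (n, n))"
    using h(3) act_act[OF A(1) parahoric_carrier[OF gg] parahoric_carrier[OF h(1)]] by (simp add: C_def)
  thus ?thesis using that[OF parahoric_mult[OF gg h(1)] h(2) _ Cn] by simp
qed

definition diagpi :: "nat \<Rightarrow> (nat \<Rightarrow> int) \<Rightarrow> (nat \<Rightarrow> 'a) \<Rightarrow> 'a mat" where
  "diagpi n e u = mat_diag n (\<lambda>i. \<pi> powi e i * u i)"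

lemma diagpi_carrier [simp]: "diagpi n e u \<in> carrier_mat n n"
  by (simp add: diagpi_def)

lemma diagpi_sym [simp]: "transpose_mat (diagpi n e u) = diagpi n e u"
  by (intro eq_matI) (auto simp: diagpi_def mat_diag_def)

lemma diagpi_Suc: "diagpi (Suc n) e u = osum (diagpi n e u) (\<pi> powi e n * u n)"
  by (simp add: diagpi_def mat_diag_Suc)

lemma diagpi_cong:
  "(\<And>i. i < n \<Longrightarrow> e i = e' i) \<Longrightarrow> (\<And>i. i < n \<Longrightarrow> u i = u' i) \<Longrightarrow> diagpi n e u = diagpi n e' u'"
  by (intro eq_matI) (auto simp: diagpi_def mat_diag_def)

definition units_on :: "nat \<Rightarrow> (nat \<Rightarrow> 'a) \<Rightarrow> bool" where
  "units_on n u \<longleftrightarrow> (\<forall>i<n. av (u i) = 1)"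

lemma av_det_diagpi:
  assumes "units_on n u" shows "av (det (diagpi n e u)) = c powi (\<Sum>i<n. e i)"
  using assms
proof (induction n)
  case (Suc n)
  hence "units_on n u" by (simp add: units_on_def)
  with Suc show ?case
    by (simp add: diagpi_Suc osum_det[of _ n] av_mult av_powi powi_add_c units_on_def)
qed simp

lemma det_diagpi_nz: "units_on n u \<Longrightarrow> det (diagpi n e u) \<noteq> 0"
  using av_det_diagpi[of n u e] c_powi_pos[of "\<Sum>i<n. e i"] by (metis av_0 less_irrefl)

lemma bounded_diagpi:
  assumes "dominant (Suc n) e" "units_on (Suc n) u"
  shows "bounded_mat (Suc n) (c powi e n) (diagpi (Suc n) e u)"
  using assms dominant_le[OF assms(1), of _ n]
  by (auto simp: bounded_mat_def diagpi_def mat_diag_def av_mult av_powi units_on_def c_powi_le_iff)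

lemma max_entry:
  assumes "A \<in> carrier_mat (Suc n) (Suc n)" "det A \<noteq> 0"
  obtains m i j where "bounded_mat (Suc n) (c powi m) A" "i < Suc n" "j < Suc n"
    "av (A $$ (i, j)) = c powi m"
proof -
  let ?S = "(\<lambda>(i, j). av (A $$ (i, j))) ` ({..<Suc n} \<times> {..<Suc n})"
  have fin: "finite ?S" "?S \<noteq> {}" by auto
  have "Max ?S \<in> ?S" using fin by (rule Max_in)
  then obtain i j where ij: "i < Suc n" "j < Suc n" "av (A $$ (i, j)) = Max ?S" by auto
  have le: "av (A $$ (i', j')) \<le> av (A $$ (i, j))" if "i' < Suc n" "j' < Suc n" for i' j'
    unfolding ij(3) using that fin by (intro Max_ge) auto
  have "A $$ (i, j) \<noteq> 0"
  proof
    assume "A $$ (i, j) = 0"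
    hence "av (A $$ (i', j')) \<le> 0" if "i' < Suc n" "j' < Suc n" for i' j' using le[OF that] by simp
    hence "A $$ (i', j') = 0" if "i' < Suc n" "j' < Suc n" for i' j'
      using that av_pos[of "A $$ (i', j')"] by fastforce
    hence "A = 0\<^sub>m (Suc n) (Suc n)" using assms(1) by (intro eq_matI) auto
    thus False using assms(2) by simp
  qed
  then obtain m where "av (A $$ (i, j)) = c powi m" using value_group by blast
  thus ?thesis using that[of m i j] ij le by (auto simp: bounded_mat_def)
qed

lemma osum_symmetric_det:
  assumes "A \<in> carrier_mat (Suc n) (Suc n)" "transpose_mat A = A" "det A \<noteq> 0"
    and "eqv (Suc n) A (osum A' a)" "A' \<in> carrier_mat n n"
  shows "transpose_mat A' = A'" "det A' \<noteq> 0"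
proof -
  have "transpose_mat (osum A' a) = osum A' a" using eqv_symmetric[OF assms(1,2,4)] .
  hence "osum (transpose_mat A') a = osum A' a" using osum_transpose[OF assms(5)] by metis
  thus "transpose_mat A' = A'" using osum_inject(1)[of "transpose_mat A'" n A' a a] assms(5) by auto
  have "av (det (osum A' a)) = av (det A)" using eqv_det[OF assms(1,4)] .
  hence "det (osum A' a) \<noteq> 0" using assms(3) by (metis av_eq_0_iff)
  thus "det A' \<noteq> 0" unfolding osum_det[OF assms(5)] by simp
qed

text \<open>A diagonalization of \<open>A\<close> extends to \<open>A \<oplus> \<langle>a\<rangle>\<close>. The exponents stay in order because no entry is larger
  than \<open>a\<close>.\<close>

lemma osum_diagpi:
  assumes A: "A \<in> carrier_mat n n" and eu: "dominant n e" "units_on n u" "eqv n A (diagpi n e u)"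
    and a: "av a = c powi m" and b: "bounded_mat (Suc n) (c powi m) (osum A a)"
  shows "dominant (Suc n) (e(n := m))" "units_on (Suc n) (u(n := a / \<pi> powi m))"
    "eqv (Suc n) (osum A a) (diagpi (Suc n) (e(n := m)) (u(n := a / \<pi> powi m)))"
proof -
  define e' where "e' = e(n := m)"
  define u' where "u' = u(n := a / \<pi> powi m)"
  have D: "diagpi (Suc n) e' u' = osum (diagpi n e u) a"
    by (simp add: diagpi_Suc e'_def u'_def diagpi_cong[of n "e(n := m)" e "u(n := a / \<pi> powi m)" u])
  show E: "eqv (Suc n) (osum A a) (diagpi (Suc n) (e(n := m)) (u(n := a / \<pi> powi m)))"
    unfolding e'_def[symmetric] u'_def[symmetric] D using osum_eqv[OF A eu(3)] .
  show u': "units_on (Suc n) (u(n := a / \<pi> powi m))"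
    using eu(2) a by (auto simp: units_on_def av_divide av_powi less_Suc_eq)
  have "bounded_mat (Suc n) (c powi m) (diagpi (Suc n) (e(n := m)) (u(n := a / \<pi> powi m)))"
    using eqv_bounded[OF _ E b] A by simp
  hence "av (diagpi (Suc n) (e(n := m)) (u(n := a / \<pi> powi m)) $$ (n - 1, n - 1)) \<le> c powi m"
    by (auto simp: bounded_mat_def)
  hence "n > 0 \<Longrightarrow> m \<le> e (n - 1)"
    using eu(2) by (auto simp: diagpi_def mat_diag_def av_mult av_powi units_on_def c_powi_le_iff split: if_splits)
  thus "dominant (Suc n) (e(n := m))"
    using eu(1) by (intro dominant_SucI) (auto simp: dominant_def)
qed

text \<open>A largest entry is moved to the last place of the diagonal and split off.\<close>

lemma diagonalization:
  assumes "A \<in> carrier_mat n n" "transpose_mat A = A" "det A \<noteq> 0"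
  shows "\<exists>e u. dominant n e \<and> units_on n u \<and> eqv n A (diagpi n e u)"
  using assms
proof (induction n arbitrary: A)
  case 0
  hence "A = diagpi 0 (\<lambda>_. 0) (\<lambda>_. 1)" by (intro eq_matI) (auto simp: diagpi_def mat_diag_def)
  thus ?case using eqv_refl[OF 0(1)] by (auto simp: dominant_def units_on_def)
next
  case (Suc n)
  obtain m i j where m: "bounded_mat (Suc n) (c powi m) A" "i < Suc n" "j < Suc n"
    "av (A $$ (i, j)) = c powi m" using max_entry[OF Suc.prems(1,3)] by blast
  obtain h A' a where h: "h \<in> parahoric (Suc n) (\<lambda>_. 0)" "A' \<in> carrier_mat n n"
    "A \<bullet>\<^sub>X h = osum A' a" "av a = c powi m"
    by (rule act_pivot[OF Suc.prems(1,2) _ m(1-3) _ _ m(4), of "\<lambda>_. 0"]) (auto simp: dominant_def)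
  have hG: "h \<in> GLO (Suc n)" using h parahoric_GLO by blast
  have E: "eqv (Suc n) A (osum A' a)" using hG h(3) unfolding eqv_def by metis
  note A's = osum_symmetric_det(1)[OF Suc.prems E h(2)]
  note A'd = osum_symmetric_det(2)[OF Suc.prems E h(2)]
  obtain e u where eu: "dominant n e" "units_on n u" "eqv n A' (diagpi n e u)"
    using Suc.IH[OF h(2) A's A'd] by blast
  note O = osum_diagpi[OF h(2) eu h(4) eqv_bounded[OF Suc.prems(1) E m(1) c_powi_nonneg]]
  have "eqv (Suc n) A (diagpi (Suc n) (e(n := m)) (u(n := a / \<pi> powi m)))"
    using E O(3) Suc.prems(1) eqv_trans by blast
  thus ?case using O(1,2) by blast
qed

subsection \<open>Classification up to equivalence\<close>

definition sgn :: "'a \<Rightarrow> int" where "sgn u = (if sq_unit u then 1 else -1)"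

lemma sgn_mult:
  assumes "av u = 1" "av v = 1" shows "sgn (u * v) = sgn u * sgn v"
proof -
  have nz: "u \<noteq> 0" "v \<noteq> 0" using assms by auto
  have "sq_unit v" if "sq_unit (u * v)" "sq_unit u"
    using sq_unit_mult[OF sq_unit_inverse[OF that(2)] that(1)] nz by (simp flip: mult.assoc)
  moreover have "sq_unit u" if "sq_unit (u * v)" "sq_unit v"
    using sq_unit_mult[OF that(1) sq_unit_inverse[OF that(2)]] nz by (simp add: mult.assoc)
  moreover note sq_unit_mult[of u v] square_classes(2)[OF assms]
  ultimately have "sq_unit (u * v) \<longleftrightarrow> (sq_unit u \<longleftrightarrow> sq_unit v)" by blast
  thus ?thesis by (simp add: sgn_def)
qed

lemma sgn_cases: "sgn u = 1 \<or> sgn u = -1" by (simp add: sgn_def)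

lemma sgn_eq_square:
  assumes "av u = 1" "av v = 1" "sgn u = sgn v"
  obtains w where "av w = 1" "v = u * w\<^sup>2"
proof -
  have "sgn (v * inverse u) = 1"
  proof -
    have "sgn (u * inverse u) = sgn u * sgn (inverse u)" using assms by (intro sgn_mult) (auto simp: av_inverse)
    moreover have "u \<noteq> 0" using assms by auto
    ultimately have "sgn u * sgn (inverse u) = 1" by (simp add: sgn_def)
    thus ?thesis using assms by (subst sgn_mult) (auto simp: av_inverse)
  qed
  then obtain w where "av w = 1" "v * inverse u = w\<^sup>2"
    by (auto simp: sgn_def sq_unit_def split: if_splits)
  moreover have "u \<noteq> 0" using assms by auto
  ultimately show ?thesis using that[of w] by (simp add: field_simps)
qed

text \<open>If \<open>u\<close> and \<open>v\<close> both lie in the square class that does not contain \<open>w\<close>, then \<open>w / u\<close> is not a square,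
  and a nonsquare unit is a sum of two squares.\<close>

lemma binary_represents:
  assumes "av u = 1" "av v = 1" "av w = 1" "sgn (u * v) = 1 \<or> sgn u = sgn w \<or> sgn v = sgn w"
  shows "\<exists>x y. av x \<le> 1 \<and> av y \<le> 1 \<and> u * x\<^sup>2 + v * y\<^sup>2 = w"
proof (cases "sgn u = sgn w \<or> sgn v = sgn w")
  case True
  thus ?thesis
  proof
    assume "sgn u = sgn w"
    then obtain x where "av x = 1" "w = u * x\<^sup>2" using sgn_eq_square[of u w] assms by blast
    thus ?thesis by (intro exI[of _ x] exI[of _ 0]) simp
  next
    assume "sgn v = sgn w"
    then obtain x where "av x = 1" "w = v * x\<^sup>2" using sgn_eq_square[of v w] assms by blast
    thus ?thesis by (intro exI[of _ 0] exI[of _ x]) simp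
  qed
next
  case False
  obtain a b where ab: "sq_unit a" "sq_unit b" "av (a + b) = 1" "\<not> sq_unit (a + b)"
    by (rule nonsquare_sum_of_squares)
  obtain s t where st: "av s = 1" "a = s\<^sup>2" "av t = 1" "b = t\<^sup>2" using ab by (auto simp: sq_unit_def)
  have "sgn (u * (a + b)) = sgn w"
    using False sgn_cases[of u] sgn_cases[of w] ab(4) assms ab(3)
    by (subst sgn_mult) (auto simp: sgn_def split: if_splits)
  then obtain x where x: "av x = 1" "w = u * (a + b) * x\<^sup>2"
    using sgn_eq_square[of "u * (a + b)" w] assms ab by (auto simp: av_mult)
  have "sgn v = sgn u" using False sgn_cases[of u] sgn_cases[of w] sgn_cases[of v] by auto
  then obtain y where y: "av y = 1" "u = v * y\<^sup>2" using sgn_eq_square[of v u] assms by blast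
  have "u * (s * x)\<^sup>2 + v * (y * t * x)\<^sup>2 = w"
    unfolding x(2) st(2,4) using y(2) by (simp add: power_mult_distrib algebra_simps)
  moreover have "av (s * x) \<le> 1" "av (y * t * x) \<le> 1"
    using st(1,3) x(1) y(1) by (simp_all add: av_mult)
  ultimately show ?thesis by blast
qed

text \<open>A vector \<open>(x, y)\<close> representing \<open>v1\<close> is completed by the orthogonal vector \<open>(- u2 y, u1 x)\<close>. The value of the
  latter has the square class that the determinant prescribes.\<close>

lemma binary_eqv:
  assumes u: "av u1 = 1" "av u2 = 1" "av v1 = 1" "av v2 = 1"
    and s: "sgn (u1 * u2) = sgn (v1 * v2)" and t: "t \<noteq> 0"
  obtains k where "k \<in> GLO 2"
    "mat_diag 2 (\<lambda>i. t * (if i = 0 then u1 else u2)) \<bullet>\<^sub>X k = mat_diag 2 (\<lambda>i. t * (if i = 0 then v1 else v2))"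
proof -
  have "sgn (u1 * u2) = 1 \<or> sgn u1 = sgn v1 \<or> sgn u2 = sgn v1"
    using sgn_mult[OF u(1,2)] sgn_cases[of u1] sgn_cases[of u2] sgn_cases[of v1]
    by (elim disjE) simp_all
  then obtain x y where xy: "av x \<le> 1" "av y \<le> 1" "u1 * x\<^sup>2 + u2 * y\<^sup>2 = v1"
    using binary_represents[OF u(1,2,3)] by blast
  have "sgn (u1 * u2 * v1) = sgn v2"
    using s u sgn_cases[of v1] by (subst sgn_mult) (auto simp: av_mult sgn_mult)
  then obtain w where w: "av w = 1" "v2 = u1 * u2 * v1 * w\<^sup>2"
    using sgn_eq_square[of "u1 * u2 * v1" v2] u by (auto simp: av_mult)
  define k where "k = mat 2 2 (\<lambda>(i, j). if j = 0 then (if i = 0 then x else y)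
      else (if i = 0 then - u2 * y * w else u1 * x * w))"
  have kc: "k \<in> carrier_mat 2 2" by (simp add: k_def)
  have b: "bounded_mat 2 1 k"
    using xy u w by (auto simp: bounded_mat_def k_def av_mult)
  have act: "mat_diag 2 (\<lambda>i. t * (if i = 0 then u1 else u2)) \<bullet>\<^sub>X k = mat_diag 2 (\<lambda>i. t * (if i = 0 then v1 else v2))"
    (is "?A \<bullet>\<^sub>X k = ?B")
  proof (rule eq_matI)
    fix i j assume "i < dim_row ?B" "j < dim_col ?B"
    hence ij: "i < 2" "j < 2" by (auto simp: mat_diag_def)
    have "(?A \<bullet>\<^sub>X k) $$ (i, j) = t * (u1 * k $$ (0, i) * k $$ (0, j) + u2 * k $$ (1, i) * k $$ (1, j))"
      using ij kc by (subst act_index[of _ 2]) (auto simp: mat_diag_def numeral_2_eq_2 algebra_simps)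
    also have "\<dots> = ?B $$ (i, j)"
    proof -
      have "i = 0 \<or> i = 1" "j = 0 \<or> j = 1" using ij by auto
      thus ?thesis
        by (elim disjE) (simp_all add: k_def mat_diag_def w(2) xy(3)[symmetric] power2_eq_square algebra_simps)
    qed
    finally show "(?A \<bullet>\<^sub>X k) $$ (i, j) = ?B $$ (i, j)" .
  qed (use kc in \<open>auto simp: act_def mat_diag_def\<close>)
  have "det (mat_diag 2 f) = f 0 * f 1" for f :: "nat \<Rightarrow> 'a"
    by (simp add: numeral_2_eq_2 mat_diag_Suc osum_det[of _ "Suc 0"] osum_det[of _ 0])
  hence "(t * v1) * (t * v2) = (det k)\<^sup>2 * ((t * u1) * (t * u2))"
    using det_act[of ?A 2 k] kc unfolding act by simp
  hence "(av t)\<^sup>2 = (av (det k))\<^sup>2 * (av t)\<^sup>2"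
    using arg_cong[of _ _ av] u by (fastforce simp: av_mult power2_eq_square)
  hence "(av (det k))\<^sup>2 = 1" using t by (simp add: av_eq_0_iff)
  hence "av (det k) = 1" using av_nonneg[of "det k"] by (simp add: power2_eq_1_iff)
  hence "k \<in> GLO 2" using kc b by (auto simp: GLO_def simp del: GLO_carrier)
  thus ?thesis using act that by blast
qed

lemma diag_block_mult:
  fixes A B C D :: "'a mat"
  assumes "A \<in> carrier_mat n n" "C \<in> carrier_mat n n" "B \<in> carrier_mat m m" "D \<in> carrier_mat m m"
  shows "four_block_mat A (0\<^sub>m n m) (0\<^sub>m m n) B * four_block_mat C (0\<^sub>m n m) (0\<^sub>m m n) D
    = four_block_mat (A * C) (0\<^sub>m n m) (0\<^sub>m m n) (B * D)"
  using assms by (subst mult_four_block_mat[of _ n n _ m _ m _ _ n _ m])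
    (auto intro!: cong_four_block_mat)

lemma osum_osum_four_block:
  fixes A :: "'a mat"
  assumes "A \<in> carrier_mat n n"
  shows "osum (osum A a) b
    = four_block_mat A (0\<^sub>m n 2) (0\<^sub>m 2 n) (mat_diag 2 (\<lambda>i. if i = 0 then a else b))"
  using assms by (intro eq_matI) (auto simp: osum_def mat_diag_def less_Suc_eq numeral_2_eq_2)

lemma osum_binary_eqv:
  assumes A: "A \<in> carrier_mat n n" and u: "av u1 = 1" "av u2 = 1" "av v1 = 1" "av v2 = 1"
    and s: "sgn (u1 * u2) = sgn (v1 * v2)" and t: "t \<noteq> 0"
  shows "eqv (Suc (Suc n)) (osum (osum A (t * u1)) (t * u2)) (osum (osum A (t * v1)) (t * v2))"
proof -
  let ?D = "\<lambda>u1 u2. mat_diag 2 (\<lambda>i. t * (if i = 0 then u1 else u2)) :: 'a mat"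
  obtain k where k: "k \<in> GLO 2" "?D u1 u2 \<bullet>\<^sub>X k = ?D v1 v2" using binary_eqv[OF u s t] by blast
  have kc: "k \<in> carrier_mat 2 2" using k by simp
  define g where "g = four_block_mat (1\<^sub>m n) (0\<^sub>m n 2) (0\<^sub>m 2 n) k"
  have gc: "g \<in> carrier_mat (n + 2) (n + 2)" unfolding g_def using kc by (intro four_block_carrier_mat) auto
  have gc': "g \<in> carrier_mat (Suc (Suc n)) (Suc (Suc n))" using gc by simp
  have "det g = det k" unfolding g_def using kc by (subst det_four_block_mat_lower_left_zero[of _ n _ 2]) auto
  moreover have "bounded_mat (Suc (Suc n)) 1 g"
    using k by (auto simp: bounded_mat_def g_def GLO_def simp del: GLO_carrier)
  ultimately have gG: "g \<in> GLO (Suc (Suc n))" using gc' k by (auto simp: GLO_def simp del: GLO_carrier)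
  have dd: "osum (osum A (t * a)) (t * b) = four_block_mat A (0\<^sub>m n 2) (0\<^sub>m 2 n) (?D a b)" for a b
    unfolding osum_osum_four_block[OF A]
    by (intro cong_four_block_mat refl) (auto intro!: eq_matI simp: mat_diag_def)
  have "four_block_mat A (0\<^sub>m n 2) (0\<^sub>m 2 n) (?D u1 u2) \<bullet>\<^sub>X g
      = four_block_mat A (0\<^sub>m n 2) (0\<^sub>m 2 n) (?D u1 u2 \<bullet>\<^sub>X k)"
  proof -
    have t: "transpose_mat g = four_block_mat (1\<^sub>m n) (0\<^sub>m n 2) (0\<^sub>m 2 n) (transpose_mat k)"
      unfolding g_def using kc by (subst transpose_four_block_mat[of _ n n _ 2 _ 2]) auto
    have dc: "?D u1 u2 \<in> carrier_mat 2 2" by simp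
    show ?thesis unfolding act_def t unfolding g_def using A kc dc
      by (simp add: diag_block_mult[of _ n _ _ 2] mult_carrier_mat[of _ 2 2 _ 2])
  qed
  thus ?thesis unfolding dd k(2) using gG unfolding eqv_def by metis
qed

text \<open>The last exponent is the valuation of the largest entries, which an integral change of basis
  cannot enlarge.\<close>

lemma dominant_max_eqv:
  assumes e: "dominant (Suc n) e" "units_on (Suc n) u" and f: "dominant (Suc n) f" "units_on (Suc n) v"
    and E: "eqv (Suc n) (diagpi (Suc n) e u) (diagpi (Suc n) f v)"
  shows "e n \<le> f n"
proof -
  have "bounded_mat (Suc n) (c powi e n) (diagpi (Suc n) f v)"
    using eqv_bounded[OF _ E bounded_diagpi[OF e]] by simp
  hence "av (diagpi (Suc n) f v $$ (n, n)) \<le> c powi e n" by (auto simp: bounded_mat_def)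
  thus ?thesis using f by (simp add: diagpi_def mat_diag_def av_mult av_powi units_on_def c_powi_le_iff)
qed

text \<open>For dominant \<open>e\<close> and a sign vector \<open>s\<close>, the product of the characters \<open>s i\<close> of the unit signs is an invariant
  of the orbit of a diagonal form with exponents \<open>e\<close> exactly if \<open>s\<close> is constant on the blocks of equal exponents.\<close>

definition block_const :: "nat \<Rightarrow> (nat \<Rightarrow> int) \<Rightarrow> (nat \<Rightarrow> int) \<Rightarrow> bool" where
  "block_const n e s \<longleftrightarrow> (\<forall>i. Suc i < n \<longrightarrow> e i = e (Suc i) \<longrightarrow> s i = s (Suc i))"

lemma sign_char_sgn_mult:
  "av u = 1 \<Longrightarrow> av v = 1 \<Longrightarrow> sign_char s (sgn (u * v)) = sign_char s (sgn u) * sign_char s (sgn v)"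
  by (simp add: sgn_mult sign_char_times[OF sgn_cases sgn_cases])

text \<open>Two unit coordinates of the same scale can be changed as long as the square class of
  their product is kept; in particular the last one can be prescribed.\<close>

lemma change_last_unit:
  assumes "units_on (Suc (Suc n)) u" "e n = e (Suc n)" "av w = 1"
  shows "\<exists>u'. units_on (Suc (Suc n)) u' \<and> u' (Suc n) = w \<and>
    eqv (Suc (Suc n)) (diagpi (Suc (Suc n)) e u) (diagpi (Suc (Suc n)) e u') \<and>
    (\<forall>s. block_const (Suc (Suc n)) e s \<longrightarrow>
      (\<Prod>i<Suc (Suc n). sign_char (s i) (sgn (u' i))) = (\<Prod>i<Suc (Suc n). sign_char (s i) (sgn (u i))))"
proof -
  define z where "z = u n * u (Suc n) * w"
  define u' where "u' = u(n := z, Suc n := w)"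
  have un: "av (u n) = 1" "av (u (Suc n)) = 1" using assms(1) by (auto simp: units_on_def)
  hence z: "av z = 1" using assms by (simp add: z_def av_mult)
  have sg: "sgn (u n * u (Suc n)) = sgn (z * w)"
  proof -
    have "sgn (z * w) = sgn (u n * u (Suc n)) * (sgn w * sgn w)"
      using un assms z by (simp add: z_def sgn_mult av_mult)
    thus ?thesis using sgn_cases[of w] by auto
  qed
  have D: "diagpi (Suc (Suc n)) e u' = osum (osum (diagpi n e u) (\<pi> powi e (Suc n) * z)) (\<pi> powi e (Suc n) * w)"
    using assms(2) by (simp add: diagpi_Suc u'_def diagpi_cong[of n e e "u(n := z, Suc n := w)" u])
  have "diagpi (Suc (Suc n)) e u
      = osum (osum (diagpi n e u) (\<pi> powi e (Suc n) * u n)) (\<pi> powi e (Suc n) * u (Suc n))"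
    using assms(2) by (simp add: diagpi_Suc)
  hence "eqv (Suc (Suc n)) (diagpi (Suc (Suc n)) e u) (diagpi (Suc (Suc n)) e u')"
    unfolding D using osum_binary_eqv[OF _ un z assms(3) sg, of "diagpi n e u" n "\<pi> powi e (Suc n)"] by simp
  moreover have "units_on (Suc (Suc n)) u'" using assms z by (auto simp: units_on_def u'_def)
  moreover have "(\<Prod>i<Suc (Suc n). sign_char (s i) (sgn (u' i))) = (\<Prod>i<Suc (Suc n). sign_char (s i) (sgn (u i)))"
    if "block_const (Suc (Suc n)) e s" for s
  proof -
    have "s n = s (Suc n)" using that assms(2) by (auto simp: block_const_def)
    moreover have "(\<Prod>i<n. sign_char (s i) (sgn (u' i))) = (\<Prod>i<n. sign_char (s i) (sgn (u i)))"
      by (intro prod.cong) (auto simp: u'_def)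
    ultimately show ?thesis
      using sign_char_sgn_mult[OF un, of "s n"] sign_char_sgn_mult[OF z assms(3), of "s n"] sg
      by (simp add: u'_def)
  qed
  moreover have "u' (Suc n) = w" by (simp add: u'_def)
  ultimately show ?thesis by blast
qed

lemma units_on_Suc: "units_on (Suc n) u \<longleftrightarrow> units_on n u \<and> av (u n) = 1"
  by (auto simp: units_on_def less_Suc_eq)

lemma block_const_Suc: "block_const (Suc n) e s \<Longrightarrow> block_const n e s"
  by (simp add: block_const_def)

lemma scaled_square_close:
  assumes "av (x - y) < av y" "y \<noteq> 0"
  obtains w where "av w = 1" "x = y * w\<^sup>2"
proof -
  have "av (x / y - 1) < 1"
  proof -
    have "x / y - 1 = (x - y) / y" using assms by (simp add: field_simps)
    thus ?thesis using assms av_pos[OF assms(2)] by (simp add: av_divide)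
  qed
  then obtain w where "w\<^sup>2 = x / y" "av w = 1" by (rule one_unit_square)
  thus ?thesis using that[of w] assms by simp
qed

text \<open>If the last exponent occurs only once, then the other terms of the last diagonal entry are smaller
  than the term of the last unit.\<close>

lemma last_unit_square:
  assumes e: "dominant (Suc n) e" "units_on (Suc n) u" and en: "n > 0 \<Longrightarrow> e n < e (n - 1)"
    and v: "units_on (Suc n) v" and f: "f n = e n"
    and E: "eqv (Suc n) (diagpi (Suc n) e u) (diagpi (Suc n) f v)"
  shows "sgn (u n) = sgn (v n)"
proof -
  obtain k where k: "k \<in> GLO (Suc n)" "diagpi (Suc n) f v = diagpi (Suc n) e u \<bullet>\<^sub>X k"
    using E by (auto simp: eqv_def)
  have ki: "av (k $$ (i, n)) \<le> 1" if "i < Suc n" for i using that k by (auto simp: GLO_def bounded_mat_def simp del: GLO_carrier)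
  have "\<pi> powi e n * v n = diagpi (Suc n) f v $$ (n, n)"
    using f by (simp add: diagpi_def mat_diag_def)
  also have "\<dots> = (\<Sum>a<Suc n. \<Sum>b<Suc n. k $$ (a, n) * diagpi (Suc n) e u $$ (a, b) * k $$ (b, n))"
    unfolding k(2) using k(1) by (subst act_index[of _ "Suc n"]) auto
  also have "\<dots> = (\<Sum>a<Suc n. k $$ (a, n) * (\<pi> powi e a * u a) * k $$ (a, n))"
  proof (intro sum.cong refl)
    fix a assume a: "a \<in> {..<Suc n}"
    have "(\<Sum>b<Suc n. k $$ (a, n) * diagpi (Suc n) e u $$ (a, b) * k $$ (b, n))
      = (\<Sum>b<Suc n. if b = a then k $$ (a, n) * (\<pi> powi e a * u a) * k $$ (a, n) else 0)"
      using a by (intro sum.cong) (auto simp: diagpi_def mat_diag_def)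
    also have "\<dots> = k $$ (a, n) * (\<pi> powi e a * u a) * k $$ (a, n)" using a by simp
    finally show "(\<Sum>b<Suc n. k $$ (a, n) * diagpi (Suc n) e u $$ (a, b) * k $$ (b, n))
      = k $$ (a, n) * (\<pi> powi e a * u a) * k $$ (a, n)" .
  qed
  finally have eq: "\<pi> powi e n * v n - \<pi> powi e n * (u n * (k $$ (n, n))\<^sup>2)
      = (\<Sum>a<n. k $$ (a, n) * (\<pi> powi e a * u a) * k $$ (a, n))"
    by (simp add: power2_eq_square algebra_simps)
  have "av (\<Sum>a<n. k $$ (a, n) * (\<pi> powi e a * u a) * k $$ (a, n)) < c powi e n"
  proof (rule av_sum_less)
    fix a assume a: "a \<in> {..<n}"
    have "e (n - 1) \<le> e a" using a by (intro dominant_le[OF e(1)]) auto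
    hence lt: "c powi e a < c powi e n" using a en by (subst c_powi_less_iff) auto
    have "av (k $$ (a, n)) \<le> 1" using ki a by simp
    hence "av (k $$ (a, n) * k $$ (a, n)) \<le> 1" by (intro av_mult_le_1)
    moreover have "av (k $$ (a, n) * (\<pi> powi e a * u a) * k $$ (a, n))
        = av (k $$ (a, n) * k $$ (a, n)) * c powi e a"
      using e(2) a by (simp add: av_mult av_powi units_on_def)
    ultimately have "av (k $$ (a, n) * (\<pi> powi e a * u a) * k $$ (a, n)) \<le> c powi e a"
      using mult_right_mono[of "av (k $$ (a, n) * k $$ (a, n))" 1 "c powi e a"] by simp
    thus "av (k $$ (a, n) * (\<pi> powi e a * u a) * k $$ (a, n)) < c powi e n" using lt by linarith
  qed simp
  hence "c powi e n * av (v n - u n * (k $$ (n, n))\<^sup>2) < c powi e n * 1"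
    unfolding eq[symmetric] by (simp flip: right_diff_distrib add: av_mult av_powi)
  hence lt: "av (u n * (k $$ (n, n))\<^sup>2 - v n) < 1"
    using c_powi_pos[of "e n"] by (subst av_commute) (simp only: mult_less_cancel_left_pos)
  have vn: "av (v n) = 1" "av (u n) = 1" using v e(2) by (auto simp: units_on_def)
  have v0: "v n \<noteq> 0" using vn(1) by (metis av_0 zero_neq_one)
  have lt': "av (u n * (k $$ (n, n))\<^sup>2 - v n) < av (v n)" using lt vn(1) by simp
  obtain w where w: "av w = 1" "u n * (k $$ (n, n))\<^sup>2 = v n * w\<^sup>2"
    by (rule scaled_square_close[OF lt' v0])
  have "av (u n * (k $$ (n, n))\<^sup>2) = av (v n * w\<^sup>2)" unfolding w(2) ..
  hence "av (k $$ (n, n)) ^ 2 = 1"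
    using vn w(1) by (simp add: av_mult av_power)
  hence kn: "av (k $$ (n, n)) = 1" using av_nonneg[of "k $$ (n, n)"] by (simp add: power2_eq_1_iff)
  have "sgn (u n * (k $$ (n, n))\<^sup>2) = sgn (v n * w\<^sup>2)" using w by simp
  thus ?thesis using kn w(1) vn sq_unit_power2 by (simp add: sgn_mult av_power) (simp add: sgn_def)
qed

text \<open>The type and the signs of an orbit are well defined. By induction: the smallest scale is the
  size of the largest entry, the unit there can be made equal on both sides, and then the last
  summand cancels.\<close>

lemma eqv_invariants:
  assumes "dominant n e" "units_on n u" "dominant n f" "units_on n v"
    "eqv n (diagpi n e u) (diagpi n f v)"
  shows "(\<forall>i<n. e i = f i) \<and> (\<forall>s. block_const n e s \<longrightarrow>
    (\<Prod>i<n. sign_char (s i) (sgn (u i))) = (\<Prod>i<n. sign_char (s i) (sgn (v i))))"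
  using assms
proof (induction n arbitrary: u v)
  case (Suc n)
  note P = Suc.prems
  have E': "eqv (Suc n) (diagpi (Suc n) f v) (diagpi (Suc n) e u)" using eqv_sym[OF diagpi_carrier P(5)] .
  have en: "e n = f n"
    using dominant_max_eqv[OF P] dominant_max_eqv[OF P(3,4,1,2) E'] by simp
  have core: "(\<forall>i<Suc n. e i = f i) \<and> (\<forall>s. block_const (Suc n) e s \<longrightarrow>
      (\<Prod>i<Suc n. sign_char (s i) (sgn (u i))) = (\<Prod>i<Suc n. sign_char (s i) (sgn (v i))))"
    if u: "units_on (Suc n) u" and v: "units_on (Suc n) v" and uv: "sgn (u n) = sgn (v n)"
      and E: "eqv (Suc n) (diagpi (Suc n) e u) (diagpi (Suc n) f v)" for u v
  proof -
    obtain w where w: "av w = 1" "v n = u n * w\<^sup>2"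
      using sgn_eq_square[OF _ _ uv] u v by (auto simp: units_on_def)
    have "eqv (Suc n) (diagpi (Suc n) e u) (osum (diagpi n e u) (\<pi> powi f n * v n))"
      using osum_eqv_square[OF diagpi_carrier w(1), of n e u "\<pi> powi e n * u n"]
      by (simp add: diagpi_Suc en w(2) mult.assoc)
    note E1 = this
    have "eqv (Suc n) (osum (diagpi n e u) (\<pi> powi f n * v n)) (diagpi (Suc n) f v)"
      using eqv_trans[OF _ eqv_sym[OF diagpi_carrier E1] E] by simp
    hence "eqv n (diagpi n e u) (diagpi n f v)"
      using u v unfolding diagpi_Suc[of n f v]
      by (rule_tac witt_cancellation[of _ _ _ "\<pi> powi f n * v n"])
        (auto simp: units_on_Suc det_diagpi_nz)
    note R = Suc.IH[OF dominant_Suc[OF P(1)] _ dominant_Suc[OF P(3)] _ this]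
    have IH: "\<forall>i<n. e i = f i" "\<And>s. block_const n e s \<Longrightarrow>
      (\<Prod>i<n. sign_char (s i) (sgn (u i))) = (\<Prod>i<n. sign_char (s i) (sgn (v i)))"
      using R u v by (auto simp only: units_on_Suc)
    show ?thesis using IH(1) en IH(2)[OF block_const_Suc] uv by (simp add: less_Suc_eq)
  qed
  consider m where "n = Suc m" "e m = e n" | m where "n = Suc m" "f m = f n"
    | "\<And>m. n = Suc m \<Longrightarrow> e m \<noteq> e n" by blast
  thus ?case
  proof cases
    case 1
    have "\<exists>u'. units_on (Suc n) u' \<and> u' n = v n \<and> eqv (Suc n) (diagpi (Suc n) e u) (diagpi (Suc n) e u') \<and>
        (\<forall>s. block_const (Suc n) e s \<longrightarrow>
        (\<Prod>i<Suc n. sign_char (s i) (sgn (u' i))) = (\<Prod>i<Suc n. sign_char (s i) (sgn (u i))))"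
      unfolding 1(1) by (rule change_last_unit) (use P(2,4) 1 in \<open>simp_all add: units_on_def\<close>)
    then obtain u' where u': "units_on (Suc n) u'" "u' n = v n"
        "eqv (Suc n) (diagpi (Suc n) e u) (diagpi (Suc n) e u')"
      and pu: "\<And>s. block_const (Suc n) e s \<Longrightarrow>
        (\<Prod>i<Suc n. sign_char (s i) (sgn (u' i))) = (\<Prod>i<Suc n. sign_char (s i) (sgn (u i)))"
      by blast
    have E: "eqv (Suc n) (diagpi (Suc n) e u') (diagpi (Suc n) f v)"
      using eqv_trans[OF diagpi_carrier eqv_sym[OF diagpi_carrier u'(3)] P(5)] .
    have "sgn (u' n) = sgn (v n)" by (simp only: u'(2))
    note c = core[OF u'(1) P(4) this E]
    have "(\<Prod>i<Suc n. sign_char (s i) (sgn (u i))) = (\<Prod>i<Suc n. sign_char (s i) (sgn (v i)))"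
      if "block_const (Suc n) e s" for s
      by (rule trans[OF pu[OF that, symmetric] conjunct2[OF c, rule_format, OF that]])
    with conjunct1[OF c] show ?thesis by blast
  next
    case 2
    have "\<exists>v'. units_on (Suc n) v' \<and> v' n = u n \<and> eqv (Suc n) (diagpi (Suc n) f v) (diagpi (Suc n) f v') \<and>
        (\<forall>s. block_const (Suc n) f s \<longrightarrow>
        (\<Prod>i<Suc n. sign_char (s i) (sgn (v' i))) = (\<Prod>i<Suc n. sign_char (s i) (sgn (v i))))"
      unfolding 2(1) by (rule change_last_unit) (use P(2,4) 2 in \<open>simp_all add: units_on_def\<close>)
    then obtain v' where v': "units_on (Suc n) v'" "v' n = u n"
        "eqv (Suc n) (diagpi (Suc n) f v) (diagpi (Suc n) f v')"
      and pv: "\<And>s. block_const (Suc n) f s \<Longrightarrow>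
        (\<Prod>i<Suc n. sign_char (s i) (sgn (v' i))) = (\<Prod>i<Suc n. sign_char (s i) (sgn (v i)))"
      by blast
    have E: "eqv (Suc n) (diagpi (Suc n) e u) (diagpi (Suc n) f v')"
      using eqv_trans[OF diagpi_carrier P(5) v'(3)] .
    have "sgn (u n) = sgn (v' n)" by (simp only: v'(2))
    note c = core[OF P(2) v'(1) this E]
    have bf: "block_const (Suc n) f s" if "block_const (Suc n) e s" for s
      using that conjunct1[OF c] by (auto simp: block_const_def)
    have "(\<Prod>i<Suc n. sign_char (s i) (sgn (u i))) = (\<Prod>i<Suc n. sign_char (s i) (sgn (v i)))"
      if "block_const (Suc n) e s" for s
      by (rule trans[OF conjunct2[OF c, rule_format, OF that] pv[OF bf[OF that]]])
    with conjunct1[OF c] show ?thesis by blast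
  next
    case 3
    have "e n < e (n - 1)" if "n > 0"
      using 3[of "n - 1"] dominant_le[OF P(1), of "n - 1" n] that by fastforce
    hence "sgn (u n) = sgn (v n)" by (rule last_unit_square[OF P(1,2) _ P(4) en[symmetric] P(5)])
    from core[OF P(2,4) this P(5)] show ?thesis .
  qed
qed simp

text \<open>The last units are made equal and the last summand is split off.\<close>

lemma eqv_of_invariants:
  assumes "dominant n e" "units_on n u" "units_on n v"
    "\<And>s. block_const n e s \<Longrightarrow> (\<Prod>i<n. sign_char (s i) (sgn (u i))) = (\<Prod>i<n. sign_char (s i) (sgn (v i)))"
  shows "eqv n (diagpi n e u) (diagpi n e v)"
  using assms
proof (induction n arbitrary: u v)
  case 0
  show ?case using eqv_refl[of "diagpi 0 e u" 0] diagpi_cong[of 0 e e u v] by simp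
next
  case (Suc n)
  note P = Suc.prems
  have nz: "sign_char a (sgn x) \<noteq> 0" for a x using sgn_cases[of x] by (auto simp: sign_char_def)
  have core: "eqv (Suc n) (diagpi (Suc n) e u) (diagpi (Suc n) e v)"
    if u: "units_on (Suc n) u" and uv: "sgn (u n) = sgn (v n)"
      and p: "\<And>s. block_const (Suc n) e s \<Longrightarrow> (\<Prod>i<Suc n. sign_char (s i) (sgn (u i))) = (\<Prod>i<Suc n. sign_char (s i) (sgn (v i)))"
    for u
  proof -
    have "(\<Prod>i<n. sign_char (s i) (sgn (u i))) = (\<Prod>i<n. sign_char (s i) (sgn (v i)))"
      if s: "block_const n e s" for s
    proof -
      \<comment> \<open>Extending \<open>s\<close> by its last value keeps it constant on the last block of \<open>e\<close>.\<close>
      define s' where "s' = s(n := s (n - 1))"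
      have "block_const (Suc n) e s'" using s by (auto simp: block_const_def s'_def less_Suc_eq)
      from p[OF this] uv nz have "(\<Prod>i<n. sign_char (s' i) (sgn (u i))) = (\<Prod>i<n. sign_char (s' i) (sgn (v i)))"
        by simp
      thus ?thesis by (simp add: s'_def)
    qed
    hence "eqv n (diagpi n e u) (diagpi n e v)"
      using Suc.IH[of u v] P u dominant_Suc by (simp add: units_on_Suc)
    hence 1: "eqv (Suc n) (diagpi (Suc n) e u) (osum (diagpi n e v) (\<pi> powi e n * u n))"
      by (simp add: diagpi_Suc osum_eqv)
    obtain w where w: "av w = 1" "v n = u n * w\<^sup>2"
      using sgn_eq_square[OF _ _ uv] u P(3) by (auto simp: units_on_def)
    have "eqv (Suc n) (osum (diagpi n e v) (\<pi> powi e n * u n)) (diagpi (Suc n) e v)"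
      using osum_eqv_square[OF diagpi_carrier w(1), of n e v "\<pi> powi e n * u n"]
      by (simp add: diagpi_Suc w(2) mult.assoc)
    with 1 show ?thesis by (rule eqv_trans[OF diagpi_carrier])
  qed
  show ?case
  proof (cases "\<exists>m. n = Suc m \<and> e m = e n")
    case True
    then obtain m where m: "n = Suc m" "e m = e n" by blast
    have "\<exists>u'. units_on (Suc n) u' \<and> u' n = v n \<and> eqv (Suc n) (diagpi (Suc n) e u) (diagpi (Suc n) e u') \<and>
        (\<forall>s. block_const (Suc n) e s \<longrightarrow>
        (\<Prod>i<Suc n. sign_char (s i) (sgn (u' i))) = (\<Prod>i<Suc n. sign_char (s i) (sgn (u i))))"
      unfolding m(1) by (rule change_last_unit) (use P(2,3) m in \<open>simp_all add: units_on_def\<close>)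
    then obtain u' where u': "units_on (Suc n) u'" "u' n = v n"
        "eqv (Suc n) (diagpi (Suc n) e u) (diagpi (Suc n) e u')"
      and pu: "\<And>s. block_const (Suc n) e s \<Longrightarrow>
        (\<Prod>i<Suc n. sign_char (s i) (sgn (u' i))) = (\<Prod>i<Suc n. sign_char (s i) (sgn (u i)))"
      by blast
    have "sgn (u' n) = sgn (v n)" by (simp only: u'(2))
    from core[OF u'(1) this trans[OF pu P(4)]]
    have "eqv (Suc n) (diagpi (Suc n) e u') (diagpi (Suc n) e v)" by blast
    with u'(3) show ?thesis by (rule eqv_trans[OF diagpi_carrier])
  next
    case False
    \<comment> \<open>The last index is a block of its own; the character of the last sign detects the last unit.\<close>
    define s where "s = (\<lambda>i. if i = n then -1 else 1 :: int)"
    have "block_const (Suc n) e s" using False by (auto simp: block_const_def s_def)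
    from P(4)[OF this] have "sgn (u n) = sgn (v n)" by (simp add: s_def sign_char_def)
    from core[OF P(2) this P(4)] show ?thesis .
  qed
qed

end

section \<open>Types of a form in two lattices\<close>

context odd_padic begin

text \<open>The comparison starts at the last index, where dominant exponents are smallest and entries of forms largest.\<close>

primrec lexge :: "nat \<Rightarrow> (nat \<Rightarrow> int) \<Rightarrow> (nat \<Rightarrow> int) \<Rightarrow> bool" where
  "lexge 0 x y \<longleftrightarrow> True"
| "lexge (Suc n) x y \<longleftrightarrow> y n < x n \<or> x n = y n \<and> lexge n x y"

lemma act_dpi_index:
  assumes "A \<in> carrier_mat n n" "i < n" "j < n"
  shows "(A \<bullet>\<^sub>X dpi n l) $$ (i, j) = \<pi> powi (l i + l j) * A $$ (i, j)"
proof -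
  have t: "transpose_mat (dpi n l) = dpi n l"
    by (intro eq_matI) (auto simp: dpi_def mat_diag_def)
  show ?thesis using assms
    by (simp add: act_def t powi_add_unif)
      (simp add: dpi_def mat_diag_mult_left[of _ n n] mat_diag_mult_right[of _ n n] algebra_simps)
qed

lemma dpi_cong: "(\<And>i. i < n \<Longrightarrow> l i = l' i) \<Longrightarrow> dpi n l = dpi n l'"
  by (intro eq_matI) (auto simp: dpi_def mat_diag_def)

lemma dpi_Suc: "dpi (Suc n) l = osum (dpi n l) (\<pi> powi l n)"
  by (simp add: dpi_def mat_diag_Suc)

lemma diagpi_act_dpi: "diagpi n e u \<bullet>\<^sub>X dpi n l = diagpi n (\<lambda>i. e i + 2 * l i) u"
proof -
  have sq: "\<pi> powi (2 * x) = \<pi> powi x * \<pi> powi x" for x by (simp flip: powi_add_unif)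
  show ?thesis (is "?A = ?B")
  proof (rule eq_matI)
    fix i j assume "i < dim_row ?B" "j < dim_col ?B"
    hence ij: "i < n" "j < n" by (auto simp: diagpi_def mat_diag_def)
    show "?A $$ (i, j) = ?B $$ (i, j)"
      unfolding act_dpi_index[OF diagpi_carrier ij]
      using ij by (simp add: diagpi_def mat_diag_def powi_add_unif sq)
  qed (auto simp: act_def diagpi_def mat_diag_def dpi_def)
qed

lemma dpi_inverse: "dpi n l * dpi n (\<lambda>i. - l i) = 1\<^sub>m n" "dpi n (\<lambda>i. - l i) * dpi n l = 1\<^sub>m n"
  by (simp_all add: dpi_mult dpi_0)

lemma det_dpi_nz: "det (dpi n l) \<noteq> 0"
proof -
  have "det (dpi n l) * det (dpi n (\<lambda>i. - l i)) = 1"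
    using dpi_inverse(1)[of n l] by (simp flip: det_mult[of _ n])
  thus ?thesis by auto
qed

lemma osum_parahoric:
  assumes "h \<in> parahoric n l" shows "osum h 1 \<in> parahoric (Suc n) l"
proof -
  have h: "h \<in> GLO n" "h \<in> carrier_mat n n" using assms parahoric_GLO by auto
  have "osum h 1 \<in> GLO (Suc n)" using osum_GLO[OF h(1)] by simp
  moreover have "\<forall>i<n. \<forall>j<n. av (h $$ (i, j)) \<le> c powi (l i - l j)"
    using assms parahoric_iff[OF h(1)] by simp
  ultimately show ?thesis
    by (subst parahoric_iff) (auto simp: osum_index[OF h(2)])
qed

lemma diagpi_top_entry:
  assumes "units_on (Suc n) v" "bounded_mat (Suc n) (c powi m) (diagpi (Suc n) f v)"
  shows "m \<le> f n"
proof -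
  have "av (diagpi (Suc n) f v $$ (n, n)) \<le> c powi m" using assms(2) by (auto simp: bounded_mat_def)
  thus ?thesis using assms(1) by (simp add: diagpi_def mat_diag_def av_mult av_powi units_on_def c_powi_le_iff)
qed

text \<open>A summand of the smallest scale can be cancelled from the type.\<close>

lemma osum_type:
  assumes "A \<in> carrier_mat (Suc n) (Suc n)" "transpose_mat A = A"
    and A': "A' \<in> carrier_mat n n" and a: "av a = c powi m" and E: "eqv (Suc n) A (osum A' a)"
    and f: "dominant (Suc n) f" "units_on (Suc n) v" "eqv (Suc n) A (diagpi (Suc n) f v)" and m: "f n = m"
  obtains u where "units_on n u" "eqv n A' (diagpi n f u)"
proof -
  have b: "bounded_mat (Suc n) (c powi m) A"
    using eqv_bounded[OF diagpi_carrier eqv_sym[OF assms(1) f(3)] bounded_diagpi[OF f(1,2)]] m by simp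
  have "av (det A) \<noteq> 0" using eqv_det[OF assms(1) f(3)] det_diagpi_nz[OF f(2)] by (metis av_eq_0_iff)
  hence d: "det A \<noteq> 0" by auto
  obtain e u where eu: "dominant n e" "units_on n u" "eqv n A' (diagpi n e u)"
    using diagonalization[OF A' osum_symmetric_det[OF assms(1,2) d E A']] by blast
  note O = osum_diagpi[OF A' eu a eqv_bounded[OF assms(1) E b c_powi_nonneg]]
  have "eqv (Suc n) (diagpi (Suc n) (e(n := m)) (u(n := a / \<pi> powi m))) (diagpi (Suc n) f v)"
    using E O(3) f(3) assms(1) eqv_sym eqv_trans by (meson diagpi_carrier eqv_carrier)
  from conjunct1[OF eqv_invariants[OF O(1,2) f(1,2) this]] have "\<forall>i<n. e i = f i"
    by (metis fun_upd_apply less_SucI less_irrefl)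
  hence "diagpi n e u = diagpi n f u" by (intro diagpi_cong) auto
  thus ?thesis using that eu by simp
qed

text \<open>This compares the types of one form with respect to two lattices in the relative position \<open>l\<close>: \<open>A\<close> has type
  \<open>e\<close> and \<open>B = A \<cdot> \<pi>\<^sup>l\<close> has type \<open>f\<close>. As \<open>l\<close> is smallest at the last index, no entry of \<open>B\<close> exceeds
  \<open>c powi (e n + 2 * l n)\<close>, which is the inequality at the last index. If equality holds there, then a largest entry
  \<open>(i, j)\<close> of \<open>B\<close> is also a largest entry of \<open>A\<close> and satisfies \<open>l i = l j = l n\<close>. The parahoric pivot step
  therefore splits off a summand of \<open>A\<close> and of \<open>B\<close> at the same time, and the rest is compared by induction. If
  equality holds at all indices, then the steps compose to a parahoric diagonalization of \<open>A\<close>.\<close>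

lemma simultaneous_reduction:
  assumes "A \<in> carrier_mat n n" "transpose_mat A = A"
    "dominant n e" "units_on n u" "eqv n A (diagpi n e u)" "dominant n l"
    "dominant n f" "units_on n v" "eqv n (A \<bullet>\<^sub>X dpi n l) (diagpi n f v)"
  shows "lexge n f (\<lambda>i. e i + 2 * l i) \<and> ((\<forall>i<n. f i = e i + 2 * l i) \<longrightarrow>
    (\<exists>h\<in>parahoric n l. \<exists>w. units_on n w \<and> A \<bullet>\<^sub>X h = diagpi n e w))"
  using assms
proof (induction n arbitrary: A u v)
  case 0
  have "A \<bullet>\<^sub>X 1\<^sub>m 0 = diagpi 0 e u" using 0(1) by (intro eq_matI) (auto simp: act_def diagpi_def mat_diag_def)
  thus ?case using 0(4) parahoric_one[of 0 l] by auto
next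
  case (Suc n)
  note P = Suc.prems
  define B where "B = A \<bullet>\<^sub>X dpi (Suc n) l"
  have B: "B \<in> carrier_mat (Suc n) (Suc n)" "transpose_mat B = B"
    using P(1) act_sym[OF P(1) dpi_carrier P(2)] by (auto simp: B_def)
  have Bi: "B $$ (i, j) = \<pi> powi (l i + l j) * A $$ (i, j)" if "i < Suc n" "j < Suc n" for i j
    unfolding B_def using act_dpi_index[OF P(1) that] .
  have bA: "bounded_mat (Suc n) (c powi e n) A"
    using eqv_bounded[OF diagpi_carrier eqv_sym[OF P(1,5)] bounded_diagpi[OF P(3,4)]] by simp
  have Bav: "av (B $$ (i, j)) = c powi (l i + l j) * av (A $$ (i, j))" if "i < Suc n" "j < Suc n" for i j
    using Bi[OF that] by (simp add: av_mult av_powi)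
  have ll: "l n \<le> l i" if "i < Suc n" for i using dominant_le[OF P(6), of i n] that by simp
  have bB: "bounded_mat (Suc n) (c powi (e n + 2 * l n)) B"
    unfolding bounded_mat_def
  proof (intro allI impI)
    fix i j assume ij: "i < Suc n" "j < Suc n"
    have "av (B $$ (i, j)) \<le> c powi (l i + l j) * c powi e n"
      unfolding Bav[OF ij] using bA ij by (intro mult_left_mono) (auto simp: bounded_mat_def)
    also have "\<dots> = c powi (l i + l j + e n)" by (simp only: powi_add_c)
    also have "\<dots> \<le> c powi (e n + 2 * l n)" using ll[OF ij(1)] ll[OF ij(2)] by (subst c_powi_le_iff) simp
    finally show "av (B $$ (i, j)) \<le> c powi (e n + 2 * l n)" .
  qed
  have EB: "eqv (Suc n) B (diagpi (Suc n) f v)" using P(9) by (simp add: B_def)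
  have ge: "e n + 2 * l n \<le> f n"
    using diagpi_top_entry[OF P(8) eqv_bounded[OF B(1) EB bB c_powi_nonneg]] .
  show ?case
  proof (cases "f n = e n + 2 * l n")
    case False
    thus ?thesis using ge by auto
  next
    case True
    have "\<exists>i j. i < Suc n \<and> j < Suc n \<and> av (B $$ (i, j)) = c powi (f n)"
    proof (rule ccontr)
      assume N: "\<not> ?thesis"
      have "av (B $$ (i, j)) \<le> c powi (f n + 1)" if ij: "i < Suc n" "j < Suc n" for i j
      proof (cases "B $$ (i, j) = 0")
        case False
        then obtain t where t: "av (B $$ (i, j)) = c powi t" using value_group by blast
        have "av (B $$ (i, j)) \<le> c powi (e n + 2 * l n)" using bB ij by (auto simp: bounded_mat_def)
        hence "c powi t \<le> c powi f n" by (simp only: t True)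
        moreover have "t \<noteq> f n" using N ij t by auto
        ultimately have "f n + 1 \<le> t" by (simp add: c_powi_le_iff)
        thus ?thesis unfolding t c_powi_le_iff .
      qed simp
      hence "bounded_mat (Suc n) (c powi (f n + 1)) B" by (auto simp: bounded_mat_def)
      from diagpi_top_entry[OF P(8) eqv_bounded[OF B(1) EB this c_powi_nonneg]] show False by simp
    qed
    then obtain i j where ij: "i < Suc n" "j < Suc n" "av (B $$ (i, j)) = c powi f n" by blast
    have "A $$ (i, j) \<noteq> 0" using ij Bi[OF ij(1,2)] c_powi_pos[of "f n"] by auto
    then obtain t where t: "av (A $$ (i, j)) = c powi t" using value_group by blast
    have "av (A $$ (i, j)) \<le> c powi e n" using bA ij by (auto simp: bounded_mat_def)
    hence "e n \<le> t" by (simp only: t c_powi_le_iff)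
    moreover have "c powi (l i + l j + t) = c powi f n"
      using ij(3) unfolding Bav[OF ij(1,2)] t by (simp only: powi_add_c)
    hence "l i + l j + t = e n + 2 * l n" using True c_powi_eq_iff by metis
    ultimately have lij: "l i = l n" "l j = l n" "t = e n" using ll[OF ij(1)] ll[OF ij(2)] by auto
    obtain h A' a where h: "h \<in> parahoric (Suc n) l" "A' \<in> carrier_mat n n"
      "A \<bullet>\<^sub>X h = osum A' a" "av a = c powi e n"
      by (rule act_pivot[OF P(1,2,6) bA ij(1,2) lij(1,2) t[unfolded lij(3)]])
    have hc: "h \<in> carrier_mat (Suc n) (Suc n)" using h by simp
    define h' where "h' = dpi (Suc n) (\<lambda>i. - l i) * h * dpi (Suc n) l"
    have h'G: "h' \<in> GLO (Suc n)" using h(1) by (simp add: parahoric_def h'_def)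
    have "B \<bullet>\<^sub>X h' = A \<bullet>\<^sub>X h \<bullet>\<^sub>X dpi (Suc n) l"
      unfolding B_def h'_def using act_dpi_conj[OF P(1) hc] .
    also have "\<dots> = osum (A' \<bullet>\<^sub>X dpi n l) (a * (\<pi> powi l n)\<^sup>2)"
      unfolding h(3) dpi_Suc using h(2) by (intro osum_act) auto
    finally have Bh: "eqv (Suc n) B (osum (A' \<bullet>\<^sub>X dpi n l) (a * (\<pi> powi l n)\<^sup>2))"
      using h'G unfolding eqv_def by metis
    have Ah: "eqv (Suc n) A (osum A' a)" using h parahoric_GLO unfolding eqv_def by metis
    have dA: "det A \<noteq> 0"
      using eqv_det[OF P(1,5)] det_diagpi_nz[OF P(4), of e] by (metis av_eq_0_iff)
    have A's: "transpose_mat A' = A'" using osum_symmetric_det(1)[OF P(1,2) dA Ah h(2)] .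
    have "c powi l n * c powi l n = c powi (2 * l n)" by (simp flip: powi_add_c)
    hence avb: "av (a * (\<pi> powi l n)\<^sup>2) = c powi f n"
      unfolding True powi_add_c by (simp add: h(4) av_mult av_powi power2_eq_square)
    obtain u' where u': "units_on n u'" "eqv n A' (diagpi n e u')"
      by (rule osum_type[OF P(1,2) h(2,4) Ah P(3-5) refl])
    obtain v' where v': "units_on n v'" "eqv n (A' \<bullet>\<^sub>X dpi n l) (diagpi n f v')"
      by (rule osum_type[OF B _ avb Bh P(7,8) EB refl]) (use h(2) in simp_all)
    note IH = Suc.IH[OF h(2) A's dominant_Suc[OF P(3)] u' dominant_Suc[OF P(6)] dominant_Suc[OF P(7)] v']
    have "\<exists>g\<in>parahoric (Suc n) l. \<exists>w. units_on (Suc n) w \<and> A \<bullet>\<^sub>X g = diagpi (Suc n) e w"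
      if eq: "\<forall>i<Suc n. f i = e i + 2 * l i"
    proof -
      obtain g w where g: "g \<in> parahoric n l" "units_on n w" "A' \<bullet>\<^sub>X g = diagpi n e w"
        using IH eq by auto
      define w' where "w' = w(n := a / \<pi> powi e n)"
      have og: "osum g 1 \<in> parahoric (Suc n) l" using osum_parahoric[OF g(1)] .
      have "A \<bullet>\<^sub>X (h * osum g 1) = osum A' a \<bullet>\<^sub>X osum g 1"
        using act_act[OF P(1) hc parahoric_carrier[OF og]] h(3) by simp
      also have "\<dots> = osum (A' \<bullet>\<^sub>X g) (a * 1\<^sup>2)"
        using h(2) g(1) by (intro osum_act) auto
      also have "\<dots> = diagpi (Suc n) e w'"
        by (simp add: g(3) diagpi_Suc w'_def diagpi_cong[of n e e "w(n := a / \<pi> powi e n)" w])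
      finally have "A \<bullet>\<^sub>X (h * osum g 1) = diagpi (Suc n) e w'" .
      moreover have "units_on (Suc n) w'"
        using g(2) h(4) by (auto simp: units_on_def w'_def av_divide av_powi less_Suc_eq)
      ultimately show ?thesis using parahoric_mult[OF h(1) og] by blast
    qed
    thus ?thesis using IH True by auto
  qed
qed

text \<open>If \<open>D \<cdot> k = D\<acute>\<close> then \<open>D k = m D\<acute>\<close> with \<open>m\<close> the inverse of the transpose of \<open>k\<close>, and \<open>m\<close> is integral.\<close>

lemma diagpi_transporter_entries:
  assumes k: "k \<in> GLO n" and u: "units_on n u" and w: "units_on n w"
    and act: "diagpi n f u \<bullet>\<^sub>X k = diagpi n f w" and ij: "i < n" "j < n"
  shows "av (k $$ (i, j)) \<le> c powi (f j - f i)"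
proof -
  obtain m where m: "m \<in> GLO n" "transpose_mat k * m = 1\<^sub>m n" "m * transpose_mat k = 1\<^sub>m n"
    using GLO_inverse[OF GLO_transpose[OF k]] by metis
  have kc: "k \<in> carrier_mat n n" "m \<in> carrier_mat n n" using k m by auto
  have "m * (transpose_mat k * (diagpi n f u * k)) = m * diagpi n f w"
    using act kc by (simp add: act_def assoc_mult_mat[of _ n n _ n _ n])
  moreover have "m * (transpose_mat k * (diagpi n f u * k)) = (m * transpose_mat k) * (diagpi n f u * k)"
    using kc by (simp add: assoc_mult_mat[of m n n "transpose_mat k" n _ n] mult_carrier_mat[of _ n n _ n])
  moreover have "diagpi n f u * k \<in> carrier_mat n n" using kc by (intro mult_carrier_mat[of _ n n]) auto
  ultimately have "diagpi n f u * k = m * diagpi n f w"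
    unfolding m(3) using left_mult_one_mat by metis
  hence "(diagpi n f u * k) $$ (i, j) = (m * diagpi n f w) $$ (i, j)" by simp
  hence "\<pi> powi f i * u i * k $$ (i, j) = m $$ (i, j) * (\<pi> powi f j * w j)"
    using kc ij unfolding diagpi_def by (simp add: mat_diag_mult_left[of _ n n] mat_diag_mult_right[of _ n n])
  hence "av (\<pi> powi f i * u i * k $$ (i, j)) = av (m $$ (i, j) * (\<pi> powi f j * w j))" by simp
  hence "c powi f i * av (k $$ (i, j)) = av (m $$ (i, j)) * c powi f j"
    using u w ij by (simp add: av_mult av_powi units_on_def)
  also have "\<dots> \<le> 1 * c powi f j"
    using m(1) ij by (intro mult_right_mono) (auto simp: GLO_def bounded_mat_def simp del: GLO_carrier)
  finally have "c powi f i * av (k $$ (i, j)) \<le> c powi f i * c powi (f j - f i)"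
    by (simp flip: powi_add_c)
  thus ?thesis by (simp only: mult_le_cancel_left_pos[OF c_powi_pos])
qed

text \<open>If a diagonal form \<open>D\<close> of type \<open>f = e + 2 l\<close> is moved by \<open>k \<pi>\<^sup>-\<^sup>l\<close> to a form of type \<open>e\<close>, then \<open>k \<pi>\<^sup>-\<^sup>l\<close> lies in the left
  coset of \<open>\<pi>\<^sup>-\<^sup>l\<close>. Indeed, the equality case of the comparison of types lets a parahoric \<open>h\<close> diagonalize the
  result, so that \<open>k\<close> times a conjugate of \<open>h\<close> carries \<open>D\<close> to a diagonal form of the same type. The entries of
  such a matrix are bounded by the differences of \<open>f\<close>, hence, \<open>e\<close> being dominant, by those of \<open>l\<close>.\<close>

lemma coset_rigidity:
  assumes e: "dominant n e" "dominant n l" and u: "units_on n u" "units_on n \<eta>" and k: "k \<in> GLO n"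
    and E: "eqv n (diagpi n (\<lambda>i. e i + 2 * l i) \<eta> \<bullet>\<^sub>X k \<bullet>\<^sub>X dpi n (\<lambda>i. - l i)) (diagpi n e u)"
  shows "dpi n l * k * dpi n (\<lambda>i. - l i) \<in> GLO n"
proof -
  define f where "f = (\<lambda>i. e i + 2 * l i)"
  have kc: "k \<in> carrier_mat n n" using k by simp
  define B where "B = diagpi n f \<eta> \<bullet>\<^sub>X k"
  define A where "A = B \<bullet>\<^sub>X dpi n (\<lambda>i. - l i)"
  have B: "B \<in> carrier_mat n n" "transpose_mat B = B"
    using kc act_sym[OF diagpi_carrier kc diagpi_sym] by (auto simp: B_def)
  have A: "A \<in> carrier_mat n n" "transpose_mat A = A"
    using B act_sym[OF B(1) dpi_carrier B(2)] by (auto simp: A_def)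
  have AB: "A \<bullet>\<^sub>X dpi n l = B"
    unfolding A_def using act_act[OF B(1) dpi_carrier dpi_carrier] by (simp add: dpi_inverse act_one[OF B(1)])
  have f: "dominant n f" using e by (auto simp: dominant_def f_def intro: add_mono)
  have EB: "eqv n (A \<bullet>\<^sub>X dpi n l) (diagpi n f \<eta>)"
    unfolding AB B_def using eqv_sym[OF diagpi_carrier eqv_act[OF k]] .
  have EA: "eqv n A (diagpi n e u)" using E by (simp add: A_def B_def f_def)
  obtain h w where h: "h \<in> parahoric n l" "units_on n w" "A \<bullet>\<^sub>X h = diagpi n e w"
    using simultaneous_reduction[OF A e(1) u(1) EA e(2) f u(2) EB] by (auto simp: f_def)
  have hG: "h \<in> GLO n" using h parahoric_GLO by blast
  have hc: "h \<in> carrier_mat n n" using h by simp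
  define h' where "h' = dpi n (\<lambda>i. - l i) * h * dpi n l"
  have h'G: "h' \<in> GLO n" using h by (simp add: parahoric_def h'_def)
  have h'c: "h' \<in> carrier_mat n n" using h'G by simp
  have "B \<bullet>\<^sub>X h' = diagpi n f w"
    using act_dpi_conj[OF A(1) hc, of l] by (simp add: AB h'_def h(3) diagpi_act_dpi f_def)
  hence kh: "diagpi n f \<eta> \<bullet>\<^sub>X (k * h') = diagpi n f w"
    unfolding B_def using act_act[OF diagpi_carrier kc h'c] by simp
  have khG: "k * h' \<in> GLO n" using k h'G by (rule GLO_mult)
  have "k * h' \<in> parahoric n (\<lambda>i. - l i)"
  proof (subst parahoric_iff[OF khG], intro allI impI)
    fix i j assume ij: "i < n" "j < n"
    have "av ((k * h') $$ (i, j)) \<le> c powi (f j - f i)"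
      using diagpi_transporter_entries[OF khG u(2) h(2) kh ij] .
    moreover have "av ((k * h') $$ (i, j)) \<le> c powi 0"
      using khG ij by (auto simp: GLO_def bounded_mat_def simp del: GLO_carrier)
    moreover have "c powi (f j - f i) \<le> c powi (- l i - - l j) \<or> c powi 0 \<le> c powi (- l i - - l j)"
    proof (cases "l j \<le> l i")
      case True thus ?thesis by (simp only: c_powi_le_iff) simp
    next
      case False
      hence "j \<le> i" using dominant_le[OF e(2) _ ij(2), of i] by (cases "j \<le> i") auto
      hence "e i \<le> e j" using dominant_le[OF e(1) _ ij(1), of j] by simp
      thus ?thesis using False by (simp only: c_powi_le_iff f_def) simp
    qed
    ultimately show "av ((k * h') $$ (i, j)) \<le> c powi (- l i - - l j)" by linarith
  qed
  hence 1: "dpi n l * (k * h') * dpi n (\<lambda>i. - l i) \<in> GLO n" by (simp add: parahoric_def)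
  have "h' * dpi n (\<lambda>i. - l i) = dpi n (\<lambda>i. - l i) * (h * (dpi n l * dpi n (\<lambda>i. - l i)))"
    unfolding h'_def using hc by (simp add: assoc_mult_mat[of _ n n _ n _ n] mult_carrier_mat[of _ n n _ n])
  hence hh: "h' * dpi n (\<lambda>i. - l i) = dpi n (\<lambda>i. - l i) * h" using hc by (simp add: dpi_inverse)
  obtain hi where hi: "hi \<in> GLO n" "h * hi = 1\<^sub>m n" using GLO_inverse[OF hG] by metis
  have hic: "hi \<in> carrier_mat n n" using hi by simp
  have "dpi n l * (k * h') * dpi n (\<lambda>i. - l i) * hi = dpi n l * (k * ((h' * dpi n (\<lambda>i. - l i)) * hi))"
    using kc h'c hic by (simp add: assoc_mult_mat[of _ n n _ n _ n] mult_carrier_mat[of _ n n _ n])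
  also have "\<dots> = dpi n l * (k * (dpi n (\<lambda>i. - l i) * (h * hi)))"
    unfolding hh using kc hc hic by (simp add: assoc_mult_mat[of _ n n _ n _ n] mult_carrier_mat[of _ n n _ n])
  also have "\<dots> = dpi n l * k * dpi n (\<lambda>i. - l i)"
    unfolding hi(2) using kc
    by (simp add: assoc_mult_mat[of _ n n _ n _ n] mult_carrier_mat[of _ n n _ n] right_mult_one_mat[of _ n n])
  finally show ?thesis using GLO_mult[OF 1 hi(1)] by simp
qed

section \<open>Cartan decomposition\<close>

lemma row_to_last:
  assumes "A \<in> carrier_mat (Suc n) (Suc n)" "i < Suc n"
  obtains P where "P \<in> GLO (Suc n)" "\<And>j. j < Suc n \<Longrightarrow> (P * A) $$ (n, j) = A $$ (i, j)"
proof (cases "i = n")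
  case True
  thus ?thesis using that[of "1\<^sub>m (Suc n)"] assms by simp
next
  case False
  let ?h = "swaprows_mat (Suc n) i n :: 'a mat"
  have "?h \<in> GLO (Suc n)"
    using assms False by (auto simp: GLO_def bounded_mat_def det_swaprows_mat simp del: GLO_carrier)
  moreover have "(?h * A) $$ (n, j) = A $$ (i, j)" if "j < Suc n" for j
    using that assms False by (subst swaprows_mat[symmetric, of A "Suc n" "Suc n" i n]) auto
  ultimately show ?thesis using that by blast
qed

lemma clear_last_row:
  assumes A: "A \<in> carrier_mat (Suc n) (Suc n)"
    and nn: "A $$ (n, n) \<noteq> 0" "\<And>j. j < n \<Longrightarrow> av (A $$ (n, j)) \<le> av (A $$ (n, n))"
  obtains h where "h \<in> GLO (Suc n)" "\<And>j. j < n \<Longrightarrow> (A * h) $$ (n, j) = 0"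
    "\<And>i. i < Suc n \<Longrightarrow> (A * h) $$ (i, n) = A $$ (i, n)"
proof -
  define h where "h = mat (Suc n) (Suc n)
    (\<lambda>(i, j). if i = j then 1 else if i = n then - (A $$ (n, j) / A $$ (n, n)) else 0)"
  have hc: "h \<in> carrier_mat (Suc n) (Suc n)" by (simp add: h_def)
  have "det h = prod_list (diag_mat h)"
    by (rule det_lower_triangular[OF _ hc]) (auto simp: h_def)
  also have "diag_mat h = map (\<lambda>_. 1) [0..<Suc n]"
    unfolding diag_mat_def by (intro map_cong) (auto simp: h_def)
  also have "prod_list (map (\<lambda>_. 1) [0..<Suc n]) = (1 :: 'a)"
    by (rule prod_list_ones)
  finally have dh: "det h = 1" .
  have q: "av (A $$ (n, j) / A $$ (n, n)) \<le> 1" if "j < n" for j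
    using nn(2)[OF that] av_pos[OF nn(1)] by (simp add: av_divide)
  have hG: "h \<in> GLO (Suc n)" using hc dh q
    by (auto simp: GLO_def bounded_mat_def h_def simp del: GLO_carrier)
  have Ah: "(A * h) $$ (i, j) = (\<Sum>b<Suc n. A $$ (i, b) * h $$ (b, j))" if "i < Suc n" "j < Suc n" for i j
    using mult_index_sum[OF A hc that] .
  have 1: "(A * h) $$ (n, j) = 0" if "j < n" for j
  proof -
    have "(\<Sum>b<n. A $$ (n, b) * h $$ (b, j)) = (\<Sum>b<n. if b = j then A $$ (n, b) else 0)"
      using that by (intro sum.cong) (auto simp: h_def)
    also have "\<dots> = A $$ (n, j)" using that by simp
    finally show ?thesis using that nn(1) by (subst Ah) (auto simp: h_def)
  qed
  have 2: "(A * h) $$ (i, n) = A $$ (i, n)" if "i < Suc n" for i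
  proof -
    have "(A * h) $$ (i, n) = (\<Sum>b<Suc n. if b = n then A $$ (i, b) else 0)"
      unfolding Ah[OF that lessI] by (intro sum.cong) (auto simp: h_def)
    thus ?thesis by simp
  qed
  show ?thesis using that hG 1 2 by blast
qed

lemma GLO_bounded: "k \<in> GLO n \<Longrightarrow> bounded_mat n 1 k"
  by (simp add: GLO_def del: GLO_carrier)

lemma GLO_det: "k \<in> GLO n \<Longrightarrow> av (det k) = 1"
  by (simp add: GLO_def del: GLO_carrier)

lemma bounded_GLO_mult:
  assumes "A \<in> carrier_mat n n" "bounded_mat n b A" "b \<ge> 0" "k1 \<in> GLO n" "k2 \<in> GLO n"
  shows "bounded_mat n b (k1 * A * k2)"
proof -
  have "bounded_mat n (1 * b) (k1 * A)"
    by (rule bounded_mat_mult[OF GLO_carrier[OF assms(4)] assms(1) GLO_bounded[OF assms(4)] assms(2) _ assms(3)]) simp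
  hence "bounded_mat n (1 * b * 1) (k1 * A * k2)"
    by (rule bounded_mat_mult[OF mult_carrier_mat[OF GLO_carrier[OF assms(4)] assms(1)] GLO_carrier[OF assms(5)] _
          GLO_bounded[OF assms(5)]]) (use assms(3) in simp_all)
  thus ?thesis by simp
qed

lemma two_sided_pivot:
  assumes A: "A \<in> carrier_mat (Suc n) (Suc n)" "det A \<noteq> 0"
  obtains k1 k2 A' a m where "k1 \<in> GLO (Suc n)" "k2 \<in> GLO (Suc n)" "A' \<in> carrier_mat n n"
    "k1 * A * k2 = osum A' a" "av a = c powi m" "bounded_mat (Suc n) (c powi m) (osum A' a)"
proof -
  let ?N = "Suc n"
  obtain m i j where m: "bounded_mat ?N (c powi m) A" "i < ?N" "j < ?N" "av (A $$ (i, j)) = c powi m"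
    by (rule max_entry[OF A])
  obtain P where P: "P \<in> GLO ?N" "\<And>j. j < ?N \<Longrightarrow> (P * A) $$ (n, j) = A $$ (i, j)"
    using row_to_last[OF A(1) m(2)] by blast
  have Pc: "P \<in> carrier_mat ?N ?N" using P by simp
  have PAc: "transpose_mat (P * A) \<in> carrier_mat ?N ?N" using Pc A by simp
  obtain Q where Q: "Q \<in> GLO ?N" "\<And>i. i < ?N \<Longrightarrow> (Q * transpose_mat (P * A)) $$ (n, i) = transpose_mat (P * A) $$ (j, i)"
    using row_to_last[OF PAc m(3)] by blast
  have Qc: "Q \<in> carrier_mat ?N ?N" using Q by simp
  define C where "C = P * A * transpose_mat Q"
  have C: "C \<in> carrier_mat ?N ?N" using Pc Qc A by (simp add: C_def)
  have Ct: "C = transpose_mat (Q * transpose_mat (P * A))"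
    unfolding C_def using Pc Qc A by (subst transpose_mult[of _ ?N ?N _ ?N]) auto
  have "C $$ (n, n) = (Q * transpose_mat (P * A)) $$ (n, n)"
    unfolding Ct using Qc PAc by (subst index_transpose_mat(1)) auto
  also have "\<dots> = A $$ (i, j)" using Q(2)[of n] P(2)[OF m(3)] Pc A m(3) by simp
  finally have Cnn: "av (C $$ (n, n)) = c powi m" using m by simp
  have bC: "bounded_mat ?N (c powi m) C" unfolding C_def
    by (rule bounded_GLO_mult[OF A(1) m(1) c_powi_nonneg P(1) GLO_transpose[OF Q(1)]])
  have C0: "C $$ (n, n) \<noteq> 0" using Cnn c_powi_pos[of m] by auto
  have Cn: "av (C $$ (n, j)) \<le> av (C $$ (n, n))" if "j < n" for j
    using that bC Cnn by (simp add: bounded_mat_def)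
  obtain h where h: "h \<in> GLO ?N" "\<And>j. j < n \<Longrightarrow> (C * h) $$ (n, j) = 0"
    "\<And>i. i < ?N \<Longrightarrow> (C * h) $$ (i, n) = C $$ (i, n)"
    using clear_last_row[OF C C0 Cn] by blast
  have hc: "h \<in> carrier_mat ?N ?N" using h by simp
  define D where "D = transpose_mat (C * h)"
  have D: "D \<in> carrier_mat ?N ?N" using C hc by (simp add: D_def)
  have Di: "D $$ (a, b) = (C * h) $$ (b, a)" if "a < ?N" "b < ?N" for a b
    unfolding D_def using that C hc by (subst index_transpose_mat(1)) auto
  have Dnn: "D $$ (n, n) = C $$ (n, n)" using Di[of n n] h(3)[of n] by simp
  have Dn: "av (D $$ (n, j)) \<le> av (D $$ (n, n))" if "j < n" for j
    using Di[of n j] h(3)[of j] that bC Cnn Dnn by (auto simp: bounded_mat_def)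
  have D0: "D $$ (n, n) \<noteq> 0" using C0 Dnn by simp
  obtain g where g: "g \<in> GLO ?N" "\<And>j. j < n \<Longrightarrow> (D * g) $$ (n, j) = 0"
    "\<And>i. i < ?N \<Longrightarrow> (D * g) $$ (i, n) = D $$ (i, n)"
    using clear_last_row[OF D D0 Dn] by blast
  have gc: "g \<in> carrier_mat ?N ?N" using g by simp
  define F where "F = transpose_mat (D * g)"
  have F: "F \<in> carrier_mat ?N ?N" using D gc by (simp add: F_def)
  have Fi: "F $$ (a, b) = (D * g) $$ (b, a)" if "a < ?N" "b < ?N" for a b
    unfolding F_def using that D gc by (subst index_transpose_mat(1)) auto
  have F0: "F $$ (j, n) = 0" if "j < n" for j using Fi[of j n] g(2) that by simp
  have F0': "F $$ (n, j) = 0" if "j < n" for j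
    using Fi[of n j] g(3)[of j] Di[of j n] h(2)[of j] that by simp
  have Fo: "F = osum (mat n n (\<lambda>ij. F $$ ij)) (F $$ (n, n))"
    using F F0 F0' by (intro osum_of_zero_border) auto
  have FC: "F = (transpose_mat g * P) * A * (transpose_mat Q * h)"
  proof -
    have "F = transpose_mat g * (C * h)"
      unfolding F_def D_def using C hc gc by (subst transpose_mult[of _ ?N ?N _ ?N]) auto
    thus ?thesis unfolding C_def using Pc Qc A hc gc
      by (simp add: assoc_mult_mat[of _ ?N ?N _ ?N _ ?N] mult_carrier_mat[of _ ?N ?N _ ?N])
  qed
  have k1: "transpose_mat g * P \<in> GLO ?N" using g P by (intro GLO_mult GLO_transpose)
  have k2: "transpose_mat Q * h \<in> GLO ?N" using Q h by (intro GLO_mult GLO_transpose)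
  have "F $$ (n, n) = C $$ (n, n)" using Fi[of n n] g(3)[of n] Dnn by simp
  hence an: "av (F $$ (n, n)) = c powi m" using Cnn by simp
  have "bounded_mat ?N (c powi m) F" unfolding FC
    by (rule bounded_GLO_mult[OF A(1) m(1) c_powi_nonneg k1 k2])
  hence "bounded_mat ?N (c powi m) (osum (mat n n (\<lambda>ij. F $$ ij)) (F $$ (n, n)))" using Fo by simp
  moreover have "transpose_mat g * P * A * (transpose_mat Q * h) = osum (mat n n (\<lambda>ij. F $$ ij)) (F $$ (n, n))"
    using Fo unfolding FC[symmetric] .
  ultimately show ?thesis using that[OF k1 k2 mat_carrier _ an] by blast
qed

text \<open>Elementary divisors: a largest entry is moved to the last place, and its row and column are cleared.\<close>

lemma cartan_decomposition:
  assumes "A \<in> carrier_mat n n" "det A \<noteq> 0"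
  shows "\<exists>l k1 k2. dominant n l \<and> k1 \<in> GLO n \<and> k2 \<in> GLO n \<and> k1 * A * k2 = dpi n l"
  using assms
proof (induction n arbitrary: A)
  case 0
  have "1\<^sub>m 0 * A * 1\<^sub>m 0 = dpi 0 (\<lambda>_. 0)" using 0 by (intro eq_matI) (auto simp: dpi_def mat_diag_def)
  moreover have "dominant 0 (\<lambda>_. 0)" by (simp add: dominant_def)
  ultimately show ?case using GLO_one[of 0] by blast
next
  case (Suc n)
  let ?N = "Suc n"
  obtain k1 k2 A' a m where k: "k1 \<in> GLO ?N" "k2 \<in> GLO ?N" "A' \<in> carrier_mat n n"
    "k1 * A * k2 = osum A' a" "av a = c powi m" "bounded_mat ?N (c powi m) (osum A' a)"
    by (rule two_sided_pivot[OF Suc.prems])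
  have kc: "k1 \<in> carrier_mat ?N ?N" "k2 \<in> carrier_mat ?N ?N" using k by auto
  have "det (osum A' a) = det k1 * det A * det k2"
    unfolding k(4)[symmetric] using kc Suc.prems(1)
    by (simp add: det_mult[of _ ?N] mult_carrier_mat[of _ ?N ?N _ ?N])
  hence "det (osum A' a) \<noteq> 0" using Suc.prems(2) GLO_det[OF k(1)] GLO_det[OF k(2)] by auto
  hence A'd: "det A' \<noteq> 0" using k(3) by (simp add: osum_det)
  obtain l q1 q2 where q: "dominant n l" "q1 \<in> GLO n" "q2 \<in> GLO n" "q1 * A' * q2 = dpi n l"
    using Suc.IH[OF k(3) A'd] by blast
  have qc: "q1 \<in> carrier_mat n n" "q2 \<in> carrier_mat n n" using q by auto
  define w where "w = \<pi> powi m / a"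
  have a0: "a \<noteq> 0" using k(5) c_powi_pos[of m] by auto
  have w: "av w = 1" using k(5) by (simp add: w_def av_divide av_powi)
  have "osum q1 1 * osum A' a * osum q2 w = osum (q1 * A' * q2) (1 * a * w)"
    using qc k(3) by (simp add: osum_mult[of _ n] mult_carrier_mat[of _ n n _ n])
  also have "\<dots> = dpi ?N (l(n := m))"
    using a0 by (simp add: q(4) dpi_Suc w_def dpi_cong[of n l "l(n := m)"])
  finally have D: "osum q1 1 * (k1 * A * k2) * osum q2 w = dpi ?N (l(n := m))" unfolding k(4) .
  have "bounded_mat n (c powi m) A'" unfolding bounded_mat_def
  proof (intro allI impI)
    fix i j assume ij: "i < n" "j < n"
    hence "av (osum A' a $$ (i, j)) \<le> c powi m" using k(6) by (simp add: bounded_mat_def)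
    thus "av (A' $$ (i, j)) \<le> c powi m" using ij osum_index[OF k(3)] by simp
  qed
  hence "bounded_mat n (c powi m) (dpi n l)" unfolding q(4)[symmetric]
    by (rule bounded_GLO_mult[OF k(3) _ c_powi_nonneg q(2,3)])
  hence "n > 0 \<Longrightarrow> av (dpi n l $$ (n - 1, n - 1)) \<le> c powi m" by (auto simp: bounded_mat_def)
  hence "n > 0 \<Longrightarrow> m \<le> l (n - 1)" by (simp add: dpi_def mat_diag_def av_powi c_powi_le_iff)
  hence "dominant ?N (l(n := m))"
    using q(1) by (intro dominant_SucI) (auto simp: dominant_def)
  moreover have g: "osum q1 1 \<in> GLO ?N" "osum q2 w \<in> GLO ?N" using q w by (auto intro: osum_GLO)
  moreover have "(osum q1 1 * k1) * A * (k2 * osum q2 w) = dpi ?N (l(n := m))"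
    using D kc Suc.prems(1) GLO_carrier[OF g(1)] GLO_carrier[OF g(2)]
    by (simp add: assoc_mult_mat[of _ ?N ?N _ ?N _ ?N] mult_carrier_mat[of _ ?N ?N _ ?N])
  ultimately show ?case using k(1,2) GLO_mult by blast
qed

section \<open>Open orbits and open cosets\<close>

text \<open>Completing the square changes the last diagonal entry by the square of a unit and the other entries by
  no more than the perturbation.\<close>

lemma diagpi_orbit_open:
  assumes "dominant n e" "units_on n u" "\<And>i. i < n \<Longrightarrow> e i < m"
    "B \<in> carrier_mat n n" "transpose_mat B = B"
    "\<And>i j. i < n \<Longrightarrow> j < n \<Longrightarrow> av (B $$ (i, j) - diagpi n e u $$ (i, j)) \<le> c powi m"
  shows "eqv n B (diagpi n e u)"
  using assms
proof (induction n arbitrary: B)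
  case 0
  have "B = diagpi 0 e u" using 0 by (intro eq_matI) (auto simp: diagpi_def mat_diag_def)
  thus ?case using eqv_refl[of B 0] 0 by simp
next
  case (Suc n)
  note P = Suc.prems
  let ?D = "diagpi (Suc n) e u"
  have Dnn: "?D $$ (n, n) = \<pi> powi e n * u n" "av (?D $$ (n, n)) = c powi e n"
    using P(2) by (simp_all add: diagpi_def mat_diag_def av_mult av_powi units_on_def)
  have lt: "c powi m < c powi e n" using P(3)[of n] by (simp add: c_powi_less_iff)
  have close: "av (B $$ (n, n) - ?D $$ (n, n)) < av (?D $$ (n, n))"
    using P(6)[of n n] lt Dnn by simp
  have "?D $$ (n, n) \<noteq> 0" using Dnn c_powi_pos[of "e n"] by auto
  then obtain w where w: "av w = 1" "B $$ (n, n) = \<pi> powi e n * u n * w\<^sup>2"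
    using scaled_square_close[OF close] Dnn(1) by metis
  have Bnn: "av (B $$ (n, n)) = c powi e n" using av_close_eq[OF close] Dnn by simp
  have Bnj: "av (B $$ (n, j)) \<le> c powi m" if "j < n" for j
    using P(6)[of n j] that by (simp add: diagpi_def mat_diag_def)
  have symB: "B $$ (j, n) = B $$ (n, j)" if "j < n" for j
    using P(4,5) that by (metis carrier_matD index_transpose_mat(1) lessI less_SucI)
  have B0: "B $$ (n, n) \<noteq> 0" using Bnn c_powi_pos[of "e n"] by auto
  have dom: "dominant (Suc n) (\<lambda>_. 0)" by (simp add: dominant_def)
  have Ble: "av (B $$ (n, j)) \<le> av (B $$ (n, n))" if "j < n" for j
    using Bnj[OF that] lt Bnn by simp
  obtain h A' where h: "h \<in> parahoric (Suc n) (\<lambda>_. 0)" "A' \<in> carrier_mat n n"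
    "B \<bullet>\<^sub>X h = osum A' (B $$ (n, n))"
    and A': "\<And>i j. i < n \<Longrightarrow> j < n \<Longrightarrow> A' $$ (i, j) = B $$ (i, j) - B $$ (n, i) * B $$ (n, j) / B $$ (n, n)"
    using act_elimination[OF P(4,5) dom B0 Ble] by blast
  have EB: "eqv (Suc n) B (osum A' (B $$ (n, n)))" using h parahoric_GLO unfolding eqv_def by metis
  have A's: "transpose_mat A' = A'"
  proof -
    have "transpose_mat (osum A' (B $$ (n, n))) = osum A' (B $$ (n, n))" using eqv_symmetric[OF P(4,5) EB] .
    hence "osum (transpose_mat A') (B $$ (n, n)) = osum A' (B $$ (n, n))" using h by (simp add: osum_transpose)
    thus ?thesis using osum_inject(1)[of "transpose_mat A'" n A'] h by auto
  qed
  have "av (A' $$ (i, j) - diagpi n e u $$ (i, j)) \<le> c powi m" if ij: "i < n" "j < n" for i j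
  proof -
    have "av (B $$ (n, i) * B $$ (n, j)) \<le> c powi m * c powi e n"
      unfolding av_mult using Bnj[OF ij(1)] order_trans[OF Bnj[OF ij(2)] less_imp_le[OF lt]]
      by (intro mult_mono) (auto simp: av_nonneg)
    hence 1: "av (B $$ (n, i) * B $$ (n, j) / B $$ (n, n)) \<le> c powi m"
      unfolding av_divide Bnn by (simp add: pos_divide_le_eq)
    have "?D $$ (i, j) = diagpi n e u $$ (i, j)" using ij by (simp add: diagpi_def mat_diag_def)
    hence 2: "av (B $$ (i, j) - diagpi n e u $$ (i, j)) \<le> c powi m" using P(6)[of i j] ij by simp
    have eq: "A' $$ (i, j) - diagpi n e u $$ (i, j)
        = (B $$ (i, j) - diagpi n e u $$ (i, j)) - B $$ (n, i) * B $$ (n, j) / B $$ (n, n)"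
      using A'[OF ij] by simp
    show ?thesis unfolding eq using av_diff_le[OF 2 1] .
  qed
  hence "eqv n A' (diagpi n e u)"
    using Suc.IH[OF dominant_Suc[OF P(1)] _ _ h(2) A's] P(2,3) by (auto simp: units_on_Suc)
  from osum_eqv[OF h(2) this, of "B $$ (n, n)"]
  have 1: "eqv (Suc n) (osum A' (B $$ (n, n))) (osum (diagpi n e u) (\<pi> powi e n * u n * w\<^sup>2))"
    by (simp only: w(2))
  have "eqv (Suc n) ?D (osum (diagpi n e u) (\<pi> powi e n * u n * w\<^sup>2))"
    unfolding diagpi_Suc using w(1) by (intro osum_eqv_square) auto
  hence 2: "eqv (Suc n) (osum (diagpi n e u) (\<pi> powi e n * u n * w\<^sup>2)) ?D" by (rule eqv_sym[OF diagpi_carrier])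
  show ?case by (rule eqv_trans[OF P(4) EB eqv_trans[OF osum_carrier[OF h(2)] 1 2]])
qed

lemma orbit_open:
  assumes A: "A \<in> carrier_mat n n" "transpose_mat A = A" "det A \<noteq> 0"
  obtains m where "\<And>B. B \<in> carrier_mat n n \<Longrightarrow> transpose_mat B = B \<Longrightarrow>
    bounded_mat n (c powi m) (B - A) \<Longrightarrow> eqv n A B"
proof -
  obtain e u where eu: "dominant n e" "units_on n u" "eqv n A (diagpi n e u)"
    using diagonalization[OF A] by blast
  obtain k where k: "k \<in> GLO n" "diagpi n e u = A \<bullet>\<^sub>X k" using eu(3) by (auto simp: eqv_def)
  have kc: "k \<in> carrier_mat n n" using k by simp
  define m where "m = (\<Sum>i<n. \<bar>e i\<bar>) + 1"
  have em: "e i < m" if "i < n" for i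
    using member_le_sum[of i "{..<n}" "\<lambda>i. \<bar>e i\<bar>"] that by (simp add: m_def)
  have "eqv n A B" if B: "B \<in> carrier_mat n n" "transpose_mat B = B" "bounded_mat n (c powi m) (B - A)" for B
  proof -
    have sub: "(B - A) \<bullet>\<^sub>X k = B \<bullet>\<^sub>X k - A \<bullet>\<^sub>X k"
      unfolding act_def using A B kc
      by (simp add: mult_minus_distrib_mat[of _ n n] minus_mult_distrib_mat[of _ n n])
    have "bounded_mat n (c powi m) (B \<bullet>\<^sub>X k - A \<bullet>\<^sub>X k)"
      unfolding sub[symmetric] using A B k by (intro bounded_mat_act) (auto intro: GLO_bounded)
    hence "av ((B \<bullet>\<^sub>X k) $$ (i, j) - diagpi n e u $$ (i, j)) \<le> c powi m" if "i < n" "j < n" for i j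
      using that A B kc act_carrier[OF A(1) kc] unfolding k(2) bounded_mat_def by fastforce
    hence "eqv n (B \<bullet>\<^sub>X k) (diagpi n e u)"
      using diagpi_orbit_open[OF eu(1,2) em, of "B \<bullet>\<^sub>X k"] B kc by (simp add: act_sym)
    hence "eqv n B (diagpi n e u)" using eqv_act[OF k(1)] B(1) eqv_trans by blast
    thus ?thesis using eu(3) A B eqv_sym eqv_trans by blast
  qed
  thus ?thesis using that by blast
qed

lemma av_prod_diff:
  assumes "finite I" "\<And>i. i \<in> I \<Longrightarrow> av (f i) \<le> 1" "\<And>i. i \<in> I \<Longrightarrow> av (g i) \<le> 1"
    "\<And>i. i \<in> I \<Longrightarrow> av (f i - g i) \<le> b" "b \<ge> 0"
  shows "av (prod f I - prod g I) \<le> b"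
  using assms
proof (induction I rule: finite_induct)
  case (insert x I)
  have "prod f (insert x I) - prod g (insert x I) = f x * (prod f I - prod g I) + (f x - g x) * prod g I"
    using insert.hyps by (simp add: algebra_simps)
  moreover have IH: "av (prod f I - prod g I) \<le> b" by (rule insert.IH) (use insert.prems in auto)
  moreover have x: "av (f x) \<le> 1" "av (f x - g x) \<le> b" "b \<ge> 0" using insert.prems by auto
  moreover have "av (f x * (prod f I - prod g I)) \<le> b"
    using IH x mult_mono[of "av (f x)" 1 "av (prod f I - prod g I)" b] by (simp add: av_mult av_nonneg)
  moreover have "av (prod g I) \<le> 1" using insert.prems by (intro prod_le_1_real) auto
  hence "av ((f x - g x) * prod g I) \<le> b"
    using x mult_mono[of "av (f x - g x)" b "av (prod g I)" 1] by (simp add: av_mult av_nonneg)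
  ultimately show ?case by (simp add: av_add_le)
qed simp

text \<open>The determinant of a matrix congruent to the identity is congruent to 1.\<close>

lemma congruence_subgroup_GLO:
  assumes k: "k \<in> carrier_mat n n" "bounded_mat n c (k - 1\<^sub>m n)"
  shows "k \<in> GLO n"
proof -
  have d: "av (k $$ (i, j) - 1\<^sub>m n $$ (i, j)) \<le> c" if "i < n" "j < n" for i j
    using k that by (auto simp: bounded_mat_def)
  have i1: "av (1\<^sub>m n $$ (i, j)) \<le> 1" if "i < n" "j < n" for i j using that by auto
  have b: "av (k $$ (i, j)) \<le> 1" if "i < n" "j < n" for i j
    using av_add_le[of "k $$ (i, j) - 1\<^sub>m n $$ (i, j)" 1 "1\<^sub>m n $$ (i, j)"] d[OF that] i1[OF that] c_less_1 by simp
  have "av (det k - det (1\<^sub>m n)) \<le> c"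
    unfolding det_def'[OF k(1)] det_def'[OF one_carrier_mat] sum_subtractf[symmetric]
  proof (intro av_sum_le)
    fix q assume "q \<in> {q. q permutes {0..<n}}"
    hence q: "q i < n" if "i < n" for i using that permutes_in_image[of q "{0..<n}" i] by auto
    have "av ((\<Prod>i = 0..<n. k $$ (i, q i)) - (\<Prod>i = 0..<n. 1\<^sub>m n $$ (i, q i))) \<le> c"
      using q d b i1 c_pos by (intro av_prod_diff) auto
    thus "av (signof q * (\<Prod>i = 0..<n. k $$ (i, q i)) - signof q * (\<Prod>i = 0..<n. 1\<^sub>m n $$ (i, q i))) \<le> c"
      unfolding right_diff_distrib[symmetric] by (simp add: av_mult sign_def)
  qed (use c_pos in simp)
  hence "av (det k - 1) < av 1" using c_less_1 by simp
  hence "av (det k) = 1" using av_close_eq[of "det k" 1] by simp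
  thus ?thesis using k b by (auto simp: GLO_def bounded_mat_def simp del: GLO_carrier)
qed

lemma mat_inverse:
  assumes "g \<in> carrier_mat n n" "det (g :: 'a mat) \<noteq> 0"
  obtains h where "h \<in> carrier_mat n n" "g * h = 1\<^sub>m n" "h * g = 1\<^sub>m n"
proof -
  have "inverse (det g) \<cdot>\<^sub>m adj_mat g \<in> carrier_mat n n" using adj_mat(1)[OF assms(1)] by simp
  moreover have "g * (inverse (det g) \<cdot>\<^sub>m adj_mat g) = 1\<^sub>m n" "(inverse (det g) \<cdot>\<^sub>m adj_mat g) * g = 1\<^sub>m n"
    using adj_mat[OF assms(1)] assms
    by (auto simp: mult_smult_distrib mult_smult_assoc_mat[of _ n n])
  ultimately show ?thesis using that by blast
qed

lemma bounded_mat_exists: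
  obtains m where "bounded_mat n (c powi (- m)) A" "m \<ge> 0"
proof -
  define b where "b = (\<Sum>i<n. \<Sum>j<n. av (A $$ (i, j)))"
  obtain N where N: "(inverse c) ^ N > b" using real_arch_pow[of "inverse c" b] c_pos c_less_1
    by (auto simp: one_less_inverse_iff)
  have "av (A $$ (i, j)) \<le> b" if "i < n" "j < n" for i j
  proof -
    have "av (A $$ (i, j)) \<le> (\<Sum>j<n. av (A $$ (i, j)))"
      using that by (intro member_le_sum) (auto simp: av_nonneg)
    also have "\<dots> \<le> b" unfolding b_def using that
      by (intro member_le_sum[of i "{..<n}" "\<lambda>i. \<Sum>j<n. av (A $$ (i, j))"]) (auto simp: av_nonneg sum_nonneg)
    finally show ?thesis .
  qed
  moreover have "c powi (- int N) = (inverse c) ^ N" by (simp add: power_int_minus power_inverse)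
  ultimately have "bounded_mat n (c powi (- int N)) A" using N by (fastforce simp: bounded_mat_def)
  thus ?thesis using that[of "int N"] by simp
qed

lemma coset_open:
  assumes g: "g \<in> carrier_mat n n" "det g \<noteq> 0"
  obtains m where "\<And>h. h \<in> carrier_mat n n \<Longrightarrow> bounded_mat n (c powi m) (h - g) \<Longrightarrow> \<exists>k\<in>GLO n. h = g * k"
proof -
  obtain gi where gi: "gi \<in> carrier_mat n n" "g * gi = 1\<^sub>m n" "gi * g = 1\<^sub>m n" using mat_inverse[OF g] by blast
  obtain M where M: "bounded_mat n (c powi (- M)) gi" using bounded_mat_exists by blast
  have "\<exists>k\<in>GLO n. h = g * k" if h: "h \<in> carrier_mat n n" "bounded_mat n (c powi (M + 1)) (h - g)" for h
  proof -
    have "bounded_mat n (c powi (- M) * c powi (M + 1)) (gi * (h - g))"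
      using g gi h M by (intro bounded_mat_mult[of _ n]) auto
    moreover have "gi * (h - g) = gi * h - 1\<^sub>m n"
      using g gi h by (simp add: mult_minus_distrib_mat[of _ n n])
    moreover have "c powi (- M) * c powi (M + 1) = c" by (simp flip: powi_add_c)
    ultimately have "gi * h \<in> GLO n" using gi h by (intro congruence_subgroup_GLO) auto
    moreover have "h = g * (gi * h)" using g gi h by (simp flip: assoc_mult_mat[of _ n n _ n _ n])
    ultimately show ?thesis by blast
  qed
  thus ?thesis using that by blast
qed

end

section \<open>Hecke algebras and Hecke modules of abstract groups\<close>

text \<open>Finiteness of the double cosets modulo \<open>K\<close> is the only trace of a topology on \<open>G\<close> in which
  \<open>K\<close> is compact and open.\<close>

locale hecke_pair = group G for G (structure) +
  fixes K :: "'a set"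
  assumes subK: "subgroup K G"
    and fin_double: "g \<in> carrier G \<Longrightarrow> finite ((\<lambda>k. (k \<otimes> g) <# K) ` K)"
begin

lemma K_carrier [simp]: "k \<in> K \<Longrightarrow> k \<in> carrier G"
  using subgroup.subset[OF subK] by blast

lemma K_one [simp]: "\<one> \<in> K" using subgroup.one_closed[OF subK] .

lemma K_mult [simp]: "k \<in> K \<Longrightarrow> l \<in> K \<Longrightarrow> k \<otimes> l \<in> K"
  using subgroup.m_closed[OF subK] .

lemma K_inv [simp]: "k \<in> K \<Longrightarrow> inv k \<in> K"
  using subgroup.m_inv_closed[OF subK] .

definition lcs :: "'a set set" where "lcs = (\<lambda>g. g <# K) ` carrier G"

lemma mem_lcos: "x \<in> g <# K \<longleftrightarrow> (\<exists>k\<in>K. x = g \<otimes> k)"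
  by (auto simp: l_coset_def)

lemma lcos_eq_iff:
  assumes "g \<in> carrier G" "h \<in> carrier G"
  shows "g <# K = h <# K \<longleftrightarrow> (\<exists>k\<in>K. h = g \<otimes> k)"
proof
  assume "g <# K = h <# K"
  moreover have "h \<in> h <# K" using assms unfolding mem_lcos by (intro bexI[of _ \<one>]) auto
  ultimately show "\<exists>k\<in>K. h = g \<otimes> k" using mem_lcos by blast
next
  assume "\<exists>k\<in>K. h = g \<otimes> k"
  then obtain k where k: "k \<in> K" "h = g \<otimes> k" by blast
  have "x \<in> g <# K \<longleftrightarrow> x \<in> h <# K" for x
  proof
    assume "x \<in> g <# K"
    then obtain l where l: "l \<in> K" "x = g \<otimes> l" unfolding mem_lcos by blast
    have "h \<otimes> (inv k \<otimes> l) = g \<otimes> (k \<otimes> (inv k \<otimes> l))"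
      using assms k l by (simp add: m_assoc)
    moreover have "k \<otimes> (inv k \<otimes> l) = l" using k l by (simp flip: m_assoc)
    ultimately have "x = h \<otimes> (inv k \<otimes> l)" using assms k l by simp
    thus "x \<in> h <# K" unfolding mem_lcos using k l by (intro bexI[of _ "inv k \<otimes> l"]) auto
  next
    assume "x \<in> h <# K"
    then obtain l where l: "l \<in> K" "x = h \<otimes> l" unfolding mem_lcos by blast
    thus "x \<in> g <# K" unfolding mem_lcos using assms k by (intro bexI[of _ "k \<otimes> l"]) (auto simp: m_assoc)
  qed
  thus "g <# K = h <# K" by blast
qed

definition rep :: "'a set \<Rightarrow> 'a" where "rep C = (SOME g. g \<in> C)"

lemma rep_lcos:
  assumes "g \<in> carrier G"
  obtains k where "k \<in> K" "rep (g <# K) = g \<otimes> k"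
proof -
  have "g \<in> g <# K" using assms unfolding mem_lcos by (intro bexI[of _ \<one>]) auto
  hence "rep (g <# K) \<in> g <# K" unfolding rep_def by (rule someI)
  thus ?thesis using that unfolding mem_lcos by blast
qed

lemma rep_carrier: "C \<in> lcs \<Longrightarrow> rep C \<in> carrier G"
proof -
  assume "C \<in> lcs"
  then obtain g where g: "g \<in> carrier G" "C = g <# K" by (auto simp: lcs_def)
  obtain k where "k \<in> K" "rep C = g \<otimes> k" using rep_lcos[OF g(1)] g(2) by blast
  thus ?thesis using g by simp
qed

lemma rep_lcs: "C \<in> lcs \<Longrightarrow> rep C <# K = C"
proof -
  assume "C \<in> lcs"
  then obtain g where g: "g \<in> carrier G" "C = g <# K" by (auto simp: lcs_def)
  obtain k where k: "k \<in> K" "rep C = g \<otimes> k" using rep_lcos[OF g(1)] g(2) by blast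
  hence "g <# K = rep C <# K" using lcos_eq_iff[of g "g \<otimes> k"] g(1) by auto
  thus ?thesis using g(2) by simp
qed

text \<open>Functions on \<open>G/K\<close>, given as right \<open>K\<close>-invariant functions on \<open>G\<close>.\<close>

definition rinv :: "('a \<Rightarrow> 'c) \<Rightarrow> bool" where
  "rinv \<phi> \<longleftrightarrow> (\<forall>g\<in>carrier G. \<forall>k\<in>K. \<phi> (g \<otimes> k) = \<phi> g)"

definition csupp :: "('a \<Rightarrow> 'c::zero) \<Rightarrow> 'a set set" where
  "csupp \<phi> = (\<lambda>g. g <# K) ` {g \<in> carrier G. \<phi> g \<noteq> 0}"

text \<open>The coset sum that enters the Hecke algebra of matrices, for an abstract group.\<close>

definition csum :: "('a \<Rightarrow> 'c::comm_monoid_add) \<Rightarrow> 'c" where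
  "csum \<phi> = Sum_any (\<lambda>C. if C \<in> lcs then \<phi> (SOME g. g \<in> C) else 0)"

lemma rinv_rep:
  assumes "rinv \<phi>" "g \<in> carrier G" shows "\<phi> (rep (g <# K)) = \<phi> g"
proof -
  obtain k where "k \<in> K" "rep (g <# K) = g \<otimes> k" using rep_lcos[OF assms(2)] by blast
  thus ?thesis using assms by (simp add: rinv_def)
qed

lemma csupp_lcs: "csupp \<phi> \<subseteq> lcs" by (auto simp: csupp_def lcs_def)

lemma csum_eq_sum:
  assumes "rinv \<phi>" "finite F" "csupp \<phi> \<subseteq> F" "F \<subseteq> lcs"
  shows "csum \<phi> = (\<Sum>C\<in>F. \<phi> (rep C))"
proof -
  have "csum \<phi> = (\<Sum>C\<in>F. if C \<in> lcs then \<phi> (SOME g. g \<in> C) else 0)"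
    unfolding csum_def
  proof (rule Sum_any.expand_superset[OF assms(2)])
    show "{C. (if C \<in> lcs then \<phi> (SOME g. g \<in> C) else 0) \<noteq> 0} \<subseteq> F"
    proof
      fix C assume "C \<in> {C. (if C \<in> lcs then \<phi> (SOME g. g \<in> C) else 0) \<noteq> 0}"
      hence C: "C \<in> lcs" "\<phi> (rep C) \<noteq> 0" by (auto simp: rep_def split: if_splits)
      hence "rep C <# K \<in> csupp \<phi>" using rep_carrier unfolding csupp_def by blast
      thus "C \<in> F" using rep_lcs[OF C(1)] assms(3) by auto
    qed
  qed
  also have "\<dots> = (\<Sum>C\<in>F. \<phi> (rep C))" using assms(4) by (intro sum.cong) (auto simp: rep_def)
  finally show ?thesis .
qed

lemma csum_cong:
  assumes "\<And>g. g \<in> carrier G \<Longrightarrow> \<phi> g = \<psi> g" shows "csum \<phi> = csum \<psi>"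
proof -
  have "(\<lambda>C. if C \<in> lcs then \<phi> (SOME g. g \<in> C) else 0) = (\<lambda>C. if C \<in> lcs then \<psi> (SOME g. g \<in> C) else 0)"
    using rep_carrier assms by (auto simp: rep_def)
  thus ?thesis unfolding csum_def by (rule arg_cong)
qed

lemma csum_add:
  assumes "rinv \<phi>" "rinv \<psi>" "finite (csupp \<phi>)" "finite (csupp \<psi>)"
  shows "csum (\<lambda>g. \<phi> g + \<psi> g) = csum \<phi> + csum \<psi>"
proof -
  let ?F = "csupp \<phi> \<union> csupp \<psi>"
  have "csupp (\<lambda>g. \<phi> g + \<psi> g) \<subseteq> ?F" unfolding csupp_def by auto
  moreover have "rinv (\<lambda>g. \<phi> g + \<psi> g)" using assms by (simp add: rinv_def)
  ultimately show ?thesis using assms csupp_lcs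
    by (subst (1 2 3) csum_eq_sum[where F = ?F]) (auto simp: sum.distrib)
qed

lemma csum_mult_right:
  fixes \<phi> :: "'a \<Rightarrow> 'c::comm_ring_1"
  assumes "rinv \<phi>" "finite (csupp \<phi>)"
  shows "csum (\<lambda>g. \<phi> g * x) = csum \<phi> * x"
proof -
  have "csupp (\<lambda>g. \<phi> g * x) \<subseteq> csupp \<phi>" unfolding csupp_def by auto
  moreover have "rinv (\<lambda>g. \<phi> g * x)" using assms by (simp add: rinv_def)
  ultimately show ?thesis using assms csupp_lcs
    by (subst (1 2) csum_eq_sum[where F = "csupp \<phi>"]) (auto simp: sum_distrib_right)
qed

lemma csum_mult_left:
  fixes \<phi> :: "'a \<Rightarrow> 'c::comm_ring_1"
  assumes "rinv \<phi>" "finite (csupp \<phi>)"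
  shows "csum (\<lambda>g. x * \<phi> g) = x * csum \<phi>"
  using csum_mult_right[OF assms, of x] by (simp add: mult.commute)

lemma lcos_translate:
  assumes "h \<in> carrier G" "g \<in> carrier G"
  shows "(h \<otimes> g) <# K = h <# (g <# K)"
  using assms by (simp add: lcos_m_assoc subgroup.subset[OF subK])

lemma lcos_inv_cancel:
  assumes "h \<in> carrier G" "C \<in> lcs" shows "h <# (inv h <# C) = C"
proof -
  obtain g where "g \<in> carrier G" "C = g <# K" using assms by (auto simp: lcs_def)
  thus ?thesis using assms by (simp flip: lcos_translate m_assoc)
qed

text \<open>Left translation permutes the left cosets.\<close>

lemma csum_translate:
  assumes "rinv \<phi>" "finite (csupp \<phi>)" and h: "h \<in> carrier G"
  shows "csum (\<lambda>g. \<phi> (h \<otimes> g)) = csum \<phi>"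
proof -
  let ?F = "csupp \<phi>"
  let ?t = "\<lambda>C. inv h <# C"
  have i: "rinv (\<lambda>g. \<phi> (h \<otimes> g))" using assms by (simp add: rinv_def flip: m_assoc)
  have s: "csupp (\<lambda>g. \<phi> (h \<otimes> g)) \<subseteq> ?t ` ?F"
  proof
    fix C assume "C \<in> csupp (\<lambda>g. \<phi> (h \<otimes> g))"
    then obtain g where g: "g \<in> carrier G" "\<phi> (h \<otimes> g) \<noteq> 0" "C = g <# K" by (auto simp: csupp_def)
    have "C = ?t ((h \<otimes> g) <# K)" using g h by (simp flip: lcos_translate m_assoc)
    moreover have "(h \<otimes> g) <# K \<in> ?F" using g h by (auto simp: csupp_def)
    ultimately show "C \<in> ?t ` ?F" by blast
  qed
  have l: "?t C \<in> lcs" if "C \<in> lcs" for C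
    using that h by (auto simp: lcs_def simp flip: lcos_translate)
  have "csum (\<lambda>g. \<phi> (h \<otimes> g)) = (\<Sum>C\<in>?t ` ?F. \<phi> (h \<otimes> rep C))"
    using i s assms l[OF subsetD[OF csupp_lcs]] by (intro csum_eq_sum) auto
  also have "\<dots> = (\<Sum>C\<in>?F. \<phi> (h \<otimes> rep (?t C)))"
  proof (rule sum.reindex_cong[OF _ refl refl, of ?t ?F])
    show "inj_on ?t ?F"
    proof (rule inj_onI)
      fix C D assume CD: "C \<in> ?F" "D \<in> ?F" "?t C = ?t D"
      have "C \<in> lcs" "D \<in> lcs" using CD csupp_lcs by blast+
      thus "C = D" using CD(3) lcos_inv_cancel[OF h] by metis
    qed
  qed
  also have "\<dots> = (\<Sum>C\<in>?F. \<phi> (rep C))"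
  proof (rule sum.cong[OF refl])
    fix C assume "C \<in> ?F"
    then obtain g where g: "g \<in> carrier G" "C = g <# K" by (auto simp: csupp_def)
    have "\<phi> (h \<otimes> rep (?t C)) = \<phi> (h \<otimes> (inv h \<otimes> g))"
      using rinv_rep[OF i, of "inv h \<otimes> g"] g h by (simp add: lcos_translate)
    also have "\<dots> = \<phi> g" using g h by (simp flip: m_assoc)
    finally show "\<phi> (h \<otimes> rep (?t C)) = \<phi> (rep C)" using rinv_rep[OF assms(1) g(1)] g(2) by simp
  qed
  also have "\<dots> = csum \<phi>" using assms csupp_lcs by (intro csum_eq_sum[symmetric]) auto
  finally show ?thesis .
qed

lemma csum_single:
  assumes "rinv \<phi>" "g \<in> carrier G" "\<And>h. h \<in> carrier G \<Longrightarrow> \<phi> h \<noteq> 0 \<Longrightarrow> \<exists>k\<in>K. h = g \<otimes> k"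
  shows "csum \<phi> = \<phi> g"
proof -
  have "csupp \<phi> \<subseteq> {g <# K}"
    using assms(2,3) lcos_eq_iff by (fastforce simp: csupp_def)
  hence "csum \<phi> = (\<Sum>C\<in>{g <# K}. \<phi> (rep C))"
    using assms by (intro csum_eq_sum) (auto simp: lcs_def)
  thus ?thesis using rinv_rep[OF assms(1,2)] by simp
qed

lemma csum_swap:
  assumes "finite A" "finite B" "A \<subseteq> lcs" "B \<subseteq> lcs"
    and i1: "\<And>h. h \<in> carrier G \<Longrightarrow> rinv (\<lambda>g. \<Phi> g h)" and i2: "\<And>g. g \<in> carrier G \<Longrightarrow> rinv (\<lambda>h. \<Phi> g h)"
    and s: "\<And>g h. g \<in> carrier G \<Longrightarrow> h \<in> carrier G \<Longrightarrow> \<Phi> g h \<noteq> 0 \<Longrightarrow> g <# K \<in> A \<and> h <# K \<in> B"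
  shows "csum (\<lambda>g. csum (\<lambda>h. \<Phi> g h)) = csum (\<lambda>h. csum (\<lambda>g. \<Phi> g h))"
proof -
  have e1: "csum (\<lambda>h. \<Phi> g h) = (\<Sum>D\<in>B. \<Phi> g (rep D))" if "g \<in> carrier G" for g
    using assms that by (intro csum_eq_sum) (auto simp: csupp_def)
  have e2: "csum (\<lambda>g. \<Phi> g h) = (\<Sum>C\<in>A. \<Phi> (rep C) h)" if "h \<in> carrier G" for h
    using assms that by (intro csum_eq_sum) (auto simp: csupp_def)
  have rB: "rep D \<in> carrier G" if "D \<in> B" for D using that assms(4) rep_carrier by blast
  have rA: "rep D \<in> carrier G" if "D \<in> A" for D using that assms(3) rep_carrier by blast
  have "csum (\<lambda>g. csum (\<lambda>h. \<Phi> g h)) = csum (\<lambda>g. \<Sum>D\<in>B. \<Phi> g (rep D))"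
    by (rule csum_cong) (rule e1)
  also have "\<dots> = (\<Sum>C\<in>A. \<Sum>D\<in>B. \<Phi> (rep C) (rep D))"
  proof (intro csum_eq_sum assms)
    show "rinv (\<lambda>g. \<Sum>D\<in>B. \<Phi> g (rep D))"
      using i1 rB by (auto simp: rinv_def intro!: sum.cong)
    show "csupp (\<lambda>g. \<Sum>D\<in>B. \<Phi> g (rep D)) \<subseteq> A"
    proof
      fix C assume "C \<in> csupp (\<lambda>g. \<Sum>D\<in>B. \<Phi> g (rep D))"
      then obtain g where g: "g \<in> carrier G" "C = g <# K" "(\<Sum>D\<in>B. \<Phi> g (rep D)) \<noteq> 0" by (auto simp: csupp_def)
      then obtain D where "D \<in> B" "\<Phi> g (rep D) \<noteq> 0" by (meson sum.not_neutral_contains_not_neutral)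
      thus "C \<in> A" using s[of g "rep D"] g rB by auto
    qed
  qed
  also have "\<dots> = (\<Sum>D\<in>B. \<Sum>C\<in>A. \<Phi> (rep C) (rep D))" by (rule sum.swap)
  also have "\<dots> = csum (\<lambda>h. \<Sum>C\<in>A. \<Phi> (rep C) h)"
  proof (intro csum_eq_sum[symmetric] assms)
    show "rinv (\<lambda>h. \<Sum>C\<in>A. \<Phi> (rep C) h)"
      using i2 rA by (auto simp: rinv_def intro!: sum.cong)
    show "csupp (\<lambda>h. \<Sum>C\<in>A. \<Phi> (rep C) h) \<subseteq> B"
    proof
      fix C assume "C \<in> csupp (\<lambda>h. \<Sum>C\<in>A. \<Phi> (rep C) h)"
      then obtain h where h: "h \<in> carrier G" "C = h <# K" "(\<Sum>C\<in>A. \<Phi> (rep C) h) \<noteq> 0" by (auto simp: csupp_def)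
      then obtain D where "D \<in> A" "\<Phi> (rep D) h \<noteq> 0" by (meson sum.not_neutral_contains_not_neutral)
      thus "C \<in> B" using s[of "rep D" h] h rA by auto
    qed
  qed
  also have "\<dots> = csum (\<lambda>h. csum (\<lambda>g. \<Phi> g h))"
    by (rule csum_cong) (simp add: e2)
  finally show ?thesis .
qed

text \<open>The Hecke algebra, with finiteness of the support modulo \<open>K\<close> in place of compactness.\<close>

definition hecke :: "('a \<Rightarrow> 'c::comm_ring_1) set" where
  "hecke = {T. (\<forall>g. g \<notin> carrier G \<longrightarrow> T g = 0) \<and>
    (\<forall>g\<in>carrier G. \<forall>k\<in>K. \<forall>k'\<in>K. T (k \<otimes> g \<otimes> k') = T g) \<and> finite (csupp T)}"

lemma hecke_rinv: "T \<in> hecke \<Longrightarrow> rinv T"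
proof -
  assume T: "T \<in> hecke"
  have "T (g \<otimes> k) = T g" if "g \<in> carrier G" "k \<in> K" for g k
  proof -
    have "T (\<one> \<otimes> g \<otimes> k) = T g" using T that K_one unfolding hecke_def by blast
    thus ?thesis using that by simp
  qed
  thus ?thesis by (simp add: rinv_def)
qed

lemma hecke_linv:
  assumes T: "T \<in> hecke" and "g \<in> carrier G" "k \<in> K"
  shows "T (k \<otimes> g) = T g"
proof -
  have "T (k \<otimes> g \<otimes> \<one>) = T g" using assms K_one unfolding hecke_def by blast
  thus ?thesis using assms by simp
qed

lemma hecke_finite: "T \<in> hecke \<Longrightarrow> finite (csupp T)"
  by (simp add: hecke_def)

lemma heckeI:
  assumes "\<And>g. g \<notin> carrier G \<Longrightarrow> T g = 0"
    "\<And>g k. g \<in> carrier G \<Longrightarrow> k \<in> K \<Longrightarrow> T (g \<otimes> k) = T g"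
    "\<And>g k. g \<in> carrier G \<Longrightarrow> k \<in> K \<Longrightarrow> T (k \<otimes> g) = T g" "finite (csupp T)"
  shows "T \<in> hecke"
proof -
  have "T (k \<otimes> g \<otimes> k') = T g" if "g \<in> carrier G" "k \<in> K" "k' \<in> K" for g k k'
    using assms(2)[of "k \<otimes> g" k'] assms(3)[of g k] that by simp
  thus ?thesis unfolding hecke_def using assms(1,4) by simp
qed

end

text \<open>Functions on a right \<open>G\<close>-set. As for \<open>G\<close>, a support that is finite modulo \<open>K\<close> stands for a
  compact one.\<close>

locale hecke_space = hecke_pair G K for G (structure) and K :: "'a set" +
  fixes X :: "'x set" and ac :: "'x \<Rightarrow> 'a \<Rightarrow> 'x"
  assumes ac_closed [simp]: "x \<in> X \<Longrightarrow> g \<in> carrier G \<Longrightarrow> ac x g \<in> X"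
    and ac_mult: "x \<in> X \<Longrightarrow> g \<in> carrier G \<Longrightarrow> h \<in> carrier G \<Longrightarrow> ac (ac x g) h = ac x (g \<otimes> h)"
    and ac_one: "x \<in> X \<Longrightarrow> ac x \<one> = x"
begin

definition orb :: "'x \<Rightarrow> 'x set" where "orb x = ac x ` K"

lemma orb_eq:
  assumes "x \<in> X" "k \<in> K" shows "orb (ac x k) = orb x"
proof -
  have "orb (ac x k) \<subseteq> orb x"
    using assms by (auto simp: orb_def ac_mult)
  moreover have eq: "ac x l = ac (ac x k) (inv k \<otimes> l)" if "l \<in> K" for l
    using assms that by (simp add: ac_mult m_assoc[symmetric])
  have "ac x l \<in> orb (ac x k)" if "l \<in> K" for l
    unfolding orb_def by (rule image_eqI[where x = "inv k \<otimes> l"], rule eq[OF that]) (use assms that in simp)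
  hence "orb x \<subseteq> orb (ac x k)" unfolding orb_def[of x] by blast
  ultimately show ?thesis by blast
qed

lemma orb_self: "x \<in> X \<Longrightarrow> x \<in> orb x"
  unfolding orb_def by (rule image_eqI[of _ _ \<one>]) (simp_all add: ac_one)

lemma orb_mem: "x \<in> X \<Longrightarrow> y \<in> orb x \<Longrightarrow> orb y = orb x"
proof -
  assume x: "x \<in> X" and "y \<in> orb x"
  then obtain k where "k \<in> K" "y = ac x k" by (auto simp: orb_def)
  thus ?thesis using orb_eq[OF x] by simp
qed

definition osupp :: "('x \<Rightarrow> 'c::zero) \<Rightarrow> 'x set set" where
  "osupp f = orb ` {x \<in> X. f x \<noteq> 0}"

definition schwartz :: "('x \<Rightarrow> 'c::comm_ring_1) set" where
  "schwartz = {f. (\<forall>x. x \<notin> X \<longrightarrow> f x = 0) \<and> (\<forall>x\<in>X. \<forall>k\<in>K. f (ac x k) = f x) \<and> finite (osupp f)}"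

definition hact :: "('a \<Rightarrow> 'c::comm_ring_1) \<Rightarrow> ('x \<Rightarrow> 'c) \<Rightarrow> 'x \<Rightarrow> 'c" where
  "hact T f x = (if x \<in> X then csum (\<lambda>g. T g * f (ac x g)) else 0)"

lemma rinv_integrand:
  assumes "T \<in> hecke" "f \<in> schwartz" "x \<in> X"
  shows "rinv (\<lambda>g. T g * f (ac x g))"
proof -
  have "f (ac x (g \<otimes> k)) = f (ac x g)" if "g \<in> carrier G" "k \<in> K" for g k
    using assms that by (auto simp: schwartz_def ac_mult[symmetric])
  thus ?thesis using hecke_rinv[OF assms(1)] by (simp add: rinv_def)
qed

lemma finite_integrand:
  assumes "T \<in> hecke" shows "finite (csupp (\<lambda>g. T g * \<phi> g))"
  by (rule finite_subset[OF _ hecke_finite[OF assms]]) (auto simp: csupp_def)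

text \<open>Invariance is the invariance of coset sums under left translation. If \<open>hact T f x\<close> does not vanish, then \<open>x\<close> is
  moved into the support of \<open>f\<close> by some \<open>g\<close> in the support of \<open>T\<close>; so the orbit of \<open>x\<close> is the image of a left
  coset in one of finitely many double cosets of elements \<open>inv g\<close>.\<close>

lemma hact_closed:
  assumes T: "T \<in> hecke" and f: "f \<in> schwartz"
  shows "hact T f \<in> schwartz"
proof -
  have "hact T f (ac x k) = hact T f x" if x: "x \<in> X" "k \<in> K" for x k
  proof -
    have "csum (\<lambda>g. T g * f (ac (ac x k) g)) = csum (\<lambda>g. T (k \<otimes> g) * f (ac x (k \<otimes> g)))"
      using x hecke_linv[OF T] by (intro csum_cong) (simp add: ac_mult)
    also have "\<dots> = csum (\<lambda>g. T g * f (ac x g))"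
      using csum_translate[OF rinv_integrand[OF T f x(1)] finite_integrand[OF T], of k] x by simp
    finally show ?thesis using x by (simp add: hact_def)
  qed
  moreover have "finite (osupp (hact T f))"
  proof -
    define S where "S = (\<Union>C\<in>csupp T. \<Union>Q\<in>osupp f. (\<lambda>D. ac (SOME y. y \<in> Q) ` D) ` ((\<lambda>k. (k \<otimes> inv (rep C)) <# K) ` K))"
    have fo: "finite (osupp f)" using f by (simp add: schwartz_def)
    have "finite ((\<lambda>k. (k \<otimes> inv (rep C)) <# K) ` K)" if "C \<in> csupp T" for C
      using that csupp_lcs rep_carrier by (intro fin_double inv_closed) blast
    hence "finite S" unfolding S_def
      by (rule_tac finite_UN_I[OF hecke_finite[OF T]], rule_tac finite_UN_I[OF fo], rule_tac finite_imageI) blast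
    moreover have "osupp (hact T f) \<subseteq> S"
    proof
      fix Q assume "Q \<in> osupp (hact T f)"
      then obtain x where x: "x \<in> X" "hact T f x \<noteq> 0" "Q = orb x" by (auto simp: osupp_def)
      hence ne: "csum (\<lambda>g. T g * f (ac x g)) \<noteq> 0" by (simp add: hact_def)
      have eq: "csum (\<lambda>g. T g * f (ac x g)) = (\<Sum>C\<in>csupp T. T (rep C) * f (ac x (rep C)))"
        using hecke_finite[OF T] csupp_lcs
        by (intro csum_eq_sum rinv_integrand[OF T f x(1)]) (auto simp: csupp_def)
      obtain C where C: "C \<in> csupp T" "T (rep C) * f (ac x (rep C)) \<noteq> 0"
        by (rule sum.not_neutral_contains_not_neutral[OF ne[unfolded eq]])
      define g where "g = rep C"
      have g: "g \<in> carrier G" using C csupp_lcs rep_carrier by (auto simp: g_def)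
      define y where "y = ac x g"
      have y: "y \<in> X" "f y \<noteq> 0" using C x g by (auto simp: y_def g_def)
      define z where "z = (SOME z. z \<in> orb y)"
      have "z \<in> orb y" unfolding z_def using orb_self[OF y(1)] by (rule someI)
      then obtain k where k: "k \<in> K" "z = ac y k" by (auto simp: orb_def)
      have zX: "z \<in> X" using k y by simp
      have yz: "ac z (inv k) = y" using k y by (simp add: ac_mult ac_one)
      have "x = ac y (inv g)" using x g by (simp add: y_def ac_mult ac_one)
      also have "\<dots> = ac (ac z (inv k)) (inv g)" by (simp only: yz)
      also have "\<dots> = ac z (inv k \<otimes> inv g)" using k g by (intro ac_mult[OF zX]) auto
      finally have xz: "x = ac z (inv k \<otimes> inv g)" .
      have "orb x = (\<lambda>k'. ac z ((inv k \<otimes> inv g) \<otimes> k')) ` K"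
        unfolding orb_def xz using k g by (intro image_cong refl ac_mult[OF zX]) auto
      also have "\<dots> = ac z ` ((inv k \<otimes> inv g) <# K)" by (auto simp: l_coset_def)
      finally have 1: "orb x = ac (SOME z. z \<in> orb y) ` ((inv k \<otimes> inv (rep C)) <# K)"
        by (simp only: z_def g_def)
      have 2: "orb y \<in> osupp f" using y by (auto simp: osupp_def)
      have 3: "(inv k \<otimes> inv (rep C)) <# K \<in> (\<lambda>k. (k \<otimes> inv (rep C)) <# K) ` K"
        using K_inv[OF k(1)] by (rule imageI)
      show "Q \<in> S" unfolding S_def x(3)
        by (rule UN_I[OF C(1)], rule UN_I[OF 2],
            rule image_eqI[of _ _ "(inv k \<otimes> inv (rep C)) <# K"], rule 1, rule 3)
    qed
    ultimately show ?thesis by (rule finite_subset[rotated])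
  qed
  ultimately show ?thesis by (simp add: schwartz_def hact_def)
qed

text \<open>The convolution \<open>V\<close> of \<open>T\<close> and \<open>U\<close> is described by its values, so that the same statement yields the
  associativity of the action and that of the convolution itself.\<close>

lemma hact_assoc:
  assumes T: "T \<in> hecke" and U: "U \<in> hecke" and f: "f \<in> schwartz" and x: "x \<in> X"
    and V: "\<And>h. h \<in> carrier G \<Longrightarrow> V h = csum (\<lambda>g. T g * U (inv g \<otimes> h))"
  shows "hact V f x = hact T (hact U f) x"
proof -
  define \<Phi> where "\<Phi> g h = T g * (U (inv g \<otimes> h) * f (ac x h))" for g h
  have Uf: "U (inv g \<otimes> (g \<otimes> h)) = U h" if "g \<in> carrier G" "h \<in> carrier G" for g h
    using that by (simp flip: m_assoc)
  have ri: "U (inv g \<otimes> (h \<otimes> k)) = U (inv g \<otimes> h)" if "g \<in> carrier G" "h \<in> carrier G" "k \<in> K" for g h k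
    using that hecke_rinv[OF U] by (simp add: rinv_def flip: m_assoc)
  have fi: "f (ac x (h \<otimes> k)) = f (ac x h)" if "h \<in> carrier G" "k \<in> K" for h k
    using f x that by (auto simp: schwartz_def ac_mult[symmetric])
  have li: "U (inv (g \<otimes> k) \<otimes> h) = U (inv g \<otimes> h)" if "g \<in> carrier G" "h \<in> carrier G" "k \<in> K" for g h k
    using that hecke_linv[OF U, of "inv g \<otimes> h" "inv k"] by (simp add: inv_mult_group m_assoc)
  have i2: "rinv (\<lambda>h. U (inv g \<otimes> h) * f (ac x h))" if "g \<in> carrier G" for g
    using that ri fi by (simp add: rinv_def)
  let ?B = "\<Union>C\<in>csupp T. (\<lambda>D. rep C <# D) ` csupp U"
  have fB: "finite ?B" using hecke_finite[OF T] hecke_finite[OF U] by auto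
  have Bl: "?B \<subseteq> lcs"
  proof
    fix E assume "E \<in> ?B"
    then obtain C D where CD: "C \<in> csupp T" "D \<in> csupp U" "E = rep C <# D" by blast
    then obtain h where h: "h \<in> carrier G" "D = h <# K" by (auto simp: csupp_def)
    have "rep C \<in> carrier G" using CD csupp_lcs rep_carrier by blast
    thus "E \<in> lcs" using CD(3) h by (auto simp: lcs_def simp flip: lcos_translate)
  qed
  have sB: "g <# K \<in> csupp T \<and> h <# K \<in> ?B"
    if gh: "g \<in> carrier G" "h \<in> carrier G" "\<Phi> g h \<noteq> 0" for g h
  proof -
    have "T g \<noteq> 0" "U (inv g \<otimes> h) \<noteq> 0" using gh by (auto simp: \<Phi>_def)
    hence 1: "g <# K \<in> csupp T" using gh by (auto simp: csupp_def)
    obtain k where k: "k \<in> K" "rep (g <# K) = g \<otimes> k" using rep_lcos[OF gh(1)] by blast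
    have "U (inv (g \<otimes> k) \<otimes> h) \<noteq> 0" using li gh k \<open>U (inv g \<otimes> h) \<noteq> 0\<close> by simp
    hence "(inv (g \<otimes> k) \<otimes> h) <# K \<in> csupp U" using gh k by (auto simp: csupp_def)
    moreover have "h <# K = (g \<otimes> k) <# ((inv (g \<otimes> k) \<otimes> h) <# K)"
      using gh k by (simp flip: lcos_translate m_assoc)
    ultimately show ?thesis using 1 k by (metis UN_I image_eqI)
  qed
  have "hact V f x = csum (\<lambda>h. csum (\<lambda>g. \<Phi> g h))"
  proof -
    have "V h * f (ac x h) = csum (\<lambda>g. \<Phi> g h)" if h: "h \<in> carrier G" for h
    proof -
      have "rinv (\<lambda>g. T g * U (inv g \<otimes> h))" using li h hecke_rinv[OF T] by (simp add: rinv_def)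
      from csum_mult_right[OF this finite_integrand[OF T], of "f (ac x h)"]
      show ?thesis by (simp add: V[OF h] \<Phi>_def mult.assoc)
    qed
    thus ?thesis using x unfolding hact_def by (simp cong: csum_cong)
  qed
  also have "\<dots> = csum (\<lambda>g. csum (\<lambda>h. \<Phi> g h))"
  proof (rule csum_swap[symmetric, OF hecke_finite[OF T] fB csupp_lcs Bl _ _ sB])
    show "rinv (\<lambda>g. \<Phi> g h)" if "h \<in> carrier G" for h
      using that li hecke_rinv[OF T] by (simp add: rinv_def \<Phi>_def)
    show "rinv (\<Phi> g)" if "g \<in> carrier G" for g
      using that ri fi by (simp add: rinv_def \<Phi>_def)
  qed
  also have "\<dots> = csum (\<lambda>g. T g * hact U f (ac x g))"
  proof (rule csum_cong)
    fix g assume g: "g \<in> carrier G"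
    have y: "ac x g \<in> X" using x g by simp
    have fin: "finite (csupp (\<lambda>h. U (inv g \<otimes> h) * f (ac x h)))"
    proof (rule finite_subset[OF _ finite_imageI[OF hecke_finite[OF U], of "\<lambda>D. g <# D"]])
      show "csupp (\<lambda>h. U (inv g \<otimes> h) * f (ac x h)) \<subseteq> (\<lambda>D. g <# D) ` csupp U"
      proof
        fix E assume "E \<in> csupp (\<lambda>h. U (inv g \<otimes> h) * f (ac x h))"
        then obtain h where h: "h \<in> carrier G" "U (inv g \<otimes> h) * f (ac x h) \<noteq> 0" "E = h <# K" by (auto simp: csupp_def)
        have "(inv g \<otimes> h) <# K \<in> csupp U" using h g by (auto simp: csupp_def)
        moreover have "E = g <# ((inv g \<otimes> h) <# K)" using h g by (simp flip: lcos_translate m_assoc)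
        ultimately show "E \<in> (\<lambda>D. g <# D) ` csupp U" by blast
      qed
    qed
    have "csum (\<lambda>h. \<Phi> g h) = T g * csum (\<lambda>h. U (inv g \<otimes> h) * f (ac x h))"
      unfolding \<Phi>_def by (rule csum_mult_left[OF i2[OF g] fin])
    also have "csum (\<lambda>h. U (inv g \<otimes> h) * f (ac x h)) = csum (\<lambda>h. U (inv g \<otimes> (g \<otimes> h)) * f (ac x (g \<otimes> h)))"
      using csum_translate[OF i2[OF g] fin g] by simp
    also have "\<dots> = csum (\<lambda>h. U h * f (ac (ac x g) h))"
      using Uf g x by (intro csum_cong) (simp add: ac_mult)
    finally show "csum (\<lambda>h. \<Phi> g h) = T g * hact U f (ac x g)" using y by (simp add: hact_def)
  qed
  also have "\<dots> = hact T (hact U f) x" using x by (simp add: hact_def)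
  finally show ?thesis .
qed

lemma hact_add_left:
  assumes "T \<in> hecke" "U \<in> hecke" "f \<in> schwartz"
  shows "hact (\<lambda>g. T g + U g) f = (\<lambda>x. hact T f x + hact U f x)"
proof
  fix x
  show "hact (\<lambda>g. T g + U g) f x = hact T f x + hact U f x"
    using csum_add[OF rinv_integrand[OF assms(1,3)] rinv_integrand[OF assms(2,3)] finite_integrand[OF assms(1)] finite_integrand[OF assms(2)], of x x]
    by (simp add: hact_def distrib_right)
qed

lemma hact_add_right:
  assumes "T \<in> hecke" "f \<in> schwartz" "f' \<in> schwartz"
  shows "hact T (\<lambda>x. f x + f' x) = (\<lambda>x. hact T f x + hact T f' x)"
proof
  fix x
  show "hact T (\<lambda>x. f x + f' x) x = hact T f x + hact T f' x"
    using csum_add[OF rinv_integrand[OF assms(1,2)] rinv_integrand[OF assms(1,3)] finite_integrand[OF assms(1)] finite_integrand[OF assms(1)], of x x]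
    by (simp add: hact_def distrib_left)
qed

lemma hact_smult_left:
  assumes "T \<in> hecke" "f \<in> schwartz"
  shows "hact (\<lambda>g. a * T g) f = (\<lambda>x. a * hact T f x)"
proof
  fix x
  show "hact (\<lambda>g. a * T g) f x = a * hact T f x"
    using csum_mult_left[OF rinv_integrand[OF assms] finite_integrand[OF assms(1)], of x a]
    by (simp add: hact_def mult.assoc)
qed

lemma hact_one:
  assumes "f \<in> schwartz"
  shows "hact (\<lambda>g. if g \<in> K then 1 else 0) f = f"
proof
  fix x
  show "hact (\<lambda>g. if g \<in> K then 1 else 0) f x = f x"
  proof (cases "x \<in> X")
    case True
    have "g \<otimes> k \<in> K \<longleftrightarrow> g \<in> K" if "g \<in> carrier G" "k \<in> K" for g k
      using that by (metis K_carrier K_inv K_mult inv_closed m_assoc r_inv r_one)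
    moreover have "f (ac x (g \<otimes> k)) = f (ac x g)" if "g \<in> carrier G" "k \<in> K" for g k
      using assms True that by (auto simp: schwartz_def ac_mult[symmetric])
    ultimately have "rinv (\<lambda>g. (if g \<in> K then 1 else 0) * f (ac x g))" by (simp add: rinv_def)
    hence "csum (\<lambda>g. (if g \<in> K then 1 else 0) * f (ac x g)) = (if \<one> \<in> K then 1 else 0) * f (ac x \<one>)"
      by (rule csum_single) (auto split: if_splits)
    thus ?thesis using True by (simp add: hact_def ac_one)
  next
    case False
    thus ?thesis using assms by (simp add: hact_def schwartz_def)
  qed
qed

lemma schwartz_add:
  assumes "f \<in> schwartz" "f' \<in> schwartz" shows "(\<lambda>x. f x + f' x) \<in> schwartz"
proof -
  have "osupp (\<lambda>x. f x + f' x) \<subseteq> osupp f \<union> osupp f'" unfolding osupp_def by auto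
  from finite_subset[OF this] show ?thesis using assms by (simp add: schwartz_def)
qed

lemma schwartz_smult:
  assumes "f \<in> schwartz" shows "(\<lambda>x. a * f x) \<in> schwartz"
proof -
  have "osupp (\<lambda>x. a * f x) \<subseteq> osupp f" unfolding osupp_def by auto
  from finite_subset[OF this] show ?thesis using assms by (simp add: schwartz_def)
qed

lemma schwartz_0: "(\<lambda>x. 0) \<in> schwartz"
  by (simp add: schwartz_def osupp_def)

lemma schwartz_sum:
  assumes "\<And>i. i \<in> I \<Longrightarrow> f i \<in> schwartz" shows "(\<lambda>x. \<Sum>i\<in>I. f i x) \<in> schwartz"
  using assms
  by (induction I rule: infinite_finite_induct) (auto intro: schwartz_0 schwartz_add)

end

context hecke_pair begin

lemma hecke_add:
  assumes "T \<in> hecke" "U \<in> hecke" shows "(\<lambda>x. T x + U x) \<in> hecke"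
proof -
  have "csupp (\<lambda>x. T x + U x) \<subseteq> csupp T \<union> csupp U" unfolding csupp_def by auto
  from finite_subset[OF this] show ?thesis using assms by (simp add: hecke_def)
qed

lemma hecke_smult:
  assumes "T \<in> hecke" shows "(\<lambda>x. a * T x) \<in> hecke"
proof -
  have "csupp (\<lambda>x. a * T x) \<subseteq> csupp T" unfolding csupp_def by auto
  from finite_subset[OF this] show ?thesis using assms by (simp add: hecke_def)
qed

lemma hecke_0: "(\<lambda>x. 0) \<in> hecke"
  by (simp add: hecke_def csupp_def)

lemma hecke_sum:
  assumes "\<And>i. i \<in> I \<Longrightarrow> f i \<in> hecke" shows "(\<lambda>x. \<Sum>i\<in>I. f i x) \<in> hecke"
  using assms
  by (induction I rule: infinite_finite_induct) (auto intro: hecke_0 hecke_add)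

lemma hecke_double_coset:
  assumes g: "g \<in> carrier G"
  shows "(\<lambda>x. if \<exists>k\<in>K. \<exists>k'\<in>K. x = k \<otimes> g \<otimes> k' then 1 else 0) \<in> hecke" (is "?T \<in> hecke")
proof (rule heckeI)
  fix x k assume x: "x \<in> carrier G" "k \<in> K"
  have "(\<exists>a\<in>K. \<exists>b\<in>K. x \<otimes> k = a \<otimes> g \<otimes> b) \<longleftrightarrow> (\<exists>a\<in>K. \<exists>b\<in>K. x = a \<otimes> g \<otimes> b)"
  proof safe
    fix a b assume ab: "a \<in> K" "b \<in> K" "x \<otimes> k = a \<otimes> g \<otimes> b"
    hence "x = a \<otimes> g \<otimes> (b \<otimes> inv k)" using x g
      by (metis K_carrier K_inv inv_closed m_assoc m_closed r_inv r_one)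
    thus "\<exists>a\<in>K. \<exists>b\<in>K. x = a \<otimes> g \<otimes> b" using ab x by (intro bexI[of _ a] bexI[of _ "b \<otimes> inv k"]) auto
  next
    fix a b assume ab: "a \<in> K" "b \<in> K" "x = a \<otimes> g \<otimes> b"
    thus "\<exists>a'\<in>K. \<exists>b'\<in>K. a \<otimes> g \<otimes> b \<otimes> k = a' \<otimes> g \<otimes> b'" using x g
      by (intro bexI[of _ a] bexI[of _ "b \<otimes> k"]) (auto simp: m_assoc)
  qed
  thus "?T (x \<otimes> k) = ?T x" by simp
  have "(\<exists>a\<in>K. \<exists>b\<in>K. k \<otimes> x = a \<otimes> g \<otimes> b) \<longleftrightarrow> (\<exists>a\<in>K. \<exists>b\<in>K. x = a \<otimes> g \<otimes> b)"
  proof safe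
    fix a b assume ab: "a \<in> K" "b \<in> K" "k \<otimes> x = a \<otimes> g \<otimes> b"
    have "x = inv k \<otimes> (k \<otimes> x)" using x by (simp flip: m_assoc)
    hence "x = (inv k \<otimes> a) \<otimes> g \<otimes> b" using ab x g by (simp add: m_assoc)
    thus "\<exists>a\<in>K. \<exists>b\<in>K. x = a \<otimes> g \<otimes> b" using ab x by (intro bexI[of _ "inv k \<otimes> a"] bexI[of _ b]) auto
  next
    fix a b assume ab: "a \<in> K" "b \<in> K" "x = a \<otimes> g \<otimes> b"
    thus "\<exists>a'\<in>K. \<exists>b'\<in>K. k \<otimes> (a \<otimes> g \<otimes> b) = a' \<otimes> g \<otimes> b'" using x g
      by (intro bexI[of _ "k \<otimes> a"] bexI[of _ b]) (auto simp: m_assoc)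
  qed
  thus "?T (k \<otimes> x) = ?T x" by simp
next
  fix x assume "x \<notin> carrier G"
  thus "?T x = 0" using g by auto
next
  have "csupp ?T \<subseteq> (\<lambda>k. (k \<otimes> g) <# K) ` K"
  proof
    fix C assume "C \<in> csupp ?T"
    then obtain a b where ab: "a \<in> K" "b \<in> K" "C = (a \<otimes> g \<otimes> b) <# K" by (auto simp: csupp_def split: if_splits)
    have "(a \<otimes> g) <# K = (a \<otimes> g \<otimes> b) <# K" using ab g by (subst lcos_eq_iff) auto
    thus "C \<in> (\<lambda>k. (k \<otimes> g) <# K) ` K" using ab by blast
  qed
  thus "finite (csupp ?T)" using fin_double[OF g] finite_subset by blast
qed

definition conv :: "('a \<Rightarrow> 'c::comm_ring_1) \<Rightarrow> ('a \<Rightarrow> 'c) \<Rightarrow> 'a \<Rightarrow> 'c" where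
  "conv T U x = (if x \<in> carrier G then csum (\<lambda>g. T g * U (inv g \<otimes> x)) else 0)"

text \<open>Convolution is the Hecke action on the functions on \<open>G\<close> itself, with \<open>G\<close> acting by
  \<open>x \<cdot> g = g\<^sup>-\<^sup>1 x\<close>; this makes associativity, the unit and distributivity special cases.\<close>

sublocale reg: hecke_space G K "carrier G" "\<lambda>x g. inv g \<otimes> x"
  by unfold_locales (auto simp: inv_mult_group m_assoc)

lemma conv_eq_hact: "conv T U = reg.hact T U"
  by (auto simp: conv_def reg.hact_def fun_eq_iff)

lemma reg_orb: "x \<in> carrier G \<Longrightarrow> reg.orb x = K #> x"
proof -
  assume x: "x \<in> carrier G"
  have "K #> x = (\<lambda>k. k \<otimes> x) ` K" by (auto simp: r_coset_def)
  also have "\<dots> = (\<lambda>k. inv k \<otimes> x) ` K"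
  proof safe
    fix k assume "k \<in> K"
    thus "k \<otimes> x \<in> (\<lambda>k. inv k \<otimes> x) ` K" by (intro image_eqI[of _ _ "inv k"]) auto
    show "inv k \<otimes> x \<in> (\<lambda>k. k \<otimes> x) ` K" using \<open>k \<in> K\<close> by (intro image_eqI[of _ _ "inv k"]) auto
  qed
  finally show ?thesis by (simp add: reg.orb_def)
qed

text \<open>In the regular action the orbits are right cosets, whereas the support of a Hecke operator is
  finite modulo left cosets. Inversion exchanges the two, and each double coset is finite modulo either.\<close>

lemma hecke_subset_reg_schwartz: "T \<in> hecke \<Longrightarrow> T \<in> reg.schwartz"
proof -
  assume T: "T \<in> hecke"
  have "finite (reg.osupp T)"
  proof -
    define S where "S = (\<Union>C\<in>csupp T. (\<lambda>D. (\<lambda>x. inv x) ` D) ` ((\<lambda>k. (k \<otimes> inv (rep C)) <# K) ` K))"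
    have "finite ((\<lambda>k. (k \<otimes> inv (rep C)) <# K) ` K)" if "C \<in> csupp T" for C
      using that csupp_lcs rep_carrier by (intro fin_double inv_closed) blast
    hence "finite S" unfolding S_def
      by (rule_tac finite_UN_I[OF hecke_finite[OF T]], rule_tac finite_imageI) blast
    moreover have "reg.osupp T \<subseteq> S"
    proof
      fix Q assume "Q \<in> reg.osupp T"
      then obtain x where x: "x \<in> carrier G" "T x \<noteq> 0" "Q = K #> x" by (auto simp: reg.osupp_def reg_orb)
      obtain k where k: "k \<in> K" "rep (x <# K) = x \<otimes> k" using rep_lcos[OF x(1)] by blast
      have "k \<otimes> inv (x \<otimes> k) = inv x" using x k
        by (simp add: inv_mult_group flip: m_assoc)
      hence "(k \<otimes> inv (rep (x <# K))) <# K = inv x <# K" using k by simp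
      moreover have "Q = (\<lambda>x. inv x) ` (inv x <# K)"
      proof -
        have "(\<lambda>x. inv x) ` (inv x <# K) = (\<lambda>k. inv k \<otimes> x) ` K"
          using x by (auto simp: l_coset_def inv_mult_group image_iff)
        thus ?thesis using reg_orb[OF x(1)] x(3) by (simp add: reg.orb_def)
      qed
      moreover have "x <# K \<in> csupp T" using x by (auto simp: csupp_def)
      ultimately show "Q \<in> S" unfolding S_def using k by (metis (no_types, lifting) UN_I image_eqI)
    qed
    ultimately show ?thesis by (rule finite_subset[rotated])
  qed
  thus ?thesis using T hecke_linv[OF T] by (auto simp: reg.schwartz_def hecke_def)
qed

lemma conv_closed:
  assumes T: "T \<in> hecke" and U: "U \<in> hecke" shows "conv T U \<in> hecke"
proof -
  have S: "conv T U \<in> reg.schwartz"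
    unfolding conv_eq_hact using reg.hact_closed[OF T hecke_subset_reg_schwartz[OF U]] .
  have r: "conv T U (x \<otimes> k) = conv T U x" if "x \<in> carrier G" "k \<in> K" for x k
    unfolding conv_def using that hecke_rinv[OF U]
    by (auto simp: rinv_def m_assoc[symmetric] intro!: csum_cong)
  have l: "conv T U (k \<otimes> x) = conv T U x" if "x \<in> carrier G" "k \<in> K" for x k
  proof -
    have "\<forall>x\<in>carrier G. \<forall>k\<in>K. conv T U (inv k \<otimes> x) = conv T U x"
      using S by (simp add: reg.schwartz_def)
    hence "conv T U (inv (inv k) \<otimes> x) = conv T U x" using that K_inv by blast
    thus ?thesis using that by simp
  qed
  have "finite (csupp (conv T U))"
  proof -
    define V where "V = conv T U"
    have Vr: "rinv V" using r by (simp add: rinv_def V_def)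
    define F where "F = (\<Union>Q\<in>reg.osupp V. (\<lambda>k. (k \<otimes> (SOME y. y \<in> Q)) <# K) ` K)"
    have Ocar: "(SOME y. y \<in> Q) \<in> carrier G" "\<exists>x\<in>carrier G. V x \<noteq> 0 \<and> Q = K #> x \<and> (\<exists>k\<in>K. (SOME y. y \<in> Q) = k \<otimes> x)"
      if Q: "Q \<in> reg.osupp V" for Q
    proof -
      obtain x where x: "x \<in> carrier G" "V x \<noteq> 0" "Q = K #> x" using Q by (auto simp: reg.osupp_def reg_orb)
      have "x \<in> Q" using x reg.orb_self[OF x(1)] by (simp add: reg_orb)
      hence "(SOME y. y \<in> Q) \<in> Q" by (rule someI)
      then obtain k where k: "k \<in> K" "(SOME y. y \<in> Q) = k \<otimes> x" unfolding x(3) by (auto simp: r_coset_def)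
      thus "(SOME y. y \<in> Q) \<in> carrier G" "\<exists>x\<in>carrier G. V x \<noteq> 0 \<and> Q = K #> x \<and> (\<exists>k\<in>K. (SOME y. y \<in> Q) = k \<otimes> x)"
        using x by auto
    qed
    have fo: "finite (reg.osupp V)" using S by (simp add: reg.schwartz_def V_def)
    have "finite F" unfolding F_def by (rule finite_UN_I[OF fo]) (rule fin_double[OF Ocar(1)])
    moreover have "csupp V \<subseteq> F"
    proof
      fix C assume "C \<in> csupp V"
      then obtain x where x: "x \<in> carrier G" "V x \<noteq> 0" "C = x <# K" by (auto simp: csupp_def)
      have Q: "K #> x \<in> reg.osupp V" using x by (auto simp: reg.osupp_def reg_orb)
      have "x \<in> K #> x" using reg.orb_self[OF x(1)] by (simp add: reg_orb x)
      hence "(SOME y. y \<in> K #> x) \<in> K #> x" by (rule someI)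
      then obtain k where k: "k \<in> K" "(SOME y. y \<in> K #> x) = k \<otimes> x" by (auto simp: r_coset_def)
      have Ceq: "C = (inv k \<otimes> (SOME y. y \<in> K #> x)) <# K" unfolding k(2) x(3) using k x by (simp flip: m_assoc)
      show "C \<in> F" unfolding F_def
        by (rule UN_I[OF Q], rule image_eqI[where x = "inv k"], rule Ceq, rule K_inv[OF k(1)])
    qed
    ultimately show ?thesis unfolding V_def by (rule finite_subset[rotated])
  qed
  thus ?thesis using r l by (intro heckeI) (auto simp: conv_def)
qed

lemma conv_assoc:
  assumes "T \<in> hecke" "U \<in> hecke" "V \<in> hecke"
  shows "conv (conv T U) V = conv T (conv U V)"
proof
  fix x
  show "conv (conv T U) V x = conv T (conv U V) x"
  proof (cases "x \<in> carrier G")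
    case True
    show ?thesis unfolding conv_eq_hact
      by (rule reg.hact_assoc[OF assms(1,2) hecke_subset_reg_schwartz[OF assms(3)] True])
        (simp add: reg.hact_def)
  qed (simp add: conv_def)
qed

lemma one_hecke: "(\<lambda>x. if x \<in> K then 1 else 0) \<in> hecke"
proof -
  have "(\<exists>k\<in>K. \<exists>k'\<in>K. x = k \<otimes> \<one> \<otimes> k') \<longleftrightarrow> x \<in> K" for x
  proof
    assume "x \<in> K"
    thus "\<exists>k\<in>K. \<exists>k'\<in>K. x = k \<otimes> \<one> \<otimes> k'" by (intro bexI[of _ \<one>] bexI[of _ x]) auto
  qed auto
  thus ?thesis using hecke_double_coset[OF one_closed] by simp
qed

lemma conv_one_right:
  assumes T: "T \<in> hecke" shows "conv T (\<lambda>x. if x \<in> K then 1 else 0) = T"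
proof
  fix x
  show "conv T (\<lambda>x. if x \<in> K then 1 else 0) x = T x"
  proof (cases "x \<in> carrier G")
    case True
    let ?\<phi> = "\<lambda>g. T g * (if inv g \<otimes> x \<in> K then 1 else 0)"
    have "rinv ?\<phi>" by (rule reg.rinv_integrand[OF T hecke_subset_reg_schwartz[OF one_hecke] True])
    hence "csum ?\<phi> = ?\<phi> x"
    proof (rule csum_single[OF _ True])
      fix h assume h: "h \<in> carrier G" "?\<phi> h \<noteq> 0"
      hence "inv h \<otimes> x \<in> K" by (auto split: if_splits)
      hence "inv (inv h \<otimes> x) \<in> K" by simp
      moreover have "h = x \<otimes> inv (inv h \<otimes> x)" using h True by (simp add: inv_mult_group flip: m_assoc)
      ultimately show "\<exists>k\<in>K. h = x \<otimes> k" by blast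
    qed
    thus ?thesis using True by (simp add: conv_def)
  next
    case False thus ?thesis using T by (simp add: conv_def hecke_def)
  qed
qed

lemma hecke_ring:
  "ring \<lparr>carrier = hecke :: ('a \<Rightarrow> 'c::comm_ring_1) set, monoid.mult = conv,
     one = (\<lambda>x. if x \<in> K then 1 else 0), zero = (\<lambda>_. 0), add = (\<lambda>T U x. T x + U x)\<rparr>" (is "ring ?H")
proof (rule ringI)
  show "abelian_group ?H"
  proof (rule abelian_groupI)
    fix T assume T: "T \<in> carrier ?H"
    define U where "U = (\<lambda>x. (-1) * T x)"
    have "U \<in> hecke" unfolding U_def by (rule hecke_smult) (use T in simp)
    moreover have "(\<lambda>x. U x + T x) = (\<lambda>_. 0)" by (simp add: U_def)
    ultimately show "\<exists>y\<in>carrier ?H. y \<oplus>\<^bsub>?H\<^esub> T = \<zero>\<^bsub>?H\<^esub>"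
      by (intro bexI[of _ U]) auto
  qed (auto simp: hecke_0 hecke_add algebra_simps)
  show "monoid ?H"
    using conv_closed conv_assoc one_hecke conv_one_right
      reg.hact_one[OF hecke_subset_reg_schwartz] by unfold_locales (auto simp: conv_eq_hact)
  fix T U V assume "T \<in> carrier ?H" "U \<in> carrier ?H" "V \<in> carrier ?H"
  hence *: "T \<in> hecke" "U \<in> hecke" "V \<in> hecke" by auto
  show "(T \<oplus>\<^bsub>?H\<^esub> U) \<otimes>\<^bsub>?H\<^esub> V = T \<otimes>\<^bsub>?H\<^esub> V \<oplus>\<^bsub>?H\<^esub> U \<otimes>\<^bsub>?H\<^esub> V"
    using reg.hact_add_left[OF *(1,2) hecke_subset_reg_schwartz[OF *(3)]] by (simp add: conv_eq_hact)
  show "V \<otimes>\<^bsub>?H\<^esub> (T \<oplus>\<^bsub>?H\<^esub> U) = V \<otimes>\<^bsub>?H\<^esub> T \<oplus>\<^bsub>?H\<^esub> V \<otimes>\<^bsub>?H\<^esub> U"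
    using reg.hact_add_right[OF *(3) hecke_subset_reg_schwartz[OF *(1)] hecke_subset_reg_schwartz[OF *(2)]]
    by (simp add: conv_eq_hact)
qed

end

section \<open>Compact supports are finite supports\<close>

text \<open>Open classes that cover a compact support are finite in number. Conversely, the support is a union of classes,
  and so is its complement; hence it is closed, and compact if it consists of finitely many classes.\<close>

lemma compactly_supported_classes:
  assumes cls: "\<And>x. x \<in> topspace T \<Longrightarrow> openin T (P x) \<and> compactin T (P x) \<and> x \<in> P x"
    and eq: "\<And>x y. x \<in> topspace T \<Longrightarrow> y \<in> P x \<Longrightarrow> P y = P x"
    and f: "\<And>x y. x \<in> topspace T \<Longrightarrow> y \<in> P x \<Longrightarrow> f y = f x"
  shows "compactly_supported T f \<longleftrightarrow> finite (P ` {x \<in> topspace T. f x \<noteq> 0})"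
proof
  let ?S = "{x \<in> topspace T. f x \<noteq> 0}"
  assume "compactly_supported T f"
  hence c: "compactin T (T closure_of ?S)" by (simp add: compactly_supported_def)
  have sub: "?S \<subseteq> T closure_of ?S" by (rule closure_of_subset) auto
  have "\<exists>\<F>. finite \<F> \<and> \<F> \<subseteq> P ` topspace T \<and> T closure_of ?S \<subseteq> \<Union>\<F>"
    using cls closure_of_subset_topspace[of T ?S] by (intro compactinD[OF c]) blast+
  then obtain \<F> where F: "finite \<F>" "\<F> \<subseteq> P ` topspace T" "T closure_of ?S \<subseteq> \<Union>\<F>" by blast
  have "P ` ?S \<subseteq> \<F>"
  proof
    fix C assume "C \<in> P ` ?S"
    then obtain x where x: "x \<in> ?S" "C = P x" by blast
    then obtain D where D: "D \<in> \<F>" "x \<in> D" using F sub by blast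
    then obtain y where y: "y \<in> topspace T" "D = P y" using F by blast
    have "P x = P y" using eq[OF y(1)] D y by blast
    thus "C \<in> \<F>" using x D y by simp
  qed
  thus "finite (P ` ?S)" using F(1) by (rule finite_subset)
next
  let ?S = "{x \<in> topspace T. f x \<noteq> 0}"
  assume fin: "finite (P ` ?S)"
  have sub: "P x \<subseteq> topspace T" if "x \<in> topspace T" for x using openin_subset[of T "P x"] cls[OF that] by simp
  have S: "?S = \<Union>(P ` ?S)"
  proof (intro equalityI subsetI)
    fix x assume "x \<in> ?S"
    thus "x \<in> \<Union>(P ` ?S)" using cls[of x] by blast
  next
    fix y assume "y \<in> \<Union>(P ` ?S)"
    then obtain x where x: "x \<in> topspace T" "f x \<noteq> 0" "y \<in> P x" by blast
    have "f y = f x" by (rule f[OF x(1,3)])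
    thus "y \<in> ?S" using x sub[OF x(1)] by auto
  qed
  have comp: "compactin T ?S" by (subst S, rule compactin_Union[OF fin]) (use cls in blast)
  have "topspace T - ?S = \<Union>(P ` (topspace T - ?S))"
  proof (intro equalityI subsetI)
    fix x assume "x \<in> topspace T - ?S"
    thus "x \<in> \<Union>(P ` (topspace T - ?S))" using cls[of x] by blast
  next
    fix y assume "y \<in> \<Union>(P ` (topspace T - ?S))"
    then obtain x where x: "x \<in> topspace T" "f x = 0" "y \<in> P x" by blast
    have "f y = f x" by (rule f[OF x(1,3)])
    thus "y \<in> topspace T - ?S" using x sub[OF x(1)] by auto
  qed
  moreover have "openin T (\<Union>(P ` (topspace T - ?S)))"
    by (rule openin_Union) (use cls in blast)
  ultimately have "openin T (topspace T - ?S)" by simp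
  hence "closedin T ?S" by (simp add: closedin_def)
  thus "compactly_supported T f" using comp by (simp add: compactly_supported_def closure_of_closedin)
qed

locale odd_padic_rank = odd_padic av p \<pi> for av :: "'a::field_char_0 \<Rightarrow> real" and p and \<pi> +
  fixes r :: nat
  assumes rank_pos: "r \<ge> 1"
begin

subsection \<open>The topology on matrices\<close>

lemma topspace_MT: "topspace (mat_topology av r) = carrier_mat r r"
  by (auto simp: mat_topology_def topspace_pullback_topology field_topology_def)

lemma strict_box_open:
  assumes "A \<in> carrier_mat r r" "b > 0"
  shows "openin (mat_topology av r) {B \<in> carrier_mat r r. \<forall>i<r. \<forall>j<r. av (B $$ (i, j) - A $$ (i, j)) < b}"
proof -
  let ?I = "{..<r} \<times> {..<r}"
  define U where "U = (PiE ?I (\<lambda>ij. AM.mball (A $$ ij) b))"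
  have "openin (product_topology (\<lambda>_. field_topology av) ?I) U"
    unfolding U_def by (subst openin_PiE_gen) (auto simp: field_topology_def)
  moreover have "{B \<in> carrier_mat r r. \<forall>i<r. \<forall>j<r. av (B $$ (i, j) - A $$ (i, j)) < b}
      = (\<lambda>A. \<lambda>ij\<in>?I. A $$ ij) -` U \<inter> carrier_mat r r" (is "?L = ?R")
  proof (rule Set.set_eqI)
    fix B
    show "B \<in> ?L \<longleftrightarrow> B \<in> ?R"
      by (simp add: U_def PiE_iff AM.mball_def av_commute[of "A $$ _"]) blast
  qed
  ultimately show ?thesis unfolding mat_topology_def openin_pullback_topology by blast
qed

lemma openin_MT_I:
  assumes "S \<subseteq> carrier_mat r r"
    and "\<And>A. A \<in> S \<Longrightarrow> \<exists>m. \<forall>B\<in>carrier_mat r r. bounded_mat r (c powi m) (B - A) \<longrightarrow> B \<in> S"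
  shows "openin (mat_topology av r) S"
proof (subst openin_subopen, intro ballI)
  fix A assume A: "A \<in> S"
  then obtain m where m: "\<And>B. B \<in> carrier_mat r r \<Longrightarrow> bounded_mat r (c powi m) (B - A) \<Longrightarrow> B \<in> S"
    using assms(2) by blast
  let ?U = "{B \<in> carrier_mat r r. \<forall>i<r. \<forall>j<r. av (B $$ (i, j) - A $$ (i, j)) < c powi m}"
  have Ac: "A \<in> carrier_mat r r" using A assms(1) by blast
  have "openin (mat_topology av r) ?U" using strict_box_open[OF Ac] by simp
  moreover have "A \<in> ?U" using Ac by simp
  moreover have "?U \<subseteq> S" proof
    fix B assume B: "B \<in> ?U"
    have "bounded_mat r (c powi m) (B - A)" using B Ac by (auto simp: bounded_mat_def intro: less_imp_le)
    thus "B \<in> S" using m[of B] B by simp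
  qed
  ultimately show "\<exists>U. openin (mat_topology av r) U \<and> A \<in> U \<and> U \<subseteq> S" by blast
qed

lemma bounded_box_compact: "compactin (mat_topology av r) {A \<in> carrier_mat r r. bounded_mat r b A}"
proof -
  let ?I = "{..<r} \<times> {..<r}"
  let ?T = "product_topology (\<lambda>_. field_topology av) ?I"
  let ?g = "\<lambda>\<phi>. mat r r \<phi>"
  let ?f = "\<lambda>A. \<lambda>ij\<in>?I. A $$ ij"
  have "continuous_map ?T ?T (?f \<circ> ?g)"
    by (rule continuous_map_eq[OF continuous_map_id]) (auto simp: fun_eq_iff PiE_iff extensional_def)
  hence "continuous_map ?T (mat_topology av r) ?g"
    unfolding mat_topology_def by (rule continuous_map_pullback') auto
  moreover have "compactin ?T (PiE ?I (\<lambda>_. {x. av x \<le> b}))"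
    unfolding compactin_PiE using integers_compact by blast
  ultimately have "compactin (mat_topology av r) (?g ` (PiE ?I (\<lambda>_. {x. av x \<le> b})))"
    using image_compactin by blast
  also have "?g ` (PiE ?I (\<lambda>_. {x. av x \<le> b})) = {A \<in> carrier_mat r r. bounded_mat r b A}"
  proof (intro equalityI subsetI)
    fix A assume A: "A \<in> {A \<in> carrier_mat r r. bounded_mat r b A}"
    hence "A = ?g (?f A)" by (intro eq_matI) auto
    moreover have "?f A \<in> PiE ?I (\<lambda>_. {x. av x \<le> b})" using A by (auto simp: bounded_mat_def)
    ultimately show "A \<in> ?g ` (PiE ?I (\<lambda>_. {x. av x \<le> b}))" by (rule image_eqI)
  next
    fix A assume "A \<in> ?g ` (PiE ?I (\<lambda>_. {x. av x \<le> b}))"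
    then obtain \<phi> where \<phi>: "\<phi> \<in> PiE ?I (\<lambda>_. {x. av x \<le> b})" "A = ?g \<phi>" by blast
    have "av (\<phi> (i, j)) \<le> b" if "i < r" "j < r" for i j
      using PiE_mem[OF \<phi>(1), of "(i, j)"] that by simp
    thus "A \<in> {A \<in> carrier_mat r r. bounded_mat r b A}" by (simp add: \<phi>(2) bounded_mat_def)
  qed
  finally show ?thesis .
qed

lemma compact_MT_I:
  assumes "S \<subseteq> {A \<in> carrier_mat r r. bounded_mat r b A}"
    and "\<And>A. A \<in> carrier_mat r r \<Longrightarrow> A \<notin> S \<Longrightarrow>
      \<exists>m. \<forall>B\<in>carrier_mat r r. bounded_mat r (c powi m) (B - A) \<longrightarrow> B \<notin> S"
  shows "compactin (mat_topology av r) S"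
proof (rule closed_compactin[OF bounded_box_compact assms(1)])
  have "openin (mat_topology av r) (carrier_mat r r - S)"
    using assms(2) by (intro openin_MT_I) blast+
  thus "closedin (mat_topology av r) S"
    using assms(1) by (auto simp: closedin_def topspace_MT)
qed

lemma bounded_mat_diff_commute:
  assumes "A \<in> carrier_mat n n" "B \<in> carrier_mat n n"
  shows "bounded_mat n b (A - B) \<longleftrightarrow> bounded_mat n b (B - A)"
proof -
  have "av ((A - B) $$ (i, j)) = av ((B - A) $$ (i, j))" if "i < n" "j < n" for i j
    using assms that av_commute[of "A $$ (i, j)" "B $$ (i, j)"] by auto
  thus ?thesis by (simp add: bounded_mat_def)
qed

subsection \<open>The group\<close>

lemma mult_GL [simp]: "monoid.mult (GL r :: 'a mat monoid) = (*)"
  by (simp add: GL_def units_of_mult ring_mat_simps)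

lemma one_GL [simp]: "\<one>\<^bsub>GL r :: 'a mat monoid\<^esub> = 1\<^sub>m r"
  by (simp add: GL_def units_of_one ring_mat_simps)

lemma carrier_GL: "g \<in> carrier (GL r) \<longleftrightarrow> g \<in> carrier_mat r r \<and> det (g :: 'a mat) \<noteq> 0"
proof
  assume "g \<in> carrier (GL r)"
  then obtain h where gh: "g \<in> carrier_mat r r" "h \<in> carrier_mat r r" "h * g = 1\<^sub>m r"
    by (auto simp: GL_def units_of_carrier Units_def ring_mat_simps)
  hence "det h * det g = 1" by (metis det_mult det_one)
  thus "g \<in> carrier_mat r r \<and> det g \<noteq> 0" using gh by auto
next
  assume g: "g \<in> carrier_mat r r \<and> det g \<noteq> 0"
  then obtain h where "h \<in> carrier_mat r r" "g * h = 1\<^sub>m r" "h * g = 1\<^sub>m r"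
    using mat_inverse by blast
  thus "g \<in> carrier (GL r)" using g
    by (auto simp: GL_def units_of_carrier Units_def ring_mat_simps)
qed

lemma GL_group: "group (GL r :: 'a mat monoid)"
  unfolding GL_def by (intro monoid.units_group ring.is_monoid ring_mat)

sublocale GLg: group "GL r :: 'a mat monoid" by (rule GL_group)

lemma GL_carrier_mat [simp]: "g \<in> carrier (GL r) \<Longrightarrow> (g :: 'a mat) \<in> carrier_mat r r"
  by (simp add: carrier_GL)

lemma GLO_sub_GL: "k \<in> GLO r \<Longrightarrow> k \<in> carrier (GL r)"
  using GLO_det[of k r] by (auto simp: carrier_GL)

lemma GL_inv: "g \<in> carrier (GL r) \<Longrightarrow> h \<in> carrier_mat r r \<Longrightarrow> h * (g :: 'a mat) = 1\<^sub>m r \<Longrightarrow> inv\<^bsub>GL r\<^esub> g = h"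
proof -
  assume g: "g \<in> carrier (GL r)" "h \<in> carrier_mat r r" "h * g = 1\<^sub>m r"
  have "det h * det g = 1" using g by (metis GL_carrier_mat det_mult det_one)
  hence "h \<in> carrier (GL r)" using g by (auto simp: carrier_GL)
  thus ?thesis using g by (intro GLg.inv_equality) auto
qed

lemma GL_integers_eq: "GL_integers av r = GLO r"
proof (intro equalityI subsetI)
  fix g assume "g \<in> GL_integers av r"
  hence g: "g \<in> carrier (GL r)" "bounded_mat r 1 g" "bounded_mat r 1 (inv\<^bsub>GL r\<^esub> g)"
    by (auto simp: GL_integers_def integral_mat_def integers_def bounded_mat_def)
  have gi: "inv\<^bsub>GL r\<^esub> g \<in> carrier (GL r)" using g by simp
  have "g * inv\<^bsub>GL r\<^esub> g = 1\<^sub>m r" using GLg.r_inv[OF g(1)] by simp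
  hence "det g * det (inv\<^bsub>GL r\<^esub> g) = 1"
    using g gi by (metis GL_carrier_mat det_mult det_one)
  hence 1: "av (det g) * av (det (inv\<^bsub>GL r\<^esub> g)) = 1" by (metis av_1 av_mult)
  have "av (det g) \<le> 1" "av (det (inv\<^bsub>GL r\<^esub> g)) \<le> 1"
    using g gi by (auto intro!: det_integral[of _ r])
  hence "av (det g) = 1" using 1 av_nonneg[of "det g"] av_nonneg[of "det (inv\<^bsub>GL r\<^esub> g)"]
    by (smt (verit) mult_left_le mult_cancel_left1)
  thus "g \<in> GLO r" using g by (auto simp: GLO_def simp del: GLO_carrier)
next
  fix k assume k: "k \<in> GLO r"
  obtain l where l: "l \<in> GLO r" "k * l = 1\<^sub>m r" "l * k = 1\<^sub>m r" using GLO_inverse[OF k] by blast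
  have "inv\<^bsub>GL r\<^esub> k = l" using k l by (intro GL_inv GLO_sub_GL) auto
  thus "k \<in> GL_integers av r"
    using GLO_sub_GL[OF k] GLO_bounded[OF k] GLO_bounded[OF l(1)]
    by (auto simp: GL_integers_def integral_mat_def integers_def bounded_mat_def)
qed

lemma GLO_subgroup: "subgroup (GLO r) (GL r)"
proof (rule GLg.subgroupI)
  show "GLO r \<noteq> {}" using GLO_one by blast
  fix k assume k: "k \<in> GLO r"
  obtain l where l: "l \<in> GLO r" "k * l = 1\<^sub>m r" "l * k = 1\<^sub>m r" using GLO_inverse[OF k] by blast
  have "inv\<^bsub>GL r\<^esub> k = l" using k l by (intro GL_inv GLO_sub_GL) auto
  thus "inv\<^bsub>GL r\<^esub> k \<in> GLO r" using l by simp
qed (auto intro: GLO_sub_GL GLO_mult)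

text \<open>There are only finitely many integral matrices modulo the \<open>N\<close>-th power of the maximal ideal.\<close>

lemma finite_residue_matrices:
  assumes "\<And>A B. A \<in> carrier_mat r r \<Longrightarrow> B \<in> carrier_mat r r \<Longrightarrow> bounded_mat r 1 A \<Longrightarrow> bounded_mat r 1 B \<Longrightarrow>
    A \<in> S \<Longrightarrow> B \<in> S \<Longrightarrow> bounded_mat r (c ^ N) (A - B) \<Longrightarrow> f A = f B"
    and S: "S \<subseteq> {A \<in> carrier_mat r r. bounded_mat r 1 A}"
  shows "finite (f ` S)"
proof -
  obtain R where R: "finite R" "R \<subseteq> integers av" "\<And>x. av x \<le> 1 \<Longrightarrow> \<exists>s\<in>R. av (x - s) \<le> c ^ N"
    using finite_reps_mod_power[of N] by blast
  define q where "q x = (SOME s. s \<in> R \<and> av (x - s) \<le> c ^ N)" for x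
  have q: "q x \<in> R \<and> av (x - q x) \<le> c ^ N" if "av x \<le> 1" for x
    unfolding q_def by (rule someI_ex) (use R(3)[OF that] in blast)
  define Q where "Q A = (\<lambda>ij\<in>{..<r} \<times> {..<r}. q (A $$ ij))" for A
  have "Q ` S \<subseteq> PiE ({..<r} \<times> {..<r}) (\<lambda>_. R)"
  proof
    fix \<phi> assume "\<phi> \<in> Q ` S"
    then obtain A where A: "A \<in> S" "\<phi> = Q A" by blast
    hence "A \<in> carrier_mat r r" "bounded_mat r 1 A" using S by auto
    hence "q (A $$ (i, j)) \<in> R" if "i < r" "j < r" for i j
      using q[of "A $$ (i, j)"] that by (auto simp: bounded_mat_def)
    thus "\<phi> \<in> PiE ({..<r} \<times> {..<r}) (\<lambda>_. R)" unfolding A(2) Q_def by (intro restrict_PiE_iff[THEN iffD2]) auto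
  qed
  hence finQ: "finite (Q ` S)" by (rule finite_subset) (intro finite_PiE, use R(1) in auto)
  have key: "f A = f B" if A: "A \<in> S" and B: "B \<in> S" and AB: "Q A = Q B" for A B
  proof -
    have c: "A \<in> carrier_mat r r" "bounded_mat r 1 A" "B \<in> carrier_mat r r" "bounded_mat r 1 B"
      using A B S by auto
    have "av (A $$ (i, j) - B $$ (i, j)) \<le> c ^ N" if ij: "i < r" "j < r" for i j
    proof -
      have "q (A $$ (i, j)) = q (B $$ (i, j))" using fun_cong[OF AB, of "(i, j)"] ij by (simp add: Q_def)
      moreover have "av (A $$ (i, j) - q (A $$ (i, j))) \<le> c ^ N" "av (B $$ (i, j) - q (B $$ (i, j))) \<le> c ^ N"
        using q[of "A $$ (i, j)"] q[of "B $$ (i, j)"] c ij by (auto simp: bounded_mat_def)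
      ultimately show ?thesis
        using av_diff_le[of "A $$ (i, j) - q (A $$ (i, j))" "c ^ N" "B $$ (i, j) - q (B $$ (i, j))"] by simp
    qed
    hence "bounded_mat r (c ^ N) (A - B)" using c(1,3) by (simp add: bounded_mat_def)
    thus ?thesis by (rule assms(1)[OF c(1,3,2,4) A B])
  qed
  have "f ` S \<subseteq> (\<lambda>y. f (SOME A. A \<in> S \<and> Q A = y)) ` (Q ` S)"
  proof
    fix z assume "z \<in> f ` S"
    then obtain A where A: "A \<in> S" "z = f A" by blast
    let ?B = "SOME B. B \<in> S \<and> Q B = Q A"
    have "?B \<in> S \<and> Q ?B = Q A" by (rule someI[of "\<lambda>B. B \<in> S \<and> Q B = Q A" A]) (simp add: A(1))
    hence B: "?B \<in> S" "Q A = Q ?B" by simp_all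
    have "f A = f ?B" by (rule key[OF A(1) B])
    hence zA: "z = f (SOME B. B \<in> S \<and> Q B = Q A)" using A(2) by simp
    show "z \<in> (\<lambda>y. f (SOME A. A \<in> S \<and> Q A = y)) ` (Q ` S)"
      by (rule rev_image_eqI[of "Q A"]) (use A(1) in simp, rule zA)
  qed
  thus ?thesis using finite_imageI[OF finQ] by (rule finite_subset)
qed

text \<open>If \<open>k\<close> and \<open>l\<close> are congruent modulo a power of the maximal ideal that absorbs the denominators of \<open>g\<close> and of
  its inverse, then \<open>k g\<close> and \<open>l g\<close> lie in the same left coset.\<close>

lemma GL_finite_double:
  assumes g: "g \<in> carrier (GL r)"
  shows "finite ((\<lambda>k. (k \<otimes>\<^bsub>GL r\<^esub> g) <#\<^bsub>GL r\<^esub> GLO r) ` GLO r)"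
proof -
  have gc: "g \<in> carrier_mat r r" "det g \<noteq> 0" using g by (auto simp: carrier_GL)
  obtain h where h: "h \<in> carrier_mat r r" "g * h = 1\<^sub>m r" "h * g = 1\<^sub>m r" using mat_inverse[OF gc] by blast
  obtain a where a: "bounded_mat r (c powi (- a)) g" "a \<ge> 0" using bounded_mat_exists by blast
  obtain b where b: "bounded_mat r (c powi (- b)) h" "b \<ge> 0" using bounded_mat_exists by blast
  \<comment> \<open>\<open>N\<close> absorbs the denominators of \<open>g\<close> and \<open>h\<close> and leaves one power of \<open>\<pi>\<close>.\<close>
  define N where "N = nat (a + b + 1)"
  have N: "c ^ N = c powi (a + b + 1)" using a b unfolding N_def by (simp add: power_int_def)
  show ?thesis
  proof (rule finite_residue_matrices[of _ N])
    fix k l assume kl: "k \<in> carrier_mat r r" "l \<in> carrier_mat r r" "k \<in> GLO r" "l \<in> GLO r" "bounded_mat r (c ^ N) (k - l)"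
    obtain li where li: "li \<in> GLO r" "l * li = 1\<^sub>m r" "li * l = 1\<^sub>m r" using GLO_inverse[OF kl(4)] by blast
    have lic: "li \<in> carrier_mat r r" using li by simp
    define m where "m = h * (li * k) * g"
    have mc: "m \<in> carrier_mat r r" using h kl lic gc by (simp add: m_def mult_carrier_mat[of _ r r _ r])
    have s1: "li * (k - l) = li * k - 1\<^sub>m r"
      using mult_minus_distrib_mat[of li r r k r l] lic kl(1,2) li(3) by simp
    have s2: "h * (li * k - 1\<^sub>m r) = h * (li * k) - h"
      using mult_minus_distrib_mat[of h r r "li * k" r "1\<^sub>m r"] h(1) lic kl(1) by simp
    have s3: "(h * (li * k) - h) * g = h * (li * k) * g - h * g"
      using minus_mult_distrib_mat[of "h * (li * k)" r r h g r] h(1) lic kl(1) gc(1)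
      by (simp add: mult_carrier_mat[of _ r r _ r])
    have "h * (li * (k - l)) * g = m - 1\<^sub>m r"
      unfolding m_def s1 s2 s3 h(3) ..
    moreover have "bounded_mat r (c powi (- b) * (1 * c ^ N) * c powi (- a)) (h * (li * (k - l)) * g)"
    proof -
      have klc: "k - l \<in> carrier_mat r r" by (rule minus_carrier_mat[OF kl(2)])
      have q: "li * (k - l) \<in> carrier_mat r r" "h * (li * (k - l)) \<in> carrier_mat r r"
        using h(1) lic klc by (auto intro!: mult_carrier_mat[of _ r r _ r])
      have "bounded_mat r (1 * c ^ N) (li * (k - l))"
        by (rule bounded_mat_mult[OF lic klc GLO_bounded[OF li(1)] kl(5)]) (use c_pos in auto)
      hence "bounded_mat r (c powi (- b) * (1 * c ^ N)) (h * (li * (k - l)))"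
        by (rule bounded_mat_mult[OF h(1) q(1) b(1)]) (use c_pos in auto)
      thus ?thesis by (rule bounded_mat_mult[OF q(2) gc(1) _ a(1)]) (use c_pos in auto)
    qed
    moreover have "c powi (- b) * (1 * c ^ N) * c powi (- a) = c"
      unfolding N by (simp flip: powi_add_c)
    ultimately have "m \<in> GLO r" using mc by (intro congruence_subgroup_GLO) auto
    moreover have "l * g * m = k * g"
    proof -
      have "l * g * m = l * ((g * h) * (li * (k * g)))"
        unfolding m_def using h(1) kl(1,2) lic gc(1)
        by (simp add: assoc_mult_mat[of _ r r _ r _ r] mult_carrier_mat[of _ r r _ r])
      also have "\<dots> = (l * li) * (k * g)"
        using h kl lic gc by (simp add: assoc_mult_mat[of _ r r _ r _ r] mult_carrier_mat[of _ r r _ r])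
      finally show ?thesis using li kl gc by (simp add: mult_carrier_mat[of _ r r _ r])
    qed
    ultimately have e: "\<exists>m\<in>GLO r. k * g = l * g * m" by metis
    have lg: "l * g \<in> carrier (GL r)" "k * g \<in> carrier (GL r)"
      using GLg.m_closed[OF GLO_sub_GL[OF kl(4)] g] GLg.m_closed[OF GLO_sub_GL[OF kl(3)] g] by auto
    have "(l * g) <#\<^bsub>GL r\<^esub> GLO r = (k * g) <#\<^bsub>GL r\<^esub> GLO r"
    proof -
      obtain m where m: "m \<in> GLO r" "k * g = l * g * m" using e by blast
      have "l * g * m \<in> (l * g) <#\<^bsub>GL r\<^esub> GLO r" using m by (auto simp: l_coset_def)
      thus ?thesis using GLg.l_repr_independence[OF _ lg(1) GLO_subgroup, of "k * g"] m by simp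
    qed
    thus "(k \<otimes>\<^bsub>GL r\<^esub> g) <#\<^bsub>GL r\<^esub> GLO r = (l \<otimes>\<^bsub>GL r\<^esub> g) <#\<^bsub>GL r\<^esub> GLO r" by simp
  qed (auto intro: GLO_bounded)
qed

sublocale HP: hecke_pair "GL r :: 'a mat monoid" "GLO r"
  by (intro hecke_pair.intro GL_group hecke_pair_axioms.intro GLO_subgroup GL_finite_double)

lemma sym_space_iff: "x \<in> sym_space r \<longleftrightarrow> x \<in> carrier_mat r r \<and> det (x :: 'a mat) \<noteq> 0 \<and> transpose_mat x = x"
  by (auto simp: sym_space_def carrier_GL)

sublocale HS: hecke_space "GL r :: 'a mat monoid" "GLO r" "sym_space r" "(\<bullet>\<^sub>X)"
proof
  fix x g h :: "'a mat"
  assume x: "x \<in> sym_space r" and g: "g \<in> carrier (GL r)"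
  show "x \<bullet>\<^sub>X g \<in> sym_space r" using x g
    by (auto simp: sym_space_iff carrier_GL det_act act_sym)
  assume h: "h \<in> carrier (GL r)"
  show "x \<bullet>\<^sub>X g \<bullet>\<^sub>X h = x \<bullet>\<^sub>X (g \<otimes>\<^bsub>GL r\<^esub> h)" using x g h
    by (simp add: sym_space_iff carrier_GL act_act[of x r g h])
qed (auto simp: sym_space_iff act_one)

lemma orb_iff: "y \<in> HS.orb x \<longleftrightarrow> eqv r x y"
  by (auto simp: HS.orb_def eqv_def)

subsection \<open>Compact open cosets and orbits\<close>

text \<open>The neighbourhoods of the points of a coset that lie in the coset can be taken of the same radius,
  since \<open>GLO r\<close> acts by isometries. So a coset is closed even in the space of all matrices, and it is bounded.\<close>

lemma lcoset_open_compact: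
  assumes g: "g \<in> carrier (GL r)"
  shows "openin (GL_topology av r) (g <#\<^bsub>GL r\<^esub> GLO r)" "compactin (GL_topology av r) (g <#\<^bsub>GL r\<^esub> GLO r)"
proof -
  let ?C = "g <#\<^bsub>GL r\<^esub> GLO r"
  have gc: "g \<in> carrier_mat r r" "det g \<noteq> 0" using g by (auto simp: carrier_GL)
  obtain m where m: "\<And>h. h \<in> carrier_mat r r \<Longrightarrow> bounded_mat r (c powi m) (h - g) \<Longrightarrow> \<exists>k\<in>GLO r. h = g * k"
    using coset_open[OF gc] by blast
  have mem: "h \<in> ?C \<longleftrightarrow> (\<exists>k\<in>GLO r. h = g * k)" for h using HP.mem_lcos[of h g] by simp
  have near: "y \<in> ?C" if z: "z \<in> ?C" and y: "y \<in> carrier_mat r r" "bounded_mat r (c powi m) (y - z)" for y z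
  proof -
    obtain k where k: "k \<in> GLO r" "z = g * k" using z mem by blast
    obtain l where l: "l \<in> GLO r" "k * l = 1\<^sub>m r" "l * k = 1\<^sub>m r" using GLO_inverse[OF k(1)] by blast
    have c: "k \<in> carrier_mat r r" "l \<in> carrier_mat r r" using k l by auto
    have "y * l - g = (y - z) * l"
      using y c gc k(2) l(2) by (simp add: minus_mult_distrib_mat[of _ r r] mult_carrier_mat[of _ r r _ r] assoc_mult_mat[of _ r r _ r _ r])
    moreover have "bounded_mat r (c powi m * 1) ((y - z) * l)"
      using y c gc k(2) GLO_bounded[OF l(1)] by (intro bounded_mat_mult[of _ r]) auto
    ultimately obtain k' where "k' \<in> GLO r" "y * l = g * k'"
      using m[OF mult_carrier_mat[OF y(1) c(2)]] by auto
    moreover have "y = (y * l) * k" using y c l by (simp add: assoc_mult_mat[of _ r r _ r _ r])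
    ultimately have "y = g * (k' * k)" using gc c by (simp add: assoc_mult_mat[of _ r r _ r _ r])
    thus ?thesis using mem \<open>k' \<in> GLO r\<close> k GLO_mult by blast
  qed
  have Cc: "?C \<subseteq> carrier (GL r)" using GLg.m_closed[OF g GLO_sub_GL] by (auto simp: mem)
  hence Cm: "?C \<subseteq> carrier_mat r r" by auto
  have "openin (mat_topology av r) ?C"
    using Cm near by (intro openin_MT_I) blast+
  thus "openin (GL_topology av r) ?C" unfolding GL_topology_def openin_subtopology using Cc by blast
  obtain a where a: "bounded_mat r (c powi (- a)) g" using bounded_mat_exists by blast
  have "compactin (mat_topology av r) ?C"
  proof (rule compact_MT_I[of _ "c powi (- a)"])
    show "?C \<subseteq> {A \<in> carrier_mat r r. bounded_mat r (c powi (- a)) A}"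
    proof
      fix h assume "h \<in> ?C"
      then obtain k where k: "k \<in> GLO r" "h = g * k" using mem by blast
      have "bounded_mat r (c powi (- a) * 1) (g * k)"
        using gc a k GLO_bounded[OF k(1)] by (intro bounded_mat_mult[of _ r]) auto
      thus "h \<in> {A \<in> carrier_mat r r. bounded_mat r (c powi (- a)) A}" using k gc by auto
    qed
    fix A assume A: "A \<in> carrier_mat r r" "A \<notin> ?C"
    have "B \<notin> ?C" if B: "B \<in> carrier_mat r r" "bounded_mat r (c powi m) (B - A)" for B
      using near[of B A] A B bounded_mat_diff_commute[OF A(1) B(1)] by blast
    thus "\<exists>m. \<forall>B\<in>carrier_mat r r. bounded_mat r (c powi m) (B - A) \<longrightarrow> B \<notin> ?C"
      by (intro exI[of _ m] ballI impI)
  qed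
  thus "compactin (GL_topology av r) ?C"
    unfolding GL_topology_def compactin_subtopology using Cc by blast
qed

text \<open>As for cosets, with the addition that a limit of symmetric matrices is symmetric.\<close>

lemma orbit_open_compact:
  assumes x: "x \<in> sym_space r"
  shows "openin (sym_topology av r) (HS.orb x)" "compactin (sym_topology av r) (HS.orb x)"
proof -
  let ?C = "HS.orb x"
  have xc: "x \<in> carrier_mat r r" "transpose_mat x = x" "det x \<noteq> 0" using x by (auto simp: sym_space_iff)
  obtain m where m: "\<And>y. y \<in> carrier_mat r r \<Longrightarrow> transpose_mat y = y \<Longrightarrow>
    bounded_mat r (c powi m) (y - x) \<Longrightarrow> eqv r x y" using orbit_open[OF xc] by blast
  have near: "y \<in> ?C" if z: "z \<in> ?C" and y: "y \<in> carrier_mat r r" "transpose_mat y = y" "bounded_mat r (c powi m) (y - z)" for y z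
  proof -
    obtain k where k: "k \<in> GLO r" "z = x \<bullet>\<^sub>X k" using z by (auto simp: HS.orb_def)
    obtain l where l: "l \<in> GLO r" "k * l = 1\<^sub>m r" "l * k = 1\<^sub>m r" using GLO_inverse[OF k(1)] by blast
    have c: "k \<in> carrier_mat r r" "l \<in> carrier_mat r r" using k l by auto
    have zc: "z \<in> carrier_mat r r" using k xc c by simp
    have "z \<bullet>\<^sub>X l = x" using k(2) xc c l by (simp add: act_act act_one)
    moreover have "(y - z) \<bullet>\<^sub>X l = y \<bullet>\<^sub>X l - z \<bullet>\<^sub>X l"
      unfolding act_def using y zc c
      by (simp add: mult_minus_distrib_mat[of _ r r] minus_mult_distrib_mat[of _ r r])
    moreover have "bounded_mat r (c powi m) ((y - z) \<bullet>\<^sub>X l)"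
      using y zc c GLO_bounded[OF l(1)] by (intro bounded_mat_act) auto
    ultimately have "eqv r x (y \<bullet>\<^sub>X l)" using m[of "y \<bullet>\<^sub>X l"] y c by (simp add: act_sym)
    moreover have "eqv r (y \<bullet>\<^sub>X l) y"
      using eqv_sym[OF y(1) eqv_act[OF l(1)]] .
    ultimately show ?thesis using eqv_trans[OF xc(1)] orb_iff by blast
  qed
  have Cc: "?C \<subseteq> sym_space r" using x GLO_sub_GL by (auto simp: HS.orb_def)
  hence Cm: "?C \<subseteq> carrier_mat r r" by (auto simp: sym_space_iff)
  define U where "U = {B \<in> carrier_mat r r. \<exists>z\<in>?C. bounded_mat r (c powi m) (B - z)}"
  have "openin (mat_topology av r) U"
  proof (rule openin_MT_I)
    fix A assume A: "A \<in> U"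
    then obtain z where z: "z \<in> ?C" "bounded_mat r (c powi m) (A - z)" "A \<in> carrier_mat r r" by (auto simp: U_def)
    have zc: "z \<in> carrier_mat r r" using z Cm by blast
    have "B \<in> U" if B: "B \<in> carrier_mat r r" "bounded_mat r (c powi m) (B - A)" for B
    proof -
      have "av (B $$ (i, j) - z $$ (i, j)) \<le> c powi m" if "i < r" "j < r" for i j
        using av_add_le[of "B $$ (i, j) - A $$ (i, j)" "c powi m" "A $$ (i, j) - z $$ (i, j)"] z zc B that
        by (auto simp: bounded_mat_def)
      hence "bounded_mat r (c powi m) (B - z)" using B zc by (auto simp: bounded_mat_def)
      thus ?thesis using z B by (auto simp: U_def)
    qed
    thus "\<exists>m. \<forall>B\<in>carrier_mat r r. bounded_mat r (c powi m) (B - A) \<longrightarrow> B \<in> U"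
      by (intro exI[of _ m] ballI impI)
  qed (auto simp: U_def)
  moreover have "?C = U \<inter> sym_space r"
  proof (intro equalityI subsetI)
    fix z assume z: "z \<in> ?C"
    hence "bounded_mat r (c powi m) (z - z)" using Cm by (auto simp: bounded_mat_def)
    thus "z \<in> U \<inter> sym_space r" using z Cc Cm by (auto simp: U_def)
  next
    fix y assume "y \<in> U \<inter> sym_space r"
    thus "y \<in> ?C" using near by (auto simp: U_def sym_space_iff)
  qed
  ultimately show "openin (sym_topology av r) ?C" unfolding sym_topology_def openin_subtopology by blast
  obtain a where a: "bounded_mat r (c powi (- a)) x" using bounded_mat_exists by blast
  have "compactin (mat_topology av r) ?C"
  proof (rule compact_MT_I[of _ "c powi (- a)"])
    show "?C \<subseteq> {A \<in> carrier_mat r r. bounded_mat r (c powi (- a)) A}"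
      using xc a by (auto simp: HS.orb_def intro!: bounded_mat_act GLO_bounded)
    fix A assume A: "A \<in> carrier_mat r r" "A \<notin> ?C"
    show "\<exists>m. \<forall>B\<in>carrier_mat r r. bounded_mat r (c powi m) (B - A) \<longrightarrow> B \<notin> ?C"
    proof (cases "transpose_mat A = A")
      case True
      have "B \<notin> ?C" if B: "B \<in> carrier_mat r r" "bounded_mat r (c powi m) (B - A)" for B
        using near[of B A] A B bounded_mat_diff_commute[OF A(1) B(1)] True by blast
      thus ?thesis by (intro exI[of _ m] ballI impI)
    next
      case False
      then obtain i j where ij: "i < r" "j < r" "A $$ (i, j) \<noteq> A $$ (j, i)"
        using A(1) by (metis carrier_matD eq_matI index_transpose_mat)
      then obtain t where t: "av (A $$ (i, j) - A $$ (j, i)) = c powi t"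
        using value_group[of "A $$ (i, j) - A $$ (j, i)"] by auto
      \<comment> \<open>\<open>B\<close> is closer to \<open>A\<close> than the defect \<open>c powi t\<close> of symmetry of \<open>A\<close>, so it is not symmetric either.\<close>
      have "B \<notin> ?C" if B: "B \<in> carrier_mat r r" "bounded_mat r (c powi (t + 1)) (B - A)" for B
      proof
        assume "B \<in> ?C"
        hence "transpose_mat B = B" using Cc by (auto simp: sym_space_iff)
        hence s: "B $$ (i, j) = B $$ (j, i)" using B ij by (metis carrier_matD index_transpose_mat(1))
        have "av (B $$ (i, j) - A $$ (i, j)) \<le> c powi (t + 1)" "av (B $$ (j, i) - A $$ (j, i)) \<le> c powi (t + 1)"
          using B A ij by (auto simp: bounded_mat_def)
        from av_diff_le[OF this(2,1)] have "c powi t \<le> c powi (t + 1)" using s t by simp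
        thus False unfolding c_powi_le_iff by simp
      qed
      thus ?thesis by (intro exI[of _ "t + 1"] ballI impI)
    qed
  qed
  thus "compactin (sym_topology av r) ?C"
    unfolding sym_topology_def compactin_subtopology using Cc by blast
qed

lemma topspace_GL: "topspace (GL_topology av r) = carrier (GL r)"
  by (auto simp: GL_topology_def topspace_MT)

lemma topspace_sym: "topspace (sym_topology av r) = sym_space r"
  by (auto simp: sym_topology_def topspace_MT sym_space_iff)

lemma hecke_algebra_carrier: "carrier (hecke_algebra av r :: ('a mat \<Rightarrow> 'c::comm_ring_1) ring) = HP.hecke"
proof -
  have "compactly_supported (GL_topology av r) T \<longleftrightarrow> finite (HP.csupp T)"
    if T: "\<forall>g\<in>carrier (GL r). \<forall>k\<in>GLO r. \<forall>k'\<in>GLO r. T (k * g * k') = T g" for T :: "'a mat \<Rightarrow> 'c"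
  proof -
    have "T (g * k) = T g" if "g \<in> carrier (GL r)" "k \<in> GLO r" for g k
      using bspec[OF bspec[OF bspec[OF T that(1)] GLO_one] that(2)] left_mult_one_mat[OF GL_carrier_mat[OF that(1)]] by simp
    note TR = this
    have "compactly_supported (GL_topology av r) T \<longleftrightarrow>
      finite ((\<lambda>g. g <#\<^bsub>GL r\<^esub> GLO r) ` {g \<in> topspace (GL_topology av r). T g \<noteq> 0})"
    proof (rule compactly_supported_classes)
      fix g assume "g \<in> topspace (GL_topology av r)"
      hence g: "g \<in> carrier (GL r)" by (simp add: topspace_GL)
      have "g \<in> g <#\<^bsub>GL r\<^esub> GLO r"
        unfolding HP.mem_lcos by (rule bexI[of _ "1\<^sub>m r"]) (use g GLO_one right_mult_one_mat[OF GL_carrier_mat[OF g]] in auto)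
      thus "openin (GL_topology av r) (g <#\<^bsub>GL r\<^esub> GLO r) \<and> compactin (GL_topology av r) (g <#\<^bsub>GL r\<^esub> GLO r)
          \<and> g \<in> g <#\<^bsub>GL r\<^esub> GLO r"
        using lcoset_open_compact[OF g] by simp
    next
      fix g h assume "g \<in> topspace (GL_topology av r)" and h: "h \<in> g <#\<^bsub>GL r\<^esub> GLO r"
      hence g: "g \<in> carrier (GL r)" by (simp add: topspace_GL)
      obtain k where k: "k \<in> GLO r" "h = g \<otimes>\<^bsub>GL r\<^esub> k" using h unfolding HP.mem_lcos by blast
      have h': "h \<in> carrier (GL r)" unfolding k(2) by (rule GLg.m_closed[OF g GLO_sub_GL[OF k(1)]])
      have "g <#\<^bsub>GL r\<^esub> GLO r = h <#\<^bsub>GL r\<^esub> GLO r"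
        by (rule HP.lcos_eq_iff[OF g h', THEN iffD2]) (use k in blast)
      thus "h <#\<^bsub>GL r\<^esub> GLO r = g <#\<^bsub>GL r\<^esub> GLO r" by simp
      show "T h = T g" using TR[OF g k(1)] k(2) by simp
    qed
    thus ?thesis by (simp add: HP.csupp_def topspace_GL)
  qed
  thus ?thesis unfolding hecke_algebra_def HP.hecke_def by (auto simp: GL_integers_eq)
qed

lemma coset_sum_eq: "coset_sum av r \<phi> = HP.csum \<phi>"
  by (simp add: coset_sum_def HP.csum_def left_cosets_def HP.lcs_def GL_integers_eq)

lemma hecke_algebra_eq:
  "hecke_algebra av r = \<lparr>carrier = HP.hecke :: ('a mat \<Rightarrow> 'c::comm_ring_1) set, monoid.mult = HP.conv,
     one = (\<lambda>x. if x \<in> GLO r then 1 else 0), zero = (\<lambda>_. 0), add = (\<lambda>T U x. T x + U x)\<rparr>"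
proof -
  have "monoid.mult (hecke_algebra av r) = (HP.conv :: ('a mat \<Rightarrow> 'c) \<Rightarrow> _)"
    by (simp add: hecke_algebra_def HP.conv_def coset_sum_eq fun_eq_iff)
  thus ?thesis using hecke_algebra_carrier[where 'c = 'c]
    by (simp add: hecke_algebra_def GL_integers_eq)
qed

lemma schwartz_carrier:
  "carrier (schwartz_module av r :: ('a mat \<Rightarrow> 'c::comm_ring_1, 'a mat \<Rightarrow> 'c) module) = HS.schwartz"
proof -
  have 1: "locally_constant (sym_topology av r) f"
      "compactly_supported (sym_topology av r) f \<longleftrightarrow> finite (HS.osupp f)"
    if f: "\<forall>x\<in>sym_space r. \<forall>k\<in>GLO r. f (x \<bullet>\<^sub>X k) = f x" for f :: "'a mat \<Rightarrow> 'c"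
  proof -
    have f': "f y = f x" if "x \<in> sym_space r" "y \<in> HS.orb x" for x y
      using f that by (auto simp: HS.orb_def)
    show "locally_constant (sym_topology av r) f"
      unfolding locally_constant_def topspace_sym
    proof
      fix x :: "'a mat" assume x: "x \<in> sym_space r"
      show "\<exists>U. openin (sym_topology av r) U \<and> x \<in> U \<and> (\<forall>y\<in>U. f y = f x)"
        by (rule exI[of _ "HS.orb x"]) (use orbit_open_compact(1)[OF x] HS.orb_self[OF x] f'[OF x] in blast)
    qed
    have "compactly_supported (sym_topology av r) f \<longleftrightarrow>
      finite (HS.orb ` {x \<in> topspace (sym_topology av r). f x \<noteq> 0})"
    proof (rule compactly_supported_classes)
      fix x assume "x \<in> topspace (sym_topology av r)"
      hence x: "x \<in> sym_space r" by (simp add: topspace_sym)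
      show "openin (sym_topology av r) (HS.orb x) \<and> compactin (sym_topology av r) (HS.orb x) \<and> x \<in> HS.orb x"
        using orbit_open_compact[OF x] HS.orb_self[OF x] by simp
    next
      fix x y assume "x \<in> topspace (sym_topology av r)" and y: "y \<in> HS.orb x"
      hence x: "x \<in> sym_space r" by (simp add: topspace_sym)
      show "HS.orb y = HS.orb x" by (rule HS.orb_mem[OF x y])
      show "f y = f x" by (rule f'[OF x y])
    qed
    thus "compactly_supported (sym_topology av r) f \<longleftrightarrow> finite (HS.osupp f)"
      by (simp add: HS.osupp_def topspace_sym)
  qed
  show ?thesis unfolding schwartz_module_def HS.schwartz_def using 1 by (auto simp: GL_integers_eq)
qed

lemma schwartz_smult_eq: "(\<odot>\<^bsub>schwartz_module av r\<^esub>) = HS.hact"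
  by (simp add: schwartz_module_def HS.hact_def coset_sum_eq fun_eq_iff)

lemma schwartz_add_eq: "(\<oplus>\<^bsub>schwartz_module av r\<^esub>) = (\<lambda>f g x. f x + g x)"
  and schwartz_zero_eq: "\<zero>\<^bsub>schwartz_module av r\<^esub> = (\<lambda>_. 0)"
  by (simp_all add: schwartz_module_def)

lemma schwartz_left_module:
  "left_module (hecke_algebra av r :: ('a mat \<Rightarrow> 'c::comm_ring_1) ring) (schwartz_module av r)"
proof (rule left_module.intro)
  let ?M = "schwartz_module av r :: ('a mat \<Rightarrow> 'c, 'a mat \<Rightarrow> 'c) module"
  let ?H = "hecke_algebra av r :: ('a mat \<Rightarrow> 'c) ring"
  show "ring ?H" unfolding hecke_algebra_eq by (rule HP.hecke_ring)
  show "abelian_group ?M"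
  proof (rule abelian_groupI)
    fix f assume f: "f \<in> carrier ?M"
    define h where "h = (\<lambda>x. (-1) * f x)"
    have "h \<in> HS.schwartz" unfolding h_def
      by (rule HS.schwartz_smult) (use f in \<open>simp add: schwartz_carrier\<close>)
    moreover have "(\<lambda>x. h x + f x) = (\<lambda>_. 0)" by (simp add: h_def)
    ultimately show "\<exists>y\<in>carrier ?M. y \<oplus>\<^bsub>?M\<^esub> f = \<zero>\<^bsub>?M\<^esub>"
      by (intro bexI[of _ h]) (auto simp: schwartz_carrier schwartz_add_eq schwartz_zero_eq)
  qed (auto simp: schwartz_carrier schwartz_add_eq schwartz_zero_eq HS.schwartz_0 HS.schwartz_add algebra_simps)
  show "left_module_axioms ?H ?M"
  proof (rule left_module_axioms.intro, unfold schwartz_carrier schwartz_smult_eq schwartz_add_eq hecke_algebra_eq, simp_all)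
    fix T U f :: "'a mat \<Rightarrow> 'c" assume "T \<in> HP.hecke" "U \<in> HP.hecke" "f \<in> HS.schwartz"
    thus "HS.hact (HP.conv T U) f = HS.hact T (HS.hact U f)"
      using HS.hact_assoc[of T U f _ "HP.conv T U"] by (auto simp: fun_eq_iff HP.conv_def HS.hact_def)
  qed (auto simp: HS.hact_closed HS.hact_add_left HS.hact_add_right HS.hact_one)
qed

end

section \<open>Signs\<close>

definition signs :: "nat \<Rightarrow> (nat \<Rightarrow> int) set" where
  "signs r = {..<r} \<rightarrow>\<^sub>E {1, -1}"

definition sgnchar :: "nat \<Rightarrow> (nat \<Rightarrow> int) \<Rightarrow> (nat \<Rightarrow> int) \<Rightarrow> int" where
  "sgnchar r s \<eta> = (\<Prod>i<r. sign_char (s i) (\<eta> i))"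

definition sgntimes :: "nat \<Rightarrow> (nat \<Rightarrow> int) \<Rightarrow> (nat \<Rightarrow> int) \<Rightarrow> (nat \<Rightarrow> int)" where
  "sgntimes r \<eta> \<zeta> = (\<lambda>i\<in>{..<r}. \<eta> i * \<zeta> i)"

lemma finite_signs [simp]: "finite (signs r)"
  unfolding signs_def by (intro finite_PiE) auto

lemma card_signs: "card (signs r) = 2 ^ r"
  unfolding signs_def by (subst card_PiE) (auto simp: numeral_2_eq_2)

lemma signs_mem: "\<eta> \<in> signs r \<Longrightarrow> i < r \<Longrightarrow> \<eta> i = 1 \<or> \<eta> i = -1"
  unfolding signs_def by (auto dest: PiE_mem)

lemma signs_eqI: "\<eta> \<in> signs r \<Longrightarrow> \<zeta> \<in> signs r \<Longrightarrow> (\<And>i. i < r \<Longrightarrow> \<eta> i = \<zeta> i) \<Longrightarrow> \<eta> = \<zeta>"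
  unfolding signs_def by (rule PiE_ext) auto

lemma sgntimes_signs: "\<eta> \<in> signs r \<Longrightarrow> \<zeta> \<in> signs r \<Longrightarrow> sgntimes r \<eta> \<zeta> \<in> signs r"
proof -
  assume e: "\<eta> \<in> signs r" and z: "\<zeta> \<in> signs r"
  have "\<eta> i * \<zeta> i \<in> {1, -1}" if "i < r" for i
    using signs_mem[OF e that] signs_mem[OF z that] by auto
  thus ?thesis by (auto simp: signs_def sgntimes_def)
qed

lemma sgntimes_self: "\<eta> \<in> signs r \<Longrightarrow> \<zeta> \<in> signs r \<Longrightarrow> sgntimes r \<eta> (sgntimes r \<eta> \<zeta>) = \<zeta>"
proof (rule signs_eqI[of _ r])
  fix i assume "\<eta> \<in> signs r" "i < r"
  thus "sgntimes r \<eta> (sgntimes r \<eta> \<zeta>) i = \<zeta> i"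
    using signs_mem[of \<eta> r i] by (auto simp: sgntimes_def)
qed (auto intro: sgntimes_signs)

lemma sgnchar_times:
  assumes "\<eta> \<in> signs r" "\<zeta> \<in> signs r"
  shows "sgnchar r s (sgntimes r \<eta> \<zeta>) = sgnchar r s \<eta> * sgnchar r s \<zeta>"
  unfolding sgnchar_def prod.distrib[symmetric]
proof (rule prod.cong[OF refl])
  fix i assume "i \<in> {..<r}"
  hence i: "i < r" by simp
  show "sign_char (s i) (sgntimes r \<eta> \<zeta> i) = sign_char (s i) (\<eta> i) * sign_char (s i) (\<zeta> i)"
    using i sign_char_times[OF signs_mem[OF assms(1) i] signs_mem[OF assms(2) i]] by (simp add: sgntimes_def)
qed

lemma sgnchar_square: "\<eta> \<in> signs r \<Longrightarrow> sgnchar r s \<eta> * sgnchar r s \<eta> = 1"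
proof -
  assume e: "\<eta> \<in> signs r"
  have "sign_char (s i) (\<eta> i) * sign_char (s i) (\<eta> i) = 1" if "i < r" for i
    using signs_mem[OF e that] by (auto simp: sign_char_def)
  thus ?thesis by (simp add: sgnchar_def flip: prod.distrib)
qed

text \<open>The orthogonality relations for the characters of \<open>{1, -1}\<^sup>r\<close>; both are products over the
  coordinates of the case of a single sign.\<close>

lemma sgnchar_orthogonal:
  assumes "s \<in> signs r" "s' \<in> signs r"
  shows "(\<Sum>\<eta>\<in>signs r. sgnchar r s \<eta> * sgnchar r s' \<eta>) = (if s = s' then 2 ^ r else 0)"
proof -
  have "(\<Sum>\<eta>\<in>signs r. sgnchar r s \<eta> * sgnchar r s' \<eta>)
      = (\<Sum>\<eta>\<in>signs r. \<Prod>i<r. sign_char (s i) (\<eta> i) * sign_char (s' i) (\<eta> i))"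
    by (simp add: sgnchar_def prod.distrib)
  also have "\<dots> = (\<Prod>i<r. \<Sum>x\<in>{1, -1}. sign_char (s i) x * sign_char (s' i) x)"
    unfolding signs_def by (rule prod_sum_PiE[symmetric]) auto
  also have "\<dots> = (\<Prod>i<r. if s i = s' i then 2 else 0)"
  proof (rule prod.cong[OF refl])
    fix i assume "i \<in> {..<r}"
    hence "i < r" by simp
    from signs_mem[OF assms(1) this] signs_mem[OF assms(2) this]
    show "(\<Sum>x\<in>{1, -1}. sign_char (s i) x * sign_char (s' i) x) = (if s i = s' i then 2 else 0)"
      by (auto simp: sign_char_def)
  qed
  also have "\<dots> = (if s = s' then 2 ^ r else 0)"
  proof (cases "s = s'")
    case False
    then obtain i where "i < r" "s i \<noteq> s' i" using signs_eqI[OF assms] by blast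
    thus ?thesis using False by (auto simp: prod_zero_iff)
  qed simp
  finally show ?thesis .
qed

lemma sgnchar_orthogonal_dual:
  assumes "\<eta> \<in> signs r" "\<zeta> \<in> signs r"
  shows "(\<Sum>s\<in>signs r. sgnchar r s \<eta> * sgnchar r s \<zeta>) = (if \<eta> = \<zeta> then 2 ^ r else 0)"
proof -
  have "(\<Sum>s\<in>signs r. sgnchar r s \<eta> * sgnchar r s \<zeta>)
      = (\<Sum>s\<in>signs r. \<Prod>i<r. sign_char (s i) (\<eta> i) * sign_char (s i) (\<zeta> i))"
    by (simp add: sgnchar_def prod.distrib)
  also have "\<dots> = (\<Prod>i<r. \<Sum>x\<in>{1, -1}. sign_char x (\<eta> i) * sign_char x (\<zeta> i))"
    unfolding signs_def by (rule prod_sum_PiE[symmetric]) auto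
  also have "\<dots> = (\<Prod>i<r. if \<eta> i = \<zeta> i then 2 else 0)"
  proof (rule prod.cong[OF refl])
    fix i assume "i \<in> {..<r}"
    hence "i < r" by simp
    from signs_mem[OF assms(1) this] signs_mem[OF assms(2) this]
    show "(\<Sum>x\<in>{1, -1}. sign_char x (\<eta> i) * sign_char x (\<zeta> i)) = (if \<eta> i = \<zeta> i then 2 else 0)"
      by (auto simp: sign_char_def)
  qed
  also have "\<dots> = (if \<eta> = \<zeta> then 2 ^ r else 0)"
  proof (cases "\<eta> = \<zeta>")
    case False
    then obtain i where "i < r" "\<eta> i \<noteq> \<zeta> i" using signs_eqI[OF assms] by blast
    thus ?thesis using False by (auto simp: prod_zero_iff)
  qed simp
  finally show ?thesis .
qed

section \<open>Characteristic functions of orbits\<close>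

context odd_padic_rank begin

lemma unit_sign_eq: "unit_sign av u = sgn u"
  by (auto simp: unit_sign_def sgn_def sq_unit_def unit_integers_def)

lemma sign_rep:
  assumes "x = 1 \<or> x = -1"
  shows "av (sign_rep av x) = 1" "sgn (sign_rep av x) = x"
proof -
  have "\<exists>u. u \<in> unit_integers av \<and> unit_sign av u = x"
  proof -
    obtain v where v: "av v = 1" "\<not> sq_unit v" using square_classes(1) by blast
    from assms show ?thesis
    proof
      assume "x = 1" thus ?thesis by (intro exI[of _ 1]) (simp add: unit_integers_def unit_sign_eq sgn_def)
    next
      assume "x = -1" thus ?thesis using v by (intro exI[of _ v]) (simp add: unit_integers_def unit_sign_eq sgn_def)
    qed
  qed
  hence "sign_rep av x \<in> unit_integers av \<and> unit_sign av (sign_rep av x) = x"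
    unfolding sign_rep_def by (rule someI_ex)
  thus "av (sign_rep av x) = 1" "sgn (sign_rep av x) = x" by (auto simp: unit_integers_def unit_sign_eq)
qed

definition srep :: "(nat \<Rightarrow> int) \<Rightarrow> nat \<Rightarrow> 'a" where "srep \<eta> i = sign_rep av (\<eta> i)"

definition dmat :: "(nat \<Rightarrow> int) \<Rightarrow> (nat \<Rightarrow> int) \<Rightarrow> 'a mat" where
  "dmat e \<eta> = diagpi r e (srep \<eta>)"

lemma srep_units: "\<eta> \<in> signs r \<Longrightarrow> units_on r (srep \<eta>)"
  unfolding units_on_def srep_def using sign_rep(1)[OF signs_mem] by simp

lemma srep_sgn: "\<eta> \<in> signs r \<Longrightarrow> i < r \<Longrightarrow> sgn (srep \<eta> i) = \<eta> i"
  unfolding srep_def by (rule sign_rep(2)[OF signs_mem])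

lemma srep_sgnchar: "\<eta> \<in> signs r \<Longrightarrow> (\<Prod>i<r. sign_char (s i) (sgn (srep \<eta> i))) = sgnchar r s \<eta>"
  unfolding sgnchar_def by (intro prod.cong) (auto simp: srep_sgn)

lemma dmat_carrier [simp]: "dmat e \<eta> \<in> carrier_mat r r"
  by (simp add: dmat_def)

lemma dmat_sym_space: "\<eta> \<in> signs r \<Longrightarrow> dmat e \<eta> \<in> sym_space r"
  using det_diagpi_nz[OF srep_units] by (simp add: sym_space_iff dmat_def)

lemma dmat_eqv_iff:
  assumes "dominant r e" "\<eta> \<in> signs r" "\<zeta> \<in> signs r"
  shows "eqv r (dmat e \<eta>) (dmat e \<zeta>) \<longleftrightarrow> (\<forall>s. block_const r e s \<longrightarrow> sgnchar r s \<eta> = sgnchar r s \<zeta>)"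
proof
  assume "eqv r (dmat e \<eta>) (dmat e \<zeta>)"
  from eqv_invariants[OF assms(1) srep_units[OF assms(2)] assms(1) srep_units[OF assms(3)] this[unfolded dmat_def]]
  show "\<forall>s. block_const r e s \<longrightarrow> sgnchar r s \<eta> = sgnchar r s \<zeta>"
    by (simp only: srep_sgnchar[OF assms(2)] srep_sgnchar[OF assms(3)]) blast
next
  assume "\<forall>s. block_const r e s \<longrightarrow> sgnchar r s \<eta> = sgnchar r s \<zeta>"
  thus "eqv r (dmat e \<eta>) (dmat e \<zeta>)" unfolding dmat_def
    by (intro eqv_of_invariants assms srep_units) (simp only: srep_sgnchar[OF assms(2)] srep_sgnchar[OF assms(3)])
qed

text \<open>The exponents are restricted to the indices below \<open>r\<close>, so that types can be compared as functions.\<close>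

definition types :: "(nat \<Rightarrow> int) set" where
  "types = {e \<in> {..<r} \<rightarrow>\<^sub>E UNIV. dominant r e}"

lemma types_dominant: "e \<in> types \<Longrightarrow> dominant r e" by (simp add: types_def)

lemma types_eqI: "e \<in> types \<Longrightarrow> f \<in> types \<Longrightarrow> (\<And>i. i < r \<Longrightarrow> e i = f i) \<Longrightarrow> e = f"
  unfolding types_def by (intro PiE_ext[of e "{..<r}" "\<lambda>_. UNIV" f]) auto

definition has_type :: "'a mat \<Rightarrow> (nat \<Rightarrow> int) \<Rightarrow> bool" where
  "has_type x e \<longleftrightarrow> (\<exists>\<eta>\<in>signs r. eqv r x (dmat e \<eta>))"

lemma has_type_exists:
  assumes "x \<in> sym_space r" shows "\<exists>e\<in>types. has_type x e"
proof -
  have x: "x \<in> carrier_mat r r" "transpose_mat x = x" "det x \<noteq> 0" using assms by (auto simp: sym_space_iff)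
  obtain e u where eu: "dominant r e" "units_on r u" "eqv r x (diagpi r e u)" using diagonalization[OF x] by blast
  define \<eta> where "\<eta> = (\<lambda>i\<in>{..<r}. sgn (u i))"
  define f where "f = (\<lambda>i\<in>{..<r}. e i)"
  have "sgn (u i) \<in> {1, -1}" for i by (simp add: sgn_def)
  hence \<eta>: "\<eta> \<in> signs r" unfolding \<eta>_def signs_def by simp
  have D: "dmat f \<eta> = diagpi r e (srep \<eta>)" unfolding dmat_def by (rule diagpi_cong) (auto simp: f_def)
  have "eqv r (diagpi r e u) (diagpi r e (srep \<eta>))"
    by (rule eqv_of_invariants[OF eu(1,2) srep_units[OF \<eta>]], rule prod.cong)
      (auto simp: srep_sgn[OF \<eta>], simp add: \<eta>_def)
  hence "eqv r x (dmat f \<eta>)" unfolding D by (rule eqv_trans[OF x(1) eu(3)])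
  moreover have "f \<in> types" using eu(1) by (auto simp: types_def f_def dominant_def)
  ultimately show ?thesis using \<eta> by (auto simp: has_type_def)
qed

lemma has_type_unique:
  assumes "x \<in> carrier_mat r r" "has_type x e" "has_type x f" "e \<in> types" "f \<in> types"
  shows "e = f"
proof -
  obtain \<eta> \<zeta> where h: "\<eta> \<in> signs r" "eqv r x (dmat e \<eta>)" "\<zeta> \<in> signs r" "eqv r x (dmat f \<zeta>)"
    using assms by (auto simp: has_type_def)
  have "eqv r (dmat e \<eta>) (dmat f \<zeta>)"
    using eqv_trans[OF dmat_carrier eqv_sym[OF assms(1) h(2)] h(4)] .
  from eqv_invariants[OF types_dominant[OF assms(4)] srep_units[OF h(1)] types_dominant[OF assms(5)] srep_units[OF h(3)] this[unfolded dmat_def]]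
  show ?thesis using types_eqI[OF assms(4,5)] by blast
qed

lemma has_type_dmat: "\<eta> \<in> signs r \<Longrightarrow> has_type (dmat e \<eta>) e"
  unfolding has_type_def using eqv_refl[OF dmat_carrier] by blast

abbreviation dchar :: "(nat \<Rightarrow> int) \<Rightarrow> (nat \<Rightarrow> int) \<Rightarrow> 'a mat \<Rightarrow> 'c::comm_ring_1" where
  "dchar s e \<equiv> delta_char av \<pi> r s e"

lemma dchar_eq:
  "dchar s e x = (\<Sum>\<eta>\<in>signs r. of_int (sgnchar r s \<eta>) * (if eqv r (dmat e \<eta>) x then 1 else 0))"
  unfolding delta_char_def delta_def orbit_char_def GL_integers_eq eqv_def dmat_def diagpi_def srep_def
    sgnchar_def signs_def by simp

lemma dchar_schwartz: "(dchar s e :: 'a mat \<Rightarrow> 'c::comm_ring_1) \<in> HS.schwartz"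
proof -
  have "(\<lambda>x. of_int (sgnchar r s \<eta>) * (if eqv r (dmat e \<eta>) x then 1 else 0)) \<in> (HS.schwartz :: ('a mat \<Rightarrow> 'c) set)"
    if \<eta>: "\<eta> \<in> signs r" for \<eta>
  proof (rule HS.schwartz_smult)
    let ?f = "\<lambda>x. if eqv r (dmat e \<eta>) x then 1 else 0 :: 'c"
    have inX: "x \<in> sym_space r" if "eqv r (dmat e \<eta>) x" for x
      using that dmat_sym_space[OF \<eta>, of e] GLO_sub_GL by (auto simp: eqv_def)
    have "eqv r (dmat e \<eta>) (x \<bullet>\<^sub>X k) \<longleftrightarrow> eqv r (dmat e \<eta>) x" if "x \<in> sym_space r" "k \<in> GLO r" for x k
    proof -
      have x: "x \<in> carrier_mat r r" using that by (simp add: sym_space_iff)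
      have 1: "eqv r x (x \<bullet>\<^sub>X k)" using eqv_act[OF that(2)] .
      show ?thesis using eqv_trans[OF dmat_carrier _ 1] eqv_trans[OF dmat_carrier _ eqv_sym[OF x 1]] by blast
    qed
    moreover have "HS.osupp ?f \<subseteq> {HS.orb (dmat e \<eta>)}"
    proof
      fix C assume "C \<in> HS.osupp ?f"
      then obtain x where x: "C = HS.orb x" "eqv r (dmat e \<eta>) x" by (auto simp: HS.osupp_def split: if_splits)
      have "x \<in> HS.orb (dmat e \<eta>)" using x orb_iff by blast
      thus "C \<in> {HS.orb (dmat e \<eta>)}" using HS.orb_mem[OF dmat_sym_space[OF \<eta>]] x by simp
    qed
    hence "finite (HS.osupp ?f)" by (rule finite_subset) simp
    ultimately show "?f \<in> HS.schwartz" using inX by (auto simp: HS.schwartz_def)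
  qed
  from HS.schwartz_sum[OF this] show ?thesis unfolding dchar_eq[abs_def] .
qed

lemma dchar_nonzero:
  assumes "dchar s e x \<noteq> (0 :: 'c::comm_ring_1)" obtains \<eta> where "\<eta> \<in> signs r" "eqv r (dmat e \<eta>) x"
proof -
  have "\<exists>\<eta>\<in>signs r. eqv r (dmat e \<eta>) x"
  proof (rule ccontr)
    assume "\<not> ?thesis"
    hence "dchar s e x = (0 :: 'c)" unfolding dchar_eq by (intro sum.neutral) auto
    thus False using assms by simp
  qed
  thus ?thesis using that by blast
qed

text \<open>For dominant \<open>e\<close>, the number of sign vectors that yield the same orbit as a given one.\<close>

definition stab_count :: "(nat \<Rightarrow> int) \<Rightarrow> nat" where
  "stab_count e = card {\<zeta> \<in> signs r. \<forall>s. block_const r e s \<longrightarrow> sgnchar r s \<zeta> = 1}"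

text \<open>Multiplication by \<open>\<eta>\<close> is a bijection onto the class of the trivial sign vector.\<close>

lemma class_card:
  assumes "\<eta> \<in> signs r"
  shows "card {\<zeta> \<in> signs r. \<forall>s. block_const r e s \<longrightarrow> sgnchar r s \<eta> = sgnchar r s \<zeta>} = stab_count e"
proof -
  let ?A = "{\<zeta> \<in> signs r. \<forall>s. block_const r e s \<longrightarrow> sgnchar r s \<eta> = sgnchar r s \<zeta>}"
  let ?B = "{\<zeta> \<in> signs r. \<forall>s. block_const r e s \<longrightarrow> sgnchar r s \<zeta> = 1}"
  have "bij_betw (sgntimes r \<eta>) ?A ?B"
  proof (rule bij_betwI[where g = "sgntimes r \<eta>"])
    show "sgntimes r \<eta> \<in> ?A \<rightarrow> ?B"
    proof (intro funcsetI CollectI conjI allI impI)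
      fix \<zeta> assume z: "\<zeta> \<in> ?A"
      thus "sgntimes r \<eta> \<zeta> \<in> signs r" using assms sgntimes_signs by blast
      fix s assume "block_const r e s"
      hence "sgnchar r s \<zeta> = sgnchar r s \<eta>" using z by simp
      thus "sgnchar r s (sgntimes r \<eta> \<zeta>) = 1" using sgnchar_times[OF assms, of \<zeta> s] z sgnchar_square[OF assms] by simp
    qed
    show "sgntimes r \<eta> \<in> ?B \<rightarrow> ?A"
    proof (intro funcsetI CollectI conjI allI impI)
      fix \<zeta> assume z: "\<zeta> \<in> ?B"
      thus "sgntimes r \<eta> \<zeta> \<in> signs r" using assms sgntimes_signs by blast
      fix s assume "block_const r e s"
      hence "sgnchar r s \<zeta> = 1" using z by simp
      thus "sgnchar r s \<eta> = sgnchar r s (sgntimes r \<eta> \<zeta>)" using sgnchar_times[OF assms, of \<zeta> s] z by simp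
    qed
  qed (use assms sgntimes_self in auto)
  thus ?thesis unfolding stab_count_def by (rule bij_betw_same_card)
qed

text \<open>The counted sign vectors form a subgroup of \<open>{1, -1}\<^sup>r\<close>, with the fibres of the block products
  as cosets. The order is therefore invertible wherever two is.\<close>

lemma stab_count_dvd: "stab_count e dvd 2 ^ r"
proof -
  let ?R = "{(\<eta>, \<zeta>). \<eta> \<in> signs r \<and> \<zeta> \<in> signs r \<and> (\<forall>s. block_const r e s \<longrightarrow> sgnchar r s \<eta> = sgnchar r s \<zeta>)}"
  have eq: "equiv (signs r) ?R"
    by (rule equivI) (auto simp: refl_on_def sym_def trans_def)
  have dv: "stab_count e dvd card X" if X: "X \<in> signs r // ?R" for X
  proof -
    obtain \<eta> where "\<eta> \<in> signs r" "X = ?R `` {\<eta>}" using X by (auto simp: quotient_def)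
    moreover from this have "X = {\<zeta> \<in> signs r. \<forall>s. block_const r e s \<longrightarrow> sgnchar r s \<eta> = sgnchar r s \<zeta>}" by auto
    ultimately show ?thesis using class_card by simp
  qed
  have "stab_count e dvd card (signs r)" by (rule equiv_imp_dvd_card[OF finite_signs eq dv])
  thus ?thesis by (simp add: card_signs)
qed

lemma dchar_dmat:
  assumes "dominant r e" "block_const r e s" "\<eta> \<in> signs r"
  shows "dchar s e (dmat e \<eta>) = of_int (sgnchar r s \<eta>) * of_nat (stab_count e)"
proof -
  let ?C = "{\<zeta> \<in> signs r. \<forall>s. block_const r e s \<longrightarrow> sgnchar r s \<eta> = sgnchar r s \<zeta>}"
  have "dchar s e (dmat e \<eta>) = (\<Sum>\<zeta>\<in>signs r. if \<zeta> \<in> ?C then of_int (sgnchar r s \<eta>) else 0)"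
    unfolding dchar_eq
  proof (rule sum.cong[OF refl])
    fix \<zeta> assume z: "\<zeta> \<in> signs r"
    have "eqv r (dmat e \<zeta>) (dmat e \<eta>) \<longleftrightarrow> \<zeta> \<in> ?C"
      using dmat_eqv_iff[OF assms(1) z assms(3)] z by auto
    moreover have "sgnchar r s \<zeta> = sgnchar r s \<eta>" if "\<zeta> \<in> ?C" using that assms(2) by simp
    ultimately show "of_int (sgnchar r s \<zeta>) * (if eqv r (dmat e \<zeta>) (dmat e \<eta>) then 1 else 0)
      = (if \<zeta> \<in> ?C then of_int (sgnchar r s \<eta>) else 0)"
      by (cases "\<zeta> \<in> ?C") (simp_all del: mem_Collect_eq)
  qed
  also have "\<dots> = (\<Sum>\<zeta>\<in>?C. of_int (sgnchar r s \<eta>))"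
    by (subst sum.inter_filter[symmetric]) (auto intro!: sum.cong)
  also have "\<dots> = of_int (sgnchar r s \<eta>) * of_nat (stab_count e)"
    using class_card[OF assms(3), of e] by (simp add: mult.commute)
  finally show ?thesis .
qed

section \<open>The Hecke operators of dominant cocharacters\<close>

text \<open>With the exponent \<open>- l\<close> the operator raises types: a form of type \<open>e + 2 l\<close> is moved to one of type \<open>e\<close>.\<close>

definition hop :: "(nat \<Rightarrow> int) \<Rightarrow> 'a mat \<Rightarrow> 'c::comm_ring_1" where
  "hop l = (\<lambda>x. if \<exists>k\<in>GLO r. \<exists>k'\<in>GLO r. x = k * dpi r (\<lambda>i. - l i) * k' then 1 else 0)"

lemma dpi_GL: "dpi r l \<in> carrier (GL r)"
  using det_dpi_nz by (simp add: carrier_GL)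

lemma hop_hecke: "(hop l :: 'a mat \<Rightarrow> 'c::comm_ring_1) \<in> HP.hecke"
  using HP.hecke_double_coset[OF dpi_GL[of "\<lambda>i. - l i"]] unfolding hop_def by simp

lemma csum_nonzero:
  assumes "HP.csum \<phi> \<noteq> (0 :: 'c::comm_ring_1)"
  obtains g where "g \<in> carrier (GL r)" "\<phi> g \<noteq> 0"
proof -
  have "\<exists>g\<in>carrier (GL r). \<phi> g \<noteq> 0"
  proof (rule ccontr)
    assume "\<not> ?thesis"
    hence "HP.csum \<phi> = HP.csum (\<lambda>_. 0)" by (intro HP.csum_cong) auto
    also have "\<dots> = 0" by (simp add: HP.csum_def)
    finally show False using assms by simp
  qed
  thus ?thesis using that by blast
qed

lemma hop_nonzero:
  assumes "hop l g \<noteq> (0 :: 'c::comm_ring_1)"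
  obtains k k' where "k \<in> GLO r" "k' \<in> GLO r" "g = k * dpi r (\<lambda>i. - l i) * k'"
proof -
  have "\<exists>k\<in>GLO r. \<exists>k'\<in>GLO r. g = k * dpi r (\<lambda>i. - l i) * k'"
  proof (rule ccontr)
    assume "\<not> ?thesis"
    hence "hop l g = (0 :: 'c)" unfolding hop_def by (rule if_not_P)
    thus False using assms by contradiction
  qed
  thus ?thesis using that by blast
qed

text \<open>If the value at \<open>x\<close> does not vanish, then some \<open>x \<cdot> k \<pi>\<^sup>-\<^sup>l\<close> has type \<open>e\<close>, and the types with respect to the two
  lattices can be compared. The sums agree because the determinants do.\<close>

lemma hact_hop_support:
  assumes e: "dominant r e" and l: "dominant r l" and f: "dominant r f" "has_type x f"
    and x: "x \<in> sym_space r" and ne: "HS.hact (hop l) (dchar s e) x \<noteq> (0 :: 'c::comm_ring_1)"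
  shows "lexge r f (\<lambda>i. e i + 2 * l i)" "(\<Sum>i<r. f i) = (\<Sum>i<r. e i + 2 * l i)"
proof -
  have xc: "x \<in> carrier_mat r r" "transpose_mat x = x" "det x \<noteq> 0" using x by (auto simp: sym_space_iff)
  have "HP.csum (\<lambda>g. hop l g * dchar s e (x \<bullet>\<^sub>X g)) \<noteq> (0 :: 'c)" using ne x by (simp add: HS.hact_def)
  then obtain g where g: "g \<in> carrier (GL r)" "hop l g * dchar s e (x \<bullet>\<^sub>X g) \<noteq> (0 :: 'c)" by (rule csum_nonzero)
  have g1: "hop l g \<noteq> (0 :: 'c)" and g2: "dchar s e (x \<bullet>\<^sub>X g) \<noteq> (0 :: 'c)" using g(2) by auto
  obtain k k' where k: "k \<in> GLO r" "k' \<in> GLO r" "g = k * dpi r (\<lambda>i. - l i) * k'" using g1 by (rule hop_nonzero)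
  obtain \<theta> where \<theta>: "\<theta> \<in> signs r" "eqv r (dmat e \<theta>) (x \<bullet>\<^sub>X g)" using g2 by (rule dchar_nonzero)
  obtain \<eta> where \<eta>: "\<eta> \<in> signs r" "eqv r x (dmat f \<eta>)" using f(2) by (auto simp: has_type_def)
  have kc: "k \<in> carrier_mat r r" "k' \<in> carrier_mat r r" using k by auto
  define y where "y = x \<bullet>\<^sub>X k"
  have y: "y \<in> carrier_mat r r" "transpose_mat y = y" using xc kc act_sym[OF xc(1) kc(1) xc(2)] by (auto simp: y_def)
  define A where "A = y \<bullet>\<^sub>X dpi r (\<lambda>i. - l i)"
  have A: "A \<in> carrier_mat r r" "transpose_mat A = A" using y act_sym[OF y(1) dpi_carrier y(2)] by (auto simp: A_def)
  have kd: "k * dpi r (\<lambda>i. - l i) \<in> carrier_mat r r" using kc by (intro mult_carrier_mat[of _ r r]) auto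
  have "x \<bullet>\<^sub>X g = A \<bullet>\<^sub>X k'"
    unfolding A_def y_def k(3) act_act[OF xc(1) kc(1) dpi_carrier] act_act[OF xc(1) kd kc(2)] ..
  hence E1: "eqv r A (x \<bullet>\<^sub>X g)" using eqv_act[OF k(2)] by simp
  have xg: "x \<bullet>\<^sub>X g \<in> carrier_mat r r" using xc g by simp
  have EA: "eqv r A (dmat e \<theta>)" using eqv_trans[OF A(1) E1 eqv_sym[OF dmat_carrier \<theta>(2)]] .
  have Ay: "A \<bullet>\<^sub>X dpi r l = y"
    unfolding A_def using act_act[OF y(1) dpi_carrier dpi_carrier] by (simp add: dpi_inverse act_one[OF y(1)])
  have Ey: "eqv r y (dmat f \<eta>)"
    using eqv_trans[OF y(1) eqv_sym[OF xc(1) eqv_act[OF k(1), of x, folded y_def]] \<eta>(2)] .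
  show "lexge r f (\<lambda>i. e i + 2 * l i)"
    using simultaneous_reduction[OF A e srep_units[OF \<theta>(1)] EA[unfolded dmat_def] l f(1) srep_units[OF \<eta>(1)]] Ay Ey
    by (simp add: dmat_def)
  have "c powi (\<Sum>i<r. f i) = av (det y)"
    using eqv_det[OF y(1) Ey] av_det_diagpi[OF srep_units[OF \<eta>(1)], of f] by (simp add: dmat_def)
  also have "\<dots> = av (det (dpi r l))^2 * av (det A)"
    using det_act[OF A(1) dpi_carrier, of l] by (simp add: Ay av_mult av_power)
  also have "av (det A) = av (det (dmat e \<theta>))" using eqv_det[OF A(1) EA] by simp
  also have "av (det (dpi r l))^2 * av (det (dmat e \<theta>)) = av (det (dmat e \<theta> \<bullet>\<^sub>X dpi r l))"
    using det_act[OF dmat_carrier dpi_carrier, of e \<theta> l] by (simp add: av_mult av_power)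
  also have "dmat e \<theta> \<bullet>\<^sub>X dpi r l = diagpi r (\<lambda>i. e i + 2 * l i) (srep \<theta>)"
    unfolding dmat_def by (rule diagpi_act_dpi)
  also have "av (det \<dots>) = c powi (\<Sum>i<r. e i + 2 * l i)" by (rule av_det_diagpi[OF srep_units[OF \<theta>(1)]])
  finally show "(\<Sum>i<r. f i) = (\<Sum>i<r. e i + 2 * l i)" by simp
qed

text \<open>At a diagonal form of type \<open>e + 2 l\<close> only the left coset of \<open>\<pi>\<^sup>-\<^sup>l\<close> contributes, by rigidity, and it moves
  the form to the diagonal form of type \<open>e\<close> with the same signs.\<close>

lemma hact_hop_leading:
  assumes e: "dominant r e" "block_const r e s" and l: "dominant r l" and \<eta>: "\<eta> \<in> signs r"
    and f: "\<And>i. i < r \<Longrightarrow> f i = e i + 2 * l i"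
  shows "HS.hact (hop l) (dchar s e) (dmat f \<eta>) = of_int (sgnchar r s \<eta>) * (of_nat (stab_count e) :: 'c::comm_ring_1)"
proof -
  define x where "x = dmat f \<eta>"
  have x: "x \<in> sym_space r" unfolding x_def by (rule dmat_sym_space[OF \<eta>])
  have xc: "x \<in> carrier_mat r r" by (simp add: x_def)
  have xe: "x = diagpi r (\<lambda>i. e i + 2 * l i) (srep \<eta>)" unfolding x_def dmat_def using f by (intro diagpi_cong) auto
  let ?d = "dpi r (\<lambda>i. - l i)"
  let ?\<phi> = "\<lambda>g. hop l g * dchar s e (x \<bullet>\<^sub>X g) :: 'c"
  have "HP.csum ?\<phi> = ?\<phi> ?d"
  proof (rule HP.csum_single[OF HS.rinv_integrand[OF hop_hecke dchar_schwartz x] dpi_GL])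
    fix h assume h: "h \<in> carrier (GL r)" "?\<phi> h \<noteq> 0"
    have h1: "hop l h \<noteq> (0 :: 'c)" and h2: "dchar s e (x \<bullet>\<^sub>X h) \<noteq> (0 :: 'c)" using h(2) by auto
    obtain k k' where k: "k \<in> GLO r" "k' \<in> GLO r" "h = k * ?d * k'" using h1 by (rule hop_nonzero)
    obtain \<theta> where \<theta>: "\<theta> \<in> signs r" "eqv r (dmat e \<theta>) (x \<bullet>\<^sub>X h)" using h2 by (rule dchar_nonzero)
    have kc: "k \<in> carrier_mat r r" "k' \<in> carrier_mat r r" using k by auto
    have kd: "k * ?d \<in> carrier_mat r r" using kc by (intro mult_carrier_mat[of _ r r]) auto
    have xk: "x \<bullet>\<^sub>X k \<bullet>\<^sub>X ?d \<in> carrier_mat r r" using xc kc by simp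
    have "x \<bullet>\<^sub>X h = x \<bullet>\<^sub>X k \<bullet>\<^sub>X ?d \<bullet>\<^sub>X k'"
      unfolding k(3) act_act[OF xc kc(1) dpi_carrier] act_act[OF xc kd kc(2)] ..
    hence E1: "eqv r (x \<bullet>\<^sub>X k \<bullet>\<^sub>X ?d) (x \<bullet>\<^sub>X h)" using eqv_act[OF k(2)] by simp
    have "eqv r (x \<bullet>\<^sub>X k \<bullet>\<^sub>X ?d) (dmat e \<theta>)" using eqv_trans[OF xk E1 eqv_sym[OF dmat_carrier \<theta>(2)]] .
    hence m: "dpi r l * k * ?d \<in> GLO r"
      unfolding xe dmat_def by (rule coset_rigidity[OF e(1) l srep_units[OF \<theta>(1)] srep_units[OF \<eta>] k(1)])
    have "?d * ((dpi r l * k * ?d) * k') = (?d * dpi r l) * (k * (?d * k'))"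
      using kc by (simp add: assoc_mult_mat[of _ r r _ r _ r] mult_carrier_mat[of _ r r _ r])
    also have "\<dots> = h" unfolding k(3) using kc
      by (simp add: dpi_inverse assoc_mult_mat[of _ r r _ r _ r] mult_carrier_mat[of _ r r _ r] left_mult_one_mat[of _ r r])
    finally have "h = ?d \<otimes>\<^bsub>GL r\<^esub> ((dpi r l * k * ?d) * k')" by simp
    thus "\<exists>k\<in>GLO r. h = ?d \<otimes>\<^bsub>GL r\<^esub> k" using GLO_mult[OF m k(2)] by blast
  qed
  moreover have "hop l ?d = (1 :: 'c)"
  proof -
    have "?d = 1\<^sub>m r * ?d * 1\<^sub>m r" by (simp add: left_mult_one_mat[of _ r r] right_mult_one_mat[of _ r r])
    hence "\<exists>k\<in>GLO r. \<exists>k'\<in>GLO r. ?d = k * ?d * k'" using GLO_one by blast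
    thus ?thesis unfolding hop_def by simp
  qed
  moreover have "x \<bullet>\<^sub>X ?d = dmat e \<eta>"
  proof -
    have "(\<lambda>i. e i + 2 * l i + 2 * - l i) = e" by auto
    thus ?thesis unfolding xe dmat_def using diagpi_act_dpi[of r "\<lambda>i. e i + 2 * l i" "srep \<eta>" "\<lambda>i. - l i"] by simp
  qed
  ultimately show ?thesis
    using x dchar_dmat[OF e \<eta>] by (simp add: HS.hact_def x_def)
qed

end

section \<open>Combinatorics of the indices\<close>

context odd_padic begin

lemma lexge_reflexive: "lexge n x x"
  by (induction n) auto

lemma lexge_trans: "lexge n x y \<Longrightarrow> lexge n y z \<Longrightarrow> lexge n x z"
  by (induction n) auto

lemma lexge_total: "lexge n x y \<or> lexge n y x"
  by (induction n) auto

lemma lexge_antisym: "lexge n x y \<Longrightarrow> lexge n y x \<Longrightarrow> i < n \<Longrightarrow> x i = y i"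
  by (induction n) (auto simp: less_Suc_eq)

lemma lexge_cong:
  assumes "\<And>i. i < n \<Longrightarrow> x i = x' i" "\<And>i. i < n \<Longrightarrow> y i = y' i"
  shows "lexge n x y = lexge n x' y'"
  using assms by (induction n) auto

lemma lexge_minimal:
  assumes "finite J" "J \<noteq> {}"
  shows "\<exists>j\<in>J. \<forall>j'\<in>J. lexge n (f j') (f j)"
  using assms
proof (induction J rule: finite_ne_induct)
  case (singleton x)
  thus ?case by (simp add: lexge_reflexive)
next
  case (insert x J)
  then obtain j where j: "j \<in> J" "\<forall>j'\<in>J. lexge n (f j') (f j)" by blast
  show ?case
  proof (cases "lexge n (f x) (f j)")
    case True thus ?thesis using j by blast
  next
    case False
    hence "lexge n (f j) (f x)" using lexge_total by blast
    hence "\<forall>j'\<in>insert x J. lexge n (f j') (f x)" using j lexge_trans lexge_reflexive by blast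
    thus ?thesis by blast
  qed
qed

end

context odd_padic_rank begin

text \<open>The types that may occur in \<open>hact (hop l) (dchar s f)\<close> when \<open>f + 2 l = e\<close>.\<close>

definition cone :: "(nat \<Rightarrow> int) \<Rightarrow> (nat \<Rightarrow> int) set" where
  "cone e = {f \<in> types. lexge r f e \<and> (\<Sum>i<r. f i) = (\<Sum>i<r. e i)}"

text \<open>The entries are bounded below by the last entry of \<open>e\<close>, and their sum is fixed.\<close>

lemma finite_cone: "finite (cone e)"
proof -
  obtain n where n: "r = Suc n" using rank_pos by (cases r) auto
  define b where "b = (\<Sum>i<r. e i) - int n * e n"
  have "cone e \<subseteq> {..<r} \<rightarrow>\<^sub>E {e n..b}"
  proof
    fix f assume "f \<in> cone e"
    hence f: "f \<in> types" "lexge r f e" "(\<Sum>i<r. f i) = (\<Sum>i<r. e i)" by (auto simp: cone_def)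
    have "lexge (Suc n) f e" using f(2) n by simp
    hence en: "e n \<le> f n" by auto
    have ge: "e n \<le> f i" if "i < r" for i
    proof -
      note en
      also have "f n \<le> f i" using that n by (intro dominant_le[OF types_dominant[OF f(1)]]) auto
      finally show ?thesis .
    qed
    have "f i \<le> b" if i: "i < r" for i
    proof -
      have "(\<Sum>j\<in>{..<r} - {i}. e n) \<le> (\<Sum>j\<in>{..<r} - {i}. f j)" using ge by (intro sum_mono) auto
      moreover have "(\<Sum>j<r. f j) = f i + (\<Sum>j\<in>{..<r} - {i}. f j)" using i by (intro sum.remove) auto
      moreover have "(\<Sum>j\<in>{..<r} - {i}. e n) = int n * e n" using i by (simp add: n)
      moreover have "(\<Sum>j<r. f j) = (\<Sum>j<r. e j)" using f(3) .
      ultimately show ?thesis unfolding b_def by linarith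
    qed
    thus "f \<in> {..<r} \<rightarrow>\<^sub>E {e n..b}" using f(1) ge by (simp add: types_def PiE_iff)
  qed
  thus ?thesis by (rule finite_subset) (intro finite_PiE, auto)
qed

definition basis_index :: "((nat \<Rightarrow> int) \<times> (nat \<Rightarrow> int)) set" where
  "basis_index = {(s, e). s \<in> signs r \<and> e \<in> {..<r} \<rightarrow>\<^sub>E UNIV \<and>
    (\<forall>i. Suc i < r \<longrightarrow> e i - e (Suc i) - sign_change s i \<in> {0, 1}) \<and> e (r - 1) \<in> {0, 1}}"

lemma basis_index_dominant:
  assumes "(s, e) \<in> basis_index" shows "dominant r e" "block_const r e s" "s \<in> signs r" "e \<in> types"
proof -
  have b: "s \<in> signs r" "e \<in> {..<r} \<rightarrow>\<^sub>E UNIV"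
    "\<And>i. Suc i < r \<Longrightarrow> e i - e (Suc i) - sign_change s i = 0 \<or> e i - e (Suc i) - sign_change s i = 1"
    using assms by (auto simp: basis_index_def)
  have c: "sign_change s i = 0 \<or> sign_change s i = 1 \<and> s i \<noteq> s (Suc i)" for i by (simp add: sign_change_def)
  show d: "dominant r e" unfolding dominant_def
  proof (intro allI impI)
    fix i assume "Suc i < r"
    thus "e (Suc i) \<le> e i" using b(3)[of i] c[of i] by auto
  qed
  show "block_const r e s" unfolding block_const_def
  proof (intro allI impI)
    fix i assume i: "Suc i < r" "e i = e (Suc i)"
    hence "sign_change s i \<noteq> 1" using b(3)[OF i(1)] by auto
    thus "s i = s (Suc i)" by (simp add: sign_change_def split: if_splits)
  qed
  show "s \<in> signs r" "e \<in> types" using b d by (auto simp: types_def)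
qed

definition ishift :: "(nat \<Rightarrow> int) \<Rightarrow> (nat \<Rightarrow> int) \<Rightarrow> (nat \<Rightarrow> int)" where
  "ishift e l = (\<lambda>i\<in>{..<r}. e i + 2 * l i)"

lemma ishift_types: "e \<in> types \<Longrightarrow> l \<in> types \<Longrightarrow> ishift e l \<in> types"
  unfolding types_def ishift_def dominant_def by (auto intro!: add_mono)

text \<open>From the last index downwards, \<open>e\<close> is determined by parities, and then \<open>l\<close> by halving.\<close>

lemma ishift_inj:
  assumes "(s, e) \<in> basis_index" "(s, e') \<in> basis_index" "l \<in> types" "l' \<in> types"
    and eq: "ishift e l = ishift e' l'"
  shows "e = e'" "l = l'"
proof -
  have p: "e i + 2 * l i = e' i + 2 * l' i" if "i < r" for i
    using fun_cong[OF eq, of i] that by (simp add: ishift_def)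
  have "l i = l' i" if "i < r" for i
  proof -
    have "i \<le> r - 1" using that by simp
    thus ?thesis using that
    proof (induction rule: inc_induct)
      case base
      have "e (r - 1) = 0 \<or> e (r - 1) = 1" "e' (r - 1) = 0 \<or> e' (r - 1) = 1"
        using assms(1,2) by (auto simp: basis_index_def)
      thus ?case using p[OF base] by presburger
    next
      case (step i)
      have i: "Suc i < r" using step.hyps by simp
      hence IH: "l (Suc i) = l' (Suc i)" using step by simp
      define d where "d = e i - e (Suc i) - sign_change s i"
      define d' where "d' = e' i - e' (Suc i) - sign_change s i"
      have "d = 0 \<or> d = 1" "d' = 0 \<or> d' = 1" using assms(1,2) i by (auto simp: basis_index_def d_def d'_def)
      moreover have "e (Suc i) = e' (Suc i)" using p[OF i] IH by simp
      hence "d + 2 * l i = d' + 2 * l' i" using p[of i] i by (simp add: d_def d'_def)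
      ultimately show ?case by presburger
    qed
  qed
  thus l: "l = l'" using types_eqI[OF assms(3,4)] by blast
  have "e i = e' i" if "i < r" for i using p[OF that] l by simp
  thus "e = e'" using types_eqI[OF basis_index_dominant(4)[OF assms(1)] basis_index_dominant(4)[OF assms(2)]] by blast
qed

text \<open>Halving the gaps: a pair \<open>(s, f)\<close> with \<open>f\<close> dominant and \<open>s\<close> constant on the blocks of \<open>f\<close>
  is \<open>(s, e + 2 l)\<close> for a unique basis index \<open>(s, e)\<close> and dominant \<open>l\<close>: the gap of \<open>e\<close> beyond its
  minimum is the parity, that of \<open>l\<close> the half.\<close>

lemma ishift_surj:
  assumes s: "s \<in> signs r" and f: "f \<in> types" "block_const r f s"
  obtains e l where "(s, e) \<in> basis_index" "l \<in> types" "ishift e l = f"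
proof -
  define g where "g i = (if Suc i < r then f i - f (Suc i) - sign_change s i else f i)" for i
  define h where "h i = (\<Sum>j = i..<r. g j div 2)" for i
  define l where "l = (\<lambda>i\<in>{..<r}. h i)"
  define e where "e = (\<lambda>i\<in>{..<r}. f i - 2 * h i)"
  have hs: "h i = g i div 2 + h (Suc i)" if "i < r" for i
    unfolding h_def using that by (simp add: sum.atLeast_Suc_lessThan)
  have g0: "g i \<ge> 0" if "Suc i < r" for i
  proof -
    have "f (Suc i) \<le> f i" using f(1) that by (auto simp: types_def dominant_def)
    moreover have "f i \<noteq> f (Suc i)" if "s i \<noteq> s (Suc i)"
      using f(2) that \<open>Suc i < r\<close> by (auto simp: block_const_def)
    ultimately show ?thesis using that by (auto simp: g_def sign_change_def)
  qed
  have "l \<in> types"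
  proof -
    have "h (Suc i) \<le> h i" if "Suc i < r" for i using hs[of i] g0[OF that] that by simp
    thus ?thesis by (auto simp: types_def dominant_def l_def)
  qed
  moreover have "(s, e) \<in> basis_index"
  proof -
    have m: "x - 2 * (x div 2) \<in> {0, 1}" for x :: int by (simp add: minus_mult_div_eq_mod) presburger
    have "e i - e (Suc i) - sign_change s i \<in> {0, 1}" if i: "Suc i < r" for i
    proof -
      have "e i - e (Suc i) - sign_change s i = g i - 2 * (g i div 2)"
        using i hs[of i] by (simp add: e_def g_def)
      thus ?thesis using m by simp
    qed
    moreover have "e (r - 1) \<in> {0, 1}"
    proof -
      have "h (r - 1) = f (r - 1) div 2" using rank_pos hs[of "r - 1"] by (simp add: g_def h_def)
      hence "e (r - 1) = f (r - 1) - 2 * (f (r - 1) div 2)" using rank_pos by (simp add: e_def)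
      thus ?thesis using m by simp
    qed
    ultimately show ?thesis using s by (simp add: basis_index_def e_def)
  qed
  moreover have "ishift e l = f"
    using f(1) by (auto simp: ishift_def e_def l_def types_def PiE_def extensional_def fun_eq_iff)
  ultimately show ?thesis using that by blast
qed

end

section \<open>The number of indices\<close>

context odd_padic_rank begin

text \<open>The sign vector and the excess of each gap over its minimum can be chosen independently.\<close>

lemma card_basis_index: "card basis_index = 4 ^ r"
proof -
  let ?E = "{..<r} \<rightarrow>\<^sub>E {0, 1 :: int}"
  define t where "t s j = (if Suc j < r then sign_change s j else 0)" for s j
  define G where "G s e = (\<lambda>i\<in>{..<r}. if Suc i < r then e i - e (Suc i) - sign_change s i else e i)"
    for s :: "nat \<Rightarrow> int" and e :: "nat \<Rightarrow> int"
  define H where "H s b = (\<lambda>i\<in>{..<r}. \<Sum>j = i..<r. b j + t s j)" for s and b :: "nat \<Rightarrow> int"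
  have last: "i = r - 1" if "i < r" "\<not> Suc i < r" for i using that by simp
  have GE: "G s e \<in> ?E" if b: "(s, e) \<in> basis_index" for s e
  proof -
    have "(if Suc i < r then e i - e (Suc i) - sign_change s i else e i) \<in> {0, 1}" if "i < r" for i
    proof (cases "Suc i < r")
      case True
      thus ?thesis using b by (simp add: basis_index_def)
    next
      case False
      thus ?thesis using b last[OF that] by (simp add: basis_index_def)
    qed
    thus ?thesis unfolding G_def by simp
  qed
  have Hs: "H s b i = b i + t s i + (if Suc i < r then H s b (Suc i) else 0)" if "i < r" for s b i
    using that by (auto simp: H_def sum.atLeast_Suc_lessThan)
  have E01: "b i \<in> {0, 1}" if "b \<in> ?E" "i < r" for b i using that by (auto dest: PiE_mem)
  have HB: "(s, H s b) \<in> basis_index" if s: "s \<in> signs r" and b: "b \<in> ?E" for s b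
  proof -
    have "H s b i - H s b (Suc i) - sign_change s i \<in> {0, 1}" if "Suc i < r" for i
      using Hs[of i s b] E01[OF b, of i] that by (simp add: t_def)
    moreover have "H s b (r - 1) \<in> {0, 1}"
      using Hs[of "r - 1" s b] E01[OF b, of "r - 1"] rank_pos by (simp add: t_def)
    ultimately show ?thesis using s by (simp add: basis_index_def H_def)
  qed
  have GH: "G s (H s b) = b" if b: "b \<in> ?E" for s b
  proof
    fix i
    show "G s (H s b) i = b i"
    proof (cases "i < r")
      case True
      thus ?thesis using Hs[of i s b] by (simp add: G_def t_def)
    next
      case False
      thus ?thesis using b by (auto simp: G_def PiE_def extensional_def)
    qed
  qed
  have HG: "H s (G s e) = e" if b: "(s, e) \<in> basis_index" for s e
  proof
    fix i
    define e' where "e' j = (if j < r then - e j else 0)" for j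
    show "H s (G s e) i = e i"
    proof (cases "i < r")
      case True
      have "(\<Sum>j = i..<r. G s e j + t s j) = (\<Sum>j = i..<r. e' (Suc j) - e' j)"
        by (rule sum.cong[OF refl]) (simp add: G_def t_def e'_def)
      also have "\<dots> = e' r - e' i" using True by (intro sum_Suc_diff') simp
      finally show ?thesis using True by (simp add: H_def e'_def)
    next
      case False
      thus ?thesis using b by (auto simp: H_def basis_index_def PiE_def extensional_def)
    qed
  qed
  have "bij_betw (\<lambda>(s, e). (s, G s e)) basis_index (signs r \<times> ?E)"
  proof (rule bij_betwI[where g = "\<lambda>(s, b). (s, H s b)"])
    show "(\<lambda>(s, e). (s, G s e)) \<in> basis_index \<rightarrow> signs r \<times> ?E"
    proof (rule funcsetI)
      fix x assume x: "x \<in> basis_index"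
      obtain s e where se: "x = (s, e)" by (cases x)
      show "(case x of (s, e) \<Rightarrow> (s, G s e)) \<in> signs r \<times> ?E"
        using GE[of s e] basis_index_dominant(3)[of s e] x by (simp add: se)
    qed
    show "(\<lambda>(s, b). (s, H s b)) \<in> signs r \<times> ?E \<rightarrow> basis_index"
    proof (rule funcsetI)
      fix x assume x: "x \<in> signs r \<times> ?E"
      obtain s b where sb: "x = (s, b)" by (cases x)
      show "(case x of (s, b) \<Rightarrow> (s, H s b)) \<in> basis_index"
        using HB[of s b] x by (simp add: sb)
    qed
  next
    fix x assume x: "x \<in> basis_index"
    obtain s e where se: "x = (s, e)" by (cases x)
    show "(case case x of (s, e) \<Rightarrow> (s, G s e) of (s, b) \<Rightarrow> (s, H s b)) = x"
      using HG[of s e] x by (simp add: se)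
  next
    fix x assume x: "x \<in> signs r \<times> ?E"
    obtain s b where sb: "x = (s, b)" by (cases x)
    show "(case case x of (s, b) \<Rightarrow> (s, H s b) of (s, e) \<Rightarrow> (s, G s e)) = x"
      using GH[of b s] x by (simp add: sb)
  qed
  hence "card basis_index = card (signs r \<times> ?E)" by (rule bij_betw_same_card)
  also have "\<dots> = 2 ^ r * card ?E" by (simp add: card_cartesian_product card_signs)
  also have "card ?E = 2 ^ r" by (subst card_PiE) (auto simp: numeral_2_eq_2)
  also have "(2::nat) ^ r * 2 ^ r = 4 ^ r" by (simp flip: power_mult_distrib)
  finally show ?thesis .
qed

lemma finite_basis_index: "finite basis_index"
  by (rule card_ge_0_finite) (simp add: card_basis_index)

lemma dchar_cong: "(\<And>i. i < r \<Longrightarrow> e i = e' i) \<Longrightarrow> dchar s e = dchar s e'"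
proof -
  assume "\<And>i. i < r \<Longrightarrow> e i = e' i"
  hence "dmat e \<eta> = dmat e' \<eta>" for \<eta> unfolding dmat_def by (rule diagpi_cong) auto
  thus ?thesis by (simp add: fun_eq_iff dchar_eq)
qed

lemma delta_basis_eq:
  "delta_basis av \<pi> r = (\<lambda>b. dchar (fst b) (snd b) :: 'a mat \<Rightarrow> 'c::comm_ring_1) ` basis_index"
proof (intro equalityI subsetI)
  fix f :: "'a mat \<Rightarrow> 'c" assume "f \<in> delta_basis av \<pi> r"
  then obtain s e where se: "f = dchar s e" "s \<in> signs r"
    "\<And>i. Suc i < r \<Longrightarrow> e i - e (Suc i) - sign_change s i \<in> {0, 1}" "e (r - 1) \<in> {0, 1}"
    unfolding delta_basis_def signs_def by blast
  define e' where "e' = (\<lambda>i\<in>{..<r}. e i)"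
  have "(s, e') \<in> basis_index" using se rank_pos by (simp add: basis_index_def e'_def)
  moreover have "f = dchar (fst (s, e')) (snd (s, e'))"
    unfolding se(1) fst_conv snd_conv by (rule dchar_cong) (simp add: e'_def)
  ultimately show "f \<in> (\<lambda>b. dchar (fst b) (snd b)) ` basis_index" by (rule rev_image_eqI)
next
  fix f :: "'a mat \<Rightarrow> 'c" assume "f \<in> (\<lambda>b. dchar (fst b) (snd b)) ` basis_index"
  then obtain s e where se: "f = dchar s e" "(s, e) \<in> basis_index" by auto
  thus "f \<in> delta_basis av \<pi> r" unfolding delta_basis_def basis_index_def signs_def by blast
qed

section \<open>The Hecke algebra is spanned by double cosets\<close>

text \<open>The Cartan decomposition is applied to the inverse of \<open>g\<close>, which accounts for the sign of the exponents.\<close>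

lemma double_coset_rep:
  assumes g: "g \<in> carrier (GL r)"
  obtains l k k' where "l \<in> types" "k \<in> GLO r" "k' \<in> GLO r" "g = k * dpi r (\<lambda>i. - l i) * k'"
proof -
  have gc: "g \<in> carrier_mat r r" "det g \<noteq> 0" using g by (auto simp: carrier_GL)
  obtain h where h: "h \<in> carrier_mat r r" "g * h = 1\<^sub>m r" "h * g = 1\<^sub>m r" using mat_inverse[OF gc] by blast
  have "det h * det g = 1" using det_mult[OF h(1) gc(1)] h(3) by simp
  hence "det h \<noteq> 0" by auto
  from cartan_decomposition[OF h(1) this] obtain m k1 k2 where
    m: "dominant r m" and k: "k1 \<in> GLO r" "k2 \<in> GLO r" "k1 * h * k2 = dpi r m" by blast
  define l where "l = (\<lambda>i\<in>{..<r}. m i)"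
  have l: "l \<in> types" using m by (auto simp: types_def l_def dominant_def)
  have dl: "dpi r m = dpi r l" unfolding dpi_def by (rule eq_matI) (auto simp: mat_diag_def l_def)
  let ?d = "dpi r (\<lambda>i. - l i)"
  have c: "k1 \<in> carrier_mat r r" "k2 \<in> carrier_mat r r" using k by auto
  have kh: "k1 * h \<in> carrier_mat r r" by (rule mult_carrier_mat[OF c(1) h(1)])
  have k2d: "k2 * ?d \<in> carrier_mat r r" by (rule mult_carrier_mat[OF c(2) dpi_carrier])
  have "(k1 * h) * (k2 * ?d) = (k1 * h * k2) * ?d"
    by (rule assoc_mult_mat[OF kh c(2) dpi_carrier, symmetric])
  also have "\<dots> = 1\<^sub>m r" unfolding k(3) dl by (simp add: dpi_mult dpi_0)
  finally have e1: "k1 * h * (k2 * ?d) = 1\<^sub>m r" .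
  hence "det (k1 * h) * det (k2 * ?d) = 1" using det_mult[OF kh k2d] by simp
  have e2: "(k2 * ?d) * (k1 * h) = 1\<^sub>m r" by (rule mat_mult_left_right_inverse[OF kh k2d e1])
  have "g = ((k2 * ?d) * (k1 * h)) * g" unfolding e2 using gc by simp
  also have "\<dots> = (k2 * ?d) * (k1 * (h * g))"
    using assoc_mult_mat[OF k2d kh gc(1)] assoc_mult_mat[OF c(1) h(1) gc(1)] by simp
  also have "\<dots> = k2 * ?d * k1" unfolding h(3) using c by simp
  finally have "g = k2 * ?d * k1" .
  thus ?thesis using that[OF l k(2) k(1)] by blast
qed

lemma hop_bi: "k \<in> GLO r \<Longrightarrow> k' \<in> GLO r \<Longrightarrow> hop l (k * dpi r (\<lambda>i. - l i) * k') = (1 :: 'c::comm_ring_1)"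
  unfolding hop_def by (rule if_P) blast

lemma hecke_bi:
  assumes "T \<in> HP.hecke" "g \<in> carrier (GL r)" "k \<in> GLO r" "k' \<in> GLO r"
  shows "T (k * g * k') = (T g :: 'c::comm_ring_1)"
  using assms unfolding HP.hecke_def by simp

text \<open>Subtracting a multiple of \<open>hop m\<close> removes a whole double coset from the support.\<close>

lemma hecke_span:
  assumes "T \<in> HP.hecke"
  shows "\<exists>L a. finite L \<and> L \<subseteq> types \<and> T = (\<lambda>g. \<Sum>l\<in>L. a l * hop l g :: 'c::comm_ring_1)"
  using assms
proof (induction "card (HP.csupp T)" arbitrary: T rule: less_induct)
  case less
  note T = less.prems
  show ?case
  proof (cases "\<exists>g\<in>carrier (GL r). T g \<noteq> 0")
    case False
    have "T g = 0" for g
      using False T by (cases "g \<in> carrier (GL r)") (auto simp: HP.hecke_def)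
    hence "T = (\<lambda>g. \<Sum>l\<in>{}. 0 * hop l g)" by (simp add: fun_eq_iff)
    thus ?thesis by (intro exI[of _ "{}"] exI[of _ "\<lambda>_. 0"]) simp
  next
    case True
    then obtain g where g: "g \<in> carrier (GL r)" "T g \<noteq> 0" by blast
    obtain m k k' where m: "m \<in> types" and k: "k \<in> GLO r" "k' \<in> GLO r" "g = k * dpi r (\<lambda>i. - m i) * k'"
      using double_coset_rep[OF g(1)] by blast
    have Tg: "T g = T (dpi r (\<lambda>i. - m i))" unfolding k(3) by (rule hecke_bi[OF T dpi_GL k(1,2)])
    define U where "U = (\<lambda>x. T x + - T g * hop m x)"
    have U: "U \<in> HP.hecke" unfolding U_def by (intro HP.hecke_add HP.hecke_smult T hop_hecke)
    have sup: "T x \<noteq> 0" if "U x \<noteq> 0" for x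
    proof (cases "hop m x = (0 :: 'c)")
      case True
      thus ?thesis using that by (simp add: U_def)
    next
      case False
      then obtain a b where ab: "a \<in> GLO r" "b \<in> GLO r" "x = a * dpi r (\<lambda>i. - m i) * b" by (rule hop_nonzero)
      have "T x = T g" unfolding Tg ab(3) by (rule hecke_bi[OF T dpi_GL ab(1,2)])
      thus ?thesis using g(2) by simp
    qed
    have "U g = 0" using hop_bi[OF k(1,2), of m, where 'c = 'c] by (simp add: U_def k(3)[symmetric])
    have "HP.csupp U \<subset> HP.csupp T"
    proof
      show "HP.csupp U \<subseteq> HP.csupp T" using sup by (auto simp: HP.csupp_def)
      have "g <#\<^bsub>GL r\<^esub> GLO r \<notin> HP.csupp U"
      proof
        assume "g <#\<^bsub>GL r\<^esub> GLO r \<in> HP.csupp U"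
        then obtain x where x: "x \<in> carrier (GL r)" "U x \<noteq> 0" "g <#\<^bsub>GL r\<^esub> GLO r = x <#\<^bsub>GL r\<^esub> GLO r"
          by (auto simp: HP.csupp_def)
        then obtain b where "b \<in> GLO r" "x = g \<otimes>\<^bsub>GL r\<^esub> b" using HP.lcos_eq_iff[OF g(1) x(1)] by blast
        hence "U x = U g" using HP.hecke_rinv[OF U] g(1) by (simp only: HP.rinv_def)
        thus False using x(2) \<open>U g = 0\<close> by simp
      qed
      moreover have "g <#\<^bsub>GL r\<^esub> GLO r \<in> HP.csupp T" using g by (auto simp: HP.csupp_def)
      ultimately show "HP.csupp U \<noteq> HP.csupp T" by blast
    qed
    hence "card (HP.csupp U) < card (HP.csupp T)" using HP.hecke_finite[OF T] by (rule psubset_card_mono[rotated])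
    from less.hyps[OF this U] obtain L a where L: "finite L" "L \<subseteq> types" "U = (\<lambda>g. \<Sum>l\<in>L. a l * hop l g)" by blast
    define a' where "a' l = (if l \<in> L then a l else 0) + (if l = m then T g else 0)" for l
    have "T x = (\<Sum>l\<in>insert m L. a' l * hop l x)" for x
    proof -
      have "(\<Sum>l\<in>insert m L. a' l * hop l x)
          = (\<Sum>l\<in>insert m L. (if l \<in> L then a l * hop l x else 0)) + (\<Sum>l\<in>insert m L. if l = m then T g * hop l x else 0)"
        unfolding sum.distrib[symmetric] by (rule sum.cong[OF refl]) (simp add: a'_def distrib_right)
      also have "(\<Sum>l\<in>insert m L. if l = m then T g * hop l x else 0) = T g * hop m x"
        using L(1) by (subst sum.delta) auto
      also have "(\<Sum>l\<in>insert m L. (if l \<in> L then a l * hop l x else 0)) = (\<Sum>l\<in>L. a l * hop l x)"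
        using L(1) by (intro sum.mono_neutral_cong_right) auto
      also have "\<dots> = U x" using L(3) by simp
      also have "U x + T g * hop m x = T x" by (simp add: U_def)
      finally show ?thesis by simp
    qed
    thus ?thesis using L(1,2) m by (intro exI[of _ "insert m L"] exI[of _ a']) auto
  qed
qed

section \<open>Spanning\<close>

lemma schwartz_eqv:
  assumes "f \<in> HS.schwartz" "x \<in> sym_space r" "eqv r x y" shows "f y = (f x :: 'c::comm_ring_1)"
proof -
  obtain k where "k \<in> GLO r" "y = x \<bullet>\<^sub>X k" using assms(3) by (auto simp: eqv_def)
  thus ?thesis using assms(1,2) by (simp add: HS.schwartz_def)
qed

definition tsupp :: "('a mat \<Rightarrow> 'c::comm_ring_1) \<Rightarrow> (nat \<Rightarrow> int) set" where
  "tsupp f = {\<nu> \<in> types. \<exists>\<eta>\<in>signs r. f (dmat \<nu> \<eta>) \<noteq> 0}"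

text \<open>Different types belong to different orbits.\<close>

lemma finite_tsupp:
  assumes "f \<in> HS.schwartz" shows "finite (tsupp f)"
proof -
  have "\<forall>\<nu>\<in>tsupp f. \<exists>\<eta>. \<eta> \<in> signs r \<and> f (dmat \<nu> \<eta>) \<noteq> 0" by (auto simp: tsupp_def)
  then obtain w where w: "\<forall>\<nu>\<in>tsupp f. w \<nu> \<in> signs r \<and> f (dmat \<nu> (w \<nu>)) \<noteq> 0"
    unfolding bchoice_iff by blast
  let ?P = "\<lambda>\<nu>. HS.orb (dmat \<nu> (w \<nu>))"
  have "inj_on ?P (tsupp f)"
  proof (rule inj_onI)
    fix \<mu> \<nu> assume m: "\<mu> \<in> tsupp f" and n: "\<nu> \<in> tsupp f" and eq: "?P \<mu> = ?P \<nu>"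
    have wm: "w \<mu> \<in> signs r" and wn: "w \<nu> \<in> signs r" using w m n by auto
    have "dmat \<nu> (w \<nu>) \<in> ?P \<mu>" unfolding eq by (rule HS.orb_self[OF dmat_sym_space[OF wn]])
    hence "has_type (dmat \<mu> (w \<mu>)) \<nu>" unfolding orb_iff has_type_def using wn by blast
    thus "\<mu> = \<nu>" using m n
      by (intro has_type_unique[OF dmat_carrier has_type_dmat[OF wm]]) (auto simp: tsupp_def)
  qed
  moreover have "?P ` tsupp f \<subseteq> HS.osupp f"
    using w dmat_sym_space by (auto simp: HS.osupp_def)
  moreover have "finite (HS.osupp f)" using assms by (simp add: HS.schwartz_def)
  ultimately show ?thesis by (rule inj_on_finite)
qed

lemma tsupp_empty:
  assumes f: "f \<in> HS.schwartz" and e: "tsupp f = {}" shows "f = (\<lambda>_. 0)"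
proof
  fix x
  show "f x = 0"
  proof (cases "x \<in> sym_space r")
    case True
    then obtain \<nu> \<eta> where n: "\<nu> \<in> types" "\<eta> \<in> signs r" "eqv r x (dmat \<nu> \<eta>)"
      using has_type_exists[OF True] unfolding has_type_def by blast
    have "f (dmat \<nu> \<eta>) = 0" using e n by (auto simp: tsupp_def)
    thus ?thesis using schwartz_eqv[OF f True n(3)] by simp
  next
    case False thus ?thesis using f by (simp add: HS.schwartz_def)
  qed
qed

text \<open>The submodule generated by the proposed basis.\<close>

definition dspan :: "('a mat \<Rightarrow> 'c::comm_ring_1) set" where
  "dspan = {f. \<exists>A. (\<forall>b\<in>basis_index. A b \<in> HP.hecke) \<and>
    f = (\<lambda>x. \<Sum>b\<in>basis_index. HS.hact (A b) (dchar (fst b) (snd b)) x)}"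

lemma hact_0: "f \<in> HS.schwartz \<Longrightarrow> HS.hact (\<lambda>_. 0) f = (\<lambda>_. 0 :: 'c::comm_ring_1)"
  using HS.hact_smult_left[OF HP.hecke_0, of f 0] by simp

lemma dspan_add:
  assumes "f \<in> dspan" "g \<in> dspan" shows "(\<lambda>x. f x + g x :: 'c::comm_ring_1) \<in> dspan"
proof -
  obtain A B where A: "\<forall>b\<in>basis_index. A b \<in> HP.hecke" "f = (\<lambda>x. \<Sum>b\<in>basis_index. HS.hact (A b) (dchar (fst b) (snd b)) x)"
    and B: "\<forall>b\<in>basis_index. B b \<in> HP.hecke" "g = (\<lambda>x. \<Sum>b\<in>basis_index. HS.hact (B b) (dchar (fst b) (snd b)) x)"
    using assms unfolding dspan_def by blast
  define C where "C b = (\<lambda>x. A b x + B b x)" for b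
  have "HS.hact (C b) (dchar (fst b) (snd b)) x =
      HS.hact (A b) (dchar (fst b) (snd b)) x + HS.hact (B b) (dchar (fst b) (snd b)) x"
    if "b \<in> basis_index" for b x
    unfolding C_def using fun_cong[OF HS.hact_add_left[OF bspec[OF A(1) that] bspec[OF B(1) that] dchar_schwartz]] .
  hence "(\<lambda>x. f x + g x) = (\<lambda>x. \<Sum>b\<in>basis_index. HS.hact (C b) (dchar (fst b) (snd b)) x)"
    unfolding A(2) B(2) by (simp add: sum.distrib)
  moreover have "\<forall>b\<in>basis_index. C b \<in> HP.hecke"
    unfolding C_def using A(1) B(1) by (intro ballI HP.hecke_add) auto
  ultimately show ?thesis unfolding dspan_def by blast
qed

lemma dspan_hop:
  assumes "(s, e) \<in> basis_index"
  shows "(\<lambda>x. a * HS.hact (hop l) (dchar s e) x :: 'c::comm_ring_1) \<in> dspan"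
proof -
  define A where "A b = (if b = (s, e) then (\<lambda>g. a * hop l g) else (\<lambda>_. 0 :: 'c))" for b
  have "(\<Sum>b\<in>basis_index. HS.hact (A b) (dchar (fst b) (snd b)) x) = a * HS.hact (hop l) (dchar s e) x" for x
  proof -
    have "(\<Sum>b\<in>basis_index. HS.hact (A b) (dchar (fst b) (snd b)) x)
        = (\<Sum>b\<in>basis_index. if b = (s, e) then a * HS.hact (hop l) (dchar s e) x else 0)"
      by (rule sum.cong[OF refl])
        (auto simp: A_def hact_0[OF dchar_schwartz] HS.hact_smult_left[OF hop_hecke dchar_schwartz])
    thus ?thesis using assms finite_basis_index by simp
  qed
  moreover have "\<forall>b\<in>basis_index. A b \<in> HP.hecke"
    by (simp add: A_def HP.hecke_smult[OF hop_hecke] HP.hecke_0)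
  ultimately show ?thesis unfolding dspan_def by (auto intro!: exI[of _ A])
qed

lemma dspan_0: "(\<lambda>_. 0 :: 'c::comm_ring_1) \<in> dspan"
  unfolding dspan_def using HP.hecke_0 by (auto intro!: exI[of _ "\<lambda>_ _. 0"] simp: hact_0[OF dchar_schwartz])

lemma dspan_sum:
  assumes "\<And>i. i \<in> I \<Longrightarrow> f i \<in> dspan" shows "(\<lambda>x. \<Sum>i\<in>I. f i x :: 'c::comm_ring_1) \<in> dspan"
  using assms
  by (induction I rule: infinite_finite_induct) (simp_all add: dspan_0 dspan_add)

lemma pow2_unit:
  assumes "(2 :: 'c::comm_ring_1) dvd 1" obtains h :: "'c::comm_ring_1" where "h * 2 ^ n = 1"
proof -
  obtain k :: 'c where "1 = 2 * k" using assms by (auto elim: dvdE)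
  hence "k ^ n * 2 ^ n = 1" by (simp add: mult.commute flip: power_mult_distrib)
  thus ?thesis using that by blast
qed

lemma stab_count_unit:
  assumes "(2 :: 'c::comm_ring_1) dvd 1" obtains h :: "'c::comm_ring_1" where "h * of_nat (stab_count e) = 1"
proof -
  obtain k where k: "2 ^ r = stab_count e * k" using stab_count_dvd by (auto elim: dvdE)
  obtain h :: 'c where h: "h * 2 ^ r = 1" using pow2_unit[OF assms] by blast
  have "(2 :: 'c) ^ r = of_nat (2 ^ r)" by simp
  also have "\<dots> = of_nat (stab_count e) * of_nat k" unfolding k by simp
  finally have "h * of_nat k * of_nat (stab_count e) = 1" using h by (simp add: ac_simps)
  thus ?thesis using that by blast
qed

text \<open>If \<open>s\<close> changes inside a block of \<open>\<nu>\<close>, then flipping the two signs at this place does not change the orbit but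
  negates the character; so twice the coefficient vanishes.\<close>

lemma vanishing_coefficient:
  assumes two: "(2 :: 'c::comm_ring_1) dvd 1" and f: "f \<in> HS.schwartz" and \<nu>: "\<nu> \<in> types"
    and s: "s \<in> signs r" "\<not> block_const r \<nu> s"
  shows "(\<Sum>\<eta>\<in>signs r. f (dmat \<nu> \<eta>) * of_int (sgnchar r s \<eta>)) = (0 :: 'c)" (is "?S = 0")
proof -
  obtain i where i: "Suc i < r" "\<nu> i = \<nu> (Suc i)" "s i \<noteq> s (Suc i)"
    using s(2) by (auto simp: block_const_def)
  define \<zeta> where "\<zeta> = (\<lambda>j\<in>{..<r}. if j = i \<or> j = Suc i then -1 else 1 :: int)"
  have \<zeta>: "\<zeta> \<in> signs r" by (simp add: \<zeta>_def signs_def)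
  have sg: "sgnchar r s' \<zeta> = sign_char (s' i) (-1) * sign_char (s' (Suc i)) (-1)" for s'
  proof -
    have "sgnchar r s' \<zeta> = (\<Prod>j\<in>{i, Suc i}. sign_char (s' j) (\<zeta> j))"
      unfolding sgnchar_def using i(1) by (intro prod.mono_neutral_right) (auto simp: \<zeta>_def sign_char_def)
    thus ?thesis using i(1) by (simp add: \<zeta>_def)
  qed
  have "sgnchar r s' \<zeta> = 1" if "block_const r \<nu> s'" for s'
    using that i by (simp add: sg block_const_def sign_char_def)
  hence E: "f (dmat \<nu> (sgntimes r \<zeta> \<eta>)) = f (dmat \<nu> \<eta>)" if "\<eta> \<in> signs r" for \<eta>
    by (intro schwartz_eqv[OF f dmat_sym_space[OF that]]
        dmat_eqv_iff[OF types_dominant[OF \<nu>] that sgntimes_signs[OF \<zeta> that], THEN iffD2])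
      (simp add: sgnchar_times[OF \<zeta> that])
  have m: "sgnchar r s \<zeta> = -1"
    using signs_mem[OF s(1), of i] signs_mem[OF s(1), of "Suc i"] i by (auto simp: sg sign_char_def)
  have "?S = (\<Sum>\<eta>\<in>signs r. f (dmat \<nu> (sgntimes r \<zeta> \<eta>)) * of_int (sgnchar r s (sgntimes r \<zeta> \<eta>)))"
  proof (rule sum.reindex_bij_betw[symmetric])
    show "bij_betw (sgntimes r \<zeta>) (signs r) (signs r)"
      by (rule bij_betwI[where g = "sgntimes r \<zeta>"]) (auto simp: sgntimes_self[OF \<zeta>] intro: sgntimes_signs[OF \<zeta>])
  qed
  also have "\<dots> = (\<Sum>\<eta>\<in>signs r. - (f (dmat \<nu> \<eta>) * of_int (sgnchar r s \<eta>)))"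
    by (rule sum.cong[OF refl]) (simp add: E sgnchar_times[OF \<zeta>] m)
  also have "\<dots> = - ?S" by (rule sum_negf)
  finally have "2 * ?S = 0" by simp
  moreover obtain h :: 'c where "h * 2 ^ 1 = 1" using pow2_unit[OF two] by blast
  ultimately have "h * (2 * ?S) = 0" "h * 2 = 1" by simp_all
  thus ?thesis by (metis mult.assoc mult_1)
qed

lemma types_lexge_antisym:
  assumes "\<nu> \<in> types" "\<mu> \<in> types" "lexge r \<nu> \<mu>" "lexge r \<mu> \<nu>" shows "\<mu> = \<nu>"
  using lexge_antisym[OF assms(3,4)] by (intro types_eqI assms) auto

lemma ishift_apply: "ishift e l = \<nu> \<Longrightarrow> i < r \<Longrightarrow> \<nu> i = e i + 2 * l i"
  by (auto simp: ishift_def)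

text \<open>Elimination of the minimal type \<open>\<nu>\<close> of \<open>S\<close>. On the forms of type \<open>\<nu>\<close> the function \<open>f\<close> is a combination of the
  characters \<open>s\<close> that are constant on the blocks of \<open>\<nu>\<close>. Each of these is a unit multiple of the leading term of some
  \<open>hact (hop l) (dchar s e)\<close> with \<open>e + 2 l = \<nu>\<close>. Subtracting such terms removes \<open>\<nu>\<close> and adds only types of \<open>cone \<nu>\<close>.\<close>

lemma schwartz_in_dspan_of_upward_closed:
  assumes two: "(2 :: 'c::comm_ring_1) dvd 1"
    and "finite S" "S \<subseteq> types" "\<And>\<nu>. \<nu> \<in> S \<Longrightarrow> cone \<nu> \<subseteq> S"
    and "f \<in> HS.schwartz" "tsupp f \<subseteq> S"
  shows "(f :: 'a mat \<Rightarrow> 'c) \<in> dspan"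
  using assms(2-)
proof (induction "card S" arbitrary: S f)
  case 0
  hence "tsupp f = {}" by simp
  thus ?case using tsupp_empty[OF "0.prems"(4)] dspan_0 by simp
next
  case (Suc n)
  note finS = Suc.prems(1) and S = Suc.prems(2) and up = Suc.prems(3) and f = Suc.prems(4) and fS = Suc.prems(5)
  have "S \<noteq> {}" using Suc.hyps(2) by auto
  then obtain \<nu> where \<nu>: "\<nu> \<in> S" "\<And>\<mu>. \<mu> \<in> S \<Longrightarrow> lexge r \<mu> \<nu>"
    using lexge_minimal[OF finS, of r "\<lambda>\<nu>. \<nu>"] by blast
  have \<nu>t: "\<nu> \<in> types" using \<nu>(1) S by blast
  define D where "D = {s \<in> signs r. block_const r \<nu> s}"
  have finD: "finite D" by (simp add: D_def)
  have "\<exists>e l m. (s, e) \<in> basis_index \<and> l \<in> types \<and> ishift e l = \<nu> \<and> m * of_nat (stab_count e) = (1 :: 'c)"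
    if "s \<in> D" for s
  proof -
    have sb: "s \<in> signs r" "block_const r \<nu> s" using that by (auto simp: D_def)
    obtain e l where el: "(s, e) \<in> basis_index" "l \<in> types" "ishift e l = \<nu>"
      using ishift_surj[OF sb(1) \<nu>t sb(2)] by blast
    obtain m :: 'c where "m * of_nat (stab_count e) = 1" using stab_count_unit[OF two] by blast
    thus ?thesis using el by blast
  qed
  hence "\<forall>s\<in>D. \<exists>q. (s, fst q) \<in> basis_index \<and> fst (snd q) \<in> types \<and> ishift (fst q) (fst (snd q)) = \<nu>
      \<and> snd (snd q) * of_nat (stab_count (fst q)) = (1 :: 'c)" by auto
  then obtain q where q: "\<forall>s\<in>D. (s, fst (q s)) \<in> basis_index \<and> fst (snd (q s)) \<in> types
      \<and> ishift (fst (q s)) (fst (snd (q s))) = \<nu> \<and> snd (snd (q s)) * of_nat (stab_count (fst (q s))) = (1 :: 'c)"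
    unfolding bchoice_iff by blast
  define E where "E s = fst (q s)" for s
  define L where "L s = fst (snd (q s))" for s
  define M where "M s = snd (snd (q s))" for s
  have Q: "(s, E s) \<in> basis_index" "L s \<in> types" "ishift (E s) (L s) = \<nu>" "M s * of_nat (stab_count (E s)) = (1 :: 'c)"
    if "s \<in> D" for s using q that by (auto simp: E_def L_def M_def)
  obtain h2 :: 'c where h2: "h2 * 2 ^ r = 1" using pow2_unit[OF two] by blast
  \<comment> \<open>The coefficient of the character \<open>s\<close> in \<open>f\<close> on the forms of type \<open>\<nu>\<close>.\<close>
  define co where "co s = h2 * (\<Sum>\<eta>\<in>signs r. f (dmat \<nu> \<eta>) * of_int (sgnchar r s \<eta>))" for s
  define h where "h = (\<lambda>x. \<Sum>s\<in>D. (co s * M s) * HS.hact (hop (L s)) (dchar s (E s)) x)"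
  have hD: "h \<in> dspan" unfolding h_def by (intro dspan_sum dspan_hop Q(1))
  have hS: "h \<in> HS.schwartz" unfolding h_def
    by (intro HS.schwartz_sum HS.schwartz_smult HS.hact_closed hop_hecke dchar_schwartz)
  define f' where "f' = (\<lambda>x. f x + (-1) * h x)"
  have f'S: "f' \<in> HS.schwartz" unfolding f'_def by (intro HS.schwartz_add HS.schwartz_smult f hS)
  have van: "f' (dmat \<nu> \<eta>) = 0" if \<eta>: "\<eta> \<in> signs r" for \<eta>
  proof -
    have "h (dmat \<nu> \<eta>) = (\<Sum>s\<in>D. co s * of_int (sgnchar r s \<eta>))" unfolding h_def
    proof (rule sum.cong[OF refl])
      fix s assume s: "s \<in> D"
      note b = basis_index_dominant[OF Q(1)[OF s]]
      have lead: "HS.hact (hop (L s)) (dchar s (E s)) (dmat \<nu> \<eta>) = of_int (sgnchar r s \<eta>) * of_nat (stab_count (E s))"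
        using hact_hop_leading[OF b(1,2) types_dominant[OF Q(2)[OF s]] \<eta> ishift_apply[OF Q(3)[OF s]]] .
      show "co s * M s * HS.hact (hop (L s)) (dchar s (E s)) (dmat \<nu> \<eta>) = co s * of_int (sgnchar r s \<eta>)"
        unfolding lead
        using arg_cong[OF Q(4)[OF s], of "\<lambda>z. co s * of_int (sgnchar r s \<eta>) * z"] by (simp add: ac_simps)
    qed
    also have "\<dots> = (\<Sum>s\<in>signs r. co s * of_int (sgnchar r s \<eta>))"
    proof (rule sum.mono_neutral_left)
      show "\<forall>s\<in>signs r - D. co s * of_int (sgnchar r s \<eta>) = 0"
      proof
        fix s assume "s \<in> signs r - D"
        hence "s \<in> signs r" "\<not> block_const r \<nu> s" by (auto simp: D_def)
        hence "co s = 0" using vanishing_coefficient[OF two f \<nu>t] by (simp add: co_def)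
        thus "co s * of_int (sgnchar r s \<eta>) = 0" by simp
      qed
    qed (auto simp: D_def)
    also have "\<dots> = (\<Sum>s\<in>signs r. \<Sum>\<zeta>\<in>signs r. h2 * f (dmat \<nu> \<zeta>) * of_int (sgnchar r s \<zeta> * sgnchar r s \<eta>))"
      by (simp add: co_def sum_distrib_left sum_distrib_right ac_simps)
    also have "\<dots> = (\<Sum>\<zeta>\<in>signs r. \<Sum>s\<in>signs r. h2 * f (dmat \<nu> \<zeta>) * of_int (sgnchar r s \<zeta> * sgnchar r s \<eta>))"
      by (rule sum.swap)
    also have "\<dots> = (\<Sum>\<zeta>\<in>signs r. if \<zeta> = \<eta> then f (dmat \<nu> \<zeta>) else 0)"
    proof (rule sum.cong[OF refl])
      fix \<zeta> assume z: "\<zeta> \<in> signs r"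
      have "(\<Sum>s\<in>signs r. h2 * f (dmat \<nu> \<zeta>) * of_int (sgnchar r s \<zeta> * sgnchar r s \<eta>))
          = h2 * f (dmat \<nu> \<zeta>) * of_int (\<Sum>s\<in>signs r. sgnchar r s \<zeta> * sgnchar r s \<eta>)"
        by (simp only: sum_distrib_left of_int_sum)
      also have "\<dots> = (if \<zeta> = \<eta> then (h2 * 2 ^ r) * f (dmat \<nu> \<zeta>) else 0)"
        unfolding sgnchar_orthogonal_dual[OF z \<eta>] by simp
      finally show "(\<Sum>s\<in>signs r. h2 * f (dmat \<nu> \<zeta>) * of_int (sgnchar r s \<zeta> * sgnchar r s \<eta>))
          = (if \<zeta> = \<eta> then f (dmat \<nu> \<zeta>) else 0)" by (simp add: h2)
    qed
    also have "\<dots> = f (dmat \<nu> \<eta>)" using \<eta> by simp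
    finally show ?thesis by (simp add: f'_def)
  qed
  have sub: "tsupp f' \<subseteq> S - {\<nu>}"
  proof
    fix \<mu> assume "\<mu> \<in> tsupp f'"
    then obtain \<eta> where \<mu>: "\<mu> \<in> types" and \<eta>: "\<eta> \<in> signs r" "f' (dmat \<mu> \<eta>) \<noteq> 0" by (auto simp: tsupp_def)
    have "\<mu> \<in> S"
    proof (cases "f (dmat \<mu> \<eta>) = 0")
      case False
      thus ?thesis using \<mu> \<eta>(1) fS by (auto simp: tsupp_def)
    next
      case True
      hence "h (dmat \<mu> \<eta>) \<noteq> 0" using \<eta>(2) by (simp add: f'_def)
      then obtain s where s: "s \<in> D" "(co s * M s) * HS.hact (hop (L s)) (dchar s (E s)) (dmat \<mu> \<eta>) \<noteq> 0"
        unfolding h_def by (rule sum.not_neutral_contains_not_neutral)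
      note b = basis_index_dominant[OF Q(1)[OF s(1)]]
      have ne: "HS.hact (hop (L s)) (dchar s (E s)) (dmat \<mu> \<eta>) \<noteq> (0 :: 'c)" using s(2) by auto
      note sup = hact_hop_support[OF b(1) types_dominant[OF Q(2)[OF s(1)]] types_dominant[OF \<mu>]
          has_type_dmat[OF \<eta>(1)] dmat_sym_space[OF \<eta>(1)] ne]
      have i: "\<nu> i = E s i + 2 * L s i" if "i < r" for i using ishift_apply[OF Q(3)[OF s(1)] that] .
      have "lexge r \<mu> \<nu>" using sup(1) lexge_cong[of r \<mu> \<mu> \<nu> "\<lambda>i. E s i + 2 * L s i"] i by simp
      moreover have "(\<Sum>i<r. \<mu> i) = (\<Sum>i<r. \<nu> i)" unfolding sup(2) by (rule sum.cong[OF refl]) (simp add: i)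
      ultimately have "\<mu> \<in> cone \<nu>" using \<mu> by (simp add: cone_def)
      thus ?thesis using up[OF \<nu>(1)] by blast
    qed
    moreover have "\<mu> \<noteq> \<nu>" using \<eta> van by blast
    ultimately show "\<mu> \<in> S - {\<nu>}" by blast
  qed
  \<comment> \<open>The remaining set is still closed upwards, since \<open>\<nu>\<close> is minimal in \<open>S\<close>.\<close>
  have up': "cone \<mu> \<subseteq> S - {\<nu>}" if m: "\<mu> \<in> S - {\<nu>}" for \<mu>
  proof -
    have "\<nu> \<notin> cone \<mu>"
    proof
      assume "\<nu> \<in> cone \<mu>"
      hence 1: "lexge r \<nu> \<mu>" by (simp add: cone_def)
      have 2: "lexge r \<mu> \<nu>" using \<nu>(2)[of \<mu>] m by simp
      have "\<mu> = \<nu>" using m S by (intro types_lexge_antisym[OF \<nu>t _ 1 2]) blast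
      thus False using m by simp
    qed
    thus ?thesis using up[of \<mu>] m by blast
  qed
  have "n = card (S - {\<nu>})" using Suc.hyps(2) \<nu>(1) finS by simp
  from Suc.hyps(1)[OF this _ _ up' f'S sub] have "f' \<in> dspan" using finS S by blast
  hence "(\<lambda>x. h x + f' x) \<in> dspan" by (rule dspan_add[OF hD])
  moreover have "(\<lambda>x. h x + f' x) = f" by (simp add: f'_def)
  ultimately show ?case by simp
qed

lemma cone_trans: "\<mu> \<in> cone \<nu> \<Longrightarrow> cone \<mu> \<subseteq> cone \<nu>"
  unfolding cone_def using lexge_trans[of r _ \<mu> \<nu>] by auto

lemma cone_self: "\<nu> \<in> types \<Longrightarrow> \<nu> \<in> cone \<nu>"
  by (simp add: cone_def lexge_reflexive)

lemma schwartz_in_dspan: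
  assumes two: "(2 :: 'c::comm_ring_1) dvd 1" and f: "f \<in> HS.schwartz"
  shows "(f :: 'a mat \<Rightarrow> 'c) \<in> dspan"
proof (rule schwartz_in_dspan_of_upward_closed[OF two _ _ _ f])
  let ?S = "\<Union>\<nu>\<in>tsupp f. cone \<nu>"
  show "finite ?S" by (rule finite_UN_I[OF finite_tsupp[OF f] finite_cone])
  show "?S \<subseteq> types" by (auto simp: cone_def)
  show "tsupp f \<subseteq> ?S"
  proof
    fix \<nu> assume n: "\<nu> \<in> tsupp f"
    hence "\<nu> \<in> types" by (simp add: tsupp_def)
    thus "\<nu> \<in> ?S" using cone_self n by blast
  qed
  show "cone \<mu> \<subseteq> ?S" if m: "\<mu> \<in> ?S" for \<mu>
  proof -
    obtain \<nu> where "\<nu> \<in> tsupp f" "\<mu> \<in> cone \<nu>" using m by blast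
    thus ?thesis using cone_trans[of \<mu> \<nu>] by blast
  qed
qed

section \<open>Linear independence\<close>

lemma hact_sum_left:
  assumes "f \<in> HS.schwartz" "\<And>l. l \<in> L \<Longrightarrow> T l \<in> HP.hecke"
  shows "HS.hact (\<lambda>g. \<Sum>l\<in>L. T l g) f x = (\<Sum>l\<in>L. HS.hact (T l) f x :: 'c::comm_ring_1)"
  using assms(2)
proof (induction L rule: infinite_finite_induct)
  case (insert l L)
  have "HS.hact (\<lambda>g. T l g + (\<Sum>l\<in>L. T l g)) f x = HS.hact (T l) f x + HS.hact (\<lambda>g. \<Sum>l\<in>L. T l g) f x"
  proof -
    have 1: "T l \<in> HP.hecke" using insert.prems by simp
    have 2: "(\<lambda>g. \<Sum>l\<in>L. T l g) \<in> HP.hecke" by (rule HP.hecke_sum) (use insert.prems in simp)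
    show ?thesis using fun_cong[OF HS.hact_add_left[OF 1 2 assms(1)]] .
  qed
  thus ?case using insert.IH insert.prems insert.hyps by simp
qed (simp_all add: hact_0[OF assms(1)])

text \<open>In a relation, expand the coefficients into the operators \<open>hop l\<close>, and let \<open>\<nu>\<close> be lexicographically minimal among the
  \<open>e + 2 l\<close> that belong to nonzero terms. On the forms of type \<open>\<nu>\<close> all terms with another \<open>e + 2 l\<close> vanish. The
  remaining ones are multiples of different characters, and these are separated by orthogonality.\<close>

lemma independent:
  assumes two: "(2 :: 'c::comm_ring_1) dvd 1"
    and A: "\<And>b. b \<in> basis_index \<Longrightarrow> A b \<in> HP.hecke"
    and zero: "\<And>x. (\<Sum>b\<in>basis_index. HS.hact (A b) (dchar (fst b) (snd b)) x) = (0 :: 'c)"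
    and b: "b \<in> basis_index"
  shows "A b = (\<lambda>_. 0)"
proof -
  have "\<forall>b\<in>basis_index. \<exists>q. finite (fst q) \<and> fst q \<subseteq> types \<and> A b = (\<lambda>g. \<Sum>l\<in>fst q. snd q l * hop l g)"
  proof
    fix b assume "b \<in> basis_index"
    from hecke_span[OF A[OF this]] obtain L a where "finite L" "L \<subseteq> types" "A b = (\<lambda>g. \<Sum>l\<in>L. a l * hop l g)" by blast
    thus "\<exists>q. finite (fst q) \<and> fst q \<subseteq> types \<and> A b = (\<lambda>g. \<Sum>l\<in>fst q. snd q l * hop l g)"
      by (intro exI[of _ "(L, a)"]) simp
  qed
  then obtain q where q: "\<forall>b\<in>basis_index. finite (fst (q b)) \<and> fst (q b) \<subseteq> types
      \<and> A b = (\<lambda>g. \<Sum>l\<in>fst (q b). snd (q b) l * hop l g)"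
    unfolding bchoice_iff by blast
  define L where "L b = fst (q b)" for b
  define a where "a b = snd (q b)" for b
  have L: "finite (L b)" "L b \<subseteq> types" "A b = (\<lambda>g. \<Sum>l\<in>L b. a b l * hop l g)" if "b \<in> basis_index" for b
    using q that by (auto simp: L_def a_def)
  define P where "P = Sigma basis_index L"
  have finP: "finite P" unfolding P_def using finite_basis_index L(1) by (rule finite_SigmaI)
  define J where "J = {p \<in> P. a (fst p) (snd p) \<noteq> 0}"
  have finJ: "finite J" using finP by (simp add: J_def)
  have "J = {}"
  proof (rule ccontr)
    assume "J \<noteq> {}"
    let ?i = "\<lambda>p. ishift (snd (fst p)) (snd p)"
    obtain p0 where p0: "p0 \<in> J" "\<And>p. p \<in> J \<Longrightarrow> lexge r (?i p) (?i p0)"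
      using lexge_minimal[OF finJ \<open>J \<noteq> {}\<close>, of r ?i] by blast
    define \<nu> where "\<nu> = ?i p0"
    define s0 where "s0 = fst (fst p0)"
    have pP: "(fst (fst p), snd (fst p)) \<in> basis_index" "snd p \<in> types" "fst p \<in> basis_index" if pP': "p \<in> P" for p
    proof -
      obtain b l where p: "b \<in> basis_index" "l \<in> L b" "p = (b, l)" using pP' unfolding P_def by (rule SigmaE)
      show "(fst (fst p), snd (fst p)) \<in> basis_index" "snd p \<in> types" "fst p \<in> basis_index"
        using p subsetD[OF L(2)[OF p(1)] p(2)] by simp_all
    qed
    have p0P: "p0 \<in> P" using p0(1) by (simp add: J_def)
    have it: "?i p \<in> types" if "p \<in> P" for p
      using ishift_types[OF basis_index_dominant(4)[OF pP(1)[OF that]] pP(2)[OF that]] .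
    have \<nu>t: "\<nu> \<in> types" unfolding \<nu>_def by (rule it[OF p0P])
    define st where "st p = (of_nat (stab_count (snd (fst p))) :: 'c)" for p :: "((nat \<Rightarrow> int) \<times> (nat \<Rightarrow> int)) \<times> (nat \<Rightarrow> int)"
    \<comment> \<open>Only leading terms contribute to the values at the forms of type \<open>\<nu>\<close>.\<close>
    have ev: "(\<Sum>p\<in>P. if ?i p = \<nu> then a (fst p) (snd p) * (of_int (sgnchar r (fst (fst p)) \<eta>) * st p) else 0) = 0"
      if \<eta>: "\<eta> \<in> signs r" for \<eta>
    proof -
      have "0 = (\<Sum>b\<in>basis_index. HS.hact (A b) (dchar (fst b) (snd b)) (dmat \<nu> \<eta>))" using zero by simp
      also have "\<dots> = (\<Sum>b\<in>basis_index. \<Sum>l\<in>L b. a b l * HS.hact (hop l) (dchar (fst b) (snd b)) (dmat \<nu> \<eta>))"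
      proof (rule sum.cong[OF refl])
        fix b assume b: "b \<in> basis_index"
        show "HS.hact (A b) (dchar (fst b) (snd b)) (dmat \<nu> \<eta>)
            = (\<Sum>l\<in>L b. a b l * HS.hact (hop l) (dchar (fst b) (snd b)) (dmat \<nu> \<eta>))"
          unfolding L(3)[OF b]
          by (subst hact_sum_left[OF dchar_schwartz HP.hecke_smult[OF hop_hecke]])
            (simp add: HS.hact_smult_left[OF hop_hecke dchar_schwartz])
      qed
      also have "\<dots> = (\<Sum>p\<in>P. a (fst p) (snd p) * HS.hact (hop (snd p)) (dchar (fst (fst p)) (snd (fst p))) (dmat \<nu> \<eta>))"
        unfolding P_def by (subst sum.Sigma) (auto simp: finite_basis_index L(1) case_prod_beta)
      also have "\<dots> = (\<Sum>p\<in>P. if ?i p = \<nu> then a (fst p) (snd p) * (of_int (sgnchar r (fst (fst p)) \<eta>) * st p) else 0)"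
      proof (rule sum.cong[OF refl])
        fix p assume p: "p \<in> P"
        note bd = basis_index_dominant[OF pP(1)[OF p]]
        show "a (fst p) (snd p) * HS.hact (hop (snd p)) (dchar (fst (fst p)) (snd (fst p))) (dmat \<nu> \<eta>)
          = (if ?i p = \<nu> then a (fst p) (snd p) * (of_int (sgnchar r (fst (fst p)) \<eta>) * st p) else 0)"
        proof (cases "?i p = \<nu>")
          case True
          have "HS.hact (hop (snd p)) (dchar (fst (fst p)) (snd (fst p))) (dmat \<nu> \<eta>)
              = of_int (sgnchar r (fst (fst p)) \<eta>) * st p"
            unfolding st_def
            using hact_hop_leading[OF bd(1,2) types_dominant[OF pP(2)[OF p]] \<eta> ishift_apply[OF True]] .
          thus ?thesis using True by simp
        next
          case False
          have "a (fst p) (snd p) = 0 \<or> HS.hact (hop (snd p)) (dchar (fst (fst p)) (snd (fst p))) (dmat \<nu> \<eta>) = (0 :: 'c)"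
          proof (rule disjCI, rule ccontr)
            assume ne: "HS.hact (hop (snd p)) (dchar (fst (fst p)) (snd (fst p))) (dmat \<nu> \<eta>) \<noteq> (0 :: 'c)"
              and "a (fst p) (snd p) \<noteq> 0"
            hence "p \<in> J" using p by (simp add: J_def)
            hence 1: "lexge r (?i p) \<nu>" unfolding \<nu>_def by (rule p0(2))
            have "lexge r \<nu> (\<lambda>i. snd (fst p) i + 2 * snd p i)"
              using hact_hop_support(1)[OF bd(1) types_dominant[OF pP(2)[OF p]] types_dominant[OF \<nu>t]
                has_type_dmat[OF \<eta>] dmat_sym_space[OF \<eta>] ne] .
            hence "lexge r \<nu> (?i p)"
              using lexge_cong[of r \<nu> \<nu> "\<lambda>i. snd (fst p) i + 2 * snd p i" "?i p"] by (simp add: ishift_def)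
            hence "?i p = \<nu>" by (rule types_lexge_antisym[OF \<nu>t it[OF p] _ 1])
            thus False using False by simp
          qed
          thus ?thesis using False by auto
        qed
      qed
      finally show ?thesis by simp
    qed
    have "0 = (\<Sum>\<eta>\<in>signs r. (\<Sum>p\<in>P. if ?i p = \<nu> then a (fst p) (snd p) * (of_int (sgnchar r (fst (fst p)) \<eta>) * st p) else 0)
        * of_int (sgnchar r s0 \<eta>))" by (simp add: ev)
    also have "\<dots> = (\<Sum>\<eta>\<in>signs r. \<Sum>p\<in>P. if ?i p = \<nu> then a (fst p) (snd p) * st p * of_int (sgnchar r (fst (fst p)) \<eta> * sgnchar r s0 \<eta>) else 0)"
      unfolding sum_distrib_right by (intro sum.cong[OF refl]) (simp add: ac_simps)
    also have "\<dots> = (\<Sum>p\<in>P. \<Sum>\<eta>\<in>signs r. if ?i p = \<nu> then a (fst p) (snd p) * st p * of_int (sgnchar r (fst (fst p)) \<eta> * sgnchar r s0 \<eta>) else 0)"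
      by (rule sum.swap)
    also have "\<dots> = (\<Sum>p\<in>P. if p = p0 then a (fst p) (snd p) * st p * 2 ^ r else 0)"
    proof (rule sum.cong[OF refl])
      fix p assume p: "p \<in> P"
      have s: "fst (fst p) \<in> signs r" "s0 \<in> signs r"
        using basis_index_dominant(3)[OF pP(1)[OF p]] basis_index_dominant(3)[OF pP(1)[OF p0P]] by (simp_all add: s0_def)
      \<comment> \<open>Given the character, the pair \<open>(e, l)\<close> is determined by \<open>e + 2 l\<close>.\<close>
      have iff: "?i p = \<nu> \<and> fst (fst p) = s0 \<longleftrightarrow> p = p0"
      proof
        assume as: "?i p = \<nu> \<and> fst (fst p) = s0"
        have "(s0, snd (fst p)) \<in> basis_index" "(s0, snd (fst p0)) \<in> basis_index"
          using pP(1)[OF p] pP(1)[OF p0P] as by (simp_all add: s0_def)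
        from ishift_inj[OF this pP(2)[OF p] pP(2)[OF p0P]] as
        have "snd (fst p) = snd (fst p0)" "snd p = snd p0" by (simp_all add: \<nu>_def)
        thus "p = p0" using as by (simp add: prod_eq_iff s0_def)
      qed (simp add: \<nu>_def s0_def)
      show "(\<Sum>\<eta>\<in>signs r. if ?i p = \<nu> then a (fst p) (snd p) * st p * of_int (sgnchar r (fst (fst p)) \<eta> * sgnchar r s0 \<eta>) else 0)
        = (if p = p0 then a (fst p) (snd p) * st p * 2 ^ r else 0)"
      proof (cases "?i p = \<nu>")
        case True
        have "(\<Sum>\<eta>\<in>signs r. a (fst p) (snd p) * st p * of_int (sgnchar r (fst (fst p)) \<eta> * sgnchar r s0 \<eta>))
          = a (fst p) (snd p) * st p * of_int (\<Sum>\<eta>\<in>signs r. sgnchar r (fst (fst p)) \<eta> * sgnchar r s0 \<eta>)"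
          by (simp only: sum_distrib_left of_int_sum)
        also have "\<dots> = (if fst (fst p) = s0 then a (fst p) (snd p) * st p * 2 ^ r else 0)"
          unfolding sgnchar_orthogonal[OF s] by simp
        finally show ?thesis using True iff by simp
      next
        case False
        hence "p \<noteq> p0" using iff by blast
        thus ?thesis using False by simp
      qed
    qed
    also have "\<dots> = a (fst p0) (snd p0) * st p0 * 2 ^ r" using finP p0P by simp
    finally have z: "a (fst p0) (snd p0) * st p0 * 2 ^ r = 0" by simp
    obtain h :: 'c where h: "h * 2 ^ r = 1" using pow2_unit[OF two] by blast
    obtain h' :: 'c where h': "h' * st p0 = 1" unfolding st_def using stab_count_unit[OF two] by blast
    have "a (fst p0) (snd p0) = a (fst p0) (snd p0) * (h' * st p0) * (h * 2 ^ r)" by (simp add: h h')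
    also have "\<dots> = h' * h * (a (fst p0) (snd p0) * st p0 * 2 ^ r)" by (simp add: ac_simps)
    also have "\<dots> = 0" unfolding z by simp
    finally show False using p0(1) by (simp add: J_def)
  qed
  have "a b l = 0" if l: "l \<in> L b" for l
  proof (rule ccontr)
    assume "a b l \<noteq> 0"
    hence "(b, l) \<in> J" using l b by (simp add: J_def P_def)
    thus False using \<open>J = {}\<close> by simp
  qed
  thus ?thesis unfolding L(3)[OF b] by simp
qed

text \<open>A coincidence would be a linear relation with coefficients 1 and -1.\<close>

lemma dchar_inj:
  assumes two: "(2 :: 'c::comm_ring_1) dvd 1"
  shows "inj_on (\<lambda>b. dchar (fst b) (snd b) :: 'a mat \<Rightarrow> 'c) basis_index"
proof (rule inj_onI, rule ccontr)
  fix b b' assume b: "b \<in> basis_index" "b' \<in> basis_index" "b \<noteq> b'"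
    and eq: "dchar (fst b) (snd b) = (dchar (fst b') (snd b') :: 'a mat \<Rightarrow> 'c)"
  define o1 :: "'a mat \<Rightarrow> 'c" where "o1 = (\<lambda>g. if g \<in> GLO r then 1 else 0)"
  have o1: "o1 \<in> HP.hecke" unfolding o1_def using HP.one_hecke by simp
  define A where "A x = (if x = b then o1 else if x = b' then (\<lambda>g. (-1) * o1 g) else (\<lambda>_. 0))" for x
  have "A x \<in> HP.hecke" for x using HP.hecke_smult[OF o1, of "-1"] by (simp add: A_def o1 HP.hecke_0)
  moreover have "(\<Sum>x\<in>basis_index. HS.hact (A x) (dchar (fst x) (snd x)) y) = 0" for y
  proof -
    have "(\<Sum>x\<in>basis_index. HS.hact (A x) (dchar (fst x) (snd x)) y)
        = (\<Sum>x\<in>basis_index. (if x = b then dchar (fst b) (snd b) y else 0) + (if x = b' then - dchar (fst b') (snd b') y else 0))"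
    proof (rule sum.cong[OF refl])
      fix x
      have 1: "HS.hact o1 (dchar s e) = (dchar s e :: 'a mat \<Rightarrow> 'c)" for s e
        unfolding o1_def by (rule HS.hact_one[OF dchar_schwartz])
      show "HS.hact (A x) (dchar (fst x) (snd x)) y
        = (if x = b then dchar (fst b) (snd b) y else 0) + (if x = b' then - dchar (fst b') (snd b') y else 0)"
        using b(3) HS.hact_smult_left[OF o1 dchar_schwartz, of "-1"]
        by (simp add: A_def 1 hact_0[OF dchar_schwartz])
    qed
    also have "\<dots> = dchar (fst b) (snd b) y - dchar (fst b') (snd b') y"
      using b(1,2) finite_basis_index by (simp add: sum.distrib)
    finally show ?thesis by (simp add: eq)
  qed
  ultimately have "A b = (\<lambda>_. 0)" using independent[OF two _ _ b(1), of A] by blast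
  hence "o1 (1\<^sub>m r) = 0" by (simp add: A_def)
  thus False using GLO_one by (simp add: o1_def)
qed

section \<open>The basis\<close>

lemma schwartz_finsum:
  assumes "finite I" "\<And>i. i \<in> I \<Longrightarrow> g i \<in> HS.schwartz"
  shows "finsum (schwartz_module av r) g I = (\<lambda>x. \<Sum>i\<in>I. g i x :: 'c::comm_ring_1)"
proof -
  interpret M: left_module "hecke_algebra av r :: ('a mat \<Rightarrow> 'c) ring" "schwartz_module av r"
    by (rule schwartz_left_module)
  show ?thesis using assms
  proof (induction I rule: finite_induct)
    case empty
    show ?case by (simp add: schwartz_zero_eq)
  next
    case (insert i I)
    have "g \<in> I \<rightarrow> carrier (schwartz_module av r)" "g i \<in> carrier (schwartz_module av r)"
      using insert.prems by (auto simp: schwartz_carrier)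
    from M.M.finsum_insert[OF insert.hyps this] insert show ?case by (simp add: schwartz_add_eq)
  qed
qed

lemma delta_basis_is_basis:
  assumes two: "(2 :: 'c::comm_ring_1) dvd 1"
  shows "finite_basis (hecke_algebra av r :: ('a mat \<Rightarrow> 'c) ring) (schwartz_module av r) (delta_basis av \<pi> r)"
proof -
  let ?H = "hecke_algebra av r :: ('a mat \<Rightarrow> 'c) ring"
  let ?M = "schwartz_module av r :: ('a mat \<Rightarrow> 'c, 'a mat \<Rightarrow> 'c) module"
  define d :: "(nat \<Rightarrow> int) \<times> (nat \<Rightarrow> int) \<Rightarrow> 'a mat \<Rightarrow> 'c" where "d b = dchar (fst b) (snd b)" for b
  define B where "B = d ` basis_index"
  have Beq: "delta_basis av \<pi> r = B" unfolding B_def d_def by (rule delta_basis_eq)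
  have finB: "finite B" unfolding B_def using finite_basis_index by (rule finite_imageI)
  have inj: "inj_on d basis_index" unfolding d_def by (rule dchar_inj[OF two])
  have dS: "d b \<in> HS.schwartz" for b unfolding d_def by (rule dchar_schwartz)
  have carH: "carrier ?H = HP.hecke" by (simp add: hecke_algebra_eq)
  have comb: "(\<Oplus>\<^bsub>?M\<^esub>\<beta>\<in>B. a \<beta> \<odot>\<^bsub>?M\<^esub> \<beta>) = (\<lambda>x. \<Sum>b\<in>basis_index. HS.hact (a (d b)) (d b) x)"
    if a: "a \<in> B \<rightarrow>\<^sub>E carrier ?H" for a
  proof -
    have "(\<Oplus>\<^bsub>?M\<^esub>\<beta>\<in>B. a \<beta> \<odot>\<^bsub>?M\<^esub> \<beta>) = (\<lambda>x. \<Sum>\<beta>\<in>B. (a \<beta> \<odot>\<^bsub>?M\<^esub> \<beta>) x)"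
    proof (rule schwartz_finsum[OF finB])
      fix \<beta> assume "\<beta> \<in> B"
      hence "a \<beta> \<in> HP.hecke" "\<beta> \<in> HS.schwartz" using PiE_mem[OF a] dS by (auto simp: carH B_def)
      thus "a \<beta> \<odot>\<^bsub>?M\<^esub> \<beta> \<in> HS.schwartz" by (simp add: schwartz_smult_eq HS.hact_closed)
    qed
    thus ?thesis unfolding B_def by (simp add: sum.reindex[OF inj] schwartz_smult_eq)
  qed
  have "\<exists>!a. a \<in> B \<rightarrow>\<^sub>E carrier ?H \<and> f = (\<Oplus>\<^bsub>?M\<^esub>\<beta>\<in>B. a \<beta> \<odot>\<^bsub>?M\<^esub> \<beta>)" if f: "f \<in> carrier ?M" for f
  proof (rule ex_ex1I)
    have "f \<in> dspan" using f schwartz_in_dspan[OF two] by (simp add: schwartz_carrier)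
    then obtain A where A: "\<forall>b\<in>basis_index. A b \<in> HP.hecke" "f = (\<lambda>x. \<Sum>b\<in>basis_index. HS.hact (A b) (d b) x)"
      unfolding dspan_def d_def by blast
    define a where "a = (\<lambda>\<beta>\<in>B. A (inv_into basis_index d \<beta>))"
    have ad: "a (d b) = A b" if "b \<in> basis_index" for b
      using that inv_into_f_f[OF inj that] by (simp add: a_def B_def)
    have a: "a \<in> B \<rightarrow>\<^sub>E carrier ?H"
    proof (rule PiE_I)
      fix \<beta> assume "\<beta> \<in> B"
      then obtain b where "b \<in> basis_index" "\<beta> = d b" by (auto simp: B_def)
      thus "a \<beta> \<in> carrier ?H" using ad A(1) by (simp add: carH)
    qed (simp add: a_def)
    have "f = (\<Oplus>\<^bsub>?M\<^esub>\<beta>\<in>B. a \<beta> \<odot>\<^bsub>?M\<^esub> \<beta>)" unfolding comb[OF a] A(2) by (simp add: ad)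
    thus "\<exists>a. a \<in> B \<rightarrow>\<^sub>E carrier ?H \<and> f = (\<Oplus>\<^bsub>?M\<^esub>\<beta>\<in>B. a \<beta> \<odot>\<^bsub>?M\<^esub> \<beta>)" using a by blast
  next
    fix a a' assume as: "a \<in> B \<rightarrow>\<^sub>E carrier ?H \<and> f = (\<Oplus>\<^bsub>?M\<^esub>\<beta>\<in>B. a \<beta> \<odot>\<^bsub>?M\<^esub> \<beta>)"
      "a' \<in> B \<rightarrow>\<^sub>E carrier ?H \<and> f = (\<Oplus>\<^bsub>?M\<^esub>\<beta>\<in>B. a' \<beta> \<odot>\<^bsub>?M\<^esub> \<beta>)"
    have a: "a \<in> B \<rightarrow>\<^sub>E carrier ?H" "a' \<in> B \<rightarrow>\<^sub>E carrier ?H" using as by auto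
    have f1: "f x = (\<Sum>b\<in>basis_index. HS.hact (a (d b)) (d b) x)" for x
      using conjunct2[OF as(1)] unfolding comb[OF a(1)] by (rule fun_cong)
    have f2: "f x = (\<Sum>b\<in>basis_index. HS.hact (a' (d b)) (d b) x)" for x
      using conjunct2[OF as(2)] unfolding comb[OF a(2)] by (rule fun_cong)
    have ah: "a (d b) \<in> HP.hecke" "a' (d b) \<in> HP.hecke" if "b \<in> basis_index" for b
      using PiE_mem[OF a(1), of "d b"] PiE_mem[OF a(2), of "d b"] that by (auto simp: carH B_def)
    define D where "D b = (\<lambda>g. a (d b) g + (-1) * a' (d b) g)" for b
    have DH: "D b \<in> HP.hecke" if "b \<in> basis_index" for b
      unfolding D_def by (intro HP.hecke_add HP.hecke_smult ah[OF that])
    have "(\<Sum>b\<in>basis_index. HS.hact (D b) (dchar (fst b) (snd b)) x) = 0" for x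
    proof -
      have "(\<Sum>b\<in>basis_index. HS.hact (D b) (d b) x)
          = (\<Sum>b\<in>basis_index. HS.hact (a (d b)) (d b) x + (-1) * HS.hact (a' (d b)) (d b) x)"
      proof (rule sum.cong[OF refl])
        fix b assume b: "b \<in> basis_index"
        show "HS.hact (D b) (d b) x = HS.hact (a (d b)) (d b) x + (-1) * HS.hact (a' (d b)) (d b) x"
          unfolding D_def HS.hact_add_left[OF ah(1)[OF b] HP.hecke_smult[OF ah(2)[OF b]] dS]
            HS.hact_smult_left[OF ah(2)[OF b] dS] ..
      qed
      also have "\<dots> = f x - f x"
        unfolding sum.distrib sum_distrib_left[symmetric] f1[symmetric] f2[symmetric] by simp
      finally show ?thesis by (simp add: d_def)
    qed
    from independent[OF two DH this] have D0: "D b = (\<lambda>_. 0)" if "b \<in> basis_index" for b using that by blast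
    show "a = a'"
    proof (rule PiE_ext[OF a])
      fix \<beta> assume "\<beta> \<in> B"
      then obtain b where b: "b \<in> basis_index" "\<beta> = d b" by (auto simp: B_def)
      show "a \<beta> = a' \<beta>"
      proof
        fix g
        show "a \<beta> g = a' \<beta> g" using fun_cong[OF D0[OF b(1)], of g] by (simp add: D_def b(2))
      qed
    qed
  qed
  moreover have "B \<subseteq> carrier ?M" using dS by (auto simp: B_def schwartz_carrier)
  ultimately show ?thesis unfolding finite_basis_def Beq using finB by blast
qed

lemma card_delta_basis:
  assumes two: "(2 :: 'c::comm_ring_1) dvd 1"
  shows "card (delta_basis av \<pi> r :: ('a mat \<Rightarrow> 'c) set) = 4 ^ r"
  unfolding delta_basis_eq card_image[OF dchar_inj[OF two]] by (rule card_basis_index)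

end

theorem corollary5p9:
  fixes av :: "'a::field_char_0 \<Rightarrow> real" and p r :: nat and \<pi> :: 'a
  assumes "padic_local_field av p"
    and "odd p"
    and "uniformizer av \<pi>"
    and "r \<ge> 1"
    and "(2 :: 'c::comm_ring_1) dvd 1"
  shows "left_module (hecke_algebra av r :: ('a mat \<Rightarrow> 'c) ring) (schwartz_module av r) \<and>
    finite_basis (hecke_algebra av r :: ('a mat \<Rightarrow> 'c) ring) (schwartz_module av r)
      (delta_basis av \<pi> r) \<and>
    card (delta_basis av \<pi> r :: ('a mat \<Rightarrow> 'c) set) = 4 ^ r"
proof -
  interpret padic_local_field av p by fact
  interpret odd_padic_rank av p \<pi> r
    by unfold_locales (use assms in auto)
  show ?thesis
    using schwartz_left_module delta_basis_is_basis[OF assms(5)] card_delta_basis[OF assms(5)] by blast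
qed

end
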